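(* (Isomorphism theorem for not necessarily symmetric Markov processes via loop soups.) Let $X$ be a Markov process on $S$ as described in the context, with transition densities $p_t(x,y)$ that need not be symmetric, and with continuous (finite) $0$-potential density $u(x,y)$. Let $\alpha>0$, let $\mathcal{L}_{\alpha}$ be a Poisson process on the path space $\Omega_\Delta$ with intensity measure $\alpha\mu$, where $\mu$ is the loop measure of $X$, and let $$\widehat L_{\alpha}^{x}=\sum_{\omega\in\mathcal{L}_{\alpha}}L_{\infty}^{x}(\omega),\qquad x\in S.$$ Then for every $x_0\in S$, every sequence $x_1,x_2,\ldots$ in $S$, and every bounded measurable function $F$ on $\mathbb{R}^{\infty}$, $$E_{\mathcal{L}_{\alpha}}\left(\widehat L_{\alpha}^{x_{0}}\,F\left(\widehat L_{\alpha}^{x_{j}}\right)\right)=\alpha\,E_{\mathcal{L}_{\alpha}}Q^{x_{0},x_{0}}\left(F\left(\widehat L_{\alpha}^{x_{j}}+L_{\infty}^{x_{j}}\right)\right),$$ where on the right-hand side $\mathcal{L}_\alpha$ and the path distributed according to the measure $Q^{x_0,x_0}$ are independent (product measure).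
   Context: $S$ is a locally compact topological space with countable base, $m$ is a measure on $S$, and $p_t(x,y)\ge 0$, $t>0$, $x,y\in S$, are transition densities with respect to $m$: $\int p_t(x,y)\,dm(y)\le 1$ and $\int p_t(x,y)p_s(y,z)\,dm(y)=p_{t+s}(x,z)$. A cemetery state $\Delta\notin S$ is adjoined in the usual way, and functions on $S$ are extended by $f(\Delta)=0$. $X=\{X_t,t\ge0\}$ is a Markov process with transition densities $p_t(x,y)$, with right continuous paths and satisfying the strong Markov property, realized as the coordinate process on the space $\Omega_\Delta$ of right continuous paths in $S\cup\{\Delta\}$, with filtration $\mathcal{F}_t$, $\mathcal F=\bigvee_t\mathcal F_t$, lifetime $\zeta$ (the time at which the path reaches $\Delta$), and laws $P^x$ ($P^x(\cdot)$ applied to a random variable denotes expectation). The potential density is $u(x,y)=\int_0^\infty p_t(x,y)\,dt$, assumed continuous. Local time: $L^{y}_{t}=\lim_{\epsilon\to0}\int_0^t f_{\epsilon,y}(X_r)\,dr$, where $f_{\epsilon,y}\ge 0$ is supported in the ball $B(y,\epsilon)$ with $\int f_{\epsilon,y}\,dm=1$ (the limit exists locally uniformly in $t$ almost surely); $L^y_\infty$ is the total local time at $y$. The measure $Q^{x,y}$ on $\Omega_\Delta$ is defined by $Q^{x,y}(F1_{\{t<\zeta\}})=P^{x}(F\,u(X_{t},y))$ for all $t$ and all $F\in\mathcal{F}_t$. Bridge measures: for $t>0$, $Q_t^{x,y}$ is the measure determined by $Q_{t}^{x,y}(G)=P^{x}(G\,p_{t-s}(X_{s},y))$ for all $G\in\mathcal{F}_s$,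 $s<t$ (extended to $\mathcal F_{t^-}$). Loop measure: for $F\in\mathcal{F}$, $\mu(F)=\int_{0}^{\infty}\frac1t\int Q_{t}^{x,x}(F\circ k_{t})\,dm(x)\,dt$, where $k_t$ is the killing operator, $k_t\omega(s)=\omega(s)$ if $s<t$ and $k_t\omega(s)=\Delta$ if $s\ge t$. A Poisson process $\mathcal L_\alpha$ with intensity $\alpha\mu$ is a random countable collection of points of $\Omega_\Delta$ such that $N(A)=\#\{\mathcal{L}_\alpha\cap A\}$ is Poisson with mean $\alpha\mu(A)$ and $N(A_1),\dots,N(A_k)$ are independent for disjoint $A_1,\dots,A_k$. $E_{\mathcal L_\alpha}$ is the corresponding expectation. For a sequence $h_{x_1},h_{x_2},\ldots$, $F(h_{x_j})$ abbreviates $F(h_{x_1},h_{x_2},\ldots)$. *)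

theory Defs
  imports "HOL-Probability.Probability"
begin

section \<open>Paths with a cemetery state\<close>

text \<open>
  The state space is a type \<open>'a\<close>; \<open>None\<close> plays the role of the cemetery \<open>\<Delta>\<close>, so \<open>'a option\<close> is
  \<open>S \<union> {\<Delta>}\<close>.  Time is \<open>{0..}\<close>, and paths are normalised by \<^const>\<open>extensional\<close> at negative times.
\<close>

type_synonym 'a path = "real \<Rightarrow> 'a option"

definition extend_zero :: "('a \<Rightarrow> 'b::zero) \<Rightarrow> 'a option \<Rightarrow> 'b" where
  "extend_zero g z = (case z of None \<Rightarrow> 0 | Some v \<Rightarrow> g v)"

definition cemetery_borel :: "'a::topological_space option measure" where
  "cemetery_borel = sigma UNIV {A. Some -` A \<in> sets borel}"

text \<open>
  Since \<open>\<Delta>\<close> is absorbing, right continuity at a time at which the path is dead is automatic, whatever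
  the topology of \<open>S \<union> {\<Delta>}\<close> near \<open>\<Delta>\<close>; hence it is only required at times at which the path is in \<open>S\<close>.
\<close>

definition paths :: "'a::topological_space path set" where
  "paths = {\<omega> \<in> extensional {0..}.
     (\<forall>s t. 0 \<le> s \<longrightarrow> s \<le> t \<longrightarrow> \<omega> s = None \<longrightarrow> \<omega> t = None) \<and>
     (\<forall>t\<ge>0. \<forall>U. open U \<longrightarrow> \<omega> t \<in> Some ` U \<longrightarrow> (\<forall>\<^sub>F s in at_right t. \<omega> s \<in> Some ` U))}"

definition lifetime :: "'a path \<Rightarrow> ennreal" where
  "lifetime \<omega> = (INF t\<in>{t. 0 \<le> t \<and> \<omega> t = None}. ennreal t)"

definition killing :: "real \<Rightarrow> 'a path \<Rightarrow> 'a path" where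
  "killing t \<omega> = (\<lambda>s\<in>{0..}. if s < t then \<omega> s else None)"

definition shift :: "real \<Rightarrow> 'a path \<Rightarrow> 'a path" where
  "shift t \<omega> = (\<lambda>s\<in>{0..}. \<omega> (t + s))"

text \<open>The uncompleted \<open>\<sigma>\<close>-algebras \<open>\<F>\<^sub>t\<close>, \<open>\<F>\<^sub>t\<^sub>-\<close> and \<open>\<F>\<close> of the coordinate process.\<close>

definition path_filtration :: "real \<Rightarrow> 'a::topological_space path measure" where
  "path_filtration t =
     sigma paths {{\<omega> \<in> paths. \<omega> s \<in> A} | s A. 0 \<le> s \<and> s \<le> t \<and> A \<in> sets cemetery_borel}"

definition path_filtration_left :: "real \<Rightarrow> 'a::topological_space path measure" where
  "path_filtration_left t = sigma paths (\<Union>s\<in>{0..<t}. sets (path_filtration s))"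

definition path_algebra :: "'a::topological_space path measure" where
  "path_algebra = sigma paths (\<Union>s\<in>{0..}. sets (path_filtration s))"

section \<open>The Markov process\<close>

definition potential_density :: "(real \<Rightarrow> 'a \<Rightarrow> 'a \<Rightarrow> real) \<Rightarrow> 'a \<Rightarrow> 'a \<Rightarrow> ennreal" where
  "potential_density p x y = (\<integral>\<^sup>+t\<in>{0<..}. ennreal (p t x y) \<partial>lborel)"

locale transition_densities = sigma_finite_measure m
  for m :: "'a::{metric_space, second_countable_topology} measure" +
  fixes p :: "real \<Rightarrow> 'a \<Rightarrow> 'a \<Rightarrow> real"
  assumes locally_compact: "locally compact (UNIV :: 'a set)"
    and sets_m: "sets m = sets borel"
    and p_measurable: "(\<lambda>(t, x, y). p t x y)
          \<in> borel_measurable (restrict_space borel {0<..} \<Otimes>\<^sub>M (borel \<Otimes>\<^sub>M borel))"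
    and p_nonneg: "0 < t \<Longrightarrow> 0 \<le> p t x y"
    and p_mass: "0 < t \<Longrightarrow> (\<integral>\<^sup>+y. ennreal (p t x y) \<partial>m) \<le> 1"
    and chapman_kolmogorov: "0 < t \<Longrightarrow> 0 < s \<Longrightarrow>
          (\<integral>\<^sup>+y. ennreal (p t x y) * ennreal (p s y z) \<partial>m) = ennreal (p (t + s) x z)"

text \<open>Stopping times of the filtration \<open>\<F>\<^sub>t\<^sub>+\<close>, and the \<open>\<sigma>\<close>-algebra \<open>\<F>\<^sub>T\<^sub>+\<close>.\<close>

definition optional_time :: "('a::topological_space path \<Rightarrow> ennreal) \<Rightarrow> bool" where
  "optional_time T \<longleftrightarrow> (\<forall>t\<ge>0. {\<omega> \<in> paths. T \<omega> < ennreal t} \<in> sets (path_filtration t))"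

definition optional_events :: "('a::topological_space path \<Rightarrow> ennreal) \<Rightarrow> 'a path set set" where
  "optional_events T = {A \<in> sets path_algebra.
     \<forall>t\<ge>0. {\<omega> \<in> A. T \<omega> < ennreal t} \<in> sets (path_filtration t)}"

text \<open>
  The strong Markov property is stated on \<open>{T < \<zeta>}\<close>; on the complement the shifted path is the dead
  path, so nothing is lost.  The ordinary Markov property is the case of constant \<open>T\<close>.
\<close>

locale strong_markov_process = transition_densities m p
  for m :: "'a::{metric_space, second_countable_topology} measure" and p +
  fixes P :: "'a \<Rightarrow> 'a path measure"
  assumes P_kernel: "P \<in> borel \<rightarrow>\<^sub>M prob_algebra path_algebra"
    and P_start: "AE \<omega> in P x. \<omega> 0 = Some x"
    and P_density: "0 < t \<Longrightarrow> C \<in> sets borel \<Longrightarrow>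
          emeasure (P x) {\<omega> \<in> paths. \<omega> t \<in> Some ` C} = (\<integral>\<^sup>+y\<in>C. ennreal (p t x y) \<partial>m)"
    and strong_markov: "optional_time T \<Longrightarrow> A \<in> optional_events T \<Longrightarrow> B \<in> sets path_algebra \<Longrightarrow>
          emeasure (P x) {\<omega> \<in> A. T \<omega> < lifetime \<omega> \<and> shift (enn2real (T \<omega>)) \<omega> \<in> B} =
          (\<integral>\<^sup>+\<omega>\<in>{\<omega> \<in> A. T \<omega> < lifetime \<omega>}.
             emeasure (P (the (\<omega> (enn2real (T \<omega>))))) B \<partial>P x)"

section \<open>Local times\<close>

definition approximate_delta ::
    "'a::metric_space measure \<Rightarrow> (real \<Rightarrow> 'a \<Rightarrow> 'a \<Rightarrow> real) \<Rightarrow> bool" where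
  "approximate_delta m f \<longleftrightarrow> (\<forall>\<epsilon>>0. \<forall>y. f \<epsilon> y \<in> borel_measurable borel \<and>
     (\<forall>v. 0 \<le> f \<epsilon> y v) \<and> (\<forall>v. v \<notin> ball y \<epsilon> \<longrightarrow> f \<epsilon> y v = 0) \<and>
     (\<integral>\<^sup>+v. ennreal (f \<epsilon> y v) \<partial>m) = 1)"

text \<open>
  \<open>L y t \<omega>\<close> is the local time \<open>L\<^sup>y\<^sub>t(\<omega>)\<close>.  The limit determines it only up to \<open>P\<^sup>x\<close>-null sets; as it is
  also evaluated under measures that are absolutely continuous with respect to \<open>P\<^sup>x\<close> only on
  \<open>\<F>\<^sub>t \<inter> {t < \<zeta>}\<close>, the usual version is fixed: adapted, with continuous nondecreasing paths that are
  constant from the lifetime on.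
\<close>

definition is_local_time :: "('a::topological_space \<Rightarrow> 'a path measure) \<Rightarrow>
    (real \<Rightarrow> 'a \<Rightarrow> 'a \<Rightarrow> real) \<Rightarrow> ('a \<Rightarrow> real \<Rightarrow> 'a path \<Rightarrow> ennreal) \<Rightarrow> bool" where
  "is_local_time P f L \<longleftrightarrow>
     (\<forall>y. \<forall>t\<ge>0. L y t \<in> borel_measurable (path_filtration t)) \<and>
     (\<forall>y. \<forall>\<omega>\<in>paths. mono_on {0..} (\<lambda>t. L y t \<omega>) \<and> continuous_on {0..} (\<lambda>t. L y t \<omega>) \<and>
        (\<forall>t\<ge>0. lifetime \<omega> \<le> ennreal t \<longrightarrow> L y t \<omega> = L y (enn2real (lifetime \<omega>)) \<omega>)) \<and>
     (\<forall>x y. AE \<omega> in P x. \<forall>t\<ge>0. L y t \<omega> < \<infinity> \<and>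
        uniform_limit {0..t} (\<lambda>\<epsilon> s. LINT r:{0..s}|lborel. extend_zero (f \<epsilon> y) (\<omega> r))
          (\<lambda>s. enn2real (L y s \<omega>)) (at_right 0))"

definition total_local_time ::
    "('a \<Rightarrow> real \<Rightarrow> 'a path \<Rightarrow> ennreal) \<Rightarrow> 'a \<Rightarrow> 'a path \<Rightarrow> ennreal" where
  "total_local_time L y \<omega> = (SUP t\<in>{0..}. L y t \<omega>)"

section \<open>The measures on path space\<close>

text \<open>
  The defining identity determines \<open>Q\<^sup>x\<^sup>,\<^sup>y\<close> on \<open>{\<zeta> > 0}\<close>; the second clause records that \<open>Q\<^sup>x\<^sup>,\<^sup>y\<close> does not
  charge the path that is dead from the start.
\<close>

definition is_Q_measure :: "('a::topological_space \<Rightarrow> 'a path measure) \<Rightarrow>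
    (real \<Rightarrow> 'a \<Rightarrow> 'a \<Rightarrow> real) \<Rightarrow> 'a \<Rightarrow> 'a \<Rightarrow> 'a path measure \<Rightarrow> bool" where
  "is_Q_measure P p x y Q \<longleftrightarrow> sets Q = sets path_algebra \<and> (AE \<omega> in Q. 0 < lifetime \<omega>) \<and>
     (\<forall>t\<ge>0. \<forall>G :: 'a path \<Rightarrow> ennreal. G \<in> borel_measurable (path_filtration t) \<longrightarrow>
        (\<integral>\<^sup>+\<omega>\<in>{\<omega>. ennreal t < lifetime \<omega>}. G \<omega> \<partial>Q) =
        (\<integral>\<^sup>+\<omega>. G \<omega> * extend_zero (\<lambda>v. potential_density p v y) (\<omega> t) \<partial>P x))"

definition is_bridge_measure :: "('a::topological_space \<Rightarrow> 'a path measure) \<Rightarrow>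
    (real \<Rightarrow> 'a \<Rightarrow> 'a \<Rightarrow> real) \<Rightarrow> real \<Rightarrow> 'a \<Rightarrow> 'a \<Rightarrow> 'a path measure \<Rightarrow> bool" where
  "is_bridge_measure P p t x y B \<longleftrightarrow> sets B = sets (path_filtration_left t) \<and>
     (\<forall>s. 0 \<le> s \<longrightarrow> s < t \<longrightarrow>
        (\<forall>G :: 'a path \<Rightarrow> ennreal. G \<in> borel_measurable (path_filtration s) \<longrightarrow>
           (\<integral>\<^sup>+\<omega>. G \<omega> \<partial>B) =
           (\<integral>\<^sup>+\<omega>. G \<omega> * extend_zero (\<lambda>v. ennreal (p (t - s) v y)) (\<omega> s) \<partial>P x)))"

definition loop_measure :: "'a::topological_space measure \<Rightarrow>
    (real \<Rightarrow> 'a \<Rightarrow> 'a \<Rightarrow> 'a path measure) \<Rightarrow> 'a path measure" where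
  "loop_measure m Qb = measure_of paths (sets path_algebra)
     (\<lambda>A. \<integral>\<^sup>+t\<in>{0<..}. ennreal (1 / t) *
        (\<integral>\<^sup>+x. emeasure (Qb t x x) (killing t -` A \<inter> paths) \<partial>m) \<partial>lborel)"

section \<open>Poisson processes\<close>

definition point_count :: "('w \<Rightarrow> 'b set) \<Rightarrow> 'b set \<Rightarrow> 'w \<Rightarrow> ennreal" where
  "point_count \<L> A w = emeasure (count_space UNIV) (\<L> w \<inter> A)"

text \<open>\<^term>\<open>poisson_pmf\<close> is only meaningful for a positive rate, so the Poisson weights are written out.\<close>

definition poisson_process :: "'w measure \<Rightarrow> 'b measure \<Rightarrow> ('w \<Rightarrow> 'b set) \<Rightarrow> bool" where
  "poisson_process M \<nu> \<L> \<longleftrightarrow> prob_space M \<and>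
     (\<forall>w\<in>space M. countable (\<L> w) \<and> \<L> w \<subseteq> space \<nu>) \<and>
     (\<forall>A\<in>sets \<nu>. point_count \<L> A \<in> borel_measurable M \<and>
        (if emeasure \<nu> A = \<infinity> then AE w in M. point_count \<L> A w = \<infinity>
         else \<forall>k. measure M {w \<in> space M. point_count \<L> A w = of_nat k} =
                  measure \<nu> A ^ k / fact k * exp (- measure \<nu> A))) \<and>
     (\<forall>(A :: nat \<Rightarrow> 'b set) k. (\<forall>i<k. A i \<in> sets \<nu>) \<longrightarrow> disjoint_family_on A {..<k} \<longrightarrow>
        prob_space.indep_vars M (\<lambda>_. borel) (\<lambda>i. point_count \<L> (A i)) {..<k})"

text \<open>The local time of the loop soup, i.e. the sum of \<open>L\<^sup>y\<^sub>\<infinity>(\<omega>)\<close> over the points \<open>\<omega>\<close> of \<open>C\<close>.\<close>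

definition soup_local_time ::
    "('a \<Rightarrow> real \<Rightarrow> 'a path \<Rightarrow> ennreal) \<Rightarrow> 'a path set \<Rightarrow> 'a \<Rightarrow> ennreal" where
  "soup_local_time L C y = (\<integral>\<^sup>+\<omega>. total_local_time L y \<omega> \<partial>count_space C)"

end

theory Submission
  imports Defs
begin

text \<open>
  Both sides are finite measures on sequences of local times, so it suffices to compare their Laplace
  transforms.  Put \<open>W = exp (- \<Sum>j. \<lambda>\<^sub>j L\<^sup>x\<^sup>j)\<close>.  The Palm formula for the Poisson process reduces the
  claim to the identity \<open>\<mu>(L\<^sup>x\<^sup>0 W) = Q\<^sup>x\<^sup>0\<^sup>,\<^sup>x\<^sup>0(W)\<close> for a single loop.  The measure \<open>Q\<^sup>x\<^sup>,\<^sup>y\<close> is the law of the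
  path killed at a time chosen according to \<open>dL\<^sup>y\<close>, and the strong Markov property at the inverse local
  time of \<open>x0\<close> gives \<open>Q\<^sup>x\<^sup>,\<^sup>y(L\<^sup>x\<^sup>0 W) = Q\<^sup>x\<^sup>,\<^sup>x\<^sup>0(W) Q\<^sup>x\<^sup>0\<^sup>,\<^sup>y(W)\<close>.  Take \<open>x = y\<close> and integrate over \<open>x\<close>: the right-hand side
  becomes \<open>Q\<^sup>x\<^sup>0\<^sup>,\<^sup>x\<^sup>0(\<zeta> W)\<close>, and the factor \<open>\<zeta>\<close> is cancelled by the weight \<open>1 / t\<close> in the loop measure.
\<close>

section \<open>Path space\<close>

text \<open>The analytic obstacle is \<open>expected_L\<close>: local time is given only as an
  almost sure limit of occupation integrals, and passing to expectations needs uniform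
  integrability. It comes from the strong Markov property at the time when an occupation exceeds a
  level, together with continuity and finiteness of the potential density near the diagonal. The
  second obstacle is null sets. Limits hold almost surely under each \<open>P x\<close>, but they
  must survive shifts by random times and be used under \<open>Q\<close>. Hence a single event
  \<open>good y\<close> that does not mention the starting point, and the representation of
  \<open>Q\<close> by killing, so that limits are evaluated under \<open>P x\<close> only. Path
  measures are known only on events in the past of a time \<open>s\<close> at which the path is
  still alive. These events generate the path algebra and are stable under intersection, so
  identities of measures and measurability of kernels are checked on them. The weight
  \<open>1 / t\<close> is not multiplicative under concatenation of paths, while
  \<open>exp (- q t)\<close> is; this is why the exponential functionals carry a rate
  \<open>q\<close> that is integrated out at the end.\<close>

lemma space_path_filtration [simp]: "space (path_filtration t) = paths"
  and space_path_algebra [simp]: "space path_algebra = paths"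
  and space_path_filtration_left [simp]: "space (path_filtration_left t) = paths"
  by (auto simp: path_filtration_def path_algebra_def path_filtration_left_def space_measure_of_conv)

lemma sets_cemetery_borel: "sets cemetery_borel = {A. Some -` A \<in> sets borel}"
proof -
  have "sigma_algebra UNIV {A. Some -` A \<in> sets (borel :: 'a measure)}"
    by (rule sigma_algebra_iff2[THEN iffD2]) (auto simp: vimage_Diff vimage_UN)
  then show ?thesis
    unfolding cemetery_borel_def by (rule sigma_algebra.sets_measure_of_eq)
qed

lemma space_cemetery_borel [simp]: "space cemetery_borel = UNIV"
  by (simp add: cemetery_borel_def space_measure_of_conv)

lemma Some_image_in_cemetery [measurable]: "C \<in> sets borel \<Longrightarrow> Some ` C \<in> sets cemetery_borel"
  by (auto simp: sets_cemetery_borel inj_vimage_image_eq)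

lemma None_in_cemetery [measurable]: "{None} \<in> sets cemetery_borel"
proof -
  have "Some -` {None :: 'a option} = {}" by auto
  then show ?thesis by (simp add: sets_cemetery_borel)
qed

text \<open>Subsets of the state space suffice as tests: the preimage of \<open>None\<close> is the
  complement of the preimage of \<open>range Some\<close>, which is the case
  \<open>C = UNIV\<close>.\<close>

lemma measurable_cemeteryI:
  assumes "\<And>C. C \<in> sets borel \<Longrightarrow> {x \<in> space M. h x \<in> Some ` C} \<in> sets M"
  shows "h \<in> M \<rightarrow>\<^sub>M cemetery_borel"
proof (rule measurableI)
  fix A :: "'a option set" assume "A \<in> sets cemetery_borel"
  then have A: "Some -` A \<in> sets borel" by (simp add: sets_cemetery_borel)
  have alive: "{x \<in> space M. h x \<in> range Some} \<in> sets M" using assms[of UNIV] by simp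
  have "h -` A \<inter> space M =
      {x \<in> space M. h x \<in> Some ` (Some -` A)} \<union>
      (if None \<in> A then space M - {x \<in> space M. h x \<in> range Some} else {})"
  proof (intro set_eqI)
    fix x show "(x \<in> h -` A \<inter> space M) = (x \<in> {x \<in> space M. h x \<in> Some ` (Some -` A)} \<union>
      (if None \<in> A then space M - {x \<in> space M. h x \<in> range Some} else {}))"
      by (cases "h x") auto
  qed
  then show "h -` A \<inter> space M \<in> sets M" using assms[OF A] alive by auto
qed simp

lemma measurable_extend_zero [measurable]:
  assumes [measurable]: "g \<in> borel_measurable borel"
  shows "extend_zero g \<in> borel_measurable cemetery_borel"
proof (rule measurableI)
  fix A :: "'b set" assume [measurable]: "A \<in> sets borel"
  have "Some -` (extend_zero g -` A) = g -` A \<inter> space borel" by (auto simp: extend_zero_def)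
  also have "\<dots> \<in> sets borel" by measurable
  finally show "extend_zero g -` A \<inter> space cemetery_borel \<in> sets cemetery_borel"
    by (simp add: sets_cemetery_borel)
qed simp

lemma extend_zero_simps [simp]: "extend_zero g None = 0" "extend_zero g (Some v) = g v"
  by (simp_all add: extend_zero_def)

lemma pathsD:
  assumes "\<omega> \<in> paths"
  shows "\<omega> \<in> extensional {0..}"
    and "\<And>s t. 0 \<le> s \<Longrightarrow> s \<le> t \<Longrightarrow> \<omega> s = None \<Longrightarrow> \<omega> t = None"
    and "\<And>t U. 0 \<le> t \<Longrightarrow> open U \<Longrightarrow> \<omega> t \<in> Some ` U \<Longrightarrow> (\<forall>\<^sub>F s in at_right t. \<omega> s \<in> Some ` U)"
  using assms unfolding paths_def by blast+

lemma sets_path_filtration: "sets (path_filtration t) =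
    sigma_sets paths {{\<omega> \<in> paths. \<omega> s \<in> A} | s A. 0 \<le> s \<and> s \<le> t \<and> A \<in> sets cemetery_borel}"
  unfolding path_filtration_def by (rule sets_measure_of) auto

lemma coordinate_filtration:
  assumes "0 \<le> s" "s \<le> t"
  shows "(\<lambda>\<omega>. \<omega> s) \<in> path_filtration t \<rightarrow>\<^sub>M cemetery_borel"
proof (rule measurableI)
  fix A :: "'a option set" assume "A \<in> sets cemetery_borel"
  then have "{\<omega> \<in> paths. \<omega> s \<in> A} \<in> sets (path_filtration t)"
    unfolding sets_path_filtration using assms by (intro sigma_sets.Basic) auto
  then show "(\<lambda>\<omega>. \<omega> s) -` A \<inter> space (path_filtration t) \<in> sets (path_filtration t)"
    by (simp add: vimage_def Int_def conj_commute)
qed simp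

lemma path_filtration_mono: "s \<le> t \<Longrightarrow> sets (path_filtration s) \<subseteq> sets (path_filtration t)"
  unfolding sets_path_filtration by (rule sigma_sets_mono') force

lemma path_filtration_into_Pow: "sets (path_filtration s) \<subseteq> Pow paths"
  using sets.space_closed[of "path_filtration s"] by simp

lemma sets_path_algebra:
  "sets path_algebra = sigma_sets paths (\<Union>s\<in>{0..}. sets (path_filtration s))"
  unfolding path_algebra_def using path_filtration_into_Pow by (intro sets_measure_of) auto

lemma sets_path_filtration_left:
  "sets (path_filtration_left t) = sigma_sets paths (\<Union>s\<in>{0..<t}. sets (path_filtration s))"
  unfolding path_filtration_left_def using path_filtration_into_Pow by (intro sets_measure_of) auto

lemma path_filtration_subset: "0 \<le> t \<Longrightarrow> sets (path_filtration t) \<subseteq> sets path_algebra"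
  unfolding sets_path_algebra by (auto intro: sigma_sets.Basic)

lemma path_filtration_left_subset:
  "0 \<le> s \<Longrightarrow> s < t \<Longrightarrow> sets (path_filtration s) \<subseteq> sets (path_filtration_left t)"
  unfolding sets_path_filtration_left by (auto intro!: sigma_sets.Basic)

lemma measurable_into_algebra:
  "0 \<le> t \<Longrightarrow> h \<in> path_filtration t \<rightarrow>\<^sub>M N \<Longrightarrow> h \<in> path_algebra \<rightarrow>\<^sub>M N"
  using path_filtration_subset[of t] by (auto simp: measurable_def)

lemma measurable_filtration_mono:
  "s \<le> t \<Longrightarrow> h \<in> path_filtration s \<rightarrow>\<^sub>M N \<Longrightarrow> h \<in> path_filtration t \<rightarrow>\<^sub>M N"
  using path_filtration_mono[of s t] by (auto simp: measurable_def)

lemma measurable_into_filtration_left: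
  "0 \<le> s \<Longrightarrow> s < t \<Longrightarrow> h \<in> path_filtration s \<rightarrow>\<^sub>M N \<Longrightarrow> h \<in> path_filtration_left t \<rightarrow>\<^sub>M N"
  using path_filtration_left_subset[of s t] by (auto simp: measurable_def)

lemma coordinate_algebra: "0 \<le> s \<Longrightarrow> (\<lambda>\<omega>. \<omega> s) \<in> path_algebra \<rightarrow>\<^sub>M cemetery_borel"
  by (rule measurable_into_algebra[OF _ coordinate_filtration]) auto

definition cylinders :: "'a::topological_space path set set" where
  "cylinders = {{\<omega> \<in> paths. \<omega> s \<in> A} | s A. 0 \<le> s \<and> A \<in> sets cemetery_borel}"

lemma sets_path_algebra_cylinders:
  "sets (path_algebra :: 'a::topological_space path measure) = sigma_sets paths cylinders"
proof (intro equalityI)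
  have "sets (path_filtration t) \<subseteq> sigma_sets paths (cylinders :: 'a path set set)" for t :: real
    unfolding sets_path_filtration by (rule sigma_sets_mono') (auto simp: cylinders_def)
  then show "sets path_algebra \<subseteq> sigma_sets paths (cylinders :: 'a path set set)"
    unfolding sets_path_algebra by (intro sigma_sets_mono) auto
  have "cylinders \<subseteq> sets (path_algebra :: 'a path measure)"
    unfolding cylinders_def
    using measurable_sets[OF coordinate_algebra] by (force simp: vimage_def Int_def conj_commute)
  from sets.sigma_sets_subset[OF this]
  show "sigma_sets paths (cylinders :: 'a path set set) \<subseteq> sets path_algebra" by simp
qed

lemma measurable_path_algebraI:
  fixes h :: "'b \<Rightarrow> 'a::topological_space path"
  assumes "\<And>x. x \<in> space M \<Longrightarrow> h x \<in> paths"
    and "\<And>s. 0 \<le> s \<Longrightarrow> (\<lambda>x. h x s) \<in> M \<rightarrow>\<^sub>M cemetery_borel"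
  shows "h \<in> M \<rightarrow>\<^sub>M path_algebra"
proof (rule measurable_sigma_sets[OF sets_path_algebra_cylinders])
  show "cylinders \<subseteq> Pow (paths :: 'a path set)" by (auto simp: cylinders_def)
  fix C assume "C \<in> (cylinders :: 'a path set set)"
  then obtain s A where C: "C = {\<omega> \<in> paths. \<omega> s \<in> A}" "0 \<le> s" "A \<in> sets cemetery_borel"
    unfolding cylinders_def by blast
  have "h -` C \<inter> space M = (\<lambda>x. h x s) -` A \<inter> space M" using assms(1) by (auto simp: C)
  then show "h -` C \<inter> space M \<in> sets M" using measurable_sets[OF assms(2)] C by simp
qed (use assms(1) in auto)

text \<open>Right continuity makes the inequality strict: a path that is in \<open>S\<close> at time
  \<open>t\<close> stays there on some interval to the right of \<open>t\<close>, so it cannot die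
  exactly at \<open>t\<close>. Absorption at \<open>None\<close> gives the rest.\<close>

lemma lifetime_greater_iff:
  assumes "\<omega> \<in> paths" "0 \<le> t"
  shows "ennreal t < lifetime \<omega> \<longleftrightarrow> \<omega> t \<noteq> None"
proof
  show "ennreal t < lifetime \<omega> \<Longrightarrow> \<omega> t \<noteq> None"
  proof
    assume "ennreal t < lifetime \<omega>" "\<omega> t = None"
    then have "lifetime \<omega> \<le> ennreal t" unfolding lifetime_def using assms by (intro INF_lower) auto
    then show False using \<open>ennreal t < lifetime \<omega>\<close> by simp
  qed
  assume "\<omega> t \<noteq> None"
  then have "\<omega> t \<in> Some ` UNIV" by (cases "\<omega> t") auto
  from pathsD(3)[OF assms(1,2) open_UNIV this] obtain b where b: "t < b" "\<And>s. t < s \<Longrightarrow> s < b \<Longrightarrow> \<omega> s \<in> Some ` UNIV"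
    by (auto simp: eventually_at_right_field)
  \<comment> \<open>A time still inside the interval of survival; it separates \<open>t\<close>
    strictly from the infimum.\<close>
  define c where "c = (t + b) / 2"
  have "\<omega> c \<noteq> None" using b(2)[of c] b(1) by (auto simp: c_def field_simps)
  have "ennreal c \<le> lifetime \<omega>" unfolding lifetime_def
  proof (rule INF_greatest)
    fix s assume "s \<in> {t. 0 \<le> t \<and> \<omega> t = None}"
    then have "\<not> s \<le> c" using pathsD(2)[OF assms(1), of s c] \<open>\<omega> c \<noteq> None\<close> by auto
    then show "ennreal c \<le> ennreal s" by (intro ennreal_leI) simp
  qed
  moreover have "ennreal t < ennreal c" using b assms(2) by (simp add: c_def ennreal_less_iff)
  ultimately show "ennreal t < lifetime \<omega>" by simp
qed

lemma alive_event: "0 \<le> s \<Longrightarrow> s \<le> t \<Longrightarrow> {\<omega> \<in> paths. ennreal s < lifetime \<omega>} \<in> sets (path_filtration t)"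
proof -
  assume s: "0 \<le> s" "s \<le> t"
  have "{\<omega> \<in> paths. ennreal s < lifetime \<omega>} = (\<lambda>\<omega>. \<omega> s) -` (UNIV - {None}) \<inter> space (path_filtration t)"
    using s by (auto simp: lifetime_greater_iff)
  also have "\<dots> \<in> sets (path_filtration t)"
    by (rule measurable_sets[OF coordinate_filtration[OF s]])
       (use None_in_cemetery sets.compl_sets[of "{None}" cemetery_borel] in simp)
  finally show ?thesis .
qed

lemma lifetime_measurable [measurable]: "lifetime \<in> borel_measurable path_algebra"
proof (rule borel_measurableI_greater)
  fix y :: ennreal
  show "{\<omega> \<in> space path_algebra. y < lifetime \<omega>} \<in> sets path_algebra"
    using alive_event[of "enn2real y" "enn2real y"] path_filtration_subset[of "enn2real y"]
    by (cases y rule: ennreal_cases) auto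
qed

text \<open>Each generator looks at one coordinate up to time \<open>t\<close>, and the property is
  stable under complements and countable unions. It is the source of later claims that an adapted
  functional ignores what happens after \<open>t\<close>.\<close>

lemma filtration_determined_sets:
  assumes "A \<in> sets (path_filtration t)" "\<omega> \<in> paths" "\<omega>' \<in> paths"
    and "\<And>s. 0 \<le> s \<Longrightarrow> s \<le> t \<Longrightarrow> \<omega> s = \<omega>' s"
  shows "\<omega> \<in> A \<longleftrightarrow> \<omega>' \<in> A"
  using assms(1) unfolding sets_path_filtration
  by (induction rule: sigma_sets.induct) (use assms in auto)

lemma filtration_determined:
  fixes G :: "'a::topological_space path \<Rightarrow> 'b::t1_space"
  assumes G: "G \<in> borel_measurable (path_filtration t)" and "\<omega> \<in> paths" "\<omega>' \<in> paths"
    and "\<And>s. 0 \<le> s \<Longrightarrow> s \<le> t \<Longrightarrow> \<omega> s = \<omega>' s"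
  shows "G \<omega> = G \<omega>'"
proof -
  have "G -` {G \<omega>'} \<inter> paths \<in> sets (path_filtration t)"
    using measurable_sets[OF G, of "{G \<omega>'}"] by simp
  from filtration_determined_sets[OF this assms(2-)] show ?thesis using assms(2,3) by auto
qed

text \<open>Freezing at \<open>t\<close> maps the past up to \<open>t\<close> measurably into the
  full path space, so adaptedness can be checked as an invariance.\<close>

definition stop :: "real \<Rightarrow> 'a path \<Rightarrow> 'a path" where
  "stop t \<omega> = (\<lambda>s\<in>{0..}. \<omega> (min s t))"

lemma stop_in_paths:
  assumes "\<omega> \<in> paths" "0 \<le> t" shows "stop t \<omega> \<in> paths"
  unfolding paths_def
proof (intro CollectI conjI allI impI)
  show "stop t \<omega> \<in> extensional {0..}" by (simp add: stop_def)
  fix r s :: real assume "0 \<le> r" "r \<le> s" "stop t \<omega> r = None"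
  then show "stop t \<omega> s = None"
    using pathsD(2)[OF assms(1), of "min r t" "min s t"] assms(2) by (simp add: stop_def)
next
  fix s :: real and U :: "'a set" assume s: "0 \<le> s" "open U" "stop t \<omega> s \<in> Some ` U"
  show "\<forall>\<^sub>F r in at_right s. stop t \<omega> r \<in> Some ` U"
  proof (cases "s < t")
    case True
    then have "\<forall>\<^sub>F r in at_right s. \<omega> r \<in> Some ` U"
      using pathsD(3)[OF assms(1) s(1,2)] s by (simp add: stop_def)
    moreover have "\<forall>\<^sub>F r in at_right s. r < t" using True eventually_at_right_real eventually_mono by fastforce
    moreover have "\<forall>\<^sub>F r in at_right s. s < r" by (simp add: eventually_at_right_less)
    ultimately show ?thesis by eventually_elim (use s in \<open>simp add: stop_def\<close>)
  next
    case False
    have "\<forall>\<^sub>F r in at_right s. s < r" by (simp add: eventually_at_right_less)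
    then show ?thesis by eventually_elim (use s False in \<open>simp add: stop_def\<close>)
  qed
qed

lemma stop_measurable: "0 \<le> t \<Longrightarrow> stop t \<in> path_filtration t \<rightarrow>\<^sub>M path_algebra"
  by (rule measurable_path_algebraI) (auto intro!: stop_in_paths coordinate_filtration, simp add: stop_def coordinate_filtration)

text \<open>Galmarino's test: a functional that does not change when the path is frozen at
  \<open>t\<close> factors through \<open>stop t\<close>, hence depends measurably on the past
  alone.\<close>

lemma adapted_via_stop:
  assumes "0 \<le> t" "G \<in> path_algebra \<rightarrow>\<^sub>M N" "\<And>\<omega>. \<omega> \<in> paths \<Longrightarrow> G (stop t \<omega>) = G \<omega>"
  shows "G \<in> path_filtration t \<rightarrow>\<^sub>M N"
proof -
  have "(\<lambda>\<omega>. G (stop t \<omega>)) \<in> path_filtration t \<rightarrow>\<^sub>M N"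
    using measurable_comp[OF stop_measurable[OF assms(1)] assms(2)] by (simp add: comp_def)
  then show ?thesis using assms(3) by (subst measurable_cong[where g="\<lambda>\<omega>. G (stop t \<omega>)"]) auto
qed

section \<open>Shift and killing operators, and joint measurability of the coordinates\<close>

lemma shift_apply [simp]: "0 \<le> s \<Longrightarrow> shift t \<omega> s = \<omega> (t + s)"
  by (simp add: shift_def)

lemma killing_apply [simp]: "0 \<le> s \<Longrightarrow> killing t \<omega> s = (if s < t then \<omega> s else None)"
  by (simp add: killing_def)

lemma eventually_at_right_shift:
  "eventually (\<lambda>r. P (t + r)) (at_right (s::real)) \<longleftrightarrow> eventually P (at_right (t + s))"
proof -
  have "(\<forall>b>t + s. \<exists>c>s. t + c = b)" "\<forall>c. t + c - t = c" by (auto intro!: exI[of _ "_ - t"])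
  show ?thesis unfolding eventually_at_right_field
  proof (intro iffI)
    assume "\<exists>b>s. \<forall>y>s. y < b \<longrightarrow> P (t + y)"
    then obtain b where b: "b > s" "\<And>y. y > s \<Longrightarrow> y < b \<Longrightarrow> P (t + y)" by auto
    have "P y" if "t + s < y" "y < t + b" for y using b(2)[of "y - t"] that by simp
    then show "\<exists>b>t + s. \<forall>y>t + s. y < b \<longrightarrow> P y" using b(1) by (intro exI[of _ "t + b"]) auto
  next
    assume "\<exists>b>t + s. \<forall>y>t + s. y < b \<longrightarrow> P y"
    then obtain b where b: "b > t + s" "\<And>y. y > t + s \<Longrightarrow> y < b \<Longrightarrow> P y" by auto
    then show "\<exists>b>s. \<forall>y>s. y < b \<longrightarrow> P (t + y)" by (intro exI[of _ "b - t"]) auto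
  qed
qed

lemma shift_in_paths:
  assumes "\<omega> \<in> paths" "0 \<le> t" shows "shift t \<omega> \<in> paths"
  unfolding paths_def
proof (intro CollectI conjI allI impI)
  show "shift t \<omega> \<in> extensional {0..}" by (simp add: shift_def)
  fix r s :: real assume "0 \<le> r" "r \<le> s" "shift t \<omega> r = None"
  then show "shift t \<omega> s = None"
    using pathsD(2)[OF assms(1), of "t + r" "t + s"] assms(2) by simp
next
  fix s :: real and U :: "'a set" assume s: "0 \<le> s" "open U" "shift t \<omega> s \<in> Some ` U"
  then have "\<forall>\<^sub>F r in at_right (t + s). \<omega> r \<in> Some ` U"
    using pathsD(3)[OF assms(1), of "t + s" U] assms(2) by simp
  then have "\<forall>\<^sub>F r in at_right s. \<omega> (t + r) \<in> Some ` U"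
    by (simp only: eventually_at_right_shift[of "\<lambda>r. \<omega> r \<in> Some ` U"])
  moreover have "\<forall>\<^sub>F r in at_right s. s < r" by (simp add: eventually_at_right_less)
  ultimately show "\<forall>\<^sub>F r in at_right s. shift t \<omega> r \<in> Some ` U"
    by eventually_elim (use s in simp)
qed

lemma killing_in_paths:
  assumes "\<omega> \<in> paths" shows "killing t \<omega> \<in> paths"
  unfolding paths_def
proof (intro CollectI conjI allI impI)
  show "killing t \<omega> \<in> extensional {0..}" by (simp add: killing_def)
  fix r s :: real assume "0 \<le> r" "r \<le> s" "killing t \<omega> r = None"
  then show "killing t \<omega> s = None"
    using pathsD(2)[OF assms(1), of r s] by (auto split: if_splits)
next
  fix s :: real and U :: "'a set" assume s: "0 \<le> s" "open U" "killing t \<omega> s \<in> Some ` U"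
  then have "s < t" by (auto split: if_splits)
  then have "\<forall>\<^sub>F r in at_right s. r < t" using eventually_at_right_real eventually_mono by fastforce
  moreover have "\<forall>\<^sub>F r in at_right s. \<omega> r \<in> Some ` U"
    using pathsD(3)[OF assms(1), of s U] s \<open>s < t\<close> by simp
  moreover have "\<forall>\<^sub>F r in at_right s. s < r" by (simp add: eventually_at_right_less)
  ultimately show "\<forall>\<^sub>F r in at_right s. killing t \<omega> r \<in> Some ` U"
    by eventually_elim (use s in simp)
qed

lemma lifetime_killing:
  assumes "\<omega> \<in> paths" "0 \<le> t" shows "lifetime (killing t \<omega>) = min (ennreal t) (lifetime \<omega>)"
proof -
  have *: "y < lifetime (killing t \<omega>) \<longleftrightarrow> y < min (ennreal t) (lifetime \<omega>)" for y
  proof (cases y rule: ennreal_cases)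
    case (real r)
    then show ?thesis
      using lifetime_greater_iff[OF killing_in_paths[OF assms(1)], of r t] lifetime_greater_iff[OF assms(1), of r]
      by (auto simp: ennreal_less_iff)
  qed simp
  show ?thesis
  proof (rule antisym)
    show "lifetime (killing t \<omega>) \<le> min (ennreal t) (lifetime \<omega>)"
      by (rule dense_le) (simp add: * less_imp_le)
    show "min (ennreal t) (lifetime \<omega>) \<le> lifetime (killing t \<omega>)"
      by (rule dense_le) (simp only: *[symmetric] less_imp_le)
  qed
qed

text \<open>At a dead time the function is constant to the right, since death is absorbing. At a
  live time continuity of \<open>g\<close> pulls open sets back to open subsets of \<open>S\<close>,
  for which the definition of \<open>paths\<close> provides right continuity.\<close>

lemma right_continuous_extend_zero:
  fixes g :: "'a::topological_space \<Rightarrow> real"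
  assumes "\<omega> \<in> paths" "0 \<le> t" "continuous_on UNIV g"
  shows "((\<lambda>s. extend_zero g (\<omega> s)) \<longlongrightarrow> extend_zero g (\<omega> t)) (at_right t)"
proof (cases "\<omega> t")
  case None
  have "\<forall>\<^sub>F s in at_right t. t < s" by (simp add: eventually_at_right_less)
  then have "\<forall>\<^sub>F s in at_right t. extend_zero g (\<omega> s) = extend_zero g (\<omega> t)"
    by eventually_elim (use pathsD(2)[OF assms(1,2)] None in auto)
  then show ?thesis by (rule tendsto_eventually)
next
  case (Some v)
  show ?thesis
  proof (rule topological_tendstoI)
    fix S :: "real set" assume S: "open S" "extend_zero g (\<omega> t) \<in> S"
    have "open (g -` S)" using assms(3) S(1) by (simp add: continuous_on_open_vimage)
    moreover have "\<omega> t \<in> Some ` (g -` S)" using S(2) Some by simp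
    ultimately have "\<forall>\<^sub>F s in at_right t. \<omega> s \<in> Some ` (g -` S)" by (rule pathsD(3)[OF assms(1,2)])
    then show "\<forall>\<^sub>F s in at_right t. extend_zero g (\<omega> s) \<in> S" by eventually_elim auto
  qed
qed

text \<open>Despite the name, a grid of mesh \<open>1 / Suc n\<close>: the value is the least grid
  point strictly above \<open>t\<close>. Strictness makes the approximation come from the right,
  where paths are continuous.\<close>

definition dyadic_above :: "nat \<Rightarrow> real \<Rightarrow> real" where
  "dyadic_above n t = (of_int \<lfloor>real (Suc n) * t\<rfloor> + 1) / real (Suc n)"

lemma dyadic_above: "t < dyadic_above n t" "dyadic_above n t \<le> t + 1 / real (Suc n)"
proof -
  have "real (Suc n) * t < of_int \<lfloor>real (Suc n) * t\<rfloor> + 1" by linarith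
  then show "t < dyadic_above n t" unfolding dyadic_above_def by (simp add: field_simps)
  have "of_int \<lfloor>real (Suc n) * t\<rfloor> + 1 \<le> real (Suc n) * t + 1" by linarith
  then have "dyadic_above n t \<le> (real (Suc n) * t + 1) / real (Suc n)"
    unfolding dyadic_above_def by (rule divide_right_mono) simp
  then show "dyadic_above n t \<le> t + 1 / real (Suc n)" by (simp add: add_divide_distrib)
qed

lemma dyadic_above_tendsto: "filterlim (\<lambda>n. dyadic_above n t) (at_right t) sequentially"
proof -
  have "(\<lambda>n. t + 1 / real (Suc n)) \<longlonglongrightarrow> t + 0"
    by (intro tendsto_intros) (use LIMSEQ_inverse_real_of_nat in \<open>simp add: inverse_eq_divide\<close>)
  then have lim: "(\<lambda>n. t + 1 / real (Suc n)) \<longlonglongrightarrow> t" by (simp only: add_0_right)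
  have "(\<lambda>n. dyadic_above n t) \<longlonglongrightarrow> t"
  proof (rule tendsto_sandwich[rotated 2])
    show "(\<lambda>n. t) \<longlonglongrightarrow> t" by simp
    show "\<forall>\<^sub>F n in sequentially. t \<le> dyadic_above n t"
      by (rule always_eventually, rule allI, rule less_imp_le[OF dyadic_above(1)])
    show "\<forall>\<^sub>F n in sequentially. dyadic_above n t \<le> t + 1 / real (Suc n)"
      by (rule always_eventually, rule allI, rule dyadic_above(2))
  qed (rule lim)
  then show ?thesis unfolding filterlim_at using dyadic_above(1) by (auto simp: less_imp_neq[symmetric])
qed

text \<open>Continuous real functions detect open sets of a metric space: \<open>infdist\<close> to
  the complement of \<open>U\<close> is positive exactly on \<open>U\<close>.\<close>

lemma measurable_cemetery_continuousI:
  fixes h :: "'b \<Rightarrow> 'a::metric_space option"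
  assumes "\<And>g :: 'a \<Rightarrow> real. continuous_on UNIV g \<Longrightarrow> (\<lambda>z. extend_zero g (h z)) \<in> borel_measurable M"
  shows "h \<in> M \<rightarrow>\<^sub>M cemetery_borel"
proof (rule measurable_cemeteryI)
  define A where "A = {z \<in> space M. h z \<noteq> None}"
  have open_ev: "{z \<in> space M. h z \<in> Some ` U} \<in> sets M" if "open U" for U
  \<comment> \<open>\<open>infdist\<close> to the empty set is zero, so the whole space is tested
    with a constant function instead.\<close>
  proof (cases "U = UNIV")
    case True
    have "(\<lambda>z. extend_zero (\<lambda>_::'a. 1::real) (h z)) \<in> borel_measurable M" by (rule assms) simp
    then have "{z \<in> space M. extend_zero (\<lambda>_::'a. 1::real) (h z) = 1} \<in> sets M" by measurable
    moreover have "{z \<in> space M. extend_zero (\<lambda>_::'a. 1::real) (h z) = 1} = {z \<in> space M. h z \<in> Some ` U}"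
      using True by (auto simp: extend_zero_def split: option.splits)
    ultimately show ?thesis by simp
  next
    case False
    have pos: "0 < infdist x (- U) \<longleftrightarrow> x \<in> U" for x
      using in_closed_iff_infdist_zero[of "- U" x] False that infdist_nonneg[of x "- U"]
      by (auto simp: less_le)
    have "(\<lambda>z. extend_zero (\<lambda>x. infdist x (- U)) (h z)) \<in> borel_measurable M"
      by (rule assms) (intro continuous_intros)
    then have "{z \<in> space M. 0 < extend_zero (\<lambda>x. infdist x (- U)) (h z)} \<in> sets M" by measurable
    moreover have "{z \<in> space M. 0 < extend_zero (\<lambda>x. infdist x (- U)) (h z)} = {z \<in> space M. h z \<in> Some ` U}"
    proof (intro set_eqI)
      fix z show "z \<in> {z \<in> space M. 0 < extend_zero (\<lambda>x. infdist x (- U)) (h z)} \<longleftrightarrow>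
          z \<in> {z \<in> space M. h z \<in> Some ` U}"
        using pos[of "the (h z)"] by (cases "h z") (simp_all add: inj_image_mem_iff)
    qed
    ultimately show ?thesis by simp
  qed
  have A: "A \<in> sets M" using open_ev[of UNIV] by (simp add: A_def image_iff notin_range_Some)
  have "(\<lambda>z. the (h z)) \<in> borel_measurable (restrict_space M A)"
  proof (rule borel_measurableI)
    fix U :: "'a set" assume "open U"
    have "(\<lambda>z. the (h z)) -` U \<inter> space (restrict_space M A) = {z \<in> space M. h z \<in> Some ` U}"
      by (auto simp: space_restrict_space A_def image_iff)
    then show "(\<lambda>z. the (h z)) -` U \<inter> space (restrict_space M A) \<in> sets (restrict_space M A)"
      using open_ev[OF \<open>open U\<close>] A by (auto simp: sets_restrict_space_iff A_def image_iff)
  qed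
  moreover fix C :: "'a set" assume "C \<in> sets borel"
  ultimately have "(\<lambda>z. the (h z)) -` C \<inter> space (restrict_space M A) \<in> sets (restrict_space M A)"
    by (rule measurable_sets)
  moreover have "(\<lambda>z. the (h z)) -` C \<inter> space (restrict_space M A) = {z \<in> space M. h z \<in> Some ` C}"
    by (auto simp: space_restrict_space A_def image_iff)
  ultimately show "{z \<in> space M. h z \<in> Some ` C} \<in> sets M"
    using A by (auto simp: sets_restrict_space_iff)
qed

text \<open>Right continuity lets the value at \<open>t\<close> be approximated by values at grid
  times above \<open>t\<close>. The \<open>max 0\<close> is there because paths carry only a default
  value at negative times.\<close>

lemma coordinate_jointly_measurable:
  "(\<lambda>(t, \<omega>). \<omega> (max 0 t)) \<in> borel \<Otimes>\<^sub>M (path_algebra :: 'a::metric_space path measure) \<rightarrow>\<^sub>M cemetery_borel"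
proof (rule measurable_cemetery_continuousI)
  fix g :: "'a \<Rightarrow> real" assume g: "continuous_on UNIV g"
  then have [measurable]: "g \<in> borel_measurable borel" by (rule borel_measurable_continuous_onI)
  have lim: "(\<lambda>n. extend_zero g (\<omega> (dyadic_above n (max 0 t)))) \<longlonglongrightarrow> extend_zero g (\<omega> (max 0 t))"
    if "\<omega> \<in> paths" for t and \<omega> :: "'a path"
    by (rule filterlim_compose[OF right_continuous_extend_zero[OF that _ g] dyadic_above_tendsto]) simp
  have meas: "(\<lambda>(t, \<omega>). extend_zero g (\<omega> (dyadic_above n (max 0 t))))
      \<in> borel_measurable (borel \<Otimes>\<^sub>M path_algebra)" for n
  proof -
    \<comment> \<open>The grid time depends on the argument only through an integer, so the
      approximation is a countable case distinction over fixed times.\<close>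
    have "(\<lambda>z. (\<lambda>(i::int) z. extend_zero g (snd z (max 0 ((of_int i + 1) / real (Suc n)))))
        (\<lfloor>real (Suc n) * max 0 (fst z)\<rfloor>) z) \<in> borel_measurable (borel \<Otimes>\<^sub>M (path_algebra :: 'a path measure))"
    proof (rule measurable_compose_countable[where f="\<lambda>(i::int) z. extend_zero g (snd z (max 0 ((of_int i + 1) / real (Suc n))))"])
      fix i :: int
      have [measurable]: "(\<lambda>\<omega>. \<omega> (max 0 ((of_int i + 1) / real (Suc n)))) \<in> path_algebra \<rightarrow>\<^sub>M cemetery_borel"
        by (rule coordinate_algebra) simp
      show "(\<lambda>z. extend_zero g (snd z (max 0 ((of_int i + 1) / real (Suc n)))))
          \<in> borel_measurable (borel \<Otimes>\<^sub>M (path_algebra :: 'a path measure))"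
        by measurable
    qed measurable
    moreover have "max 0 ((of_int \<lfloor>real (Suc n) * max 0 t\<rfloor> + 1) / real (Suc n)) = dyadic_above n (max 0 t)" for t
      using dyadic_above(1)[of "max 0 t" n] by (simp add: dyadic_above_def)
    ultimately show ?thesis by (simp add: case_prod_beta')
  qed
  show "(\<lambda>z. extend_zero g (case z of (t, \<omega>) \<Rightarrow> \<omega> (max 0 t))) \<in> borel_measurable (borel \<Otimes>\<^sub>M path_algebra)"
    by (rule borel_measurable_LIMSEQ_real[OF _ meas]) (auto simp: space_pair_measure intro: lim)
qed

lemma coordinate_at_measurable:
  fixes W :: "'b \<Rightarrow> 'a::metric_space path"
  assumes [measurable]: "T \<in> borel_measurable M" "W \<in> M \<rightarrow>\<^sub>M path_algebra"
    and "\<And>x. x \<in> space M \<Longrightarrow> 0 \<le> T x"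
  shows "(\<lambda>x. W x (T x)) \<in> M \<rightarrow>\<^sub>M cemetery_borel"
proof -
  have "(\<lambda>x. (T x, W x)) \<in> M \<rightarrow>\<^sub>M borel \<Otimes>\<^sub>M path_algebra" by measurable
  from measurable_compose[OF this coordinate_jointly_measurable]
  show ?thesis using assms(3) by (subst measurable_cong[where g="\<lambda>x. W x (max 0 (T x))"]) auto
qed

lemma shift_measurable:
  fixes W :: "'b \<Rightarrow> 'a::metric_space path"
  assumes [measurable]: "T \<in> borel_measurable M" "W \<in> M \<rightarrow>\<^sub>M path_algebra"
    and "\<And>x. x \<in> space M \<Longrightarrow> 0 \<le> T x"
  shows "(\<lambda>x. shift (T x) (W x)) \<in> M \<rightarrow>\<^sub>M path_algebra"
proof (rule measurable_path_algebraI)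
  show "shift (T x) (W x) \<in> paths" if "x \<in> space M" for x
    using shift_in_paths assms(3)[OF that] measurable_space[OF assms(2) that] by auto
  show "(\<lambda>x. shift (T x) (W x) s) \<in> M \<rightarrow>\<^sub>M cemetery_borel" if "0 \<le> s" for s
    unfolding shift_apply[OF that] by (rule coordinate_at_measurable) (use that assms(3) in auto)
qed

lemma killing_measurable:
  fixes W :: "'b \<Rightarrow> 'a::metric_space path"
  assumes [measurable]: "T \<in> borel_measurable M" "W \<in> M \<rightarrow>\<^sub>M path_algebra"
  shows "(\<lambda>x. killing (T x) (W x)) \<in> M \<rightarrow>\<^sub>M path_algebra"
proof (rule measurable_path_algebraI)
  show "killing (T x) (W x) \<in> paths" if "x \<in> space M" for x
    using killing_in_paths measurable_space[OF assms(2) that] by auto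
  fix s :: real assume s: "0 \<le> s"
  have [measurable]: "(\<lambda>x. W x s) \<in> M \<rightarrow>\<^sub>M cemetery_borel"
    by (rule coordinate_at_measurable) (use s in auto)
  have [measurable]: "(\<lambda>x. None) \<in> M \<rightarrow>\<^sub>M cemetery_borel" by (rule measurable_const) simp
  show "(\<lambda>x. killing (T x) (W x) s) \<in> M \<rightarrow>\<^sub>M cemetery_borel"
    using s by (simp add: measurable_If)
qed

lemma killing_measurable_left:
  "killing t \<in> path_filtration_left t \<rightarrow>\<^sub>M path_algebra"
proof (rule measurable_path_algebraI)
  fix s :: real assume s: "0 \<le> s"
  show "(\<lambda>\<omega>. killing t \<omega> s) \<in> path_filtration_left t \<rightarrow>\<^sub>M cemetery_borel"
    using s by (cases "s < t") (auto intro: measurable_into_filtration_left[OF _ _ coordinate_filtration[OF s order_refl]])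
qed (simp add: killing_in_paths)

section \<open>Occupation times and the strong Markov property\<close>

definition occupation :: "('a \<Rightarrow> ennreal) \<Rightarrow> real \<Rightarrow> 'a path \<Rightarrow> ennreal" where
  "occupation g t \<omega> = (\<integral>\<^sup>+s\<in>{0..t}. extend_zero g (\<omega> s) \<partial>lborel)"

definition total_occupation :: "('a \<Rightarrow> ennreal) \<Rightarrow> 'a path \<Rightarrow> ennreal" where
  "total_occupation g \<omega> = (\<integral>\<^sup>+s\<in>{0..}. extend_zero g (\<omega> s) \<partial>lborel)"

lemma path_section_measurable:
  fixes g :: "'a::metric_space \<Rightarrow> 'b::{topological_space, zero}"
  assumes [measurable]: "g \<in> borel_measurable borel" and \<omega>: "\<omega> \<in> paths"
  shows "(\<lambda>s. extend_zero g (\<omega> (max 0 s))) \<in> borel_measurable lborel"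
proof -
  have const: "(\<lambda>s. \<omega>) \<in> borel \<rightarrow>\<^sub>M path_algebra" using \<omega> by (intro measurable_const) simp
  have max: "(\<lambda>s::real. max 0 s) \<in> borel_measurable borel" by measurable
  have [measurable]: "(\<lambda>s. \<omega> (max 0 s)) \<in> borel \<rightarrow>\<^sub>M cemetery_borel"
    by (rule coordinate_at_measurable[OF max const max.cobounded1])
  show ?thesis by measurable
qed

lemma path_section_measurable_indicator:
  fixes g :: "'a::metric_space \<Rightarrow> ennreal"
  assumes "g \<in> borel_measurable borel" "\<omega> \<in> paths" "S \<subseteq> {0..}" "S \<in> sets borel"
  shows "(\<lambda>s. extend_zero g (\<omega> s) * indicator S s) \<in> borel_measurable lborel"
proof -
  have [measurable]: "(\<lambda>s. extend_zero g (\<omega> (max 0 s))) \<in> borel_measurable lborel"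
    by (rule path_section_measurable) fact+
  have "(\<lambda>s. extend_zero g (\<omega> (max 0 s)) * indicator S s) \<in> borel_measurable lborel"
    using assms(4) by measurable
  also have "(\<lambda>s. extend_zero g (\<omega> (max 0 s)) * indicator S s) = (\<lambda>s. extend_zero g (\<omega> s) * indicator S s)"
    using assms(3) by (intro ext) (auto simp: indicator_def)
  finally show ?thesis .
qed

lemma coordinate_jointly_measurable':
  "(\<lambda>z. snd z (max 0 (fst z))) \<in> borel \<Otimes>\<^sub>M (path_algebra :: 'a::metric_space path measure) \<rightarrow>\<^sub>M cemetery_borel"
  "(\<lambda>z. snd z (max 0 (fst z))) \<in> lborel \<Otimes>\<^sub>M (path_algebra :: 'a path measure) \<rightarrow>\<^sub>M cemetery_borel"
  "(\<lambda>z. fst z (max 0 (snd z))) \<in> (path_algebra :: 'a path measure) \<Otimes>\<^sub>M borel \<rightarrow>\<^sub>M cemetery_borel"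
  "(\<lambda>z. fst z (max 0 (snd z))) \<in> (path_algebra :: 'a path measure) \<Otimes>\<^sub>M lborel \<rightarrow>\<^sub>M cemetery_borel"
  by ((rule coordinate_at_measurable[where T="\<lambda>z. max 0 (fst z)" and W="snd"] |
       rule coordinate_at_measurable[where T="\<lambda>z. max 0 (snd z)" and W="fst"]); (measurable | simp))+

lemma path_integral_measurable:
  fixes g :: "'a::metric_space \<Rightarrow> ennreal"
  assumes [measurable]: "g \<in> borel_measurable borel" "S \<in> sets borel" and "S \<subseteq> {0..}"
  shows "(\<lambda>\<omega>. \<integral>\<^sup>+s\<in>S. extend_zero g (\<omega> s) \<partial>lborel) \<in> borel_measurable path_algebra"
proof -
  note [measurable] = coordinate_jointly_measurable'
  have "(\<lambda>\<omega>. \<integral>\<^sup>+s\<in>S. extend_zero g (\<omega> (max 0 s)) \<partial>lborel) \<in> borel_measurable path_algebra"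
    by measurable
  also have "(\<lambda>\<omega>. \<integral>\<^sup>+s\<in>S. extend_zero g (\<omega> (max 0 s)) \<partial>lborel) =
      (\<lambda>\<omega>. \<integral>\<^sup>+s\<in>S. extend_zero g (\<omega> s) \<partial>lborel)"
    using assms(3) by (intro ext nn_integral_cong) (auto simp: indicator_def)
  finally show ?thesis .
qed

lemma occupation_measurable [measurable]:
  fixes g :: "'a::metric_space \<Rightarrow> ennreal"
  assumes "g \<in> borel_measurable borel"
  shows "occupation g t \<in> borel_measurable path_algebra"
    and "total_occupation g \<in> borel_measurable path_algebra"
  unfolding occupation_def[abs_def] total_occupation_def[abs_def]
  by (rule path_integral_measurable; use assms in auto)+

lemma occupation_adapted:
  fixes g :: "'a::metric_space \<Rightarrow> ennreal"
  assumes "g \<in> borel_measurable borel" "0 \<le> t"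
  shows "occupation g t \<in> borel_measurable (path_filtration t)"
proof (rule adapted_via_stop[OF assms(2) occupation_measurable(1)[OF assms(1)]])
  show "occupation g t (stop t \<omega>) = occupation g t \<omega>" for \<omega>
    unfolding occupation_def by (intro nn_integral_cong) (auto simp: indicator_def stop_def)
qed

lemma occupation_mono: "s \<le> t \<Longrightarrow> occupation g s \<omega> \<le> occupation g t \<omega>"
  unfolding occupation_def by (intro nn_integral_mono) (auto simp: indicator_def)

lemma occupation_le_total: "occupation g s \<omega> \<le> total_occupation g \<omega>"
  unfolding occupation_def total_occupation_def by (intro nn_integral_mono) (auto simp: indicator_def)

text \<open>Translation invariance of Lebesgue measure; the finite and the infinite horizon are both
  instances of \<open>split\<close>.\<close>

lemma occupation_add:
  fixes g :: "'a::metric_space \<Rightarrow> ennreal"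
  assumes [measurable]: "g \<in> borel_measurable borel" and \<omega>: "\<omega> \<in> paths" and "0 \<le> T"
  shows "0 \<le> t \<Longrightarrow> occupation g (T + t) \<omega> = occupation g T \<omega> + occupation g t (shift T \<omega>)"
    and "total_occupation g \<omega> = occupation g T \<omega> + total_occupation g (shift T \<omega>)"
proof -
  \<comment> \<open>\<open>S'\<close> is \<open>S\<close> translated by \<open>- T\<close>, except
    possibly at time \<open>0\<close>. That point is null; it is lost when \<open>{T<..}\<close> is
    matched with a closed half line.\<close>
  have split: "(\<integral>\<^sup>+s\<in>{0..T} \<union> S. extend_zero g (\<omega> s) \<partial>lborel) =
      occupation g T \<omega> + (\<integral>\<^sup>+s\<in>S'. extend_zero g (shift T \<omega> s) \<partial>lborel)"
    if S: "S \<subseteq> {T<..}" "S' \<subseteq> {0..}" "S \<in> sets borel" "\<And>s. s \<noteq> 0 \<Longrightarrow> T + s \<in> S \<longleftrightarrow> s \<in> S'" for S S'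
  proof -
    have "(\<integral>\<^sup>+s\<in>{0..T} \<union> S. extend_zero g (\<omega> s) \<partial>lborel) =
        (\<integral>\<^sup>+s. extend_zero g (\<omega> s) * indicator {0..T} s + extend_zero g (\<omega> s) * indicator S s \<partial>lborel)"
      using S by (intro nn_integral_cong) (auto simp: indicator_def)
    also have "\<dots> = occupation g T \<omega> + (\<integral>\<^sup>+s. extend_zero g (\<omega> s) * indicator S s \<partial>lborel)"
      unfolding occupation_def using S \<omega> \<open>0 \<le> T\<close> by (intro nn_integral_add path_section_measurable_indicator) force+
    also have "(\<integral>\<^sup>+s. extend_zero g (\<omega> s) * indicator S s \<partial>lborel) =
        (\<integral>\<^sup>+s. extend_zero g (\<omega> (T + s)) * indicator S (T + s) \<partial>lborel)"
      using S \<omega> \<open>0 \<le> T\<close> nn_integral_real_affine[of "\<lambda>s. extend_zero g (\<omega> s) * indicator S s" 1 T]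
        path_section_measurable_indicator[of g \<omega> S] by force
    also have "\<dots> = (\<integral>\<^sup>+s\<in>S'. extend_zero g (shift T \<omega> s) \<partial>lborel)"
    proof (rule nn_integral_cong_AE)
      show "AE s in lborel. extend_zero g (\<omega> (T + s)) * indicator S (T + s) =
          extend_zero g (shift T \<omega> s) * indicator S' s"
        using AE_lborel_singleton[of 0] by eventually_elim (use S in \<open>auto simp: indicator_def shift_def\<close>)
    qed
    finally show ?thesis .
  qed
  show "occupation g (T + t) \<omega> = occupation g T \<omega> + occupation g t (shift T \<omega>)" if "0 \<le> t"
  proof -
    have "{0..T + t} = {0..T} \<union> {T<..T+t}" using that assms(3) by auto
    moreover have "s \<noteq> 0 \<Longrightarrow> T + s \<in> {T<..T+t} \<longleftrightarrow> s \<in> {0..t}" for s by auto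
    ultimately show ?thesis using split[of "{T<..T+t}" "{0..t}"] unfolding occupation_def by force
  qed
  have *: "{0..} = {0..T} \<union> {T<..}" using assms(3) by auto
  show "total_occupation g \<omega> = occupation g T \<omega> + total_occupation g (shift T \<omega>)"
    using split[of "{T<..}" "{0..}"] unfolding total_occupation_def by (subst *) force
qed

lemma occupation_tendsto_total:
  fixes g :: "'a::metric_space \<Rightarrow> ennreal"
  assumes "g \<in> borel_measurable borel" and "\<omega> \<in> paths"
  shows "(SUP n. occupation g (real n) \<omega>) = total_occupation g \<omega>"
proof -
  have "total_occupation g \<omega> = (\<integral>\<^sup>+s. (SUP n. extend_zero g (\<omega> s) * indicator {0..real n} s) \<partial>lborel)"
    unfolding total_occupation_def
  proof (intro nn_integral_cong)
    fix s :: real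
    obtain n where n: "s \<le> real n" using real_arch_simple by blast
    show "extend_zero g (\<omega> s) * indicator {0..} s = (SUP n. extend_zero g (\<omega> s) * indicator {0..real n} s)"
      by (intro antisym SUP_least SUP_upper2[of n]) (use n in \<open>auto simp: indicator_def\<close>)
  qed
  also have "\<dots> = (SUP n. occupation g (real n) \<omega>)" unfolding occupation_def
    by (intro nn_integral_monotone_convergence_SUP path_section_measurable_indicator assms)
       (auto simp: incseq_def le_fun_def indicator_def)
  finally show ?thesis ..
qed

text \<open>Left continuity of the occupation in time, by monotone convergence over
  \<open>{0..T - 1 / Suc n}\<close>, since the endpoint \<open>T\<close> is Lebesgue null. Monotone
  convergence also covers infinite occupations.\<close>

lemma occupation_le_if_before:
  fixes g :: "'a::metric_space \<Rightarrow> ennreal"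
  assumes "g \<in> borel_measurable borel" and \<omega>: "\<omega> \<in> paths" and T: "0 \<le> T"
    and le: "\<And>s. 0 \<le> s \<Longrightarrow> s < T \<Longrightarrow> occupation g s \<omega> \<le> k"
  shows "occupation g T \<omega> \<le> k"
proof -
  have "occupation g T \<omega> = (\<integral>\<^sup>+s. (SUP n. extend_zero g (\<omega> s) * indicator {0..T - 1 / real (Suc n)} s) \<partial>lborel)"
    unfolding occupation_def
  proof (rule nn_integral_cong_AE)
    show "AE s in lborel. extend_zero g (\<omega> s) * indicator {0..T} s =
        (SUP n. extend_zero g (\<omega> s) * indicator {0..T - 1 / real (Suc n)} s)"
      using AE_lborel_singleton[of T]
    proof eventually_elim
      fix s :: real assume "s \<noteq> T"
      show "extend_zero g (\<omega> s) * indicator {0..T} s =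
        (SUP n. extend_zero g (\<omega> s) * indicator {0..T - 1 / real (Suc n)} s)"
      proof (cases "s < T")
        case True
        then obtain n where n: "1 / real (Suc n) < T - s" using nat_approx_posE[of "T - s"] by auto
        have le: "s \<le> T - 1 / real (Suc m) \<Longrightarrow> s \<le> T" for m
          by (rule order_trans) auto
        show ?thesis
          by (intro antisym SUP_least SUP_upper2[of n]) (use n le in \<open>auto simp: indicator_def\<close>)
      next
        case False
        then have "\<not> s \<le> T - 1 / real (Suc n)" for n
          using \<open>s \<noteq> T\<close> divide_pos_pos[of 1 "real (Suc n)"] by linarith
        then show ?thesis using False \<open>s \<noteq> T\<close> by (simp add: indicator_def)
      qed
    qed
  qed
  also have "\<dots> = (SUP n. occupation g (T - 1 / real (Suc n)) \<omega>)" unfolding occupation_def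
  proof (intro nn_integral_monotone_convergence_SUP path_section_measurable_indicator assms)
    have "1 / real (Suc n) \<le> 1 / real (Suc m)" if "m \<le> n" for m n using that by (simp add: frac_le)
    then have "T - 1 / real (Suc m) \<le> T - 1 / real (Suc n)" if "m \<le> n" for m n using that by (simp only: diff_left_mono)
    then show "incseq (\<lambda>n s. extend_zero g (\<omega> s) * indicator {0..T - 1 / real (Suc n)} s)"
      by (auto simp: incseq_def le_fun_def indicator_def intro: order_trans)
  qed auto
  also have "\<dots> \<le> k"
  proof (rule SUP_least)
    fix n
    show "occupation g (T - 1 / real (Suc n)) \<omega> \<le> k"
    proof (cases "0 \<le> T - 1 / real (Suc n)")
      case True then show ?thesis by (intro le) auto
    next
      case False
      then have "{0..T - 1 / real (Suc n)} = {}" by simp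
      then show ?thesis by (simp only: occupation_def) simp
    qed
  qed
  finally show ?thesis .
qed

lemma optional_time_measurable:
  assumes "optional_time T" shows "T \<in> borel_measurable path_algebra"
proof (rule borel_measurableI_less)
  fix y :: ennreal
  have *: "{\<omega> \<in> paths. T \<omega> < ennreal t} \<in> sets path_algebra" if "0 \<le> t" for t
    using assms that path_filtration_subset[of t] unfolding optional_time_def by blast
  show "{\<omega> \<in> space path_algebra. T \<omega> < y} \<in> sets path_algebra"
  proof (cases y rule: ennreal_cases)
    case top
    have "{\<omega> \<in> space path_algebra. T \<omega> < y} = (\<Union>n. {\<omega> \<in> paths. T \<omega> < ennreal (real n)})"
    proof (intro equalityI subsetI)
      fix \<omega> assume \<omega>: "\<omega> \<in> {\<omega> \<in> space path_algebra. T \<omega> < y}"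
      then obtain n where "T \<omega> < of_nat n" using ennreal_Ex_less_of_nat[of "T \<omega>"] top by auto
      then show "\<omega> \<in> (\<Union>n. {\<omega> \<in> paths. T \<omega> < ennreal (real n)})"
        using \<omega> by (auto simp: ennreal_of_nat_eq_real_of_nat)
    qed (use top in \<open>auto simp: less_top[symmetric] top_unique\<close>)
    then show ?thesis using * by auto
  qed (use * in simp)
qed

section \<open>Transition densities and the potential density\<close>

context transition_densities
begin

text \<open>Extension by zero to nonpositive times lets time integrals run over the whole line, so
  that translations in time produce no boundary terms.\<close>

definition p0 :: "real \<Rightarrow> 'a \<Rightarrow> 'a \<Rightarrow> ennreal" where
  "p0 t x y = (if 0 < t then ennreal (p t x y) else 0)"

lemma p0_jointly_measurable: "(\<lambda>(t, x, y). p0 t x y) \<in> borel_measurable (borel \<Otimes>\<^sub>M (borel \<Otimes>\<^sub>M borel))"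
proof -
  let ?N = "borel \<Otimes>\<^sub>M (borel \<Otimes>\<^sub>M borel) :: (real \<times> 'a \<times> 'a) measure"
  let ?S = "{z. 0 < fst z} :: (real \<times> 'a \<times> 'a) set"
  have [measurable]: "(\<lambda>z. z) \<in> restrict_space ?N ?S \<rightarrow>\<^sub>M restrict_space borel {0<..} \<Otimes>\<^sub>M (borel \<Otimes>\<^sub>M borel)"
    unfolding measurable_pair_iff comp_def
    by (intro conjI measurable_restrict_space2 measurable_restrict_space1 measurable_fst measurable_snd)
       (auto simp: space_restrict_space)
  have "(\<lambda>z. ennreal (case z of (t, x, y) \<Rightarrow> p t x y)) \<in> borel_measurable (restrict_space ?N ?S)"
    by (rule measurable_compose[OF _ measurable_ennreal],
        rule measurable_compose[OF _ p_measurable]) measurable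
  then have "(\<lambda>z. if z \<in> ?S then ennreal (case z of (t, x, y) \<Rightarrow> p t x y) else 0) \<in> borel_measurable ?N"
    by (intro measurable_If_restrict_space_iff[THEN iffD2]) auto
  then show ?thesis by (rule measurable_cong[THEN iffD1, rotated]) (auto simp: p0_def)
qed

lemma p0_measurable [measurable (raw)]:
  assumes [measurable]: "T \<in> borel_measurable N" "f \<in> borel_measurable N" "g \<in> borel_measurable N"
  shows "(\<lambda>z. p0 (T z) (f z) (g z)) \<in> borel_measurable N"
proof -
  have "(\<lambda>z. (T z, f z, g z)) \<in> N \<rightarrow>\<^sub>M borel \<Otimes>\<^sub>M (borel \<Otimes>\<^sub>M borel)" by measurable
  from measurable_compose[OF this p0_jointly_measurable] show ?thesis by simp
qed

lemma measurable_m: "measurable m N = measurable borel N" "measurable N m = measurable N borel"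
  by (rule measurable_cong_sets; simp add: sets_m)+

declare sets_m [measurable_cong, simp]

lemma space_m [simp]: "space m = UNIV"
  using sets_eq_imp_space_eq[OF sets_m] by simp

lemma potential_density_eq: "potential_density p x y = (\<integral>\<^sup>+t. p0 t x y \<partial>lborel)"
  unfolding potential_density_def p0_def by (intro nn_integral_cong) (auto simp: indicator_def)

abbreviation u :: "'a \<Rightarrow> 'a \<Rightarrow> ennreal" where "u \<equiv> potential_density p"

lemma u_measurable [measurable (raw)]:
  assumes [measurable]: "f \<in> borel_measurable N" "g \<in> borel_measurable N"
  shows "(\<lambda>z. u (f z) (g z)) \<in> borel_measurable N"
  unfolding potential_density_eq by measurable

lemma p0_chapman_kolmogorov:
  assumes "0 < t" "0 < s" shows "(\<integral>\<^sup>+v. p0 t x v * p0 s v y \<partial>m) = p0 (t + s) x y"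
  using chapman_kolmogorov[OF assms] assms by (simp add: p0_def)

end

section \<open>Markov properties and marginals for nonnegative functionals\<close>

context strong_markov_process
begin

lemma P_prob: "prob_space (P x)" and sets_P [measurable_cong, simp]: "sets (P x) = sets path_algebra"
  using measurable_space[OF P_kernel, of x] by (auto simp: space_prob_algebra)

lemma space_P [simp]: "space (P x) = paths"
  using sets_eq_imp_space_eq[OF sets_P] by simp

lemma emeasure_P_paths [simp]: "emeasure (P x) paths = 1"
  using prob_space.emeasure_space_1[OF P_prob[of x]] by simp

lemma AE_P_paths: "AE \<omega> in P x. \<omega> \<in> paths"
  using AE_space[of "P x"] by simp

lemma P_subprob [measurable]: "P \<in> borel \<rightarrow>\<^sub>M subprob_algebra path_algebra"
  using P_kernel by (rule measurable_prob_algebraD)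

lemma P_integral_measurable [measurable]:
  assumes "H \<in> borel_measurable path_algebra"
  shows "(\<lambda>x. \<integral>\<^sup>+\<omega>. H \<omega> \<partial>P x) \<in> borel_measurable borel"
  using measurable_compose[OF P_subprob nn_integral_measurable_subprob_algebra[OF assms]] .

lemma optional_events_measurable: "A \<in> optional_events T \<Longrightarrow> A \<in> sets path_algebra"
  by (simp add: optional_events_def)

lemma optional_coordinate_measurable:
  fixes T :: "'a path \<Rightarrow> ennreal"
  assumes "optional_time T"
  shows "(\<lambda>\<omega>. \<omega> (enn2real (T \<omega>))) \<in> path_algebra \<rightarrow>\<^sub>M cemetery_borel"
    and "(\<lambda>\<omega>. shift (enn2real (T \<omega>)) \<omega>) \<in> path_algebra \<rightarrow>\<^sub>M path_algebra"
proof -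
  have *: "(\<lambda>\<omega>. enn2real (T \<omega>)) \<in> borel_measurable path_algebra" "(\<lambda>\<omega>. \<omega>) \<in> path_algebra \<rightarrow>\<^sub>M (path_algebra :: 'a path measure)"
    using optional_time_measurable[OF assms] by measurable
  show "(\<lambda>\<omega>. \<omega> (enn2real (T \<omega>))) \<in> path_algebra \<rightarrow>\<^sub>M cemetery_borel"
    by (rule coordinate_at_measurable[OF *]) simp
  show "(\<lambda>\<omega>. shift (enn2real (T \<omega>)) \<omega>) \<in> path_algebra \<rightarrow>\<^sub>M path_algebra"
    by (rule shift_measurable[OF *]) simp
qed

lemma alive_at:
  assumes "T < lifetime \<omega>" "\<omega> \<in> paths"
  shows "T = ennreal (enn2real T)" "\<omega> (enn2real T) \<noteq> None"
proof -
  show T: "T = ennreal (enn2real T)"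
    using less_le_trans[OF assms(1) top_greatest] by (simp add: ennreal_enn2real)
  then show "\<omega> (enn2real T) \<noteq> None"
    using lifetime_greater_iff[OF assms(2), of "enn2real T"] assms(1) by simp
qed

text \<open>The locale assumption covers indicators of events; a monotone class induction carries it
  to nonnegative functionals. Before the lifetime the path is in \<open>S\<close>, so the partial
  \<open>the\<close> of the assumption can be replaced by the total
  \<open>extend_zero\<close>.\<close>

lemma strong_markov_nn:
  assumes T: "optional_time T" and A: "A \<in> optional_events T"
    and H: "H \<in> borel_measurable path_algebra"
  shows "(\<integral>\<^sup>+\<omega>. indicator {\<omega> \<in> A. T \<omega> < lifetime \<omega>} \<omega> * H (shift (enn2real (T \<omega>)) \<omega>) \<partial>P x) =
    (\<integral>\<^sup>+\<omega>. indicator {\<omega> \<in> A. T \<omega> < lifetime \<omega>} \<omega> *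
       extend_zero (\<lambda>v. \<integral>\<^sup>+\<omega>'. H \<omega>' \<partial>P v) (\<omega> (enn2real (T \<omega>))) \<partial>P x)"
proof -
  note [measurable] = optional_time_measurable[OF T] optional_coordinate_measurable[OF T]
    optional_events_measurable[OF A]
  have Ap: "A \<subseteq> paths" using sets.sets_into_space[OF optional_events_measurable[OF A]] by simp
  define S where "S = {\<omega> \<in> A. T \<omega> < lifetime \<omega>}"
  have "{\<omega> \<in> space path_algebra. \<omega> \<in> A \<and> T \<omega> < lifetime \<omega>} \<in> sets path_algebra" by measurable
  also have "{\<omega> \<in> space path_algebra. \<omega> \<in> A \<and> T \<omega> < lifetime \<omega>} = S" using Ap by (auto simp: S_def)
  finally have [measurable]: "S \<in> sets path_algebra" .
  show ?thesis unfolding S_def[symmetric] using H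
  proof (induction rule: borel_measurable_induct)
    case (cong f g)
    have "(\<integral>\<^sup>+\<omega>. indicator S \<omega> * f (shift (enn2real (T \<omega>)) \<omega>) \<partial>P x) =
        (\<integral>\<^sup>+\<omega>. indicator S \<omega> * g (shift (enn2real (T \<omega>)) \<omega>) \<partial>P x)"
      using cong.hyps(3) by (intro nn_integral_cong) (auto simp: indicator_def S_def shift_in_paths)
    moreover have "(\<integral>\<^sup>+\<omega>'. f \<omega>' \<partial>P v) = (\<integral>\<^sup>+\<omega>'. g \<omega>' \<partial>P v)" for v
      using cong.hyps(3) by (intro nn_integral_cong) auto
    ultimately show ?case using cong.IH by simp
  next
    case (set B)
    have "(\<integral>\<^sup>+\<omega>. indicator S \<omega> * indicator B (shift (enn2real (T \<omega>)) \<omega>) \<partial>P x) =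
        (\<integral>\<^sup>+\<omega>. indicator {\<omega> \<in> A. T \<omega> < lifetime \<omega> \<and> shift (enn2real (T \<omega>)) \<omega> \<in> B} \<omega> \<partial>P x)"
      by (intro nn_integral_cong) (auto simp: indicator_def S_def)
    also have "\<dots> = emeasure (P x) {\<omega> \<in> A. T \<omega> < lifetime \<omega> \<and> shift (enn2real (T \<omega>)) \<omega> \<in> B}"
    proof (rule nn_integral_indicator)
      have "{\<omega> \<in> A. T \<omega> < lifetime \<omega> \<and> shift (enn2real (T \<omega>)) \<omega> \<in> B} =
          {\<omega> \<in> space path_algebra. \<omega> \<in> S \<and> shift (enn2real (T \<omega>)) \<omega> \<in> B}" using Ap by (auto simp: S_def)
      also have "\<dots> \<in> sets path_algebra" using set by measurable
      finally show "{\<omega> \<in> A. T \<omega> < lifetime \<omega> \<and> shift (enn2real (T \<omega>)) \<omega> \<in> B} \<in> sets (P x)" by simp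
    qed
    also have "\<dots> = (\<integral>\<^sup>+\<omega>\<in>S. emeasure (P (the (\<omega> (enn2real (T \<omega>))))) B \<partial>P x)"
      unfolding S_def by (rule strong_markov[OF T A set])
    also have "\<dots> = (\<integral>\<^sup>+\<omega>. indicator S \<omega> *
       extend_zero (\<lambda>v. \<integral>\<^sup>+\<omega>'. indicator B \<omega>' \<partial>P v) (\<omega> (enn2real (T \<omega>))) \<partial>P x)"
    proof (intro nn_integral_cong)
      fix \<omega> assume "\<omega> \<in> space (P x)"
      then show "emeasure (P (the (\<omega> (enn2real (T \<omega>))))) B * indicator S \<omega> = indicator S \<omega> *
         extend_zero (\<lambda>v. \<integral>\<^sup>+\<omega>'. indicator B \<omega>' \<partial>P v) (\<omega> (enn2real (T \<omega>)))"
        using alive_at[of "T \<omega>" \<omega>] set by (auto simp: indicator_def S_def mult.commute simp flip: nn_integral_indicator)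
    qed
    finally show ?case .
  next
    case (mult f c)
    note [measurable] = mult.hyps(2)
    have "extend_zero (\<lambda>v. \<integral>\<^sup>+\<omega>'. c * f \<omega>' \<partial>P v) z = c * extend_zero (\<lambda>v. \<integral>\<^sup>+\<omega>'. f \<omega>' \<partial>P v) z" for z
      by (cases z) (auto simp: nn_integral_cmult)
    then show ?case using mult.IH by (simp add: mult.left_commute[of _ c] nn_integral_cmult)
  next
    case (add f g)
    note [measurable] = add.hyps(1,3)
    have "extend_zero (\<lambda>v. \<integral>\<^sup>+\<omega>'. g \<omega>' + f \<omega>' \<partial>P v) z =
        extend_zero (\<lambda>v. \<integral>\<^sup>+\<omega>'. g \<omega>' \<partial>P v) z + extend_zero (\<lambda>v. \<integral>\<^sup>+\<omega>'. f \<omega>' \<partial>P v) z" for z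
      by (cases z) (auto simp: nn_integral_add)
    then show ?case using add.IH by (simp add: distrib_left nn_integral_add)
  next
    case (seq U)
    note [measurable] = seq.hyps(1)
    have U: "incseq (\<lambda>i. U i \<omega>)" for \<omega> using seq.hyps(3) by (auto simp: incseq_def le_fun_def)
    have 1: "indicator S \<omega> * (SUP i. U i) (shift (enn2real (T \<omega>)) \<omega>) =
        (SUP i. indicator S \<omega> * U i (shift (enn2real (T \<omega>)) \<omega>))" for \<omega>
      by (simp add: SUP_mult_left_ennreal image_comp)
    have "(\<integral>\<^sup>+\<omega>'. (SUP i. U i) \<omega>' \<partial>P v) = (SUP i. \<integral>\<^sup>+\<omega>'. U i \<omega>' \<partial>P v)" for v
    proof -
      have "(\<integral>\<^sup>+\<omega>'. (SUP i. U i) \<omega>' \<partial>P v) = (\<integral>\<^sup>+\<omega>'. (SUP i. U i \<omega>') \<partial>P v)"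
        by (intro nn_integral_cong) (simp add: image_comp)
      also have "\<dots> = (SUP i. \<integral>\<^sup>+\<omega>'. U i \<omega>' \<partial>P v)"
        using seq.hyps(3) by (intro nn_integral_monotone_convergence_SUP) auto
      finally show ?thesis .
    qed
    then have 2: "indicator S \<omega> * extend_zero (\<lambda>v. \<integral>\<^sup>+\<omega>'. (SUP i. U i) \<omega>' \<partial>P v) z =
        (SUP i. indicator S \<omega> * extend_zero (\<lambda>v. \<integral>\<^sup>+\<omega>'. U i \<omega>' \<partial>P v) z)" for \<omega> z
      by (cases z) (auto simp: SUP_mult_left_ennreal)
    have 3: "incseq (\<lambda>i. extend_zero (\<lambda>v. \<integral>\<^sup>+\<omega>'. U i \<omega>' \<partial>P v) z)" for z
      using seq.hyps(3) by (cases z) (auto simp: incseq_def le_fun_def intro!: nn_integral_mono)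
    show ?case unfolding 1 2
      by (subst (1 2) nn_integral_monotone_convergence_SUP)
         (use U 3 seq.IH in \<open>auto simp: incseq_def le_fun_def intro!: mult_left_mono\<close>)
  qed
qed

lemma optional_time_const: "0 \<le> s \<Longrightarrow> optional_time (\<lambda>_. ennreal s)"
  unfolding optional_time_def
proof (intro allI impI)
  fix t :: real
  show "{\<omega> \<in> paths. ennreal s < ennreal t} \<in> sets (path_filtration t)"
    using sets.top[of "path_filtration t"] by (cases "ennreal s < ennreal t") simp_all
qed

lemma optional_events_const:
  "0 \<le> s \<Longrightarrow> A \<in> sets (path_filtration s) \<Longrightarrow> A \<in> optional_events (\<lambda>_. ennreal s)"
  unfolding optional_events_def
proof (intro CollectI conjI allI impI)
  assume s: "0 \<le> s" and A: "A \<in> sets (path_filtration s)"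
  show "A \<in> sets path_algebra" using path_filtration_subset[OF s] A by blast
  fix t :: real
  show "{\<omega> \<in> A. ennreal s < ennreal t} \<in> sets (path_filtration t)"
    using path_filtration_mono[of s t] A by (cases "s < t") (auto simp: ennreal_less_iff[OF s])
qed

text \<open>The case of a constant time, with a second monotone class induction that turns the event
  into an adapted weight \<open>G\<close>. The survival indicator disappears on the right because
  \<open>extend_zero\<close> vanishes at \<open>None\<close>.\<close>

lemma markov_nn:
  assumes s: "0 \<le> s" and G: "G \<in> borel_measurable (path_filtration s)"
    and H: "H \<in> borel_measurable path_algebra"
  shows "(\<integral>\<^sup>+\<omega>. G \<omega> * (indicator {\<omega>. ennreal s < lifetime \<omega>} \<omega> * H (shift s \<omega>)) \<partial>P x) =
    (\<integral>\<^sup>+\<omega>. G \<omega> * extend_zero (\<lambda>v. \<integral>\<^sup>+\<omega>'. H \<omega>' \<partial>P v) (\<omega> s) \<partial>P x)"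
proof -
  note [measurable] = coordinate_algebra[OF s] H
  have [measurable]: "shift s \<in> path_algebra \<rightarrow>\<^sub>M (path_algebra :: 'a path measure)"
    using shift_measurable[of "\<lambda>_. s" path_algebra "\<lambda>\<omega>. \<omega>"] s by simp
  have zero: "indicator {\<omega> \<in> A. ennreal s < lifetime \<omega>} \<omega> *
         extend_zero (\<lambda>v. \<integral>\<^sup>+\<omega>'. H \<omega>' \<partial>P v) (\<omega> s) = indicator A \<omega> * extend_zero (\<lambda>v. \<integral>\<^sup>+\<omega>'. H \<omega>' \<partial>P v) (\<omega> s)"
    if "\<omega> \<in> paths" for A \<omega>
    using lifetime_greater_iff[OF that s] by (auto simp: indicator_def)
  show ?thesis using G
  proof (induction rule: borel_measurable_induct)
    case (cong f g)
    then show ?case by (simp cong: nn_integral_cong_simp)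
  next
    case (set A)
    have "(\<integral>\<^sup>+\<omega>. indicator A \<omega> * (indicator {\<omega>. ennreal s < lifetime \<omega>} \<omega> * H (shift s \<omega>)) \<partial>P x) =
       (\<integral>\<^sup>+\<omega>. indicator {\<omega> \<in> A. ennreal s < lifetime \<omega>} \<omega> * H (shift (enn2real (ennreal s)) \<omega>) \<partial>P x)"
      using s by (intro nn_integral_cong) (auto simp: indicator_def)
    also have "\<dots> = (\<integral>\<^sup>+\<omega>. indicator {\<omega> \<in> A. ennreal s < lifetime \<omega>} \<omega> *
       extend_zero (\<lambda>v. \<integral>\<^sup>+\<omega>'. H \<omega>' \<partial>P v) (\<omega> (enn2real (ennreal s))) \<partial>P x)"
      by (rule strong_markov_nn[OF optional_time_const[OF s] optional_events_const[OF s set] H])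
    also have "\<dots> = (\<integral>\<^sup>+\<omega>. indicator A \<omega> * extend_zero (\<lambda>v. \<integral>\<^sup>+\<omega>'. H \<omega>' \<partial>P v) (\<omega> s) \<partial>P x)"
      using s zero by (intro nn_integral_cong) simp
    finally show ?case .
  next
    case (mult f c)
    note [measurable] = measurable_into_algebra[OF s mult.hyps(2)]
    show ?case using mult.IH by (simp add: mult.assoc nn_integral_cmult)
  next
    case (add f g)
    note [measurable] = measurable_into_algebra[OF s add.hyps(1)] measurable_into_algebra[OF s add.hyps(3)]
    show ?case using add.IH by (simp add: distrib_right nn_integral_add)
  next
    case (seq U)
    note [measurable] = measurable_into_algebra[OF s seq.hyps(1)]
    have U: "U i \<omega> \<le> U (Suc i) \<omega>" for i \<omega> using seq.hyps(3) by (auto simp: incseq_Suc_iff le_fun_def)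
    have 1: "(SUP i. U i) \<omega> * z = (SUP i. U i \<omega> * z)" for \<omega> z by (simp add: SUP_mult_right_ennreal image_comp)
    show ?case unfolding 1
      by (subst (1 2) nn_integral_monotone_convergence_SUP)
         (use U seq.IH in \<open>auto simp: incseq_Suc_iff le_fun_def intro!: mult_right_mono\<close>)
  qed
qed

lemma P_marginal:
  assumes t: "0 < t" and g: "g \<in> borel_measurable borel"
  shows "(\<integral>\<^sup>+\<omega>. extend_zero g (\<omega> t) \<partial>P x) = (\<integral>\<^sup>+y. p0 t x y * g y \<partial>m)"
proof -
  have [measurable]: "(\<lambda>\<omega>. \<omega> t) \<in> path_algebra \<rightarrow>\<^sub>M cemetery_borel" using t by (intro coordinate_algebra) simp
  show ?thesis using g
  proof (induction rule: borel_measurable_induct)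
    case (cong f g)
    then have "f = g" by (intro ext) simp
    with cong show ?case by simp
  next
    case (set C)
    have "(\<integral>\<^sup>+\<omega>. extend_zero (indicator C) (\<omega> t) \<partial>P x) = (\<integral>\<^sup>+\<omega>. indicator {\<omega> \<in> paths. \<omega> t \<in> Some ` C} \<omega> \<partial>P x)"
      by (intro nn_integral_cong) (auto simp: extend_zero_def indicator_def split: option.splits)
    also have "\<dots> = emeasure (P x) {\<omega> \<in> paths. \<omega> t \<in> Some ` C}"
    proof (rule nn_integral_indicator)
      have "{\<omega> \<in> space path_algebra. \<omega> t \<in> Some ` C} \<in> sets path_algebra" using set by measurable
      then show "{\<omega> \<in> paths. \<omega> t \<in> Some ` C} \<in> sets (P x)" by simp
    qed
    finally show ?case using P_density[OF t, of C x] set t by (simp add: p0_def)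
  next
    case (mult f c)
    have "extend_zero (\<lambda>x. c * f x) z = c * extend_zero f z" for z by (cases z) auto
    then show ?case using mult by (simp add: nn_integral_cmult mult.left_commute[of _ c])
  next
    case (add f g)
    have "extend_zero (\<lambda>x. g x + f x) z = extend_zero g z + extend_zero f z" for z by (cases z) auto
    then show ?case using add by (simp add: nn_integral_add distrib_left)
  next
    case (seq U)
    have U: "U i y \<le> U (Suc i) y" for i y using seq.hyps(3) by (auto simp: incseq_Suc_iff le_fun_def)
    have 1: "extend_zero (SUP i. U i) z = (SUP i. extend_zero (U i) z)" for z by (cases z) (auto simp: image_comp)
    have 2: "p0 t x y * (SUP i. U i) y = (SUP i. p0 t x y * U i y)" for y
      by (simp add: SUP_mult_left_ennreal image_comp)
    have 3: "extend_zero (U i) z \<le> extend_zero (U (Suc i)) z" for i z using U by (cases z) auto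
    note [measurable] = seq.hyps(1)
    show ?case unfolding 1 2
      by (subst (1 2) nn_integral_monotone_convergence_SUP)
         (use U 3 seq.IH in \<open>auto simp: incseq_Suc_iff le_fun_def intro!: mult_left_mono\<close>)
  qed
qed

lemma P_start_integral:
  assumes "g \<in> borel_measurable borel"
  shows "(\<integral>\<^sup>+\<omega>. extend_zero g (\<omega> 0) \<partial>P x) = g x"
proof -
  have "(\<integral>\<^sup>+\<omega>. extend_zero g (\<omega> 0) \<partial>P x) = (\<integral>\<^sup>+\<omega>. g x \<partial>P x)"
    by (rule nn_integral_cong_AE) (use P_start[of x] in eventually_elim, simp)
  then show ?thesis by simp
qed

text \<open>Fubini's theorem and the one-dimensional marginals; time \<open>0\<close>, where
  \<open>p0\<close> is zero by convention, is Lebesgue null.\<close>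

lemma expected_total_occupation:
  assumes [measurable]: "g \<in> borel_measurable borel"
  shows "(\<integral>\<^sup>+\<omega>. total_occupation g \<omega> \<partial>P x) = (\<integral>\<^sup>+y. u x y * g y \<partial>m)"
proof -
  interpret P: prob_space "P x" by (rule P_prob)
  interpret pair_sigma_finite lborel "P x" by standard
  note [measurable] = coordinate_jointly_measurable'
  have "(\<integral>\<^sup>+\<omega>. total_occupation g \<omega> \<partial>P x) =
      (\<integral>\<^sup>+\<omega>. \<integral>\<^sup>+s. extend_zero g (\<omega> (max 0 s)) * indicator {0..} s \<partial>lborel \<partial>P x)"
    unfolding total_occupation_def by (intro nn_integral_cong) (auto simp: indicator_def)
  also have "\<dots> = (\<integral>\<^sup>+s. \<integral>\<^sup>+\<omega>. extend_zero g (\<omega> (max 0 s)) * indicator {0..} s \<partial>P x \<partial>lborel)"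
    by (rule Fubini') (simp add: case_prod_beta')
  also have "\<dots> = (\<integral>\<^sup>+s. \<integral>\<^sup>+y. p0 s x y * g y \<partial>m \<partial>lborel)"
  proof (rule nn_integral_cong_AE)
    show "AE s in lborel. (\<integral>\<^sup>+\<omega>. extend_zero g (\<omega> (max 0 s)) * indicator {0..} s \<partial>P x) = (\<integral>\<^sup>+y. p0 s x y * g y \<partial>m)"
      using AE_lborel_singleton[of 0]
    proof eventually_elim
      fix s :: real assume "s \<noteq> 0"
      then show "(\<integral>\<^sup>+\<omega>. extend_zero g (\<omega> (max 0 s)) * indicator {0..} s \<partial>P x) = (\<integral>\<^sup>+y. p0 s x y * g y \<partial>m)"
        using P_marginal[of s g x] by (cases "0 < s") (auto simp: p0_def max_def)
    qed
  qed
  also have "\<dots> = (\<integral>\<^sup>+y. \<integral>\<^sup>+s. p0 s x y * g y \<partial>lborel \<partial>m)"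
  proof -
    interpret q: pair_sigma_finite m lborel by standard
    show ?thesis by (rule q.Fubini') measurable
  qed
  also have "\<dots> = (\<integral>\<^sup>+y. u x y * g y \<partial>m)"
    unfolding potential_density_eq by (intro nn_integral_cong nn_integral_multc) measurable
  finally show ?thesis .
qed

text \<open>Chapman-Kolmogorov inside the time integral shifts the range of integration by
  \<open>t\<close>. The semigroup identity needs a positive \<open>t\<close>, so time
  \<open>0\<close> is read off from the starting point.\<close>

lemma expected_u:
  assumes "0 \<le> t"
  shows "(\<integral>\<^sup>+\<omega>. extend_zero (\<lambda>v. u v y) (\<omega> t) \<partial>P x) = (\<integral>\<^sup>+s\<in>{t<..}. p0 s x y \<partial>lborel)"
proof (cases "t = 0")
  case True
  have "u x y = (\<integral>\<^sup>+s\<in>{0<..}. p0 s x y \<partial>lborel)"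
    unfolding potential_density_eq by (intro nn_integral_cong) (auto simp: p0_def indicator_def)
  then show ?thesis using True P_start_integral[of "\<lambda>v. u v y" x] by simp
next
  case False
  with assms have t: "0 < t" by simp
  interpret q: pair_sigma_finite m lborel by standard
  have "(\<integral>\<^sup>+\<omega>. extend_zero (\<lambda>v. u v y) (\<omega> t) \<partial>P x) = (\<integral>\<^sup>+v. \<integral>\<^sup>+s. p0 t x v * p0 s v y \<partial>lborel \<partial>m)"
    by (subst P_marginal[OF t]) (auto simp: potential_density_eq nn_integral_cmult)
  also have "\<dots> = (\<integral>\<^sup>+s. \<integral>\<^sup>+v. p0 t x v * p0 s v y \<partial>m \<partial>lborel)"
    by (rule q.Fubini'[symmetric]) measurable
  also have "\<dots> = (\<integral>\<^sup>+s. p0 (t + s) x y * indicator {t<..} (t + s) \<partial>lborel)"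
    using p0_chapman_kolmogorov[OF t] by (intro nn_integral_cong) (auto simp: p0_def indicator_def)
  also have "\<dots> = (\<integral>\<^sup>+s\<in>{t<..}. p0 s x y \<partial>lborel)"
    using nn_integral_real_affine[of "\<lambda>s. p0 s x y * indicator {t<..} s" 1 t] by simp
  finally show ?thesis .
qed

end

section \<open>Expected local time\<close>

text \<open>The strict inequality gives the right continuous inverse, whose events
  \<open>< t\<close> are decided by rational times before \<open>t\<close>; hence an optional time
  for monotone adapted \<open>V\<close>. An infimum over the empty set is \<open>top\<close>, which
  encodes a level that is never exceeded.\<close>

definition inverse_time :: "(real \<Rightarrow> 'a path \<Rightarrow> ennreal) \<Rightarrow> ennreal \<Rightarrow> 'a path \<Rightarrow> ennreal" where
  "inverse_time V k \<omega> = (INF t\<in>{t. 0 \<le> t \<and> k < V t \<omega>}. ennreal t)"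

lemma inverse_time_less_iff:
  assumes "mono_on {0..} (\<lambda>t. V t \<omega>)"
  shows "inverse_time V k \<omega> < ennreal t \<longleftrightarrow> (\<exists>r\<in>\<rat>. 0 \<le> r \<and> r < t \<and> k < V r \<omega>)"
proof
  assume "inverse_time V k \<omega> < ennreal t"
  then obtain s where s: "0 \<le> s" "k < V s \<omega>" "s < t"
    unfolding inverse_time_def by (auto simp: INF_less_iff ennreal_less_iff)
  obtain r where r: "r \<in> \<rat>" "s < r" "r < t" using Rats_dense_in_real[OF s(3)] by auto
  have "V s \<omega> \<le> V r \<omega>" using mono_onD[OF assms, of s r] s r by simp
  then show "\<exists>r\<in>\<rat>. 0 \<le> r \<and> r < t \<and> k < V r \<omega>" using r s by (intro bexI[of _ r]) auto
next
  assume "\<exists>r\<in>\<rat>. 0 \<le> r \<and> r < t \<and> k < V r \<omega>"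
  then show "inverse_time V k \<omega> < ennreal t"
    unfolding inverse_time_def by (auto simp: INF_less_iff ennreal_less_iff)
qed

lemma inverse_time_after:
  assumes "mono_on {0..} (\<lambda>t. V t \<omega>)" "inverse_time V k \<omega> < ennreal s"
  shows "k < V s \<omega>"
proof -
  obtain r where "0 \<le> r" "r < s" "k < V r \<omega>" using inverse_time_less_iff[where V=V and \<omega>=\<omega>, OF assms(1)] assms(2) by auto
  then show ?thesis using mono_onD[OF assms(1), of r s] by simp
qed

lemma inverse_time_before: "0 \<le> s \<Longrightarrow> ennreal s < inverse_time V k \<omega> \<Longrightarrow> V s \<omega> \<le> k"
  by (rule ccontr) (auto simp: inverse_time_def not_le dest!: less_INF_D)

lemma inverse_time_optional:
  assumes adapted: "\<And>t. 0 \<le> t \<Longrightarrow> V t \<in> borel_measurable (path_filtration t)"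
    and mono: "\<And>\<omega>. \<omega> \<in> paths \<Longrightarrow> mono_on {0..} (\<lambda>t. V t \<omega>)"
  shows "optional_time (inverse_time V k)"
  unfolding optional_time_def
proof (intro allI impI)
  fix t :: real
  have "{\<omega> \<in> paths. inverse_time V k \<omega> < ennreal t} =
      (\<Union>r\<in>{r\<in>\<rat>. 0 \<le> r \<and> r < t}. {\<omega> \<in> paths. k < V r \<omega>})"
    using inverse_time_less_iff[of V _ k t] mono by auto
  also have "\<dots> \<in> sets (path_filtration t)"
  proof (rule sets.countable_UN')
    show "countable {r\<in>\<rat>. 0 \<le> r \<and> r < t}" by (rule countable_subset[OF _ countable_rat]) auto
    show "(\<lambda>r. {\<omega> \<in> paths. k < V r \<omega>}) ` {r\<in>\<rat>. 0 \<le> r \<and> r < t} \<subseteq> sets (path_filtration t)"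
    proof (rule image_subsetI)
    fix r assume r: "r \<in> {r\<in>\<rat>. 0 \<le> r \<and> r < t}"
    then have [measurable]: "V r \<in> borel_measurable (path_filtration t)"
      by (intro measurable_filtration_mono[OF _ adapted]) auto
    have "{\<omega> \<in> space (path_filtration t). k < V r \<omega>} \<in> sets (path_filtration t)" by measurable
    then show "{\<omega> \<in> paths. k < V r \<omega>} \<in> sets (path_filtration t)" by simp
    qed
  qed
  finally show "{\<omega> \<in> paths. inverse_time V k \<omega> < ennreal t} \<in> sets (path_filtration t)" .
qed

text \<open>A path outside the closed ball at \<open>T\<close> would stay in its open complement for
  a while, against the early visits. The ball in the conclusion must be closed, as the visits may
  only accumulate at its boundary.\<close>

lemma visits_immediately_after:
  fixes y :: "'a::metric_space"
  assumes \<omega>: "\<omega> \<in> paths" and "0 \<le> T"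
    and visit: "\<And>s. T < s \<Longrightarrow> \<exists>r. T \<le> r \<and> r \<le> s \<and> \<omega> r \<in> Some ` ball y e"
  shows "\<omega> T \<in> Some ` cball y e"
proof (cases "\<omega> T")
  case None
  then show ?thesis using visit[of "T + 1"] pathsD(2)[OF \<omega> \<open>0 \<le> T\<close>] by fastforce
next
  case (Some v)
  have "v \<in> cball y e"
  proof (rule ccontr)
    assume "v \<notin> cball y e"
    then have "\<omega> T \<in> Some ` (- cball y e)" using Some by simp
    from pathsD(3)[OF \<omega> \<open>0 \<le> T\<close> _ this] obtain b where
      b: "T < b" "\<And>s. T < s \<Longrightarrow> s < b \<Longrightarrow> \<omega> s \<in> Some ` (- cball y e)"
      by (auto simp: eventually_at_right_field)
    from visit[of "(T + b) / 2"] b(1) obtain r where r: "T \<le> r" "r \<le> (T + b) / 2" "\<omega> r \<in> Some ` ball y e"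
      by auto
    show False
    proof (cases "r = T")
      case True then show False using r Some \<open>v \<notin> cball y e\<close> by auto
    next
      case False
      then have "\<omega> r \<in> Some ` (- cball y e)" using r b(1) by (intro b(2)) auto
      then show False using r(3) by auto
    qed
  qed
  then show ?thesis using Some by simp
qed

text \<open>While the path avoids the set that carries \<open>g\<close>, the integrand of the
  occupation is zero.\<close>

lemma occupation_increase_visit:
  fixes g :: "'a::metric_space \<Rightarrow> ennreal"
  assumes g: "g \<in> borel_measurable borel" "\<And>v. v \<notin> B \<Longrightarrow> g v = 0" and \<omega>: "\<omega> \<in> paths"
    and "0 \<le> T" "T \<le> s" "occupation g T \<omega> < occupation g s \<omega>"
  shows "\<exists>r. T \<le> r \<and> r \<le> s \<and> \<omega> r \<in> Some ` B"
proof (rule ccontr)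
  assume "\<not> ?thesis"
  then have "\<omega> (T + r) \<notin> Some ` B" if "0 \<le> r" "r \<le> s - T" for r using that by auto
  then have "extend_zero g (shift T \<omega> r) * indicator {0..s - T} r = 0" for r
    using g(2) by (cases "\<omega> (T + r)") (auto simp: indicator_def image_iff)
  then have "occupation g (s - T) (shift T \<omega>) = 0" unfolding occupation_def by (intro nn_integral_zero' AE_I2)
  then show False using occupation_add(1)[OF g(1) \<omega> \<open>0 \<le> T\<close>, of "s - T"] assms by simp
qed

lemma occupation_mono_on: "mono_on {0..} (\<lambda>t. occupation g t \<omega>)"
  by (intro mono_onI occupation_mono)

lemma shift_measurable_const: "0 \<le> s \<Longrightarrow> shift s \<in> path_algebra \<rightarrow>\<^sub>M (path_algebra :: 'a::metric_space path measure)"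
  using shift_measurable[of "\<lambda>_. s" path_algebra "\<lambda>\<omega>. \<omega>"] by simp

section \<open>Bounds on occupation times that do not depend on the starting point\<close>

context strong_markov_process
begin

text \<open>
  The strong Markov property at the first time the occupation exceeds \<open>k\<close>: at that time the process
  is in the closed ball, so the expected future occupation is at most \<open>C\<close>.
\<close>

lemma occupation_excess:
  assumes g [measurable]: "g \<in> borel_measurable borel" and supp: "\<And>v. v \<notin> ball y e \<Longrightarrow> g v = 0"
    and C: "\<And>v. v \<in> cball y e \<Longrightarrow> (\<integral>\<^sup>+z. u v z * g z \<partial>m) \<le> C" and k: "k < top"
  shows "(\<integral>\<^sup>+\<omega>. total_occupation g \<omega> - k \<partial>P x) \<le> C * emeasure (P x) {\<omega> \<in> paths. k < total_occupation g \<omega>}"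
proof -
  define T where "T = inverse_time (occupation g) k"
  have T: "optional_time T" unfolding T_def
    by (intro inverse_time_optional occupation_adapted g occupation_mono_on)
  note [measurable] = optional_time_measurable[OF T] optional_coordinate_measurable[OF T]
  have A: "paths \<in> optional_events T"
    using T sets.top[of path_algebra] by (auto simp: optional_events_def optional_time_def)
  \<comment> \<open>At \<open>T\<close> the occupation has not yet passed \<open>k\<close>, by left
    continuity, but it has passed \<open>k\<close> at every later time. So the ball is visited in
    every time interval that starts at \<open>T\<close>.\<close>
  have at_T: "T \<omega> < lifetime \<omega> \<and> \<omega> (enn2real (T \<omega>)) \<in> Some ` cball y e \<and>
      occupation g (enn2real (T \<omega>)) \<omega> \<le> k \<and> k < total_occupation g \<omega>"
    if \<omega>: "\<omega> \<in> paths" "T \<omega> < top" for \<omega>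
  proof -
    define t where "t = enn2real (T \<omega>)"
    have t: "0 \<le> t" "T \<omega> = ennreal t" using \<omega>(2) by (auto simp: t_def)
    have le: "occupation g t \<omega> \<le> k"
      by (rule occupation_le_if_before[OF g \<omega>(1) t(1)])
         (use t in \<open>auto intro!: inverse_time_before simp flip: T_def simp: ennreal_less_iff\<close>)
    have gt: "k < occupation g s \<omega>" if "t < s" for s
      using that t by (intro inverse_time_after[of "occupation g"] occupation_mono_on)
        (simp flip: T_def add: ennreal_less_iff)
    have "\<omega> t \<in> Some ` cball y e"
      by (rule visits_immediately_after[OF \<omega>(1) t(1)],
          rule occupation_increase_visit[OF g supp \<omega>(1) t(1)]) (use le gt in \<open>auto intro: le_less_trans\<close>)
    moreover from this have "ennreal t < lifetime \<omega>" using lifetime_greater_iff[OF \<omega>(1) t(1)] by auto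
    ultimately show ?thesis
      using le gt[of "t + 1"] occupation_le_total[of g "t + 1" \<omega>] t by (simp add: t_def[symmetric])
  qed
  \<comment> \<open>Up to \<open>T\<close> at most \<open>k\<close> has been collected, so the
    excess is bounded by what the shifted path collects. If \<open>T\<close> is infinite, the total
    is at most \<open>k\<close> and the truncated difference is zero.\<close>
  have pointwise: "total_occupation g \<omega> - k \<le>
      indicator {\<omega> \<in> paths. T \<omega> < lifetime \<omega>} \<omega> * total_occupation g (shift (enn2real (T \<omega>)) \<omega>)"
    if \<omega>: "\<omega> \<in> paths" for \<omega>
  proof (cases "T \<omega> < top")
    case True
    note at = at_T[OF \<omega> True]
    have "total_occupation g \<omega> \<le> k + total_occupation g (shift (enn2real (T \<omega>)) \<omega>)"
      using occupation_add(2)[OF g \<omega>, of "enn2real (T \<omega>)"] at by (simp add: add_right_mono)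
    then show ?thesis using at \<omega> k by (auto simp: ennreal_minus_le_iff)
  next
    case False
    then have "occupation g t \<omega> \<le> k" if "0 \<le> t" for t
      using that by (intro inverse_time_before) (auto simp flip: T_def simp: less_top[symmetric])
    then have "total_occupation g \<omega> \<le> k"
      unfolding occupation_tendsto_total[OF g \<omega>, symmetric] by (intro SUP_least) auto
    then have "total_occupation g \<omega> - k = 0" using k by (auto simp: diff_eq_0_iff_ennreal)
    then show ?thesis by simp
  qed
  have set: "{\<omega> \<in> paths. k < total_occupation g \<omega>} \<in> sets (P x)"
  proof -
    have "{\<omega> \<in> space (P x). k < total_occupation g \<omega>} \<in> sets (P x)" by measurable
    then show ?thesis by simp
  qed
  have "(\<integral>\<^sup>+\<omega>. total_occupation g \<omega> - k \<partial>P x) \<le> (\<integral>\<^sup>+\<omega>. indicator {\<omega> \<in> paths. T \<omega> < lifetime \<omega>} \<omega> *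
      total_occupation g (shift (enn2real (T \<omega>)) \<omega>) \<partial>P x)"
    using pointwise by (intro nn_integral_mono) simp
  also have "\<dots> = (\<integral>\<^sup>+\<omega>. indicator {\<omega> \<in> paths. T \<omega> < lifetime \<omega>} \<omega> *
       extend_zero (\<lambda>v. \<integral>\<^sup>+\<omega>'. total_occupation g \<omega>' \<partial>P v) (\<omega> (enn2real (T \<omega>))) \<partial>P x)"
    by (rule strong_markov_nn[OF T A]) measurable
  also have "\<dots> \<le> (\<integral>\<^sup>+\<omega>. C * indicator {\<omega> \<in> paths. k < total_occupation g \<omega>} \<omega> \<partial>P x)"
  proof (intro nn_integral_mono)
    fix \<omega> assume "\<omega> \<in> space (P x)"
    then have \<omega>: "\<omega> \<in> paths" by simp
    show "indicator {\<omega> \<in> paths. T \<omega> < lifetime \<omega>} \<omega> *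
       extend_zero (\<lambda>v. \<integral>\<^sup>+\<omega>'. total_occupation g \<omega>' \<partial>P v) (\<omega> (enn2real (T \<omega>)))
       \<le> C * indicator {\<omega> \<in> paths. k < total_occupation g \<omega>} \<omega>"
    proof (cases "T \<omega> < lifetime \<omega>")
      case True
      have "T \<omega> < top" using less_le_trans[OF True top_greatest] .
      from at_T[OF \<omega> this] show ?thesis
        using C \<omega> by (auto simp: expected_total_occupation[OF g])
    qed simp
  qed
  also have "\<dots> = C * emeasure (P x) {\<omega> \<in> paths. k < total_occupation g \<omega>}"
    using set by (simp add: nn_integral_cmult_indicator)
  finally show ?thesis .
qed

text \<open>The level \<open>k = 0\<close> of \<open>occupation_excess\<close>, with a probability
  bounded by one. It is a maximum principle: a bound on the potential of \<open>g\<close> near its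
  support is a bound at every starting point.\<close>

lemma total_occupation_bound:
  assumes g [measurable]: "g \<in> borel_measurable borel" and supp: "\<And>v. v \<notin> ball y e \<Longrightarrow> g v = 0"
    and C: "\<And>v. v \<in> cball y e \<Longrightarrow> (\<integral>\<^sup>+z. u v z * g z \<partial>m) \<le> C"
  shows "(\<integral>\<^sup>+\<omega>. total_occupation g \<omega> \<partial>P x) \<le> C"
proof -
  have "(\<integral>\<^sup>+\<omega>. total_occupation g \<omega> \<partial>P x) \<le> C * emeasure (P x) {\<omega> \<in> paths. 0 < total_occupation g \<omega>}"
    using occupation_excess[where k=0 and x=x, OF assms] by simp
  also have "\<dots> \<le> C * 1" using prob_space.measure_le_1[OF P_prob[of x]] prob_space.emeasure_le_1[OF P_prob[of x]] by (intro mult_left_mono) auto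
  finally show ?thesis by simp
qed

text \<open>Markov's inequality for the tail probability in \<open>occupation_excess\<close>. The
  excess over \<open>k\<close> decays like \<open>1 / k\<close> with a constant that depends on
  \<open>g\<close> only through \<open>C\<close>; this is the uniform integrability behind
  \<open>expected_L\<close>.\<close>

lemma occupation_excess_bound:
  assumes g [measurable]: "g \<in> borel_measurable borel" and supp: "\<And>v. v \<notin> ball y e \<Longrightarrow> g v = 0"
    and C: "\<And>v. v \<in> cball y e \<Longrightarrow> (\<integral>\<^sup>+z. u v z * g z \<partial>m) \<le> C" and k: "k < top"
  shows "k * (\<integral>\<^sup>+\<omega>. total_occupation g \<omega> - k \<partial>P x) \<le> C * C"
proof -
  have set: "{\<omega> \<in> paths. k < total_occupation g \<omega>} \<in> sets (P x)"
  proof -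
    have "{\<omega> \<in> space (P x). k < total_occupation g \<omega>} \<in> sets (P x)" by measurable
    then show ?thesis by simp
  qed
  have "k * (\<integral>\<^sup>+\<omega>. total_occupation g \<omega> - k \<partial>P x) \<le> k * (C * emeasure (P x) {\<omega> \<in> paths. k < total_occupation g \<omega>})"
    by (intro mult_left_mono occupation_excess[OF assms] zero_le)
  also have "\<dots> = C * (\<integral>\<^sup>+\<omega>. k * indicator {\<omega> \<in> paths. k < total_occupation g \<omega>} \<omega> \<partial>P x)"
    using set by (simp add: nn_integral_cmult_indicator mult.left_commute)
  also have "\<dots> \<le> C * (\<integral>\<^sup>+\<omega>. total_occupation g \<omega> \<partial>P x)"
    by (intro mult_left_mono nn_integral_mono) (auto simp: indicator_def)
  also have "\<dots> \<le> C * C" by (intro mult_left_mono total_occupation_bound[OF g supp C]) auto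
  finally show ?thesis .
qed

end

section \<open>Local time as a limit of occupation times\<close>

locale local_time_process = strong_markov_process m p P
  for m :: "'a::{metric_space, second_countable_topology} measure" and p P +
  fixes f :: "real \<Rightarrow> 'a \<Rightarrow> 'a \<Rightarrow> real" and L :: "'a \<Rightarrow> real \<Rightarrow> 'a path \<Rightarrow> ennreal"
  assumes u_finite: "potential_density p x y < \<infinity>"
    and u_continuous: "continuous_on UNIV (\<lambda>(x, y). potential_density p x y)"
    and delta: "approximate_delta m f"
    and local_time: "is_local_time P f L"
begin

lemma radius_exists: "\<exists>e>0. \<forall>v\<in>cball y e. \<forall>z\<in>cball y e. u v z \<le> u y y + 1"
proof -
  have "open ((\<lambda>(x, y). u x y) -` {..<u y y + 1})"
    by (rule open_vimage[OF open_lessThan u_continuous])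
  \<comment> \<open>Finiteness of the potential density on the diagonal makes this strict, which
    provides the open neighbourhood.\<close>
  moreover have "u y y < u y y + 1" using u_finite[of y y]
    by (cases "u y y" rule: ennreal_cases) (auto simp flip: ennreal_1 ennreal_plus simp: ennreal_less_iff)
  then have "(y, y) \<in> (\<lambda>(x, y). u x y) -` {..<u y y + 1}" by simp
  ultimately obtain A B where AB: "open A" "open B" "y \<in> A" "y \<in> B" "A \<times> B \<subseteq> (\<lambda>(x, y). u x y) -` {..<u y y + 1}"
    by (metis mem_Sigma_iff open_prod_elim)
  obtain e1 where e1: "0 < e1" "cball y e1 \<subseteq> A" using open_contains_cball AB by metis
  obtain e2 where e2: "0 < e2" "cball y e2 \<subseteq> B" using open_contains_cball AB by metis
  show ?thesis
  proof (intro exI[of _ "min e1 e2"] conjI ballI)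
    fix v z assume "v \<in> cball y (min e1 e2)" "z \<in> cball y (min e1 e2)"
    then have "(v, z) \<in> A \<times> B" using e1 e2 by auto
    then show "u v z \<le> u y y + 1" using AB by (auto simp: less_imp_le)
  qed (use e1 e2 in auto)
qed

definition radius :: "'a \<Rightarrow> real" where
  "radius y = (SOME e. 0 < e \<and> (\<forall>v\<in>cball y e. \<forall>z\<in>cball y e. u v z \<le> u y y + 1))"

lemma radius: "0 < radius y" "v \<in> cball y (radius y) \<Longrightarrow> z \<in> cball y (radius y) \<Longrightarrow> u v z \<le> u y y + 1"
  using someI_ex[OF radius_exists[of y]] unfolding radius_def by blast+

text \<open>The approximate delta along a sequence, so that the limit theorems for integrals apply.
  It starts at scale \<open>radius y\<close>, which puts every support where \<open>u\<close> is at
  most \<open>u y y + 1\<close>.\<close>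

definition bump :: "'a \<Rightarrow> nat \<Rightarrow> 'a \<Rightarrow> ennreal" where
  "bump y n v = ennreal (f (radius y / real (Suc n)) y v)"

lemma radius_Suc: "0 < radius y / real (Suc n)" "radius y / real (Suc n) \<le> radius y"
proof -
  show "0 < radius y / real (Suc n)" using radius(1) by simp
  have "radius y / real (Suc n) \<le> radius y / 1" by (rule divide_left_mono) (use radius(1)[of y] in auto)
  then show "radius y / real (Suc n) \<le> radius y" by simp
qed

lemma f_delta:
  assumes "0 < e"
  shows "f e y \<in> borel_measurable borel" "0 \<le> f e y v" "v \<notin> ball y e \<Longrightarrow> f e y v = 0"
    "(\<integral>\<^sup>+v. ennreal (f e y v) \<partial>m) = 1"
  using delta assms unfolding approximate_delta_def by blast+

lemma bump_measurable [measurable]: "bump y n \<in> borel_measurable borel"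
  unfolding bump_def using f_delta(1)[OF radius_Suc(1)] by measurable

lemma bump_support: "v \<notin> ball y (radius y / real (Suc n)) \<Longrightarrow> bump y n v = 0"
  unfolding bump_def using f_delta(3)[OF radius_Suc(1)] by simp

lemma bump_mass: "(\<integral>\<^sup>+v. bump y n v \<partial>m) = 1"
  unfolding bump_def by (rule f_delta(4)[OF radius_Suc(1)])

lemma bump_potential_le:
  assumes "\<And>z. z \<in> ball y (radius y / real (Suc n)) \<Longrightarrow> u v z \<le> C"
  shows "(\<integral>\<^sup>+z. u v z * bump y n z \<partial>m) \<le> C"
proof -
  have "(\<integral>\<^sup>+z. u v z * bump y n z \<partial>m) \<le> (\<integral>\<^sup>+z. C * bump y n z \<partial>m)"
  proof (intro nn_integral_mono)
    fix z show "u v z * bump y n z \<le> C * bump y n z"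
      using assms[of z] bump_support[of z y n] by (cases "z \<in> ball y (radius y / real (Suc n))") (auto intro: mult_right_mono)
  qed
  also have "\<dots> = C" by (simp add: nn_integral_cmult bump_mass)
  finally show ?thesis .
qed

lemma bump_potential_ge:
  assumes "\<And>z. z \<in> ball y (radius y / real (Suc n)) \<Longrightarrow> C \<le> u v z"
  shows "C \<le> (\<integral>\<^sup>+z. u v z * bump y n z \<partial>m)"
proof -
  have "C = (\<integral>\<^sup>+z. C * bump y n z \<partial>m)" by (simp add: nn_integral_cmult bump_mass)
  also have "\<dots> \<le> (\<integral>\<^sup>+z. u v z * bump y n z \<partial>m)"
  proof (intro nn_integral_mono)
    fix z show "C * bump y n z \<le> u v z * bump y n z"
      using assms[of z] bump_support[of z y n] by (cases "z \<in> ball y (radius y / real (Suc n))") (auto intro: mult_right_mono)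
  qed
  finally show ?thesis .
qed

lemma bump_support': "v \<notin> ball y (radius y) \<Longrightarrow> bump y n v = 0"
  by (rule bump_support) (use radius_Suc(2)[of y n] in auto)

lemma bump_potential_bound: "v \<in> cball y (radius y) \<Longrightarrow> (\<integral>\<^sup>+z. u v z * bump y n z \<partial>m) \<le> u y y + 1"
  by (rule bump_potential_le, rule radius(2)) (use radius_Suc(2)[of y n] in auto)

lemma bump_total_occupation_bound: "(\<integral>\<^sup>+\<omega>. total_occupation (bump y n) \<omega> \<partial>P x) \<le> u y y + 1"
  by (rule total_occupation_bound[OF bump_measurable bump_support' bump_potential_bound])

lemma bump_excess_bound:
  "k < top \<Longrightarrow> k * (\<integral>\<^sup>+\<omega>. total_occupation (bump y n) \<omega> - k \<partial>P x) \<le> (u y y + 1) * (u y y + 1)"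
  by (rule occupation_excess_bound[OF bump_measurable bump_support' bump_potential_bound])

lemma u_bound_finite: "u y y + 1 < top"
  using u_finite[of y y] by simp

lemma radius_tendsto: "(\<lambda>n. radius y / real (Suc n)) \<longlonglongrightarrow> 0"
  using tendsto_mult[OF tendsto_const[of "radius y"] LIMSEQ_inverse_real_of_nat] by (simp add: divide_inverse)

text \<open>Averages of the continuous function \<open>u x\<close> over unit masses shrinking to
  \<open>y\<close>: a bound that holds on a small ball passes to the average, from below and from
  above.\<close>

lemma bump_potential_tendsto: "(\<lambda>n. \<integral>\<^sup>+z. u x z * bump y n z \<partial>m) \<longlonglongrightarrow> u x y"
proof -
  have cont: "continuous_on UNIV (u x)"
  proof -
    have "continuous_on UNIV ((\<lambda>(x, y). u x y) \<circ> Pair x)"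
      by (rule continuous_on_compose) (auto intro!: continuous_intros continuous_on_subset[OF u_continuous])
    then show ?thesis by (simp add: comp_def)
  qed
  have nbhd: "\<forall>\<^sub>F n in sequentially. ball y (radius y / real (Suc n)) \<subseteq> U" if U: "open U" "y \<in> U" for U
  proof -
    obtain e where e: "0 < e" "ball y e \<subseteq> U" by (rule openE[OF U])
    have "\<forall>\<^sub>F n in sequentially. radius y / real (Suc n) < e"
      using order_tendstoD(2)[OF radius_tendsto e(1)] .
    then show ?thesis by eventually_elim (use e in auto)
  qed
  show ?thesis
  proof (rule order_tendstoI)
    fix a assume "a < u x y"
    then obtain b where b: "a < b" "b < u x y" using dense by blast
    have "\<forall>\<^sub>F n in sequentially. ball y (radius y / real (Suc n)) \<subseteq> u x -` {b<..}"
      using b by (intro nbhd open_vimage[OF open_greaterThan cont]) auto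
    then show "\<forall>\<^sub>F n in sequentially. a < (\<integral>\<^sup>+z. u x z * bump y n z \<partial>m)"
    proof eventually_elim
      case (elim n)
      have "b \<le> (\<integral>\<^sup>+z. u x z * bump y n z \<partial>m)" by (rule bump_potential_ge) (use elim in \<open>auto simp: less_imp_le subset_eq\<close>)
      then show ?case using b by simp
    qed
  next
    fix a assume "u x y < a"
    then obtain b where b: "u x y < b" "b < a" using dense by blast
    have "\<forall>\<^sub>F n in sequentially. ball y (radius y / real (Suc n)) \<subseteq> u x -` {..<b}"
      using b by (intro nbhd open_vimage[OF open_lessThan cont]) auto
    then show "\<forall>\<^sub>F n in sequentially. (\<integral>\<^sup>+z. u x z * bump y n z \<partial>m) < a"
    proof eventually_elim
      case (elim n)
      have "(\<integral>\<^sup>+z. u x z * bump y n z \<partial>m) \<le> b" by (rule bump_potential_le) (use elim in \<open>auto simp: less_imp_le subset_eq\<close>)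
      then show ?case using b by simp
    qed
  qed
qed

lemma L_adapted: "0 \<le> t \<Longrightarrow> L y t \<in> borel_measurable (path_filtration t)"
  using local_time unfolding is_local_time_def by blast

lemma L_measurable [measurable]: "0 \<le> t \<Longrightarrow> L y t \<in> borel_measurable path_algebra"
  by (rule measurable_into_algebra[OF _ L_adapted])

lemma L_paths:
  assumes "\<omega> \<in> paths"
  shows "mono_on {0..} (\<lambda>t. L y t \<omega>)" "continuous_on {0..} (\<lambda>t. L y t \<omega>)"
    "0 \<le> t \<Longrightarrow> lifetime \<omega> \<le> ennreal t \<Longrightarrow> L y t \<omega> = L y (enn2real (lifetime \<omega>)) \<omega>"
  using local_time assms unfolding is_local_time_def by blast+

lemma L_mono: "\<omega> \<in> paths \<Longrightarrow> 0 \<le> s \<Longrightarrow> s \<le> t \<Longrightarrow> L y s \<omega> \<le> L y t \<omega>"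
  using mono_onD[OF L_paths(1), of \<omega> s t y] by simp

text \<open>Links the Lebesgue integral in the definition of local time to the
  \<open>ennreal\<close> integrals used here. \<open>enn2real\<close> hides an infinite value, which
  \<open>AE_total_occupation_finite\<close> excludes afterwards.\<close>

lemma occupation_eq_LINT:
  assumes \<omega>: "\<omega> \<in> paths"
  shows "(LINT r:{0..s}|lborel. extend_zero (f (radius y / real (Suc n)) y) (\<omega> r)) =
    enn2real (occupation (bump y n) s \<omega>)"
proof -
  let ?f = "f (radius y / real (Suc n)) y"
  have [measurable]: "?f \<in> borel_measurable borel" by (rule f_delta(1)[OF radius_Suc(1)])
  have [measurable]: "(\<lambda>r. extend_zero ?f (\<omega> (max 0 r))) \<in> borel_measurable lborel"
    by (rule path_section_measurable[OF _ \<omega>]) measurable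
  have nn: "0 \<le> extend_zero ?f z" for z using f_delta(2)[OF radius_Suc(1)] by (cases z) auto
  have "(LINT r:{0..s}|lborel. extend_zero ?f (\<omega> r)) = (LINT r|lborel. indicator {0..s} r * extend_zero ?f (\<omega> (max 0 r)))"
    unfolding set_lebesgue_integral_def by (intro Bochner_Integration.integral_cong) (auto simp: indicator_def)
  also have "\<dots> = enn2real (\<integral>\<^sup>+r. ennreal (indicator {0..s} r * extend_zero ?f (\<omega> (max 0 r))) \<partial>lborel)"
  proof (rule integral_eq_nn_integral)
    show "(\<lambda>r. indicator {0..s} r * extend_zero ?f (\<omega> (max 0 r))) \<in> borel_measurable lborel" by measurable
  qed (simp add: nn del: of_nat_Suc)
  also have "(\<integral>\<^sup>+r. ennreal (indicator {0..s} r * extend_zero ?f (\<omega> (max 0 r))) \<partial>lborel) = occupation (bump y n) s \<omega>"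
    unfolding occupation_def
  proof (intro nn_integral_cong)
    fix r show "ennreal (indicator {0..s} r * extend_zero ?f (\<omega> (max 0 r))) =
        extend_zero (bump y n) (\<omega> r) * indicator {0..s} r"
      by (cases "\<omega> r") (auto simp: indicator_def bump_def)
  qed
  finally show ?thesis .
qed

lemma AE_total_occupation_finite: "AE \<omega> in P x. \<forall>n. total_occupation (bump y n) \<omega> < top"
proof (subst AE_all_countable, intro allI)
  fix n
  have "AE \<omega> in P x. total_occupation (bump y n) \<omega> \<noteq> \<infinity>"
  proof (rule nn_integral_PInf_AE)
    show "total_occupation (bump y n) \<in> borel_measurable (P x)" by measurable
    show "(\<integral>\<^sup>+\<omega>. total_occupation (bump y n) \<omega> \<partial>P x) \<noteq> \<infinity>"
      using le_less_trans[OF bump_total_occupation_bound[of x y n] u_bound_finite[of y]] by auto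
  qed
  then show "AE \<omega> in P x. total_occupation (bump y n) \<omega> < top" by (simp add: less_top)
qed

lemma AE_occupation_tendsto_L:
  "AE \<omega> in P x. \<forall>t\<ge>0. L y t \<omega> < top \<and> (\<lambda>n. occupation (bump y n) t \<omega>) \<longlonglongrightarrow> L y t \<omega>"
proof -
  have "AE \<omega> in P x. \<forall>t\<ge>0. L y t \<omega> < \<infinity> \<and>
        uniform_limit {0..t} (\<lambda>\<epsilon> s. LINT r:{0..s}|lborel. extend_zero (f \<epsilon> y) (\<omega> r))
          (\<lambda>s. enn2real (L y s \<omega>)) (at_right 0)"
    using local_time unfolding is_local_time_def by blast
  then show ?thesis using AE_total_occupation_finite[where x=x and y=y] AE_P_paths[of x]
  proof eventually_elim
    case (elim \<omega>)
    show ?case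
    proof (intro allI impI conjI)
      fix t :: real assume t: "0 \<le> t"
      have fin: "L y t \<omega> < top" using elim(1) t by simp
      then show "L y t \<omega> < top" .
      have ul: "uniform_limit {0..t} (\<lambda>\<epsilon> s. LINT r:{0..s}|lborel. extend_zero (f \<epsilon> y) (\<omega> r))
          (\<lambda>s. enn2real (L y s \<omega>)) (at_right 0)" using elim(1) t by blast
      have "((\<lambda>\<epsilon>. LINT r:{0..t}|lborel. extend_zero (f \<epsilon> y) (\<omega> r)) \<longlongrightarrow> enn2real (L y t \<omega>)) (at_right 0)"
        by (rule tendsto_uniform_limitI[OF ul]) (use t in simp)
      moreover have "filterlim (\<lambda>n. radius y / real (Suc n)) (at_right 0) sequentially"
        unfolding filterlim_at using radius_tendsto radius(1)[of y] by (auto intro!: always_eventually)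
      ultimately have "(\<lambda>n. LINT r:{0..t}|lborel. extend_zero (f (radius y / real (Suc n)) y) (\<omega> r)) \<longlonglongrightarrow> enn2real (L y t \<omega>)"
        by (rule filterlim_compose)
      then have "(\<lambda>n. ennreal (enn2real (occupation (bump y n) t \<omega>))) \<longlonglongrightarrow> ennreal (enn2real (L y t \<omega>))"
        unfolding occupation_eq_LINT[OF elim(3)] by (rule tendsto_ennrealI)
      moreover have "ennreal (enn2real (occupation (bump y n) t \<omega>)) = occupation (bump y n) t \<omega>" for n
        using le_less_trans[OF occupation_le_total[of "bump y n" t \<omega>]] elim(2)
        by (simp add: ennreal_enn2real)
      ultimately show "(\<lambda>n. occupation (bump y n) t \<omega>) \<longlonglongrightarrow> L y t \<omega>" using fin by simp
    qed
  qed
qed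

end

lemma total_occupation_dead:
  assumes "\<omega> \<in> paths" "0 \<le> t" "\<not> ennreal t < lifetime \<omega>"
  shows "total_occupation g (shift t \<omega>) = 0"
proof -
  have "\<omega> t = None" using assms lifetime_greater_iff[OF assms(1,2)] by simp
  then have "extend_zero g (shift t \<omega> s) * indicator {0..} s = 0" for s
    using pathsD(2)[OF assms(1,2), of "t + s"] by (cases "0 \<le> s") auto
  then show ?thesis unfolding total_occupation_def by (intro nn_integral_zero' AE_I2)
qed

text \<open>The values at \<open>s\<close> are squeezed between those at rational times on either
  side, as for the convergence of distribution functions to a continuous one. Time \<open>0\<close>
  has no left neighbours but is itself rational.\<close>

lemma tendsto_monotone_dense:
  fixes X :: "nat \<Rightarrow> real \<Rightarrow> ennreal" and l :: "real \<Rightarrow> ennreal"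
  assumes mono: "\<And>n s t. s \<le> t \<Longrightarrow> X n s \<le> X n t" and cont: "continuous_on {0..} l"
    and lim: "\<And>r. r \<in> \<rat> \<Longrightarrow> 0 \<le> r \<Longrightarrow> (\<lambda>n. X n r) \<longlonglongrightarrow> l r" and s: "0 \<le> s"
  shows "(\<lambda>n. X n s) \<longlonglongrightarrow> l s"
proof (cases "s = 0")
  case True then show ?thesis using lim[of 0] by simp
next
  case False
  with s have s: "0 < s" by simp
  have cont': "isCont l s"
    using continuous_on_interior[OF cont, of s] s by (simp add: interior_real_atLeast)
  show ?thesis
  proof (rule order_tendstoI)
    fix a assume "a < l s"
    then have "\<forall>\<^sub>F r in at s. a < l r" using cont' by (auto simp: isCont_def dest: order_tendstoD(1))
    then obtain d where d: "0 < d" "\<And>r. r \<noteq> s \<Longrightarrow> dist r s < d \<Longrightarrow> a < l r"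
      by (auto simp: eventually_at)
    obtain r where r: "r \<in> \<rat>" "max 0 (s - d) < r" "r < s"
      using Rats_dense_in_real[of "max 0 (s - d)" s] s d by auto
    have "a < l r" using r d(2)[of r] by (auto simp: dist_real_def)
    from order_tendstoD(1)[OF lim[OF r(1)] this] have "\<forall>\<^sub>F n in sequentially. a < X n r" using r by simp
    then show "\<forall>\<^sub>F n in sequentially. a < X n s"
      by eventually_elim (use mono[of r s] r in \<open>auto intro: less_le_trans\<close>)
  next
    fix a assume "l s < a"
    then have "\<forall>\<^sub>F r in at s. l r < a" using cont' by (auto simp: isCont_def dest: order_tendstoD(2))
    then obtain d where d: "0 < d" "\<And>r. r \<noteq> s \<Longrightarrow> dist r s < d \<Longrightarrow> l r < a"
      by (auto simp: eventually_at)
    obtain r where r: "r \<in> \<rat>" "s < r" "r < s + d"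
      using Rats_dense_in_real[of s "s + d"] d by auto
    have "l r < a" using r d(2)[of r] by (auto simp: dist_real_def)
    from order_tendstoD(2)[OF lim[OF r(1)] this] have "\<forall>\<^sub>F n in sequentially. X n r < a" using r s by simp
    then show "\<forall>\<^sub>F n in sequentially. X n s < a"
      by eventually_elim (use mono[of s r] r in \<open>auto intro: le_less_trans\<close>)
  qed
qed

section \<open>Expectation, additivity and inverse of the local time\<close>

context local_time_process
begin

text \<open>The total occupation splits at time \<open>t\<close>, and by the Markov property the
  part after \<open>t\<close> has the expectation of a potential at the position at time
  \<open>t\<close>. The expectations of the total and of the later part both converge, so their
  difference does.\<close>

lemma expected_occupation_tendsto:
  assumes t: "0 \<le> t"
  shows "(\<lambda>n. \<integral>\<^sup>+\<omega>. occupation (bump y n) t \<omega> \<partial>P x) \<longlonglongrightarrow> (\<integral>\<^sup>+s\<in>{..t}. p0 s x y \<partial>lborel)"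
proof -
  note [measurable] = coordinate_algebra[OF t] shift_measurable_const[OF t]
  define U where "U n v = (\<integral>\<^sup>+z. u v z * bump y n z \<partial>m)" for n v
  have [measurable]: "U n \<in> borel_measurable borel" for n unfolding U_def by measurable
  define a where "a n = (\<integral>\<^sup>+\<omega>. occupation (bump y n) t \<omega> \<partial>P x)" for n
  define b where "b n = (\<integral>\<^sup>+\<omega>. extend_zero (U n) (\<omega> t) \<partial>P x)" for n
  define b' where "b' = (\<integral>\<^sup>+\<omega>. extend_zero (\<lambda>v. u v y) (\<omega> t) \<partial>P x)"
  have bound: "U n v \<le> u y y + 1" for n v
    using bump_total_occupation_bound[of v y n] by (simp add: U_def expected_total_occupation)
  have ab: "a n + b n = U n x" for n
  proof -
    have "U n x = (\<integral>\<^sup>+\<omega>. total_occupation (bump y n) \<omega> \<partial>P x)"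
      by (simp add: U_def expected_total_occupation)
    also have "\<dots> = (\<integral>\<^sup>+\<omega>. occupation (bump y n) t \<omega> + 1 * (indicator {\<omega>. ennreal t < lifetime \<omega>} \<omega> *
        total_occupation (bump y n) (shift t \<omega>)) \<partial>P x)"
    proof (intro nn_integral_cong)
      fix \<omega> assume "\<omega> \<in> space (P x)"
      then show "total_occupation (bump y n) \<omega> = occupation (bump y n) t \<omega> +
        1 * (indicator {\<omega>. ennreal t < lifetime \<omega>} \<omega> * total_occupation (bump y n) (shift t \<omega>))"
        using occupation_add(2)[OF bump_measurable _ t, of \<omega> y n] total_occupation_dead[OF _ t, of \<omega> "bump y n"]
        by (auto simp: indicator_def)
    qed
    also have "\<dots> = a n + (\<integral>\<^sup>+\<omega>. 1 * (indicator {\<omega>. ennreal t < lifetime \<omega>} \<omega> *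
        total_occupation (bump y n) (shift t \<omega>)) \<partial>P x)"
      unfolding a_def by (intro nn_integral_add) measurable
    also have "(\<integral>\<^sup>+\<omega>. 1 * (indicator {\<omega>. ennreal t < lifetime \<omega>} \<omega> *
        total_occupation (bump y n) (shift t \<omega>)) \<partial>P x) =
        (\<integral>\<^sup>+\<omega>. 1 * extend_zero (\<lambda>v. \<integral>\<^sup>+\<omega>'. total_occupation (bump y n) \<omega>' \<partial>P v) (\<omega> t) \<partial>P x)"
      by (rule markov_nn[OF t]) measurable
    also have "\<dots> = b n" by (simp add: b_def U_def[abs_def] expected_total_occupation)
    finally show ?thesis by simp
  qed
  \<comment> \<open>The bound \<open>u y y + 1\<close>, uniform in \<open>n\<close> and in the
    position, is the dominating function.\<close>
  have b: "b \<longlonglongrightarrow> b'" unfolding b_def b'_def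
  proof (rule nn_integral_dominated_convergence[where w="\<lambda>_. u y y + 1"])
    show "AE \<omega> in P x. extend_zero (U j) (\<omega> t) \<le> u y y + 1" for j
    proof (intro AE_I2)
      show "extend_zero (U j) (\<omega> t) \<le> u y y + 1" for \<omega> using bound by (cases "\<omega> t") auto
    qed
    show "AE \<omega> in P x. (\<lambda>i. extend_zero (U i) (\<omega> t)) \<longlonglongrightarrow> extend_zero (\<lambda>v. u v y) (\<omega> t)"
    proof (intro AE_I2)
      show "(\<lambda>i. extend_zero (U i) (\<omega> t)) \<longlonglongrightarrow> extend_zero (\<lambda>v. u v y) (\<omega> t)" for \<omega>
        using bump_potential_tendsto by (cases "\<omega> t") (auto simp: U_def)
    qed
    show "(\<integral>\<^sup>+\<omega>. u y y + 1 \<partial>P x) < \<infinity>" using u_bound_finite by simp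
  qed measurable
  have U: "(\<lambda>n. U n x) \<longlonglongrightarrow> u x y" unfolding U_def by (rule bump_potential_tendsto)
  have split: "u x y = (\<integral>\<^sup>+s\<in>{..t}. p0 s x y \<partial>lborel) + b'"
  proof -
    have "u x y = (\<integral>\<^sup>+s. p0 s x y * indicator {..t} s + p0 s x y * indicator {t<..} s \<partial>lborel)"
      unfolding potential_density_eq by (intro nn_integral_cong) (auto simp: indicator_def)
    then show ?thesis unfolding b'_def expected_u[OF t] by (subst (asm) nn_integral_add) auto
  qed
  \<comment> \<open>Subtraction in \<open>ennreal\<close> cancels only finite terms.\<close>
  have fin: "b n \<noteq> top" for n
  proof -
    have "b n \<le> a n + b n" by simp
    also have "\<dots> < top" unfolding ab using bound[of n x] u_bound_finite[of y] by (rule le_less_trans)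
    finally show ?thesis by simp
  qed
  have "b' \<noteq> top" using split u_finite[of x y] by (auto simp: less_top)
  then have "(\<lambda>n. U n x - b n) \<longlonglongrightarrow> u x y - b'"
    using u_finite[of x y] by (intro tendsto_diff_ennreal U b) auto
  moreover have "U n x - b n = a n" for n using ab[of n, symmetric] fin[of n] by (simp add: less_top)
  moreover have "u x y - b' = (\<integral>\<^sup>+s\<in>{..t}. p0 s x y \<partial>lborel)" using split \<open>b' \<noteq> top\<close> by (simp add: less_top)
  ultimately show ?thesis by (simp add: a_def)
qed

text \<open>Fatou's lemma gives the upper bound. For the lower bound the occupations are cut at a
  level \<open>k\<close>: the bounded parts converge by dominated convergence, and the parts above
  \<open>k\<close> are of order \<open>1 / k\<close> uniformly in \<open>n\<close>.\<close>

theorem expected_L: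
  assumes t: "0 \<le> t"
  shows "(\<integral>\<^sup>+\<omega>. L y t \<omega> \<partial>P x) = (\<integral>\<^sup>+s\<in>{..t}. p0 s x y \<partial>lborel)" (is "_ = ?a")
proof (rule antisym)
  note [measurable] = L_measurable[OF t]
  interpret P: prob_space "P x" by (rule P_prob)
  let ?X = "\<lambda>n \<omega>. occupation (bump y n) t \<omega>"
  note lim = expected_occupation_tendsto[OF t, of x y]
  have AE_lim: "AE \<omega> in P x. (\<lambda>n. ?X n \<omega>) \<longlonglongrightarrow> L y t \<omega>"
    using AE_occupation_tendsto_L[of y x] by eventually_elim (use t in auto)
  have "(\<integral>\<^sup>+\<omega>. L y t \<omega> \<partial>P x) = (\<integral>\<^sup>+\<omega>. liminf (\<lambda>n. ?X n \<omega>) \<partial>P x)"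
    by (rule nn_integral_cong_AE, use AE_lim in eventually_elim) (simp add: lim_imp_Liminf)
  also have "\<dots> \<le> liminf (\<lambda>n. \<integral>\<^sup>+\<omega>. ?X n \<omega> \<partial>P x)" by (rule nn_integral_liminf) measurable
  also have "\<dots> = ?a" using lim by (simp add: lim_imp_Liminf)
  finally show "(\<integral>\<^sup>+\<omega>. L y t \<omega> \<partial>P x) \<le> ?a" .
  \<comment> \<open>The constant of \<open>bump_excess_bound\<close>, which depends neither on
    \<open>n\<close> nor on the level.\<close>
  define C where "C = (u y y + 1) * (u y y + 1)"
  have C: "C < top" using u_bound_finite[of y] by (simp add: C_def ennreal_mult_less_top)
  have trunc: "?a \<le> (\<integral>\<^sup>+\<omega>. L y t \<omega> \<partial>P x) + C / ennreal (real (Suc k))" for k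
  proof -
    let ?k = "ennreal (real (Suc k))"
    have k: "0 < ?k" "?k < top" by (simp_all del: of_nat_Suc)
    have excess: "(\<integral>\<^sup>+\<omega>. ?X n \<omega> - ?k \<partial>P x) \<le> C / ?k" for n
    proof -
      have "(\<integral>\<^sup>+\<omega>. ?X n \<omega> - ?k \<partial>P x) \<le> (\<integral>\<^sup>+\<omega>. total_occupation (bump y n) \<omega> - ?k \<partial>P x)"
        by (intro nn_integral_mono ennreal_minus_mono occupation_le_total) simp
      also have "\<dots> = ?k * (\<integral>\<^sup>+\<omega>. total_occupation (bump y n) \<omega> - ?k \<partial>P x) / ?k"
        using k by (subst mult.commute, subst mult_divide_eq_ennreal) (auto simp del: of_nat_Suc)
      also have "\<dots> \<le> C / ?k"
        unfolding C_def by (intro divide_right_mono_ennreal bump_excess_bound k)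
      finally show ?thesis .
    qed
    have "(\<integral>\<^sup>+\<omega>. ?X n \<omega> \<partial>P x) \<le> (\<integral>\<^sup>+\<omega>. min (?X n \<omega>) ?k \<partial>P x) + C / ?k" for n
    proof -
      have "?X n \<omega> = min (?X n \<omega>) ?k + (?X n \<omega> - ?k)" for \<omega>
      proof (cases "?X n \<omega> \<le> ?k")
        case True
        then show ?thesis using le_less_trans[OF True k(2)] diff_eq_0_ennreal[of "?X n \<omega>" ?k] by (simp add: min_def)
      next
        case False
        then have le: "?k \<le> ?X n \<omega>" using linear by blast
        show ?thesis unfolding min.absorb2[OF le] add_diff_inverse_ennreal[OF le] ..
      qed
      then have "(\<integral>\<^sup>+\<omega>. ?X n \<omega> \<partial>P x) = (\<integral>\<^sup>+\<omega>. min (?X n \<omega>) ?k + (?X n \<omega> - ?k) \<partial>P x)" by simp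
      also have "\<dots> = (\<integral>\<^sup>+\<omega>. min (?X n \<omega>) ?k \<partial>P x) + (\<integral>\<^sup>+\<omega>. ?X n \<omega> - ?k \<partial>P x)"
        by (rule nn_integral_add) measurable
      finally show ?thesis using excess[of n] by (simp add: add_left_mono)
    qed
    moreover have "(\<lambda>n. (\<integral>\<^sup>+\<omega>. min (?X n \<omega>) ?k \<partial>P x)) \<longlonglongrightarrow> (\<integral>\<^sup>+\<omega>. min (L y t \<omega>) ?k \<partial>P x)"
    proof (rule nn_integral_dominated_convergence[where w="\<lambda>_. ?k"])
      show "AE \<omega> in P x. (\<lambda>n. min (?X n \<omega>) ?k) \<longlonglongrightarrow> min (L y t \<omega>) ?k"
        using AE_lim by eventually_elim (intro tendsto_min tendsto_const)
    qed (use k in \<open>auto simp del: of_nat_Suc\<close>)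
    ultimately have "?a \<le> (\<integral>\<^sup>+\<omega>. min (L y t \<omega>) ?k \<partial>P x) + C / ?k"
      using lim by (intro LIMSEQ_le[OF lim tendsto_add[OF _ tendsto_const]]) auto
    also have "\<dots> \<le> (\<integral>\<^sup>+\<omega>. L y t \<omega> \<partial>P x) + C / ?k" by (intro add_right_mono nn_integral_mono) simp
    finally show ?thesis .
  qed
  have "(\<lambda>k. C / ennreal (real (Suc k))) \<longlonglongrightarrow> 0"
  proof -
    obtain c where c: "C = ennreal c" "0 \<le> c" using C by (cases C rule: ennreal_cases) auto
    have "(\<lambda>k. c / real (Suc k)) \<longlonglongrightarrow> 0"
      using tendsto_mult[OF tendsto_const[of c] LIMSEQ_inverse_real_of_nat] by (simp add: divide_inverse)
    then have "(\<lambda>k. ennreal (c / real (Suc k))) \<longlonglongrightarrow> ennreal 0" by (rule tendsto_ennrealI)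
    then show ?thesis using c by (simp add: divide_ennreal del: of_nat_Suc)
  qed
  from tendsto_add[OF tendsto_const this] have
    "(\<lambda>k. (\<integral>\<^sup>+\<omega>. L y t \<omega> \<partial>P x) + C / ennreal (real (Suc k))) \<longlonglongrightarrow> (\<integral>\<^sup>+\<omega>. L y t \<omega> \<partial>P x)" by simp
  then show "?a \<le> (\<integral>\<^sup>+\<omega>. L y t \<omega> \<partial>P x)"
    by (rule LIMSEQ_le_const) (use trunc in auto)
qed

abbreviation "L_infinity \<equiv> total_local_time L"

lemma total_local_time_eq:
  assumes "\<omega> \<in> paths" shows "L_infinity y \<omega> = (SUP n. L y (real n) \<omega>)"
  unfolding total_local_time_def
proof (rule antisym)
  show "(SUP t\<in>{0..}. L y t \<omega>) \<le> (SUP n. L y (real n) \<omega>)"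
  proof (rule SUP_least)
    fix t :: real assume t: "t \<in> {0..}"
    obtain n where "t \<le> real n" using real_arch_simple by blast
    then show "L y t \<omega> \<le> (SUP n. L y (real n) \<omega>)"
      using L_mono[OF assms, of t "real n" y] t by (intro SUP_upper2[of n]) auto
  qed
qed (auto intro!: SUP_least SUP_upper)

lemma L_infinity_measurable [measurable]: "L_infinity y \<in> borel_measurable path_algebra"
proof -
  have "(\<lambda>\<omega>. SUP n. L y (real n) \<omega>) \<in> borel_measurable path_algebra" by measurable
  then show ?thesis using total_local_time_eq by (subst measurable_cong[where g="\<lambda>\<omega>. SUP n. L y (real n) \<omega>"]) auto
qed

lemma L_le_infinity: "0 \<le> t \<Longrightarrow> L y t \<omega> \<le> L_infinity y \<omega>"
  unfolding total_local_time_def by (intro SUP_upper) auto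

theorem expected_L_infinity: "(\<integral>\<^sup>+\<omega>. L_infinity y \<omega> \<partial>P x) = u x y"
proof -
  have "(\<integral>\<^sup>+\<omega>. L_infinity y \<omega> \<partial>P x) = (\<integral>\<^sup>+\<omega>. (SUP n. L y (real n) \<omega>) \<partial>P x)"
    using total_local_time_eq by (intro nn_integral_cong) simp
  also have "\<dots> = (SUP n. \<integral>\<^sup>+\<omega>. L y (real n) \<omega> \<partial>P x)"
    by (intro nn_integral_monotone_convergence_SUP_AE)
       (auto intro!: L_mono AE_I2 simp: L_measurable)
  also have "\<dots> = (SUP n. \<integral>\<^sup>+s\<in>{..real n}. p0 s x y \<partial>lborel)" by (simp add: expected_L)
  also have "\<dots> = (\<integral>\<^sup>+s. (SUP n. p0 s x y * indicator {..real n} s) \<partial>lborel)"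
    by (intro nn_integral_monotone_convergence_SUP[symmetric])
       (auto simp: incseq_def le_fun_def indicator_def)
  also have "\<dots> = u x y" unfolding potential_density_eq
  proof (intro nn_integral_cong)
    fix s
    obtain n where n: "s \<le> real n" using real_arch_simple by blast
    show "(SUP n. p0 s x y * indicator {..real n} s) = p0 s x y"
      by (intro antisym SUP_least SUP_upper2[of n]) (use n in \<open>auto simp: indicator_def\<close>)
  qed
  finally show ?thesis .
qed

text \<open>
  Paths on which the occupation measures converge to the local time at \<open>y\<close>; unlike the exceptional
  null sets in the definition of local time this event does not depend on the starting point.
\<close>

definition good :: "'a \<Rightarrow> 'a path set" where
  "good y = {\<omega> \<in> paths. \<forall>r\<in>\<rat> \<inter> {0..}. L y r \<omega> < top \<and> (\<lambda>n. occupation (bump y n) r \<omega>) \<longlonglongrightarrow> L y r \<omega>}"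

lemma good_sets [measurable]: "good y \<in> sets path_algebra"
proof -
  \<comment> \<open>Convergence is expressed by upper and lower limits, which are measurable, and
    only countably many times are involved.\<close>
  have eq: "good y = (\<Inter>r\<in>\<rat> \<inter> {0..}. {\<omega> \<in> space path_algebra. L y r \<omega> < top \<and>
      limsup (\<lambda>n. occupation (bump y n) r \<omega>) = L y r \<omega> \<and> liminf (\<lambda>n. occupation (bump y n) r \<omega>) = L y r \<omega>})"
    unfolding good_def tendsto_iff_Liminf_eq_Limsup[OF sequentially_bot] using Rats_0 by auto
  show ?thesis unfolding eq
  proof (rule sets.countable_INT', goal_cases)
    case 1 show ?case by (rule countable_subset[OF _ countable_rat]) auto
  next
    case 2 show ?case using Rats_0 by (auto intro!: exI[of _ 0])
  next
    case 3 show ?case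
    proof (rule image_subsetI)
    fix r :: real assume "r \<in> \<rat> \<inter> {0..}"
    then have r: "0 \<le> r" by simp
    show "{\<omega> \<in> space path_algebra. L y r \<omega> < top \<and> limsup (\<lambda>n. occupation (bump y n) r \<omega>) = L y r \<omega> \<and>
        liminf (\<lambda>n. occupation (bump y n) r \<omega>) = L y r \<omega>} \<in> sets path_algebra"
    proof -
      note [measurable] = L_measurable[OF r]
      have [measurable]: "{\<omega> \<in> space path_algebra. limsup (\<lambda>n. occupation (bump y n) r \<omega>) = L y r \<omega>} \<in> sets path_algebra"
        "{\<omega> \<in> space path_algebra. liminf (\<lambda>n. occupation (bump y n) r \<omega>) = L y r \<omega>} \<in> sets path_algebra"
        by (rule borel_measurable_eq; measurable)+
      show ?thesis by measurable
    qed
    qed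
  qed
qed

lemma AE_good: "AE \<omega> in P x. \<omega> \<in> good y"
  using AE_occupation_tendsto_L[of y x] AE_P_paths[of x] by eventually_elim (auto simp: good_def)

lemma good_paths: "\<omega> \<in> good y \<Longrightarrow> \<omega> \<in> paths" by (simp add: good_def)

text \<open>Rational times suffice because occupations increase in time and their limit is
  continuous.\<close>

lemma good_tendsto: "\<omega> \<in> good y \<Longrightarrow> 0 \<le> s \<Longrightarrow> (\<lambda>n. occupation (bump y n) s \<omega>) \<longlonglongrightarrow> L y s \<omega>"
  by (rule tendsto_monotone_dense[where X="\<lambda>n s. occupation (bump y n) s \<omega>", OF occupation_mono L_paths(2)])
     (auto simp: good_def)

lemma good_finite: "\<omega> \<in> good y \<Longrightarrow> 0 \<le> s \<Longrightarrow> L y s \<omega> < top"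
proof -
  assume \<omega>: "\<omega> \<in> good y" and s: "0 \<le> s"
  obtain n where n: "s \<le> real n" using real_arch_simple by blast
  have "real n \<in> \<rat> \<inter> {0..}" by auto
  then have "L y (real n) \<omega> < top" using \<omega> unfolding good_def by blast
  then show "L y s \<omega> < top" using le_less_trans[OF L_mono[OF good_paths[OF \<omega>] s n]] by simp
qed

lemma good_zero: "\<omega> \<in> good y \<Longrightarrow> L y 0 \<omega> = 0"
proof -
  assume \<omega>: "\<omega> \<in> good y"
  have "occupation (bump y n) 0 \<omega> = 0" for n
  proof -
    have "AE s in lborel. extend_zero (bump y n) (\<omega> s) * indicator {0..0} s = 0"
      using AE_lborel_singleton[of 0] by eventually_elim (auto simp: indicator_def)
    then show ?thesis unfolding occupation_def by (intro nn_integral_zero')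
  qed
  then show ?thesis using good_tendsto[OF \<omega>, of 0] LIMSEQ_unique[OF _ tendsto_const] by simp
qed

text \<open>Additivity of occupation times passes to the limit. The shifted path has to be good as
  well, since only there is its local time tied to its occupation times.\<close>

lemma L_add:
  assumes "\<omega> \<in> good y" "0 \<le> T" "shift T \<omega> \<in> good y" "0 \<le> t"
  shows "L y (T + t) \<omega> = L y T \<omega> + L y t (shift T \<omega>)"
proof (rule LIMSEQ_unique)
  show "(\<lambda>n. occupation (bump y n) (T + t) \<omega>) \<longlonglongrightarrow> L y (T + t) \<omega>"
    using assms by (intro good_tendsto) auto
  show "(\<lambda>n. occupation (bump y n) (T + t) \<omega>) \<longlonglongrightarrow> L y T \<omega> + L y t (shift T \<omega>)"
    unfolding occupation_add(1)[OF bump_measurable good_paths[OF assms(1)] assms(2,4)]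
    using assms by (intro tendsto_add good_tendsto) auto
qed

definition tau :: "'a \<Rightarrow> real \<Rightarrow> 'a path \<Rightarrow> ennreal" where
  "tau y l = inverse_time (L y) (ennreal l)"

lemma tau_optional: "optional_time (tau y l)"
  unfolding tau_def by (intro inverse_time_optional L_adapted L_paths)

lemma tau_after: "\<omega> \<in> paths \<Longrightarrow> tau y l \<omega> < ennreal s \<Longrightarrow> ennreal l < L y s \<omega>"
  unfolding tau_def by (rule inverse_time_after[OF L_paths(1)])

text \<open>Continuity of the local time gives the converse of \<open>tau_after\<close>: a level
  exceeded at \<open>s\<close> is already exceeded slightly earlier.\<close>

lemma tau_less_iff:
  assumes "\<omega> \<in> paths" "0 < s" shows "tau y l \<omega> < ennreal s \<longleftrightarrow> ennreal l < L y s \<omega>"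
proof
  assume "ennreal l < L y s \<omega>"
  have "isCont (\<lambda>t. L y t \<omega>) s"
    using continuous_on_interior[OF L_paths(2)[OF assms(1)], of s] assms(2) by (simp add: interior_real_atLeast)
  then have "\<forall>\<^sub>F r in at s. ennreal l < L y r \<omega>"
    using \<open>ennreal l < L y s \<omega>\<close> by (auto simp: isCont_def dest: order_tendstoD(1))
  then obtain d where d: "0 < d" "\<And>r. r \<noteq> s \<Longrightarrow> dist r s < d \<Longrightarrow> ennreal l < L y r \<omega>"
    by (auto simp: eventually_at)
  \<comment> \<open>A time before \<open>s\<close> at distance less than \<open>d\<close> from it;
    the entry \<open>s / 2\<close> keeps it nonnegative.\<close>
  define r where "r = max (s / 2) (s - d / 2)"
  have r: "0 \<le> r" "r < s" "ennreal l < L y r \<omega>"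
    using assms(2) d(1) by (auto simp: r_def dist_real_def max_def intro!: d(2))
  then have "tau y l \<omega> \<le> ennreal r" unfolding tau_def inverse_time_def by (intro INF_lower) auto
  also have "\<dots> < ennreal s" using r by (simp add: ennreal_less_iff)
  finally show "tau y l \<omega> < ennreal s" .
qed (rule tau_after[OF assms(1)])

text \<open>Local time at \<open>y\<close> only grows while the path is at \<open>y\<close>, by right continuity of the path.\<close>

lemma tau_at_point:
  assumes \<omega>: "\<omega> \<in> good y" and "tau y l \<omega> < top"
  shows "\<omega> (enn2real (tau y l \<omega>)) = Some y"
proof -
  define t where "t = enn2real (tau y l \<omega>)"
  have t: "0 \<le> t" "tau y l \<omega> = ennreal t" using assms(2) by (auto simp: t_def ennreal_enn2real)
  \<comment> \<open>The level is not exceeded at \<open>t\<close> itself.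
    \<open>tau_less_iff\<close> needs a positive time, and at time \<open>0\<close> the local time
    vanishes.\<close>
  have le: "L y t \<omega> \<le> ennreal l"
  proof (cases "t = 0")
    case False
    then show ?thesis using tau_less_iff[OF good_paths[OF \<omega>], of t y l] t by (auto simp: not_less)
  qed (simp add: good_zero[OF \<omega>])
  have increase: "L y t \<omega> < L y s \<omega>" if "t < s" for s
    using tau_after[OF good_paths[OF \<omega>], of y l s] le t that by (simp add: ennreal_less_iff)
  have "\<omega> t \<in> Some ` cball y e" if "0 < e" for e
  proof (rule visits_immediately_after[OF good_paths[OF \<omega>] t(1)])
    fix s assume s: "t < s"
    \<comment> \<open>The value \<open>c\<close> separates the occupations at \<open>t\<close> and
      at \<open>s\<close> for large \<open>n\<close>. So the \<open>n\<close>-th occupation grows on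
      \<open>[t, s]\<close>, and the path visits its shrinking support in that interval.\<close>
    then obtain c where c: "L y t \<omega> < c" "c < L y s \<omega>" using increase dense by blast
    have "\<forall>\<^sub>F n in sequentially. radius y / real (Suc n) < e" using order_tendstoD(2)[OF radius_tendsto that] .
    moreover have "\<forall>\<^sub>F n in sequentially. occupation (bump y n) t \<omega> < c"
      by (rule order_tendstoD(2)[OF good_tendsto[OF \<omega> t(1)] c(1)])
    moreover have "\<forall>\<^sub>F n in sequentially. c < occupation (bump y n) s \<omega>"
      by (rule order_tendstoD(1)[OF good_tendsto[OF \<omega>] c(2)]) (use s t in simp)
    ultimately have "\<forall>\<^sub>F n in sequentially. \<exists>r. t \<le> r \<and> r \<le> s \<and> \<omega> r \<in> Some ` ball y e"
    proof eventually_elim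
      case (elim n)
      have "\<exists>r. t \<le> r \<and> r \<le> s \<and> \<omega> r \<in> Some ` ball y (radius y / real (Suc n))"
        by (rule occupation_increase_visit[OF bump_measurable bump_support good_paths[OF \<omega>] t(1)])
           (use elim s in auto)
      then show ?case using elim(1) by (fastforce simp: image_iff)
    qed
    then show "\<exists>r. t \<le> r \<and> r \<le> s \<and> \<omega> r \<in> Some ` ball y e"
      by simp
  qed
  note in_ball = this
  obtain v where v: "\<omega> t = Some v" using in_ball[of 1] by auto
  have "dist y v \<le> e" if "0 < e" for e using in_ball[OF that] v by auto
  then have "dist y v \<le> 0" using dense_ge[of 0 "dist y v"] by blast
  then show ?thesis using v by (simp add: t_def)
qed

lemma tau_alive:
  assumes \<omega>: "\<omega> \<in> good y" and "tau y l \<omega> < top"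
  shows "tau y l \<omega> < lifetime \<omega>"
  using tau_at_point[OF assms] lifetime_greater_iff[OF good_paths[OF \<omega>], of "enn2real (tau y l \<omega>)"] assms(2)
  by (simp add: ennreal_enn2real)

end

section \<open>Measures determined by the paths alive at a given time\<close>

text \<open>\<open>Q\<close> and the bridge measures are described through the past of a time
  \<open>s\<close> on survival beyond \<open>s\<close>. The whole space is added so that total
  masses are part of any comparison on this generator.\<close>

definition alive_events :: "'a::topological_space path set set" where
  "alive_events = insert paths {{\<omega> \<in> A. ennreal s < lifetime \<omega>} | s A. 0 \<le> s \<and> A \<in> sets (path_filtration s)}"

lemma path_filtration_alive:
  assumes "0 \<le> s" "A \<in> sets (path_filtration s)"
  shows "{\<omega> \<in> A. ennreal s < lifetime \<omega>} \<in> sets (path_filtration s)"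
proof -
  have "{\<omega> \<in> A. ennreal s < lifetime \<omega>} = A \<inter> {\<omega> \<in> paths. ennreal s < lifetime \<omega>}"
    using sets.sets_into_space[OF assms(2)] by auto
  then show ?thesis using assms alive_event[OF assms(1) order_refl] by auto
qed

lemma alive_events_subset: "alive_events \<subseteq> sets path_algebra"
  unfolding alive_events_def using path_filtration_alive path_filtration_subset sets.top[of path_algebra] by fastforce

lemma alive_events_Int_stable: "Int_stable alive_events"
proof (rule Int_stableI)
  fix a b :: "'a path set" assume ab: "a \<in> alive_events" "b \<in> alive_events"
  have *: "{\<omega> \<in> A. ennreal s < lifetime \<omega>} \<inter> {\<omega> \<in> B. ennreal t < lifetime \<omega>} \<in> alive_events"
    if st: "0 \<le> s" "s \<le> t" and A: "A \<in> sets (path_filtration s)" and B: "B \<in> sets (path_filtration t)"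
    for A B :: "'a path set" and s t
  proof -
    have "{\<omega> \<in> A. ennreal s < lifetime \<omega>} \<inter> {\<omega> \<in> B. ennreal t < lifetime \<omega>} =
        {\<omega> \<in> {\<omega> \<in> A. ennreal s < lifetime \<omega>} \<inter> B. ennreal t < lifetime \<omega>}" by auto
    moreover have "{\<omega> \<in> A. ennreal s < lifetime \<omega>} \<inter> B \<in> sets (path_filtration t)"
      using path_filtration_alive[OF st(1) A] path_filtration_mono[OF st(2)] B by auto
    ultimately show ?thesis unfolding alive_events_def using st by fastforce
  qed
  consider "a = paths" | "b = paths" | s A t B where "a = {\<omega> \<in> A. ennreal s < lifetime \<omega>}" "0 \<le> s"
    "A \<in> sets (path_filtration s)" "b = {\<omega> \<in> B. ennreal t < lifetime \<omega>}" "0 \<le> t" "B \<in> sets (path_filtration t)"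
    using ab unfolding alive_events_def by blast
  then show "a \<inter> b \<in> alive_events"
  proof cases
    case 1 then have "a \<inter> b = b" using ab alive_events_subset sets.space_closed[of path_algebra] by force
    then show ?thesis using ab by simp
  next
    case 2 then have "a \<inter> b = a" using ab alive_events_subset sets.space_closed[of path_algebra] by force
    then show ?thesis using ab by simp
  next
    case (3 s A t B)
    then show ?thesis using *[of s t A B] *[of t s B A] by (cases "s \<le> t") (auto simp: Int_commute)
  qed
qed

text \<open>A cylinder that excludes \<open>None\<close> forces survival past its time, so it is an
  alive event; one that contains \<open>None\<close> is the complement of such a cylinder.\<close>

lemma sigma_alive_events: "sets path_algebra = sigma_sets paths (alive_events :: 'a::topological_space path set set)"
proof (rule antisym)
  show "sigma_sets paths alive_events \<subseteq> sets (path_algebra :: 'a path measure)"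
    using sets.sigma_sets_subset[OF alive_events_subset] by simp
  have "C \<in> sigma_sets paths alive_events" if cyl: "C \<in> cylinders" for C :: "'a path set"
  proof -
    obtain s A where C: "C = {\<omega> \<in> paths. \<omega> s \<in> A}" "0 \<le> s" "A \<in> sets cemetery_borel"
      using cyl unfolding cylinders_def by blast
    have ev: "{\<omega> \<in> paths. \<omega> s \<in> A'} \<in> alive_events" if "None \<notin> A'" "A' \<in> sets cemetery_borel" for A'
    proof -
      have "{\<omega> \<in> paths. \<omega> s \<in> A'} = {\<omega> \<in> {\<omega> \<in> paths. \<omega> s \<in> A'}. ennreal s < lifetime \<omega>}"
        using that(1) lifetime_greater_iff[OF _ C(2)] by force
      moreover have "{\<omega> \<in> paths. \<omega> s \<in> A'} \<in> sets (path_filtration s)"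
        unfolding sets_path_filtration using that(2) C(2) by (intro sigma_sets.Basic) auto
      ultimately show ?thesis unfolding alive_events_def using C(2) by blast
    qed
    show ?thesis
    proof (cases "None \<in> A")
      case True
      have "UNIV - A \<in> sets cemetery_borel" using sets.compl_sets[OF C(3)] by simp
      from ev[OF _ this] True have "paths - {\<omega> \<in> paths. \<omega> s \<in> UNIV - A} \<in> sigma_sets paths alive_events"
        by (intro sigma_sets.Compl sigma_sets.Basic) auto
      moreover have "paths - {\<omega> \<in> paths. \<omega> s \<in> UNIV - A} = C" using C by auto
      ultimately show ?thesis by simp
    next
      case False then show ?thesis using ev[of A] C by (auto intro: sigma_sets.Basic)
    qed
  qed
  then show "sets path_algebra \<subseteq> sigma_sets paths (alive_events :: 'a path set set)"
    unfolding sets_path_algebra_cylinders by (intro sigma_sets_mono) auto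
qed

lemma emeasure_paths_alive:
  assumes "sets M = sets path_algebra" "AE \<omega> in M. 0 < lifetime \<omega>"
  shows "emeasure M {\<omega> \<in> paths. ennreal 0 < lifetime \<omega>} = emeasure M paths"
proof (rule emeasure_eq_AE)
  have sp: "space M = paths" using sets_eq_imp_space_eq[OF assms(1)] by simp
  show "AE \<omega> in M. (\<omega> \<in> {\<omega> \<in> paths. ennreal 0 < lifetime \<omega>}) = (\<omega> \<in> paths)"
    using assms(2) AE_space[of M] unfolding sp by eventually_elim auto
  show "{\<omega> \<in> paths. ennreal 0 < lifetime \<omega>} \<in> sets M"
    using alive_event[of 0 0] path_filtration_subset[of 0] assms(1) by auto
  show "paths \<in> sets M" using sets.top[of M] sp by simp
qed

text \<open>Dynkin's uniqueness theorem on \<open>alive_events\<close>. Without mass on paths dead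
  at time \<open>0\<close>, agreement of the total masses is the case \<open>s = 0\<close>.\<close>

lemma path_measure_eqI:
  assumes M: "sets M = sets path_algebra" "AE \<omega> in M. 0 < lifetime \<omega>"
    and N: "sets N = sets path_algebra" "AE \<omega> in N. 0 < lifetime \<omega>"
    and fin: "emeasure M paths \<noteq> \<infinity>"
    and eq: "\<And>s A. 0 \<le> s \<Longrightarrow> A \<in> sets (path_filtration s) \<Longrightarrow>
      emeasure M {\<omega> \<in> A. ennreal s < lifetime \<omega>} = emeasure N {\<omega> \<in> A. ennreal s < lifetime \<omega>}"
  shows "M = N"
proof (rule measure_eqI_generator_eq[OF alive_events_Int_stable, where \<Omega>=paths and A="\<lambda>_. paths"])
  show "alive_events \<subseteq> Pow (paths :: 'a path set)"
    using alive_events_subset sets.space_closed[of path_algebra] by force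
  fix X :: "'a path set" assume X: "X \<in> alive_events"
  have "emeasure M paths = emeasure N paths"
    using emeasure_paths_alive[OF M] emeasure_paths_alive[OF N] eq[of 0 paths] sets.top[of "path_filtration 0"] by simp
  then show "emeasure M X = emeasure N X" using X eq unfolding alive_events_def by blast
qed (use M N fin sigma_alive_events in \<open>auto simp: alive_events_def\<close>)

text \<open>The same generator carries measurability in a parameter, by a Dynkin induction in which
  finite total mass turns complements into subtractions.\<close>

lemma path_kernel_measurable:
  fixes K :: "'z \<Rightarrow> 'a::topological_space path measure"
  assumes K: "\<And>z. z \<in> space Z \<Longrightarrow> sets (K z) = sets path_algebra"
      "\<And>z. z \<in> space Z \<Longrightarrow> AE \<omega> in K z. 0 < lifetime \<omega>" "\<And>z. z \<in> space Z \<Longrightarrow> emeasure (K z) paths \<noteq> \<infinity>"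
    and gen: "\<And>s A. 0 \<le> s \<Longrightarrow> A \<in> sets (path_filtration s) \<Longrightarrow>
      (\<lambda>z. emeasure (K z) {\<omega> \<in> A. ennreal s < lifetime \<omega>}) \<in> borel_measurable Z"
    and B: "B \<in> sets path_algebra"
  shows "(\<lambda>z. emeasure (K z) B) \<in> borel_measurable Z"
proof -
  have sp: "space (K z) = paths" if "z \<in> space Z" for z using sets_eq_imp_space_eq[OF K(1)[OF that]] by simp
  have total: "(\<lambda>z. emeasure (K z) paths) \<in> borel_measurable Z"
    using gen[of 0 paths] sets.top[of "path_filtration 0"] emeasure_paths_alive[OF K(1,2)]
    by (subst measurable_cong[where g="\<lambda>z. emeasure (K z) {\<omega> \<in> paths. ennreal 0 < lifetime \<omega>}"]) auto
  have "alive_events \<subseteq> Pow (paths :: 'a path set)"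
    using alive_events_subset sets.space_closed[of path_algebra] by force
  moreover have "B \<in> sigma_sets paths alive_events" using B sigma_alive_events by blast
  ultimately show ?thesis
  proof (induction rule: sigma_sets_induct_disjoint[OF alive_events_Int_stable, consumes 2, case_names basic empty compl union])
    case (basic A)
    then show ?case using total gen unfolding alive_events_def by blast
  next
    case empty show ?case by simp
  next
    case (compl A)
    then have "A \<in> sets path_algebra" using sigma_alive_events by blast
    have "emeasure (K z) (paths - A) = emeasure (K z) paths - emeasure (K z) A" if "z \<in> space Z" for z
      using \<open>A \<in> sets path_algebra\<close> K[OF that] sp[OF that] sets.sets_into_space[OF \<open>A \<in> sets path_algebra\<close>]
        emeasure_mono[of A paths "K z"] sets.top[of "K z"]
      by (intro emeasure_Diff) (auto simp: top_unique)
    then show ?case using total compl by (subst measurable_cong[where g="\<lambda>z. emeasure (K z) paths - emeasure (K z) A"]) auto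
  next
    case (union A)
    then have A: "range A \<subseteq> sets path_algebra" using sigma_alive_events by blast
    have "(\<lambda>z. \<Sum>i. emeasure (K z) (A i)) \<in> borel_measurable Z" using union by measurable
    moreover have "emeasure (K z) (\<Union>i. A i) = (\<Sum>i. emeasure (K z) (A i))" if "z \<in> space Z" for z
      using A union(1) K(1)[OF that] by (intro suminf_emeasure[symmetric]) auto
    ultimately show ?case by (subst measurable_cong) auto
  qed
qed

lemma path_kernel_integral_measurable:
  fixes K :: "'z \<Rightarrow> 'a::topological_space path measure"
  assumes K: "\<And>z. z \<in> space Z \<Longrightarrow> sets (K z) = sets path_algebra"
    and meas: "\<And>B. B \<in> sets path_algebra \<Longrightarrow> (\<lambda>z. emeasure (K z) B) \<in> borel_measurable Z"
    and H: "H \<in> borel_measurable path_algebra"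
  shows "(\<lambda>z. \<integral>\<^sup>+\<omega>. H \<omega> \<partial>K z) \<in> borel_measurable Z"
proof -
  have mK: "measurable (K z) N = measurable path_algebra N" if "z \<in> space Z" for z N
    using K[OF that] by (rule measurable_cong_sets) simp
  have sp: "space (K z) = paths" if "z \<in> space Z" for z using sets_eq_imp_space_eq[OF K(1)[OF that]] by simp
  show ?thesis using H
  proof (induction rule: borel_measurable_induct)
    case (cong f g)
    have eq: "(\<integral>\<^sup>+\<omega>. f \<omega> \<partial>K z) = (\<integral>\<^sup>+\<omega>. g \<omega> \<partial>K z)" if "z \<in> space Z" for z
      using cong.hyps(3) sp[OF that] by (intro nn_integral_cong) auto
    show ?case using cong.IH eq by (subst measurable_cong[where g="\<lambda>z. \<integral>\<^sup>+\<omega>. g \<omega> \<partial>K z"]) auto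
  next
    case (set A)
    have eq: "(\<integral>\<^sup>+\<omega>. indicator A \<omega> \<partial>K z) = emeasure (K z) A" if "z \<in> space Z" for z
      using set K[OF that] by simp
    show ?case using meas[OF set] eq by (subst measurable_cong[where g="\<lambda>z. emeasure (K z) A"]) auto
  next
    case (mult f c)
    have eq: "(\<integral>\<^sup>+\<omega>. c * f \<omega> \<partial>K z) = c * (\<integral>\<^sup>+\<omega>. f \<omega> \<partial>K z)" if "z \<in> space Z" for z
      using mult.hyps(2) that by (intro nn_integral_cmult) (simp add: mK)
    have "(\<lambda>z. c * (\<integral>\<^sup>+\<omega>. f \<omega> \<partial>K z)) \<in> borel_measurable Z" using mult.IH by measurable
    then show ?case by (rule measurable_cong[THEN iffD1, rotated]) (simp add: eq)
  next
    case (add f g)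
    have eq: "(\<integral>\<^sup>+\<omega>. g \<omega> + f \<omega> \<partial>K z) = (\<integral>\<^sup>+\<omega>. g \<omega> \<partial>K z) + (\<integral>\<^sup>+\<omega>. f \<omega> \<partial>K z)" if "z \<in> space Z" for z
      using add.hyps(1,3) that by (intro nn_integral_add) (simp_all add: mK)
    have "(\<lambda>z. (\<integral>\<^sup>+\<omega>. g \<omega> \<partial>K z) + (\<integral>\<^sup>+\<omega>. f \<omega> \<partial>K z)) \<in> borel_measurable Z" using add.IH by measurable
    then show ?case by (rule measurable_cong[THEN iffD1, rotated]) (simp add: eq)
  next
    case (seq U)
    have eq: "(\<integral>\<^sup>+\<omega>. (SUP i. U i) \<omega> \<partial>K z) = (SUP i. \<integral>\<^sup>+\<omega>. U i \<omega> \<partial>K z)" if "z \<in> space Z" for z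
    proof -
      have "(\<integral>\<^sup>+\<omega>. (SUP i. U i) \<omega> \<partial>K z) = (\<integral>\<^sup>+\<omega>. (SUP i. U i \<omega>) \<partial>K z)"
        by (intro nn_integral_cong) (simp add: image_comp)
      also have "\<dots> = (SUP i. \<integral>\<^sup>+\<omega>. U i \<omega> \<partial>K z)"
        using seq.hyps(1,3) that by (intro nn_integral_monotone_convergence_SUP) (simp_all add: mK)
      finally show ?thesis .
    qed
    have "(\<lambda>z. SUP i. \<integral>\<^sup>+\<omega>. U i \<omega> \<partial>K z) \<in> borel_measurable Z" using seq.IH by measurable
    then show ?case by (rule measurable_cong[THEN iffD1, rotated]) (simp only: eq)
  qed
qed

text \<open>Integration of a kernel whose members need not be probability measures. The set function
  is shown to be countably additive in \<open>emeasure_mixture\<close>, where measurability of the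
  kernel is assumed.\<close>

definition mixture :: "'z measure \<Rightarrow> ('z \<Rightarrow> 'a::topological_space path measure) \<Rightarrow> 'a path measure" where
  "mixture Z K = measure_of paths (sets path_algebra) (\<lambda>B. \<integral>\<^sup>+z. emeasure (K z) B \<partial>Z)"

lemma sets_mixture [measurable_cong, simp]: "sets (mixture Z K) = sets path_algebra"
  unfolding mixture_def using sets.sets_measure_of_eq[of path_algebra] by simp

lemma space_mixture [simp]: "space (mixture Z K) = paths"
  using sets_eq_imp_space_eq[OF sets_mixture] by simp

lemma emeasure_mixture:
  assumes K: "\<And>z. z \<in> space Z \<Longrightarrow> sets (K z) = sets path_algebra"
    and meas: "\<And>B. B \<in> sets path_algebra \<Longrightarrow> (\<lambda>z. emeasure (K z) B) \<in> borel_measurable Z"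
    and B: "B \<in> sets path_algebra"
  shows "emeasure (mixture Z K) B = (\<integral>\<^sup>+z. emeasure (K z) B \<partial>Z)"
proof (rule emeasure_measure_of[OF mixture_def])
  show "sets path_algebra \<subseteq> Pow paths" using sets.space_closed[of path_algebra] by simp
  show "positive (sets (mixture Z K)) (\<lambda>B. \<integral>\<^sup>+z. emeasure (K z) B \<partial>Z)" by (simp add: positive_def)
  show "countably_additive (sets (mixture Z K)) (\<lambda>B. \<integral>\<^sup>+z. emeasure (K z) B \<partial>Z)"
  proof (rule countably_additiveI)
    fix A :: "nat \<Rightarrow> 'b path set" assume A: "range A \<subseteq> sets (mixture Z K)" "disjoint_family A"
    have "(\<Sum>i. \<integral>\<^sup>+z. emeasure (K z) (A i) \<partial>Z) = (\<integral>\<^sup>+z. (\<Sum>i. emeasure (K z) (A i)) \<partial>Z)"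
      using A meas by (intro nn_integral_suminf[symmetric]) auto
    also have "\<dots> = (\<integral>\<^sup>+z. emeasure (K z) (\<Union>i. A i) \<partial>Z)"
      using A K by (intro nn_integral_cong suminf_emeasure) auto
    finally show "(\<Sum>i. \<integral>\<^sup>+z. emeasure (K z) (A i) \<partial>Z) = (\<integral>\<^sup>+z. emeasure (K z) (\<Union>i. A i) \<partial>Z)" .
  qed
qed (use B in simp)

lemma nn_integral_mixture:
  assumes K: "\<And>z. z \<in> space Z \<Longrightarrow> sets (K z) = sets path_algebra"
    and meas: "\<And>B. B \<in> sets path_algebra \<Longrightarrow> (\<lambda>z. emeasure (K z) B) \<in> borel_measurable Z"
    and H: "H \<in> borel_measurable path_algebra"
  shows "(\<integral>\<^sup>+\<omega>. H \<omega> \<partial>mixture Z K) = (\<integral>\<^sup>+z. \<integral>\<^sup>+\<omega>. H \<omega> \<partial>K z \<partial>Z)"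
proof -
  have mK: "measurable (K z) N = measurable path_algebra N" if "z \<in> space Z" for z N
    using K[OF that] by (rule measurable_cong_sets) simp
  have sp: "space (K z) = paths" if "z \<in> space Z" for z using sets_eq_imp_space_eq[OF K(1)[OF that]] by simp
  note int_meas = path_kernel_integral_measurable[OF K meas]
  show ?thesis using H
  proof (induction rule: borel_measurable_induct)
    case (cong f g)
    have "(\<integral>\<^sup>+z. \<integral>\<^sup>+\<omega>. f \<omega> \<partial>K z \<partial>Z) = (\<integral>\<^sup>+z. \<integral>\<^sup>+\<omega>. g \<omega> \<partial>K z \<partial>Z)"
      using cong.hyps(3) sp by (intro nn_integral_cong) auto
    moreover have "(\<integral>\<^sup>+\<omega>. f \<omega> \<partial>mixture Z K) = (\<integral>\<^sup>+\<omega>. g \<omega> \<partial>mixture Z K)"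
      using cong.hyps(3) by (intro nn_integral_cong) auto
    ultimately show ?case using cong.IH by simp
  next
    case (set A)
    have "(\<integral>\<^sup>+z. \<integral>\<^sup>+\<omega>. indicator A \<omega> \<partial>K z \<partial>Z) = (\<integral>\<^sup>+z. emeasure (K z) A \<partial>Z)"
      using set K by (intro nn_integral_cong) auto
    then show ?case using emeasure_mixture[OF K meas set] set by simp
  next
    case (mult f c)
    note [measurable] = mult.hyps(2)
    have "(\<integral>\<^sup>+z. \<integral>\<^sup>+\<omega>. c * f \<omega> \<partial>K z \<partial>Z) = (\<integral>\<^sup>+z. c * (\<integral>\<^sup>+\<omega>. f \<omega> \<partial>K z) \<partial>Z)"
      using mult.hyps(2) by (intro nn_integral_cong nn_integral_cmult) (simp add: mK)
    also have "\<dots> = c * (\<integral>\<^sup>+z. (\<integral>\<^sup>+\<omega>. f \<omega> \<partial>K z) \<partial>Z)"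
      by (intro nn_integral_cmult int_meas) (use mult.hyps in auto)
    finally show ?case using mult.IH by (simp add: nn_integral_cmult)
  next
    case (add f g)
    note [measurable] = add.hyps(1,3)
    have "(\<integral>\<^sup>+z. \<integral>\<^sup>+\<omega>. g \<omega> + f \<omega> \<partial>K z \<partial>Z) = (\<integral>\<^sup>+z. (\<integral>\<^sup>+\<omega>. g \<omega> \<partial>K z) + (\<integral>\<^sup>+\<omega>. f \<omega> \<partial>K z) \<partial>Z)"
      using add.hyps(1,3) by (intro nn_integral_cong nn_integral_add) (simp_all add: mK)
    also have "\<dots> = (\<integral>\<^sup>+z. (\<integral>\<^sup>+\<omega>. g \<omega> \<partial>K z) \<partial>Z) + (\<integral>\<^sup>+z. (\<integral>\<^sup>+\<omega>. f \<omega> \<partial>K z) \<partial>Z)"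
      by (intro nn_integral_add int_meas) (use add.hyps in auto)
    finally show ?case using add.IH by (simp add: nn_integral_add)
  next
    case (seq U)
    note [measurable] = seq.hyps(1)
    have 1: "(\<integral>\<^sup>+\<omega>. (SUP i. U i) \<omega> \<partial>N) = (SUP i. \<integral>\<^sup>+\<omega>. U i \<omega> \<partial>N)" if "sets N = sets path_algebra" for N
    proof -
      have "(\<integral>\<^sup>+\<omega>. (SUP i. U i) \<omega> \<partial>N) = (\<integral>\<^sup>+\<omega>. (SUP i. U i \<omega>) \<partial>N)"
        by (intro nn_integral_cong) (simp add: image_comp)
      also have "\<dots> = (SUP i. \<integral>\<^sup>+\<omega>. U i \<omega> \<partial>N)"
      proof (intro nn_integral_monotone_convergence_SUP seq.hyps(3))
        show "U i \<in> borel_measurable N" for i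
          using seq.hyps(1)[of i] by (subst measurable_cong_sets[OF that refl])
      qed
      finally show ?thesis .
    qed
    have "(\<integral>\<^sup>+z. \<integral>\<^sup>+\<omega>. (SUP i. U i) \<omega> \<partial>K z \<partial>Z) = (\<integral>\<^sup>+z. (SUP i. \<integral>\<^sup>+\<omega>. U i \<omega> \<partial>K z) \<partial>Z)"
      using 1 K by (intro nn_integral_cong) auto
    also have "\<dots> = (SUP i. \<integral>\<^sup>+z. \<integral>\<^sup>+\<omega>. U i \<omega> \<partial>K z \<partial>Z)"
      using seq.hyps(3) by (intro nn_integral_monotone_convergence_SUP int_meas seq.hyps)
        (auto simp: incseq_def le_fun_def intro!: nn_integral_mono)
    finally show ?case using seq.IH 1[OF sets_mixture, of Z K] by simp
  qed
qed

text \<open>Only positive reals are used as tests, because \<open>tau_less_iff\<close> speaks of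
  positive times.\<close>

lemma ennreal_eqI_real_less:
  fixes a b :: ennreal
  assumes "\<And>s. 0 < s \<Longrightarrow> a < ennreal s \<longleftrightarrow> b < ennreal s"
  shows "a = b"
proof -
  have le: "x \<le> y" if "\<And>s. 0 < s \<Longrightarrow> y < ennreal s \<Longrightarrow> x < ennreal s" for x y :: ennreal
  proof (rule ccontr)
    assume "\<not> x \<le> y"
    then have "y < x" by simp
    then obtain c where c: "y < c" "c < x" using dense by blast
    then obtain s where s: "c = ennreal s" "0 \<le> s" by (cases c rule: ennreal_cases) auto
    have "0 < s" using c(1) s by (cases "s = 0") auto
    then show False using that[of s] c s by auto
  qed
  show ?thesis by (rule antisym) (use le assms in auto)
qed

section \<open>Joint measurability and shifts of the inverse local time\<close>

context local_time_process
begin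

text \<open>\<open>tau_less_iff\<close> replaces the infimum over times by a comparison of the level
  with the local time at one fixed positive time.\<close>

lemma tau_jointly_measurable: "(\<lambda>(\<omega>, l). tau y l \<omega>) \<in> borel_measurable (path_algebra \<Otimes>\<^sub>M borel)"
proof (rule borel_measurableI_less)
  fix c :: ennreal
  have ev: "{z \<in> space (path_algebra \<Otimes>\<^sub>M borel). (case z of (\<omega>, l) \<Rightarrow> tau y l \<omega>) < ennreal s}
      \<in> sets (path_algebra \<Otimes>\<^sub>M borel)" if "0 < s" for s
  proof -
    have [measurable]: "L y s \<in> borel_measurable path_algebra" using that by (intro L_measurable) simp
    have "{z \<in> space (path_algebra \<Otimes>\<^sub>M borel). (case z of (\<omega>, l) \<Rightarrow> tau y l \<omega>) < ennreal s} =
        {z \<in> space (path_algebra \<Otimes>\<^sub>M borel). ennreal (snd z) < L y s (fst z)}"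
      using tau_less_iff that by (auto simp: space_pair_measure)
    also have "\<dots> \<in> sets (path_algebra \<Otimes>\<^sub>M borel)" by measurable
    finally show ?thesis .
  qed
  show "{z \<in> space (path_algebra \<Otimes>\<^sub>M borel). (case z of (\<omega>, l) \<Rightarrow> tau y l \<omega>) < c} \<in> sets (path_algebra \<Otimes>\<^sub>M borel)"
  proof (cases "c = top")
    case True
    have "{z \<in> space (path_algebra \<Otimes>\<^sub>M borel). (case z of (\<omega>, l) \<Rightarrow> tau y l \<omega>) < c} =
        (\<Union>n. {z \<in> space (path_algebra \<Otimes>\<^sub>M borel). (case z of (\<omega>, l) \<Rightarrow> tau y l \<omega>) < ennreal (real (Suc n))})"
    proof (intro equalityI subsetI)
      fix z assume z: "z \<in> {z \<in> space (path_algebra \<Otimes>\<^sub>M borel). (case z of (\<omega>, l) \<Rightarrow> tau y l \<omega>) < c}"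
      then obtain n where n: "(case z of (\<omega>, l) \<Rightarrow> tau y l \<omega>) < of_nat n"
        using ennreal_Ex_less_of_nat True by auto
      also have "(of_nat n :: ennreal) \<le> ennreal (real (Suc n))" by (simp add: ennreal_of_nat_eq_real_of_nat ennreal_leI del: of_nat_Suc)
      finally show "z \<in> (\<Union>n. {z \<in> space (path_algebra \<Otimes>\<^sub>M borel). (case z of (\<omega>, l) \<Rightarrow> tau y l \<omega>) < ennreal (real (Suc n))})"
        using z by auto
    next
      fix z assume "z \<in> (\<Union>n. {z \<in> space (path_algebra \<Otimes>\<^sub>M borel). (case z of (\<omega>, l) \<Rightarrow> tau y l \<omega>) < ennreal (real (Suc n))})"
      then show "z \<in> {z \<in> space (path_algebra \<Otimes>\<^sub>M borel). (case z of (\<omega>, l) \<Rightarrow> tau y l \<omega>) < c}"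
        using True order.strict_trans2[OF _ top_greatest] by auto
    qed
    then show ?thesis using ev by (auto simp del: of_nat_Suc)
  next
    case False
    then obtain s where s: "c = ennreal s" "0 \<le> s" by (cases c rule: ennreal_cases) auto
    then show ?thesis using ev[of s] by (cases "s = 0") auto
  qed
qed

lemma tau_measurable [measurable (raw)]:
  assumes "W \<in> N \<rightarrow>\<^sub>M path_algebra" "l \<in> borel_measurable N"
  shows "(\<lambda>x. tau y (l x) (W x)) \<in> borel_measurable N"
  using measurable_compose[OF measurable_Pair[OF assms] tau_jointly_measurable] by simp

lemma tau_section_measurable: "\<omega> \<in> paths \<Longrightarrow> (\<lambda>l. tau y l \<omega>) \<in> borel_measurable borel"
  by (rule tau_measurable) simp_all

text \<open>Inversion of an additive functional: by time \<open>\<sigma>\<close> the level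
  \<open>L y \<sigma>\<close> has been used up, so a further increase by \<open>l\<close> is reached
  at the inverse local time of the shifted path.\<close>

lemma tau_shift:
  assumes \<omega>: "\<omega> \<in> good y" "0 \<le> \<sigma>" "shift \<sigma> \<omega> \<in> good y" and l: "0 \<le> l"
  shows "tau y (enn2real (L y \<sigma> \<omega>) + l) \<omega> = ennreal \<sigma> + tau y l (shift \<sigma> \<omega>)"
proof (rule ennreal_eqI_real_less)
  fix s :: real assume s: "0 < s"
  have fin: "ennreal (enn2real (L y \<sigma> \<omega>)) = L y \<sigma> \<omega>" using good_finite[OF \<omega>(1,2)] by (simp add: ennreal_enn2real)
  have *: "tau y (enn2real (L y \<sigma> \<omega>) + l) \<omega> < ennreal s \<longleftrightarrow> L y \<sigma> \<omega> + ennreal l < L y s \<omega>"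
    using tau_less_iff[OF good_paths[OF \<omega>(1)] s] l by (simp add: fin)
  show "tau y (enn2real (L y \<sigma> \<omega>) + l) \<omega> < ennreal s \<longleftrightarrow> ennreal \<sigma> + tau y l (shift \<sigma> \<omega>) < ennreal s"
  proof (cases "\<sigma> < s")
    case True
    then have "L y s \<omega> = L y \<sigma> \<omega> + L y (s - \<sigma>) (shift \<sigma> \<omega>)" using L_add[OF \<omega>, of "s - \<sigma>"] by simp
    then have "L y \<sigma> \<omega> + ennreal l < L y s \<omega> \<longleftrightarrow> ennreal l < L y (s - \<sigma>) (shift \<sigma> \<omega>)"
      using good_finite[OF \<omega>(1,2)] by (auto simp: ennreal_add_left_cancel_less)
    also have "\<dots> \<longleftrightarrow> tau y l (shift \<sigma> \<omega>) < ennreal (s - \<sigma>)"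
      using tau_less_iff[OF good_paths[OF \<omega>(3)], of "s - \<sigma>"] True by simp
    also have "\<dots> \<longleftrightarrow> ennreal \<sigma> + tau y l (shift \<sigma> \<omega>) < ennreal \<sigma> + ennreal (s - \<sigma>)"
      by (simp add: ennreal_add_left_cancel_less)
    also have "ennreal \<sigma> + ennreal (s - \<sigma>) = ennreal s" using True \<omega>(2) by (simp flip: ennreal_plus)
    finally show ?thesis using * by simp
  next
    case False
    then have "ennreal s \<le> ennreal \<sigma> + tau y l (shift \<sigma> \<omega>)"
      using ennreal_leI[of s \<sigma>] by (intro add_increasing2) auto
    moreover have "L y s \<omega> \<le> L y \<sigma> \<omega> + ennreal l"
      using L_mono[OF good_paths[OF \<omega>(1)], of s \<sigma> y] False s by (intro add_increasing2) auto
    ultimately show ?thesis using * by (auto simp: not_less)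
  qed
qed

text \<open>Local time starts at zero and is continuous, so a positive level is not exceeded at
  once.\<close>

lemma tau_positive:
  assumes "\<omega> \<in> good y" "0 < l" shows "0 < tau y l \<omega>"
proof -
  have "continuous (at 0 within {0..}) (\<lambda>t. L y t \<omega>)"
    using L_paths(2)[OF good_paths[OF assms(1)], of y] by (simp add: continuous_on_eq_continuous_within)
  then have "((\<lambda>t. L y t \<omega>) \<longlongrightarrow> 0) (at 0 within {0..})"
    using good_zero[OF assms(1)] by (simp add: continuous_within)
  then have "\<forall>\<^sub>F t in at 0 within {0..}. L y t \<omega> < ennreal l"
    using assms(2) by (intro order_tendstoD(2)) auto
  then obtain d where d: "0 < d" "\<And>t. 0 \<le> t \<Longrightarrow> t \<noteq> 0 \<Longrightarrow> dist t 0 < d \<Longrightarrow> L y t \<omega> < ennreal l"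
    by (auto simp: eventually_at)
  have "\<not> tau y l \<omega> < ennreal (d / 2)"
    using tau_less_iff[OF good_paths[OF assms(1)], of "d/2" y l] d(1) d(2)[of "d/2"] by (auto simp: dist_real_def)
  then have "ennreal (d / 2) \<le> tau y l \<omega>" by simp
  moreover have "0 < ennreal (d / 2)" using d(1) by simp
  ultimately show ?thesis by (rule less_le_trans[rotated])
qed

end

section \<open>The measures \<open>Q\<^sup>x\<^sup>,\<^sup>y\<close> and the inverse local time\<close>

lemma killing_in_filtration_event:
  assumes "A \<in> sets (path_filtration s)" "\<omega> \<in> paths" "s < t"
  shows "killing t \<omega> \<in> A \<longleftrightarrow> \<omega> \<in> A"
  by (rule filtration_determined_sets[OF assms(1) killing_in_paths assms(2)]) (use assms in auto)

text \<open>For events of the generator, killing at \<open>t\<close> matters only through the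
  condition \<open>s < t\<close>. This makes \<open>alive_events\<close> suited to laws of killed
  paths.\<close>

lemma killing_in_alive_event:
  assumes "A \<in> sets (path_filtration s)" "\<omega> \<in> paths" "0 \<le> s" "0 \<le> t"
  shows "killing t \<omega> \<in> {\<omega> \<in> A. ennreal s < lifetime \<omega>} \<longleftrightarrow> s < t \<and> \<omega> \<in> A \<and> ennreal s < lifetime \<omega>"
  using killing_in_filtration_event[OF assms(1,2), of t] assms
  by (auto simp: lifetime_killing ennreal_less_iff)

lemma measurable_the [measurable]: "the \<in> cemetery_borel \<rightarrow>\<^sub>M (borel :: 'a::topological_space measure)"
proof (rule measurableI)
  fix A :: "'a set" assume "A \<in> sets borel"
  moreover have "Some -` (the -` A) = A" by auto
  ultimately show "the -` A \<inter> space cemetery_borel \<in> sets cemetery_borel" by (simp add: sets_cemetery_borel)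
qed simp

lemma extend_zero_parametric_measurable:
  fixes h :: "'x \<Rightarrow> 'a::topological_space \<Rightarrow> ennreal"
  assumes h: "(\<lambda>z. h (fst z) (snd z)) \<in> borel_measurable (N \<Otimes>\<^sub>M borel)" and [measurable]: "W \<in> N \<rightarrow>\<^sub>M cemetery_borel"
  shows "(\<lambda>x. extend_zero (h x) (W x)) \<in> borel_measurable N"
proof -
  have 1: "(\<lambda>x. h x (the (W x))) \<in> borel_measurable N"
    using measurable_compose[OF _ h, of "\<lambda>x. (x, the (W x))"] by simp
  have 2: "{x \<in> space N. W x \<in> {None}} \<in> sets N"
    using None_in_cemetery by measurable
  have "(\<lambda>x. if W x \<in> {None} then 0 else h x (the (W x))) \<in> borel_measurable N"
    using 1 2 by (intro measurable_If) auto
  moreover have "extend_zero (h x) (W x) = (if W x \<in> {None} then 0 else h x (the (W x)))" for x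
    by (cases "W x") auto
  ultimately show ?thesis by simp
qed

lemma AE_alive_from_integral:
  assumes [measurable_cong]: "sets N = sets path_algebra"
    and zero: "(\<integral>\<^sup>+\<omega>. indicator {\<omega> \<in> space path_algebra. lifetime \<omega> = 0} \<omega> \<partial>N) = 0"
  shows "AE \<omega> in N. 0 < lifetime \<omega>"
proof -
  have [measurable]: "{\<omega> \<in> space path_algebra. lifetime \<omega> = 0} \<in> sets path_algebra" by measurable
  have sp: "space N = paths" using sets_eq_imp_space_eq[OF assms(1)] by simp
  have "AE \<omega> in N. indicator {\<omega> \<in> space path_algebra. lifetime \<omega> = 0} \<omega> = (0 :: ennreal)"
    by (rule nn_integral_0_iff_AE[THEN iffD1, OF _ zero]) measurable
  then show ?thesis using AE_space[of N]
    by eventually_elim (auto simp: sp indicator_def zero_less_iff_neq_zero split: if_splits)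
qed

section \<open>Change of variables from time to local time\<close>

context local_time_process
begin

text \<open>Levels are translated by \<open>L y \<sigma>\<close> and \<open>tau_shift\<close>
  applies. The indicator on the left removes the levels that are exhausted by time
  \<open>\<sigma>\<close>.\<close>

lemma tau_integral_shift:
  assumes \<omega>: "\<omega> \<in> good y" "0 \<le> \<sigma>" "shift \<sigma> \<omega> \<in> good y" and G: "G \<in> borel_measurable borel"
  shows "(\<integral>\<^sup>+l\<in>{0<..}. G (tau y l \<omega>) * indicator {ennreal \<sigma><..} (tau y l \<omega>) \<partial>lborel) =
    (\<integral>\<^sup>+l\<in>{0<..}. G (ennreal \<sigma> + tau y l (shift \<sigma> \<omega>)) \<partial>lborel)"
proof -
  note [measurable] = tau_section_measurable[OF good_paths[OF \<omega>(1)]] G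
  define c where "c = enn2real (L y \<sigma> \<omega>)"
  have c: "0 \<le> c" "L y \<sigma> \<omega> = ennreal c" using good_finite[OF \<omega>(1,2)] by (auto simp: c_def ennreal_enn2real)
  let ?h = "\<lambda>l. G (tau y l \<omega>) * indicator {ennreal \<sigma><..} (tau y l \<omega>) * indicator {0<..} l"
  have "(\<integral>\<^sup>+l. ?h l \<partial>lborel) = (\<integral>\<^sup>+l. ?h (c + l) \<partial>lborel)"
    using nn_integral_real_affine[of ?h 1 c] by simp
  also have "\<dots> = (\<integral>\<^sup>+l\<in>{0<..}. G (ennreal \<sigma> + tau y l (shift \<sigma> \<omega>)) \<partial>lborel)"
  proof (rule nn_integral_cong_AE)
    \<comment> \<open>The increment \<open>0\<close> is left out as a null set: there the right side
      is zero, while the left side need not be.\<close>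
    show "AE l in lborel. ?h (c + l) = G (ennreal \<sigma> + tau y l (shift \<sigma> \<omega>)) * indicator {0<..} l"
      using AE_lborel_singleton[of 0]
    proof eventually_elim
      fix l :: real assume l: "l \<noteq> 0"
      show "?h (c + l) = G (ennreal \<sigma> + tau y l (shift \<sigma> \<omega>)) * indicator {0<..} l"
      proof (cases "0 < l")
        case True
        then have "tau y (c + l) \<omega> = ennreal \<sigma> + tau y l (shift \<sigma> \<omega>)"
          using tau_shift[OF \<omega>, of l] by (simp add: c_def)
        moreover have "ennreal \<sigma> + 0 < ennreal \<sigma> + tau y l (shift \<sigma> \<omega>)"
          using tau_positive[OF \<omega>(3) True] by (subst ennreal_add_left_cancel_less) auto
        ultimately show ?thesis using True c by simp
      next
        \<comment> \<open>A negative increment belongs to a level below \<open>L y \<sigma>\<close>,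
          which is exceeded before \<open>\<sigma>\<close>, so the indicator on the left is zero;
          nonpositive levels are excluded from the integral anyway.\<close>
        case False
        show ?thesis
        proof (cases "0 < c + l")
          case True
          then have "ennreal (c + l) < L y \<sigma> \<omega>" using c l False by (auto simp: ennreal_less_iff)
          moreover have "0 < \<sigma>" using calculation good_zero[OF \<omega>(1)] \<omega>(2) by (cases "\<sigma> = 0") auto
          ultimately have "tau y (c + l) \<omega> < ennreal \<sigma>"
            using tau_less_iff[OF good_paths[OF \<omega>(1)]] by simp
          then show ?thesis using False by (simp add: indicator_def not_less less_imp_le)
        qed (use False in simp)
      qed
    qed
  qed
  finally show ?thesis .
qed

text \<open>A positive level is exceeded before \<open>t\<close> exactly when it lies below
  \<open>L y t\<close>, so the integral is the length of an interval of levels.\<close>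

lemma tau_integral_L:
  assumes \<omega>: "\<omega> \<in> good y" and t: "0 \<le> t"
  shows "(\<integral>\<^sup>+l\<in>{0<..}. indicator {..<ennreal t} (tau y l \<omega>) \<partial>lborel) = L y t \<omega>"
proof (cases "t = 0")
  case True then show ?thesis using good_zero[OF \<omega>] by simp
next
  case False
  with t have t: "0 < t" by simp
  obtain c where c: "L y t \<omega> = ennreal c" "0 \<le> c"
    using good_finite[OF \<omega>, of t] t by (cases "L y t \<omega>" rule: ennreal_cases) auto
  have "indicator {..<ennreal t} (tau y l \<omega>) * indicator {0<..} l = (indicator {0<..<c} l :: ennreal)" for l
    using tau_less_iff[OF good_paths[OF \<omega>] t, of y l] c by (auto simp: indicator_def ennreal_less_iff)
  then have "(\<integral>\<^sup>+l\<in>{0<..}. indicator {..<ennreal t} (tau y l \<omega>) \<partial>lborel) = (\<integral>\<^sup>+l. indicator {0<..<c} l \<partial>lborel)"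
    by simp
  then show ?thesis using c by simp
qed

lemma tau_integral_total:
  assumes \<omega>: "\<omega> \<in> good y"
  shows "(\<integral>\<^sup>+l\<in>{0<..}. indicator {..<top} (tau y l \<omega>) \<partial>lborel) = L_infinity y \<omega>"
proof -
  note [measurable] = tau_section_measurable[OF good_paths[OF \<omega>]]
  have "(\<integral>\<^sup>+l\<in>{0<..}. indicator {..<top} (tau y l \<omega>) \<partial>lborel) =
      (\<integral>\<^sup>+l. (SUP n. indicator {..<ennreal (real n)} (tau y l \<omega>) * indicator {0<..} l) \<partial>lborel)"
  proof (intro nn_integral_cong)
    fix l :: real
    show "indicator {..<top} (tau y l \<omega>) * indicator {0<..} l =
      (SUP n. indicator {..<ennreal (real n)} (tau y l \<omega>) * indicator {0<..} l :: ennreal)"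
    proof (cases "tau y l \<omega> < top")
      case True
      then obtain n where n: "tau y l \<omega> < of_nat n" using ennreal_Ex_less_of_nat by blast
      show ?thesis
        by (intro antisym SUP_upper2[of n] SUP_least)
           (use True n in \<open>auto simp: indicator_def ennreal_of_nat_eq_real_of_nat\<close>)
    next
      case False
      then have "tau y l \<omega> = top" by (metis less_top)
      then show ?thesis by simp
    qed
  qed
  also have "\<dots> = (SUP n. \<integral>\<^sup>+l\<in>{0<..}. indicator {..<ennreal (real n)} (tau y l \<omega>) \<partial>lborel)"
  proof (intro nn_integral_monotone_convergence_SUP)
    show "incseq (\<lambda>n l. indicator {..<ennreal (real n)} (tau y l \<omega>) * indicator {0<..} l :: ennreal)"
    proof (intro incseq_SucI le_funI)
      fix n l
      have "ennreal (real n) \<le> ennreal (real (Suc n))" by (intro ennreal_leI) simp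
      then show "indicator {..<ennreal (real n)} (tau y l \<omega>) * indicator {0<..} l \<le>
        (indicator {..<ennreal (real (Suc n))} (tau y l \<omega>) * indicator {0<..} l :: ennreal)"
        by (auto simp: indicator_def intro: less_le_trans simp del: of_nat_Suc)
    qed
  qed measurable
  also have "\<dots> = (SUP n. L y (real n) \<omega>)" using tau_integral_L[OF \<omega>] by simp
  also have "\<dots> = L_infinity y \<omega>" by (rule total_local_time_eq[OF good_paths[OF \<omega>], symmetric])
  finally show ?thesis .
qed

text \<open>The complement of \<open>good y\<close> is null for every starting point, hence also for
  the path restarted at \<open>T\<close>, by the strong Markov property. A null set that varied with
  the starting point could not be used here.\<close>

lemma AE_shift_good:
  assumes T: "optional_time T"
  shows "AE \<omega> in P x. T \<omega> < lifetime \<omega> \<longrightarrow> shift (enn2real (T \<omega>)) \<omega> \<in> good y"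
proof -
  note [measurable] = optional_time_measurable[OF T] optional_coordinate_measurable[OF T]
  have A: "paths \<in> optional_events T"
    using T sets.top[of path_algebra] by (auto simp: optional_events_def optional_time_def)
  have set: "{\<omega> \<in> paths. T \<omega> < lifetime \<omega>} \<in> sets path_algebra"
  proof -
    have "{\<omega> \<in> space path_algebra. T \<omega> < lifetime \<omega>} \<in> sets path_algebra" by measurable
    then show ?thesis by simp
  qed
  note [measurable] = set
  have bad [measurable]: "paths - good y \<in> sets path_algebra" using sets.compl_sets[OF good_sets[of y]] by simp
  have zero: "(\<integral>\<^sup>+\<omega>'. indicator (paths - good y) \<omega>' \<partial>P v) = 0" for v
  proof (rule nn_integral_zero')
    show "AE \<omega> in P v. indicator (paths - good y) \<omega> = (0::ennreal)"
      using AE_good[of y v] by eventually_elim simp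
  qed
  have "(\<integral>\<^sup>+\<omega>. indicator {\<omega> \<in> paths. T \<omega> < lifetime \<omega>} \<omega> * indicator (paths - good y) (shift (enn2real (T \<omega>)) \<omega>) \<partial>P x) =
    (\<integral>\<^sup>+\<omega>. indicator {\<omega> \<in> paths. T \<omega> < lifetime \<omega>} \<omega> *
       extend_zero (\<lambda>v. \<integral>\<^sup>+\<omega>'. indicator (paths - good y) \<omega>' \<partial>P v) (\<omega> (enn2real (T \<omega>))) \<partial>P x)"
    by (rule strong_markov_nn[OF T A]) measurable
  also have "\<dots> = 0"
  proof -
    have "extend_zero (\<lambda>v. 0::ennreal) z = 0" for z :: "'a option" by (cases z) auto
    then show ?thesis unfolding zero by simp
  qed
  finally have "AE \<omega> in P x. indicator {\<omega> \<in> paths. T \<omega> < lifetime \<omega>} \<omega> *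
      indicator (paths - good y) (shift (enn2real (T \<omega>)) \<omega>) = (0::ennreal)"
    by (subst (asm) nn_integral_0_iff_AE) auto
  then show ?thesis using AE_P_paths[of x]
    by eventually_elim (auto simp: indicator_def shift_in_paths split: if_splits)
qed

lemma AE_shift_good_const:
  assumes "0 \<le> s" shows "AE \<omega> in P x. ennreal s < lifetime \<omega> \<longrightarrow> shift s \<omega> \<in> good y"
  using AE_shift_good[OF optional_time_const[OF assms], of y x] assms by simp

end

section \<open>The measures Q as laws of killed paths\<close>

locale loop_process = local_time_process m p P f L
  for m :: "'a::{metric_space, second_countable_topology} measure" and p P f L +
  fixes Q :: "'a \<Rightarrow> 'a \<Rightarrow> 'a path measure" and Qb :: "real \<Rightarrow> 'a \<Rightarrow> 'a \<Rightarrow> 'a path measure"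
  assumes Q: "is_Q_measure P p x y (Q x y)"
    and bridge: "0 < t \<Longrightarrow> is_bridge_measure P p t x y (Qb t x y)"
begin

lemma sets_Q [measurable_cong, simp]: "sets (Q x y) = sets path_algebra"
  and AE_Q_alive: "AE \<omega> in Q x y. 0 < lifetime \<omega>"
  using Q[of x y] unfolding is_Q_measure_def by auto

lemma space_Q [simp]: "space (Q x y) = paths"
  using sets_eq_imp_space_eq[OF sets_Q] by simp

lemma Q_alive_event:
  assumes s: "0 \<le> s" and A: "A \<in> sets (path_filtration s)"
  shows "emeasure (Q x y) {\<omega> \<in> A. ennreal s < lifetime \<omega>} =
    (\<integral>\<^sup>+\<omega>. indicator A \<omega> * extend_zero (\<lambda>v. u v y) (\<omega> s) \<partial>P x)"
proof -
  have "indicator A \<in> borel_measurable (path_filtration s)" using A by measurable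
  then have "(\<integral>\<^sup>+\<omega>\<in>{\<omega>. ennreal s < lifetime \<omega>}. indicator A \<omega> \<partial>Q x y) =
      (\<integral>\<^sup>+\<omega>. indicator A \<omega> * extend_zero (\<lambda>v. u v y) (\<omega> s) \<partial>P x)"
    using Q[of x y] s unfolding is_Q_measure_def by blast
  moreover have "(\<integral>\<^sup>+\<omega>\<in>{\<omega>. ennreal s < lifetime \<omega>}. indicator A \<omega> \<partial>Q x y) =
      (\<integral>\<^sup>+\<omega>. indicator {\<omega> \<in> A. ennreal s < lifetime \<omega>} \<omega> \<partial>Q x y)"
    by (intro nn_integral_cong) (auto simp: indicator_def)
  moreover have "\<dots> = emeasure (Q x y) {\<omega> \<in> A. ennreal s < lifetime \<omega>}"
    using path_filtration_alive[OF s A] path_filtration_subset[OF s] by (intro nn_integral_indicator) auto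
  ultimately show ?thesis by simp
qed

lemma emeasure_Q_paths: "emeasure (Q x y) paths = u x y"
  using Q_alive_event[of 0 paths x y] emeasure_paths_alive[OF sets_Q AE_Q_alive, of x y]
    sets.top[of "path_filtration 0"] P_start_integral[of "\<lambda>v. u v y" x]
    nn_integral_cong[of "P x" "\<lambda>\<omega>. indicator paths \<omega> * extend_zero (\<lambda>v. u v y) (\<omega> 0)" "\<lambda>\<omega>. extend_zero (\<lambda>v. u v y) (\<omega> 0)"]
  by simp

lemma finite_measure_Q: "finite_measure (Q x y)"
  by standard (use emeasure_Q_paths[of x y] u_finite[of x y] in auto)

text \<open>
  The measure \<open>Q\<^sup>x\<^sup>,\<^sup>y\<close> is the law of the path killed at a time chosen according to \<open>dL\<^sup>y\<close>; the inverse local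
  time turns \<open>dL\<^sup>y\<close> into Lebesgue measure.
\<close>

theorem Q_representation:
  assumes H: "H \<in> borel_measurable path_algebra"
  shows "(\<integral>\<^sup>+\<omega>. H \<omega> \<partial>Q x y) = (\<integral>\<^sup>+\<omega>. (\<integral>\<^sup>+l\<in>{0<..}. indicator {..<top} (tau y l \<omega>) *
    H (killing (enn2real (tau y l \<omega>)) \<omega>) \<partial>lborel) \<partial>P x)"
proof -
  let ?Z = "P x \<Otimes>\<^sub>M (lborel :: real measure)"
  let ?k = "\<lambda>z. killing (enn2real (tau y (snd z) (fst z))) (fst z)"
  let ?d = "\<lambda>z. indicator {..<top} (tau y (snd z) (fst z)) * indicator {0<..} (snd z) :: ennreal"
  have fst_meas [measurable]: "fst \<in> ?Z \<rightarrow>\<^sub>M path_algebra" by measurable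
  have [measurable]: "(\<lambda>z. tau y (snd z) (fst z)) \<in> borel_measurable ?Z"
    by (rule tau_measurable) measurable
  have k [measurable]: "?k \<in> ?Z \<rightarrow>\<^sub>M path_algebra" by (rule killing_measurable) measurable
  \<comment> \<open>The candidate for \<open>Q x y\<close>: the path under \<open>P x\<close> killed
    at \<open>tau y l\<close>, with \<open>l\<close> spread by Lebesgue measure over the positive
    levels that are exceeded at a finite time.\<close>
  define N where "N = distr (density ?Z ?d) path_algebra ?k"
  have [measurable_cong, simp]: "sets N = sets path_algebra" by (simp add: N_def)
  have N_integral: "(\<integral>\<^sup>+\<omega>. H \<omega> \<partial>N) = (\<integral>\<^sup>+\<omega>. (\<integral>\<^sup>+l\<in>{0<..}. indicator {..<top} (tau y l \<omega>) *
    H (killing (enn2real (tau y l \<omega>)) \<omega>) \<partial>lborel) \<partial>P x)"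
    if [measurable]: "H \<in> borel_measurable path_algebra" for H
  proof -
    have "(\<integral>\<^sup>+\<omega>. H \<omega> \<partial>N) = (\<integral>\<^sup>+z. ?d z * H (?k z) \<partial>?Z)"
      unfolding N_def by (subst nn_integral_distr, measurable, subst nn_integral_density) measurable
    also have "\<dots> = (\<integral>\<^sup>+\<omega>. \<integral>\<^sup>+l. ?d (\<omega>, l) * H (?k (\<omega>, l)) \<partial>lborel \<partial>P x)"
      by (rule lborel.nn_integral_fst[symmetric]) measurable
    finally show ?thesis by (simp add: mult_ac)
  qed
  have "Q x y = N"
  proof (rule path_measure_eqI)
    show "AE \<omega> in N. 0 < lifetime \<omega>"
    proof -
      have "(\<integral>\<^sup>+\<omega>. indicator {\<omega> \<in> space path_algebra. lifetime \<omega> = 0} \<omega> \<partial>N) = 0"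
      proof (subst N_integral)
        show "(\<integral>\<^sup>+\<omega>. (\<integral>\<^sup>+l\<in>{0<..}. indicator {..<top} (tau y l \<omega>) * indicator {\<omega> \<in> space path_algebra. lifetime \<omega> = 0}
          (killing (enn2real (tau y l \<omega>)) \<omega>) \<partial>lborel) \<partial>P x) = 0"
        proof (rule nn_integral_zero', use AE_good[of y x] in eventually_elim)
          case (elim \<omega>)
          have "indicator {..<top} (tau y l \<omega>) * indicator {\<omega> \<in> space path_algebra. lifetime \<omega> = 0}
              (killing (enn2real (tau y l \<omega>)) \<omega>) * indicator {0<..} l = (0::ennreal)" for l
          proof (cases "0 < l \<and> tau y l \<omega> < top")
            case True
            then have "0 < min (tau y l \<omega>) (lifetime \<omega>)"
              using tau_positive[OF elim, of l] tau_alive[OF elim, of l] by auto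
            then show ?thesis using True good_paths[OF elim]
              by (auto simp: lifetime_killing ennreal_enn2real indicator_def min_def split: if_splits)
          qed (auto simp: indicator_def)
          then show ?case by (intro nn_integral_zero' AE_I2)
        qed
      qed measurable
      then show ?thesis by (rule AE_alive_from_integral[rotated]) simp
    qed
    show "emeasure (Q x y) paths \<noteq> \<infinity>" using emeasure_Q_paths[of x y] u_finite[of x y] by simp
    fix s :: real and A :: "'a path set" assume s: "0 \<le> s" and A: "A \<in> sets (path_filtration s)"
    let ?B = "{\<omega> \<in> A. ennreal s < lifetime \<omega>}"
    have B: "?B \<in> sets path_algebra" using path_filtration_alive[OF s A] path_filtration_subset[OF s] by auto
    have "emeasure N ?B = (\<integral>\<^sup>+\<omega>. indicator ?B \<omega> \<partial>N)" using B by simp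
    also have "\<dots> = (\<integral>\<^sup>+\<omega>. (\<integral>\<^sup>+l\<in>{0<..}. indicator {..<top} (tau y l \<omega>) *
        indicator ?B (killing (enn2real (tau y l \<omega>)) \<omega>) \<partial>lborel) \<partial>P x)"
      by (rule N_integral[OF borel_measurable_indicator[OF B]])
    also have "\<dots> = (\<integral>\<^sup>+\<omega>. indicator A \<omega> * (indicator {\<omega>. ennreal s < lifetime \<omega>} \<omega> * L_infinity y (shift s \<omega>)) \<partial>P x)"
    proof (rule nn_integral_cong_AE, use AE_good[of y x] AE_shift_good_const[OF s, of y x] in eventually_elim)
      case (elim \<omega>)
      note \<omega> = good_paths[OF elim(1)]
      note [measurable] = tau_section_measurable[OF \<omega>]
      \<comment> \<open>By \<open>killing_in_alive_event\<close> the killed path is in the event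
        exactly when the path is and the killing happens after \<open>s\<close>.\<close>
      have eq: "indicator {..<top} (tau y l \<omega>) * indicator ?B (killing (enn2real (tau y l \<omega>)) \<omega>) * indicator {0<..} l =
          indicator ?B \<omega> * (indicator {..<top} (tau y l \<omega>) * indicator {ennreal s<..} (tau y l \<omega>) * indicator {0<..} l :: ennreal)" for l
      proof (cases "tau y l \<omega> < top")
        case True
        then obtain t where t: "tau y l \<omega> = ennreal t" "0 \<le> t" by (cases "tau y l \<omega>" rule: ennreal_cases) auto
        have "killing t \<omega> \<in> ?B \<longleftrightarrow> s < t \<and> \<omega> \<in> ?B"
          using killing_in_alive_event[OF A \<omega> s t(2)] by auto
        then show ?thesis using t s by (auto simp: indicator_def ennreal_less_iff)
      qed simp
      have "(\<integral>\<^sup>+l\<in>{0<..}. indicator {..<top} (tau y l \<omega>) * indicator ?B (killing (enn2real (tau y l \<omega>)) \<omega>) \<partial>lborel) =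
          indicator ?B \<omega> * (\<integral>\<^sup>+l\<in>{0<..}. indicator {..<top} (tau y l \<omega>) * indicator {ennreal s<..} (tau y l \<omega>) \<partial>lborel)"
        unfolding eq by (rule nn_integral_cmult) measurable
      also have "\<dots> = indicator A \<omega> * (indicator {\<omega>. ennreal s < lifetime \<omega>} \<omega> * L_infinity y (shift s \<omega>))"
      proof (cases "ennreal s < lifetime \<omega>")
        case True
        then have "shift s \<omega> \<in> good y" using elim(2) by blast
        from tau_integral_shift[OF elim(1) s this, of "indicator {..<top}"] tau_integral_total[OF this]
        have "(\<integral>\<^sup>+l\<in>{0<..}. indicator {..<top} (tau y l \<omega>) * indicator {ennreal s<..} (tau y l \<omega>) \<partial>lborel) = L_infinity y (shift s \<omega>)"
          by (simp add: indicator_def cong: if_cong)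
        then show ?thesis using True by (simp add: indicator_def)
      qed simp
      finally show ?case .
    qed
    \<comment> \<open>The levels exceeded after \<open>s\<close> have the total local time of the
      shifted path as their length. Its expectation from the position at \<open>s\<close> is the
      potential density that defines \<open>Q\<close>.\<close>
    also have "\<dots> = (\<integral>\<^sup>+\<omega>. indicator A \<omega> * extend_zero (\<lambda>v. \<integral>\<^sup>+\<omega>'. L_infinity y \<omega>' \<partial>P v) (\<omega> s) \<partial>P x)"
      by (rule markov_nn[OF s borel_measurable_indicator[OF A] L_infinity_measurable])
    also have "\<dots> = emeasure (Q x y) ?B" by (simp add: Q_alive_event[OF s A] expected_L_infinity)
    finally show "emeasure (Q x y) ?B = emeasure N ?B" by simp
  qed (use AE_Q_alive in auto)
  then show ?thesis using N_integral[OF H] by simp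
qed

end

context strong_markov_process
begin

lemma P_parametric_measurable:
  assumes F: "(\<lambda>z. h (fst z) (snd z)) \<in> borel_measurable (N \<Otimes>\<^sub>M path_algebra)" and x: "x \<in> borel_measurable N"
  shows "(\<lambda>z. \<integral>\<^sup>+\<omega>. h z \<omega> \<partial>P (x z)) \<in> borel_measurable N"
  using nn_integral_measurable_subprob_algebra2[of h N path_algebra "\<lambda>z. P (x z)"] F
    measurable_compose[OF x P_subprob]
  by (simp add: case_prod_beta')

text \<open>The parameter enters both the starting point and the function that is evaluated; this is
  the shape of the formulas for \<open>Q\<close> and for bridges on the generator.\<close>

lemma P_coordinate_parametric_measurable:
  fixes h :: "'z \<Rightarrow> 'a \<Rightarrow> ennreal"
  assumes h: "(\<lambda>z. h (fst z) (snd z)) \<in> borel_measurable (N \<Otimes>\<^sub>M borel)" and x: "x \<in> borel_measurable N"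
    and [measurable]: "A \<in> sets path_algebra" and s: "0 \<le> s"
  shows "(\<lambda>z. \<integral>\<^sup>+\<omega>. indicator A \<omega> * extend_zero (h z) (\<omega> s) \<partial>P (x z)) \<in> borel_measurable N"
proof (rule P_parametric_measurable[OF _ x])
  note [measurable] = coordinate_algebra[OF s]
  have [measurable]: "(\<lambda>z. extend_zero (h (fst z)) (snd z s)) \<in> borel_measurable (N \<Otimes>\<^sub>M path_algebra)"
  proof (rule extend_zero_parametric_measurable)
    show "(\<lambda>z. snd z s) \<in> N \<Otimes>\<^sub>M path_algebra \<rightarrow>\<^sub>M cemetery_borel" by measurable
    show "(\<lambda>z. h (fst (fst z)) (snd z)) \<in> borel_measurable ((N \<Otimes>\<^sub>M path_algebra) \<Otimes>\<^sub>M borel)"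
    proof -
      have "(\<lambda>z. (fst (fst z), snd z)) \<in> (N \<Otimes>\<^sub>M path_algebra) \<Otimes>\<^sub>M borel \<rightarrow>\<^sub>M N \<Otimes>\<^sub>M borel" by measurable
      from measurable_compose[OF this h] show ?thesis by simp
    qed
  qed
  show "(\<lambda>z. indicator A (snd z) * extend_zero (h (fst z)) (snd z s)) \<in> borel_measurable (N \<Otimes>\<^sub>M path_algebra)"
    by measurable
qed

end

section \<open>Kernel measurability, bridges, and Q as a mixture of bridges\<close>

context loop_process
begin

text \<open>The measures \<open>Q x y\<close> are given one pair at a time; measurability in the end
  points comes from their explicit values on the generator.\<close>

lemma Q_kernel_measurable:
  assumes B: "B \<in> sets path_algebra"
  shows "(\<lambda>z. emeasure (Q (fst z) (snd z)) B) \<in> borel_measurable (borel \<Otimes>\<^sub>M borel)"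
proof (rule path_kernel_measurable[OF _ _ _ _ B])
  show "emeasure (Q (fst z) (snd z)) paths \<noteq> \<infinity>" for z
    using emeasure_Q_paths[of "fst z" "snd z"] u_finite[of "fst z" "snd z"] by simp
  fix s :: real and A :: "'a path set" assume s: "0 \<le> s" and A: "A \<in> sets (path_filtration s)"
  show "(\<lambda>z. emeasure (Q (fst z) (snd z)) {\<omega> \<in> A. ennreal s < lifetime \<omega>}) \<in> borel_measurable (borel \<Otimes>\<^sub>M borel)"
    unfolding Q_alive_event[OF s A]
    by (rule P_coordinate_parametric_measurable)
       (use A path_filtration_subset[OF s] s in \<open>auto intro!: u_measurable measurable_compose[OF measurable_fst]\<close>)
qed (auto simp: AE_Q_alive)

lemma Q_integral_measurable:
  assumes H: "H \<in> borel_measurable path_algebra"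
  shows "(\<lambda>z. \<integral>\<^sup>+\<omega>. H \<omega> \<partial>Q (fst z) (snd z)) \<in> borel_measurable (borel \<Otimes>\<^sub>M borel)"
  by (rule path_kernel_integral_measurable[OF _ Q_kernel_measurable H]) auto

text \<open>Bridge measures live on an algebra that varies with \<open>t\<close>; the push-forward
  under \<open>killing t\<close> puts all of them on \<open>path_algebra\<close>. The null measure
  at nonpositive \<open>t\<close> matches the convention for \<open>p0\<close>.\<close>

definition bridge_kill :: "real \<Rightarrow> 'a \<Rightarrow> 'a \<Rightarrow> 'a path measure" where
  "bridge_kill t x y = (if 0 < t then distr (Qb t x y) path_algebra (killing t) else null_measure path_algebra)"

lemma sets_bridge_kill [measurable_cong, simp]: "sets (bridge_kill t x y) = sets path_algebra"
  by (simp add: bridge_kill_def)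

lemma space_bridge_kill [simp]: "space (bridge_kill t x y) = paths"
  using sets_eq_imp_space_eq[OF sets_bridge_kill] by simp

lemma sets_Qb: "0 < t \<Longrightarrow> sets (Qb t x y) = sets (path_filtration_left t)"
  using bridge[of t x y] by (simp add: is_bridge_measure_def)

lemma space_Qb: "0 < t \<Longrightarrow> space (Qb t x y) = paths"
  using sets_eq_imp_space_eq[OF sets_Qb] by simp

lemma killing_measurable_Qb: "0 < t \<Longrightarrow> killing t \<in> Qb t x y \<rightarrow>\<^sub>M path_algebra"
  using killing_measurable_left[of t] measurable_cong_sets[OF sets_Qb refl] by blast

lemma bridge_integral:
  assumes "0 < t" "0 \<le> s" "s < t" "G \<in> borel_measurable (path_filtration s)"
  shows "(\<integral>\<^sup>+\<omega>. G \<omega> \<partial>Qb t x y) = (\<integral>\<^sup>+\<omega>. G \<omega> * extend_zero (\<lambda>v. p0 (t - s) v y) (\<omega> s) \<partial>P x)"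
proof -
  have "(\<integral>\<^sup>+\<omega>. G \<omega> \<partial>Qb t x y) = (\<integral>\<^sup>+\<omega>. G \<omega> * extend_zero (\<lambda>v. ennreal (p (t - s) v y)) (\<omega> s) \<partial>P x)"
    using bridge[OF assms(1), of x y] assms unfolding is_bridge_measure_def by blast
  then show ?thesis using assms by (simp add: p0_def)
qed

text \<open>One formula for all \<open>t\<close>: if \<open>t \<le> s\<close>, the killed path is
  dead at time \<open>s\<close> and \<open>p0 (t - s)\<close> vanishes too.\<close>

lemma bridge_kill_event:
  assumes s: "0 \<le> s" and A: "A \<in> sets (path_filtration s)"
  shows "emeasure (bridge_kill t x y) {\<omega> \<in> A. ennreal s < lifetime \<omega>} =
    (\<integral>\<^sup>+\<omega>. indicator A \<omega> * extend_zero (\<lambda>v. p0 (t - s) v y) (\<omega> s) \<partial>P x)"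
proof -
  let ?B = "{\<omega> \<in> A. ennreal s < lifetime \<omega>}"
  have B: "?B \<in> sets (path_filtration s)" "?B \<in> sets path_algebra"
    using path_filtration_alive[OF s A] path_filtration_subset[OF s] by auto
  have zero: "extend_zero (\<lambda>v. 0::ennreal) z = 0" for z :: "'a option" by (cases z) auto
  show ?thesis
  proof (cases "0 < t")
    case True
    have "emeasure (bridge_kill t x y) ?B = emeasure (Qb t x y) (killing t -` ?B \<inter> paths)"
      using True B by (simp add: bridge_kill_def emeasure_distr killing_measurable_Qb space_Qb)
    also have "killing t -` ?B \<inter> paths = (if s < t then ?B else {})"
      using killing_in_alive_event[OF A _ s, of _ t] sets.sets_into_space[OF A] True by auto
    finally have *: "emeasure (bridge_kill t x y) ?B = emeasure (Qb t x y) (if s < t then ?B else {})" .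
    show ?thesis
    proof (cases "s < t")
      case False
      then show ?thesis using * by (simp add: p0_def zero)
    next
      case st: True
      have "emeasure (Qb t x y) ?B = (\<integral>\<^sup>+\<omega>. indicator ?B \<omega> \<partial>Qb t x y)"
        using B(1) path_filtration_left_subset[OF s st] sets_Qb[OF True] by (intro nn_integral_indicator[symmetric]) auto
      also have "\<dots> = (\<integral>\<^sup>+\<omega>. indicator ?B \<omega> * extend_zero (\<lambda>v. p0 (t - s) v y) (\<omega> s) \<partial>P x)"
        by (rule bridge_integral[OF True s st borel_measurable_indicator[OF B(1)]])
      also have "\<dots> = (\<integral>\<^sup>+\<omega>. indicator A \<omega> * extend_zero (\<lambda>v. p0 (t - s) v y) (\<omega> s) \<partial>P x)"
      proof (intro nn_integral_cong)
        fix \<omega> assume "\<omega> \<in> space (P x)"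
        then show "indicator ?B \<omega> * extend_zero (\<lambda>v. p0 (t - s) v y) (\<omega> s) =
            indicator A \<omega> * extend_zero (\<lambda>v. p0 (t - s) v y) (\<omega> s)"
          using lifetime_greater_iff[of \<omega> s] s by (auto simp: indicator_def)
      qed
      finally show ?thesis using * st by simp
    qed
  next
    case False
    then have "p0 (t - s) v y = 0" for v using s by (simp add: p0_def)
    then show ?thesis using False by (simp add: bridge_kill_def zero)
  qed
qed

lemma emeasure_bridge_kill_paths: "emeasure (bridge_kill t x y) paths = p0 t x y"
proof (cases "0 < t")
  case True
  have "emeasure (bridge_kill t x y) paths = emeasure (Qb t x y) (killing t -` paths \<inter> paths)"
    using True sets.top[of path_algebra] emeasure_distr[OF killing_measurable_Qb[OF True], of paths x y]
    by (simp add: bridge_kill_def space_Qb)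
  also have "killing t -` paths \<inter> paths = space (Qb t x y)"
    using killing_in_paths space_Qb[OF True] by auto
  also have "emeasure (Qb t x y) \<dots> = (\<integral>\<^sup>+\<omega>. 1 \<partial>Qb t x y)" by simp
  also have "\<dots> = (\<integral>\<^sup>+\<omega>. 1 * extend_zero (\<lambda>v. p0 (t - 0) v y) (\<omega> 0) \<partial>P x)"
    by (rule bridge_integral) (use True in auto)
  also have "\<dots> = p0 t x y" by (simp add: P_start_integral)
  finally show ?thesis .
qed (simp add: bridge_kill_def p0_def)

lemma p0_finite [simp]: "p0 t x y \<noteq> top" by (simp add: p0_def)

lemma bridge_kill_lifetime_greater:
  assumes "0 \<le> s" "s < t"
  shows "emeasure (bridge_kill t x y) {\<omega> \<in> paths. ennreal s < lifetime \<omega>} = p0 t x y"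
proof -
  have "emeasure (bridge_kill t x y) {\<omega> \<in> paths. ennreal s < lifetime \<omega>} =
      (\<integral>\<^sup>+\<omega>. indicator paths \<omega> * extend_zero (\<lambda>v. p0 (t - s) v y) (\<omega> s) \<partial>P x)"
    using sets.top[of "path_filtration s"] by (intro bridge_kill_event[OF assms(1)]) simp
  also have "\<dots> = (\<integral>\<^sup>+\<omega>. extend_zero (\<lambda>v. p0 (t - s) v y) (\<omega> s) \<partial>P x)"
    by (intro nn_integral_cong) simp
  also have "\<dots> = p0 t x y"
  proof (cases "s = 0")
    case False
    then show ?thesis using assms p0_chapman_kolmogorov[of s "t - s" x y] by (simp add: P_marginal)
  qed (simp add: P_start_integral)
  finally show ?thesis .
qed

text \<open>By Chapman-Kolmogorov the mass alive past any \<open>s < t\<close> is already the total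
  mass \<open>p0 t x y\<close>, and nothing survives past \<open>t\<close>. As masses are finite,
  equality of masses means almost sure survival.\<close>

lemma AE_bridge_kill_lifetime: "AE \<omega> in bridge_kill t x y. lifetime \<omega> = ennreal t"
proof (cases "0 < t")
  case True
  have ev: "{\<omega> \<in> paths. ennreal s < lifetime \<omega>} \<in> sets path_algebra" if "0 \<le> s" for s
    using alive_event[OF that order_refl] path_filtration_subset[OF that] by auto
  have "AE \<omega> in bridge_kill t x y. ennreal r < lifetime \<omega>" if r: "0 \<le> r" "r < t" for r
  proof (rule AE_I')
    have "emeasure (bridge_kill t x y) (space (bridge_kill t x y) - {\<omega> \<in> paths. ennreal r < lifetime \<omega>}) =
        emeasure (bridge_kill t x y) (space (bridge_kill t x y)) - emeasure (bridge_kill t x y) {\<omega> \<in> paths. ennreal r < lifetime \<omega>}"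
      using bridge_kill_lifetime_greater[OF r, of x y] ev[OF r(1)] by (intro emeasure_compl) auto
    also have "\<dots> = 0" using bridge_kill_lifetime_greater[OF r, of x y] emeasure_bridge_kill_paths[of t x y] by simp
    finally show "paths - {\<omega> \<in> paths. ennreal r < lifetime \<omega>} \<in> null_sets (bridge_kill t x y)"
      using ev[OF r(1)] sets.compl_sets[OF ev[OF r(1)]] by (intro null_setsI) auto
  qed auto
  \<comment> \<open>Countably many times increasing to \<open>t\<close>, beginning with time
    \<open>0\<close> at \<open>n = 0\<close>.\<close>
  then have "AE \<omega> in bridge_kill t x y. ennreal (t - t / real (Suc n)) < lifetime \<omega>" for n
    using True by (simp add: field_simps)
  then have ge: "AE \<omega> in bridge_kill t x y. \<forall>n. ennreal (t - t / real (Suc n)) < lifetime \<omega>"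
    by (subst AE_all_countable) auto
  have le: "AE \<omega> in bridge_kill t x y. \<not> ennreal t < lifetime \<omega>"
  proof (rule AE_I')
    have "emeasure (bridge_kill t x y) {\<omega> \<in> paths. ennreal t < lifetime \<omega>} =
        (\<integral>\<^sup>+\<omega>. indicator paths \<omega> * extend_zero (\<lambda>v. p0 (t - t) v y) (\<omega> t) \<partial>P x)"
      using sets.top[of "path_filtration t"] True by (intro bridge_kill_event) auto
    also have "\<dots> = 0"
    proof -
      have "extend_zero (\<lambda>v. 0::ennreal) z = 0" for z :: "'a option" by (cases z) auto
      then show ?thesis by (simp add: p0_def)
    qed
    finally show "{\<omega> \<in> paths. ennreal t < lifetime \<omega>} \<in> null_sets (bridge_kill t x y)"
      using ev[of t] True by (intro null_setsI) auto
  qed auto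
  show ?thesis using ge le
  proof eventually_elim
    case (elim \<omega>)
    have "(\<lambda>n. t - t * inverse (real (Suc n))) \<longlonglongrightarrow> t - t * 0"
      by (intro tendsto_intros LIMSEQ_inverse_real_of_nat)
    then have "(\<lambda>n. ennreal (t - t / real (Suc n))) \<longlonglongrightarrow> ennreal t"
      by (intro tendsto_ennrealI) (simp add: divide_inverse)
    then have "ennreal t \<le> lifetime \<omega>" by (rule LIMSEQ_le_const2) (use elim(1) in \<open>auto intro: less_imp_le\<close>)
    then show ?case using elim(2) by simp
  qed
next
  case False
  then have "paths \<in> null_sets (bridge_kill t x y)"
    using emeasure_bridge_kill_paths[of t x y] sets.top[of path_algebra] by (intro null_setsI) (auto simp: p0_def)
  then show ?thesis by (rule AE_I') auto
qed

lemma AE_bridge_kill_alive: "AE \<omega> in bridge_kill t x y. 0 < lifetime \<omega>"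
proof (cases "0 < t")
  case True
  show ?thesis using AE_bridge_kill_lifetime[of t x y] by eventually_elim (simp add: True)
next
  case False
  then have "paths \<in> null_sets (bridge_kill t x y)"
    using emeasure_bridge_kill_paths[of t x y] sets.top[of path_algebra] by (intro null_setsI) (auto simp: p0_def)
  then show ?thesis by (rule AE_I') auto
qed

lemma bridge_kill_measurable:
  assumes B: "B \<in> sets path_algebra"
  shows "(\<lambda>z. emeasure (bridge_kill (fst z) (fst (snd z)) (snd (snd z))) B) \<in> borel_measurable (borel \<Otimes>\<^sub>M (borel \<Otimes>\<^sub>M borel))"
proof (rule path_kernel_measurable[OF _ _ _ _ B])
  fix s :: real and A :: "'a path set" assume s: "0 \<le> s" and A: "A \<in> sets (path_filtration s)"
  show "(\<lambda>z. emeasure (bridge_kill (fst z) (fst (snd z)) (snd (snd z))) {\<omega> \<in> A. ennreal s < lifetime \<omega>})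
      \<in> borel_measurable (borel \<Otimes>\<^sub>M (borel \<Otimes>\<^sub>M borel))"
    unfolding bridge_kill_event[OF s A]
  proof (rule P_coordinate_parametric_measurable)
    show "(\<lambda>z. p0 (fst (fst z) - s) (snd z) (snd (snd (fst z))))
        \<in> borel_measurable ((borel \<Otimes>\<^sub>M (borel \<Otimes>\<^sub>M borel)) \<Otimes>\<^sub>M borel)"
      by (intro p0_measurable) measurable
  qed (use A path_filtration_subset[OF s] s in auto)
qed (auto simp: AE_bridge_kill_alive emeasure_bridge_kill_paths)

lemma bridge_kill_measurable':
  assumes B: "B \<in> sets path_algebra"
    and [measurable]: "T \<in> borel_measurable N" "X \<in> borel_measurable N" "Y \<in> borel_measurable N"
  shows "(\<lambda>z. emeasure (bridge_kill (T z) (X z) (Y z)) B) \<in> borel_measurable N"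
proof -
  have "(\<lambda>z. (T z, X z, Y z)) \<in> N \<rightarrow>\<^sub>M borel \<Otimes>\<^sub>M (borel \<Otimes>\<^sub>M borel)" by measurable
  from measurable_compose[OF this bridge_kill_measurable[OF B]] show ?thesis by simp
qed

lemma bridge_kill_integral_measurable:
  assumes H: "H \<in> borel_measurable path_algebra"
    and "T \<in> borel_measurable N" "X \<in> borel_measurable N" "Y \<in> borel_measurable N"
  shows "(\<lambda>z. \<integral>\<^sup>+\<omega>. H \<omega> \<partial>bridge_kill (T z) (X z) (Y z)) \<in> borel_measurable N"
  by (rule path_kernel_integral_measurable[OF _ bridge_kill_measurable' H]) (use assms in auto)

lemma AE_mixture_alive:
  assumes K: "\<And>z. z \<in> space Z \<Longrightarrow> sets (K z) = sets path_algebra"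
    and meas: "\<And>B. B \<in> sets path_algebra \<Longrightarrow> (\<lambda>z. emeasure (K z) B) \<in> borel_measurable Z"
    and alive: "\<And>z. z \<in> space Z \<Longrightarrow> AE \<omega> in K z. 0 < lifetime \<omega>"
  shows "AE \<omega> in mixture Z K. 0 < lifetime \<omega>"
proof (rule AE_alive_from_integral)
  have S: "{\<omega> \<in> space path_algebra. lifetime \<omega> = 0} \<in> sets path_algebra" by measurable
  have "(\<integral>\<^sup>+\<omega>. indicator {\<omega> \<in> space path_algebra. lifetime \<omega> = 0} \<omega> \<partial>mixture Z K) =
      (\<integral>\<^sup>+z. \<integral>\<^sup>+\<omega>. indicator {\<omega> \<in> space path_algebra. lifetime \<omega> = 0} \<omega> \<partial>K z \<partial>Z)"
    by (rule nn_integral_mixture[OF K meas borel_measurable_indicator[OF S]])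
  also have "\<dots> = (\<integral>\<^sup>+z. 0 \<partial>Z)"
  proof (intro nn_integral_cong nn_integral_zero')
    fix z assume "z \<in> space Z"
    from alive[OF this] show "AE \<omega> in K z. indicator {\<omega> \<in> space path_algebra. lifetime \<omega> = 0} \<omega> = (0::ennreal)"
      by eventually_elim (auto simp: indicator_def)
  qed
  finally show "(\<integral>\<^sup>+\<omega>. indicator {\<omega> \<in> space path_algebra. lifetime \<omega> = 0} \<omega> \<partial>mixture Z K) = 0" by simp
qed simp

text \<open>On the generator both sides are expectations over the position \<open>v\<close> at time
  \<open>s\<close>, and integrating \<open>p0 (t - s) v y\<close> over all lengths \<open>t\<close>
  gives \<open>u v y\<close>.\<close>

theorem Q_eq_bridge_mixture: "Q x y = mixture lborel (\<lambda>t. bridge_kill t x y)"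
proof (rule path_measure_eqI)
  have meas: "(\<lambda>t. emeasure (bridge_kill t x y) B) \<in> borel_measurable lborel" if "B \<in> sets path_algebra" for B
    by (rule bridge_kill_measurable'[OF that]) auto
  show "AE \<omega> in mixture lborel (\<lambda>t. bridge_kill t x y). 0 < lifetime \<omega>"
    by (rule AE_mixture_alive[OF _ meas]) (auto simp: AE_bridge_kill_alive)
  show "emeasure (Q x y) paths \<noteq> \<infinity>" using emeasure_Q_paths[of x y] u_finite[of x y] by simp
  fix s :: real and A :: "'a path set" assume s: "0 \<le> s" and A: "A \<in> sets (path_filtration s)"
  let ?B = "{\<omega> \<in> A. ennreal s < lifetime \<omega>}"
  have B: "?B \<in> sets path_algebra" using path_filtration_alive[OF s A] path_filtration_subset[OF s] by auto
  have [measurable]: "A \<in> sets path_algebra" using A path_filtration_subset[OF s] by auto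
  note [measurable] = coordinate_algebra[OF s]
  interpret PP: prob_space "P x" by (rule P_prob)
  interpret pair_sigma_finite "P x" lborel by standard
  have joint [measurable]: "(\<lambda>z. extend_zero (\<lambda>v. p0 (snd z - s) v y) (fst z s)) \<in> borel_measurable (P x \<Otimes>\<^sub>M lborel)"
  proof (rule extend_zero_parametric_measurable)
    show "(\<lambda>z. fst z s) \<in> P x \<Otimes>\<^sub>M lborel \<rightarrow>\<^sub>M cemetery_borel" by measurable
    show "(\<lambda>z. p0 (snd (fst z) - s) (snd z) y) \<in> borel_measurable ((P x \<Otimes>\<^sub>M lborel) \<Otimes>\<^sub>M borel)"
      by (intro p0_measurable) measurable
  qed
  have "emeasure (mixture lborel (\<lambda>t. bridge_kill t x y)) ?B =
      (\<integral>\<^sup>+t. \<integral>\<^sup>+\<omega>. indicator A \<omega> * extend_zero (\<lambda>v. p0 (t - s) v y) (\<omega> s) \<partial>P x \<partial>lborel)"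
    by (subst emeasure_mixture[OF _ meas B]) (auto simp: bridge_kill_event[OF s A])
  also have "\<dots> = (\<integral>\<^sup>+\<omega>. \<integral>\<^sup>+t. indicator A \<omega> * extend_zero (\<lambda>v. p0 (t - s) v y) (\<omega> s) \<partial>lborel \<partial>P x)"
    by (rule Fubini') (simp add: case_prod_beta')
  also have "\<dots> = (\<integral>\<^sup>+\<omega>. indicator A \<omega> * extend_zero (\<lambda>v. u v y) (\<omega> s) \<partial>P x)"
  proof (intro nn_integral_cong)
    fix \<omega>
    show "(\<integral>\<^sup>+t. indicator A \<omega> * extend_zero (\<lambda>v. p0 (t - s) v y) (\<omega> s) \<partial>lborel) =
        indicator A \<omega> * extend_zero (\<lambda>v. u v y) (\<omega> s)"
    proof (cases "\<omega> s")
      case (Some v)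
      have "(\<integral>\<^sup>+t. p0 (t - s) v y \<partial>lborel) = u v y"
        unfolding potential_density_eq using nn_integral_real_affine[of "\<lambda>t. p0 (t - s) v y" 1 s] by simp
      then show ?thesis using Some by (simp add: nn_integral_cmult)
    qed simp
  qed
  also have "\<dots> = emeasure (Q x y) ?B" by (rule Q_alive_event[OF s A, symmetric])
  finally show "emeasure (Q x y) ?B = emeasure (mixture lborel (\<lambda>t. bridge_kill t x y)) ?B" by simp
qed (auto simp: AE_Q_alive)

lemma Q_integral_bridge:
  assumes "H \<in> borel_measurable path_algebra"
  shows "(\<integral>\<^sup>+\<omega>. H \<omega> \<partial>Q x y) = (\<integral>\<^sup>+t. \<integral>\<^sup>+\<omega>. H \<omega> \<partial>bridge_kill t x y \<partial>lborel)"
  unfolding Q_eq_bridge_mixture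
  by (rule nn_integral_mixture) (auto intro: assms bridge_kill_measurable')

end

lemma adapted_event_via_stop:
  assumes "0 \<le> t" "E \<in> sets path_algebra" "\<And>\<omega>. \<omega> \<in> paths \<Longrightarrow> stop t \<omega> \<in> E \<longleftrightarrow> \<omega> \<in> E"
  shows "E \<in> sets (path_filtration t)"
proof -
  have "stop t -` E \<inter> space (path_filtration t) \<in> sets (path_filtration t)"
    by (rule measurable_sets[OF stop_measurable[OF assms(1)] assms(2)])
  moreover have "stop t -` E \<inter> space (path_filtration t) = E"
    using assms(3) sets.sets_into_space[OF assms(2)] by auto
  ultimately show ?thesis by simp
qed

lemma killing_stop: "s \<le> t \<Longrightarrow> killing s (stop t \<omega>) = killing s \<omega>"
  by (auto simp: killing_def stop_def intro!: restrict_ext)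

lemma killing_adapted: "0 \<le> t \<Longrightarrow> killing t \<in> path_filtration t \<rightarrow>\<^sub>M path_algebra"
proof (rule measurable_path_algebraI)
  fix s :: real assume s: "0 \<le> s" and t: "0 \<le> t"
  show "(\<lambda>\<omega>. killing t \<omega> s) \<in> path_filtration t \<rightarrow>\<^sub>M cemetery_borel"
    using s by (cases "s < t") (auto intro: coordinate_filtration)
qed (simp add: killing_in_paths)

text \<open>Both sides have the same finite times below them once these exceed
  \<open>\<sigma>\<close>. Right continuity makes the remaining lifetime positive, which excludes
  the boundary case.\<close>

lemma lifetime_shift:
  assumes "\<omega> \<in> paths" "0 \<le> \<sigma>" "ennreal \<sigma> < lifetime \<omega>"
  shows "lifetime \<omega> = ennreal \<sigma> + lifetime (shift \<sigma> \<omega>)"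
proof -
  have *: "c < lifetime \<omega> \<longleftrightarrow> c < ennreal \<sigma> + lifetime (shift \<sigma> \<omega>)" if "ennreal \<sigma> < c" for c
  proof (cases c rule: ennreal_cases)
    case (real r)
    with that assms(2) have r: "\<sigma> < r" by (simp add: ennreal_less_iff)
    have "c < lifetime \<omega> \<longleftrightarrow> \<omega> r \<noteq> None" using lifetime_greater_iff[OF assms(1), of r] real by simp
    also have "\<dots> \<longleftrightarrow> ennreal (r - \<sigma>) < lifetime (shift \<sigma> \<omega>)"
      using lifetime_greater_iff[OF shift_in_paths[OF assms(1,2)], of "r - \<sigma>"] r by simp
    also have "\<dots> \<longleftrightarrow> ennreal \<sigma> + ennreal (r - \<sigma>) < ennreal \<sigma> + lifetime (shift \<sigma> \<omega>)"
      by (simp add: ennreal_add_left_cancel_less)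
    also have "ennreal \<sigma> + ennreal (r - \<sigma>) = c" using r assms(2) real by (simp flip: ennreal_plus)
    finally show ?thesis .
  qed simp
  have pos: "ennreal \<sigma> < ennreal \<sigma> + lifetime (shift \<sigma> \<omega>)"
  proof -
    have "ennreal 0 < lifetime (shift \<sigma> \<omega>)"
      using lifetime_greater_iff[OF shift_in_paths[OF assms(1,2)], of 0] lifetime_greater_iff[OF assms(1,2)] assms(3) by simp
    then have "ennreal \<sigma> + 0 < ennreal \<sigma> + lifetime (shift \<sigma> \<omega>)"
      by (subst ennreal_add_left_cancel_less) auto
    then show ?thesis by simp
  qed
  show ?thesis
  proof (rule antisym)
    show "lifetime \<omega> \<le> ennreal \<sigma> + lifetime (shift \<sigma> \<omega>)"
    proof (rule ccontr)
      assume "\<not> ?thesis"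
      then have "ennreal \<sigma> + lifetime (shift \<sigma> \<omega>) < lifetime \<omega>" by simp
      then show False using *[of "ennreal \<sigma> + lifetime (shift \<sigma> \<omega>)"] pos by simp
    qed
    show "ennreal \<sigma> + lifetime (shift \<sigma> \<omega>) \<le> lifetime \<omega>"
    proof (rule ccontr)
      assume "\<not> ?thesis"
      then show False using *[of "lifetime \<omega>"] assms(3) by simp
    qed
  qed
qed

section \<open>Strong Markov property at the inverse local time\<close>

context local_time_process
begin

lemma L_killing_before:
  assumes "\<omega> \<in> paths" "0 \<le> s" "s < t" shows "L y s (killing t \<omega>) = L y s \<omega>"
  by (rule filtration_determined[OF L_adapted[OF assms(2)] killing_in_paths[OF assms(1)] assms(1)])
     (use assms in auto)

text \<open>Before \<open>t\<close> the killed path has the same local time by adaptedness, and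
  continuity extends this to \<open>t\<close>. From its lifetime on, which is at most
  \<open>t\<close>, the local time of the killed path is constant. These are the three properties of
  the chosen version.\<close>

lemma L_infinity_killing:
  assumes \<omega>: "\<omega> \<in> paths" and t: "0 < t"
  shows "L_infinity y (killing t \<omega>) = L y t \<omega>"
proof -
  let ?k = "killing t \<omega>"
  note k = killing_in_paths[OF \<omega>, of t]

  have lim: "((\<lambda>s. L y s w) \<longlongrightarrow> L y t w) (at_left t)" if "w \<in> paths" for w
  proof -
    have "isCont (\<lambda>s. L y s w) t"
      using continuous_on_interior[OF L_paths(2)[OF that], of t] t by (simp add: interior_real_atLeast)
    then show ?thesis by (simp add: isCont_def filterlim_at_split)
  qed
  have "\<forall>\<^sub>F s in at_left t. 0 < s" using t eventually_at_left_real eventually_mono by fastforce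
  then have "\<forall>\<^sub>F s in at_left t. L y s ?k = L y s \<omega>"
    using eventually_at_left_real[OF t]
    by eventually_elim (auto intro: L_killing_before[OF \<omega>])
  then have "((\<lambda>s. L y s \<omega>) \<longlongrightarrow> L y t ?k) (at_left t)"
    using lim[OF k] by (rule Lim_transform_eventually[rotated])
  then have eq: "L y t ?k = L y t \<omega>"
    using lim[OF \<omega>] by (rule tendsto_unique[rotated]) simp
  have le: "lifetime ?k \<le> ennreal t" using t by (simp add: lifetime_killing[OF \<omega>])
  have "L y s ?k \<le> L y t ?k" if "0 \<le> s" for s
  proof (cases "s \<le> t")
    case True then show ?thesis using that by (intro L_mono k) auto
  next
    case False
    then have "lifetime ?k \<le> ennreal s" using le by (meson ennreal_leI le_less_linear less_imp_le order_trans)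
    then have "L y s ?k = L y t ?k"
      using L_paths(3)[OF k, of s y] L_paths(3)[OF k, of t y] le that t by simp
    then show ?thesis by simp
  qed
  then have "L_infinity y ?k \<le> L y t ?k" unfolding total_local_time_def by (intro SUP_least) auto
  moreover have "L y t ?k \<le> L_infinity y ?k" using t by (intro L_le_infinity) simp
  ultimately show ?thesis using eq by simp
qed

lemma L_stop: "\<omega> \<in> paths \<Longrightarrow> 0 \<le> s \<Longrightarrow> s \<le> t \<Longrightarrow> L y s (stop t \<omega>) = L y s \<omega>"
  using filtration_determined[OF L_adapted stop_in_paths, of s \<omega> t \<omega> y] by (auto simp: stop_def)

lemma tau_stop:
  assumes \<omega>: "\<omega> \<in> paths" and t: "0 < t"
  shows "tau y l (stop t \<omega>) < ennreal t \<longleftrightarrow> tau y l \<omega> < ennreal t"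
    and "tau y l \<omega> < ennreal t \<Longrightarrow> tau y l (stop t \<omega>) = tau y l \<omega>"
proof -
  have st: "stop t \<omega> \<in> paths" using t by (intro stop_in_paths[OF \<omega>]) simp
  have *: "tau y l (stop t \<omega>) < ennreal s \<longleftrightarrow> tau y l \<omega> < ennreal s" if "0 < s" "s \<le> t" for s
    using that tau_less_iff[OF \<omega> that(1), of y l] tau_less_iff[OF st that(1), of y l] L_stop[OF \<omega>, of s t y] by simp
  show 1: "tau y l (stop t \<omega>) < ennreal t \<longleftrightarrow> tau y l \<omega> < ennreal t" using *[OF t order_refl] .
  assume less: "tau y l \<omega> < ennreal t"
  show "tau y l (stop t \<omega>) = tau y l \<omega>"
  proof (rule ennreal_eqI_real_less)
    fix s :: real assume s: "0 < s"
    show "tau y l (stop t \<omega>) < ennreal s \<longleftrightarrow> tau y l \<omega> < ennreal s"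
    proof (cases "s \<le> t")
      case False
      then have "ennreal t \<le> ennreal s" by (intro ennreal_leI) simp
      then show ?thesis using 1 less by (meson less_le_trans)
    qed (use * s in auto)
  qed
qed

text \<open>Galmarino's test: on \<open>tau y l < t\<close>, freezing the path at \<open>t\<close>
  changes neither \<open>tau y l\<close> nor the path killed there.\<close>

lemma killing_at_tau_event:
  assumes B: "B \<in> sets path_algebra"
  shows "{\<omega> \<in> paths. tau y l \<omega> < top \<and> killing (enn2real (tau y l \<omega>)) \<omega> \<in> B} \<in> optional_events (tau y l)"
proof -
  note [measurable] = optional_time_measurable[OF tau_optional, of y l]
  have k [measurable]: "(\<lambda>\<omega>. killing (enn2real (tau y l \<omega>)) \<omega>) \<in> path_algebra \<rightarrow>\<^sub>M path_algebra"
    by (rule killing_measurable) measurable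
  let ?A = "{\<omega> \<in> paths. tau y l \<omega> < top \<and> killing (enn2real (tau y l \<omega>)) \<omega> \<in> B}"
  have "{\<omega> \<in> space path_algebra. tau y l \<omega> < top \<and> killing (enn2real (tau y l \<omega>)) \<omega> \<in> B} \<in> sets path_algebra"
    using B by measurable
  then have A [measurable]: "?A \<in> sets path_algebra" by simp
  have "{\<omega> \<in> ?A. tau y l \<omega> < ennreal t} \<in> sets (path_filtration t)" if t: "0 \<le> t" for t
  proof (cases "t = 0")
    case True then show ?thesis by simp
  next
    case False
    with t have t: "0 < t" by simp
    show ?thesis
    proof (rule adapted_event_via_stop)
      have "{\<omega> \<in> space path_algebra. tau y l \<omega> < ennreal t} \<in> sets path_algebra" by measurable
      from sets.Int[OF A this]
      have "?A \<inter> {\<omega> \<in> space path_algebra. tau y l \<omega> < ennreal t} \<in> sets path_algebra" .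
      moreover have "?A \<inter> {\<omega> \<in> space path_algebra. tau y l \<omega> < ennreal t} = {\<omega> \<in> ?A. tau y l \<omega> < ennreal t}" by auto
      ultimately show "{\<omega> \<in> ?A. tau y l \<omega> < ennreal t} \<in> sets path_algebra" by simp
      fix \<omega> :: "'a path" assume \<omega>: "\<omega> \<in> paths"
      note st = tau_stop[OF \<omega> t, of y l]
      have "enn2real (tau y l \<omega>) \<le> t" if "tau y l \<omega> < ennreal t"
        using that t by (intro enn2real_leI) auto
      then show "stop t \<omega> \<in> {\<omega> \<in> ?A. tau y l \<omega> < ennreal t} \<longleftrightarrow> \<omega> \<in> {\<omega> \<in> ?A. tau y l \<omega> < ennreal t}"
        using st stop_in_paths[OF \<omega>, of t] t \<omega> by (auto simp: killing_stop)
    qed (use t in simp)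
  qed
  then show ?thesis using A unfolding optional_events_def by blast
qed

text \<open>At a finite \<open>tau y l\<close> the path is almost surely at the fixed point
  \<open>y\<close>. The expected future is therefore a constant, and past and future
  factorise.\<close>

lemma strong_markov_at_tau:
  assumes H: "H \<in> borel_measurable path_algebra" and F: "F \<in> borel_measurable path_algebra"
  shows "(\<integral>\<^sup>+\<omega>. indicator {..<top} (tau y l \<omega>) * (H (killing (enn2real (tau y l \<omega>)) \<omega>) *
      F (shift (enn2real (tau y l \<omega>)) \<omega>)) \<partial>P x) =
    (\<integral>\<^sup>+\<omega>. indicator {..<top} (tau y l \<omega>) * H (killing (enn2real (tau y l \<omega>)) \<omega>) \<partial>P x) * (\<integral>\<^sup>+\<omega>. F \<omega> \<partial>P y)"
proof -
  note [measurable] = optional_time_measurable[OF tau_optional, of y l] optional_coordinate_measurable[OF tau_optional, of y l] F H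
  let ?k = "\<lambda>\<omega>. killing (enn2real (tau y l \<omega>)) \<omega>"
  let ?s = "\<lambda>\<omega>. shift (enn2real (tau y l \<omega>)) \<omega>"
  let ?i = "\<lambda>\<omega>. indicator {..<top} (tau y l \<omega>) :: ennreal"
  have k [measurable]: "?k \<in> path_algebra \<rightarrow>\<^sub>M path_algebra" by (rule killing_measurable) measurable
  let ?c = "\<integral>\<^sup>+\<omega>. F \<omega> \<partial>P y"
  \<comment> \<open>Both sides are read as measures in the killed path. The strong Markov property
    compares them on events, and equality of the measures then gives the identity for every
    \<open>H\<close>.\<close>
  define M1 where "M1 = distr (density (P x) (\<lambda>\<omega>. ?i \<omega> * F (?s \<omega>))) path_algebra ?k"
  define M2 where "M2 = density (distr (density (P x) ?i) path_algebra ?k) (\<lambda>_. ?c)"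
  have M1: "(\<integral>\<^sup>+\<omega>. H \<omega> \<partial>M1) = (\<integral>\<^sup>+\<omega>. ?i \<omega> * F (?s \<omega>) * H (?k \<omega>) \<partial>P x)"
    if [measurable]: "H \<in> borel_measurable path_algebra" for H
    unfolding M1_def by (subst nn_integral_distr, measurable, subst nn_integral_density) measurable
  have M2: "(\<integral>\<^sup>+\<omega>. H \<omega> \<partial>M2) = ?c * (\<integral>\<^sup>+\<omega>. ?i \<omega> * H (?k \<omega>) \<partial>P x)"
    if [measurable]: "H \<in> borel_measurable path_algebra" for H
  proof -
    have "(\<integral>\<^sup>+\<omega>. H \<omega> \<partial>M2) = (\<integral>\<^sup>+\<omega>. ?c * H \<omega> \<partial>distr (density (P x) ?i) path_algebra ?k)"
      unfolding M2_def by (subst nn_integral_density) measurable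
    also have "\<dots> = (\<integral>\<^sup>+\<omega>. ?c * H (?k \<omega>) \<partial>density (P x) ?i)"
      by (subst nn_integral_distr) measurable
    also have "\<dots> = (\<integral>\<^sup>+\<omega>. ?i \<omega> * (?c * H (?k \<omega>)) \<partial>P x)"
      by (subst nn_integral_density) measurable
    also have "\<dots> = ?c * (\<integral>\<^sup>+\<omega>. ?i \<omega> * H (?k \<omega>) \<partial>P x)"
      by (simp add: mult.left_commute[of _ ?c] nn_integral_cmult)
    finally show ?thesis .
  qed
  have "M1 = M2"
  proof (rule measure_eqI)
    fix B assume "B \<in> sets M1"
    then have B [measurable]: "B \<in> sets path_algebra" by (simp add: M1_def)
    let ?A = "{\<omega> \<in> paths. tau y l \<omega> < top \<and> ?k \<omega> \<in> B}"
    let ?S = "{\<omega> \<in> ?A. tau y l \<omega> < lifetime \<omega>}"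
    have ind: "AE \<omega> in P x. \<omega> \<in> paths \<and> (?i \<omega> * indicator B (?k \<omega>) = (indicator ?S \<omega> :: ennreal)) \<and>
        (\<omega> \<in> ?S \<longrightarrow> \<omega> (enn2real (tau y l \<omega>)) = Some y)"
      using AE_good[of y x]
    proof eventually_elim
      case (elim \<omega>)
      then show ?case using tau_alive[OF elim, of l] tau_at_point[OF elim, of l] good_paths[OF elim]
        by (auto simp: indicator_def)
    qed
    have "emeasure M1 B = (\<integral>\<^sup>+\<omega>. indicator B \<omega> \<partial>M1)" using B by (simp add: M1_def)
    also have "\<dots> = (\<integral>\<^sup>+\<omega>. ?i \<omega> * F (?s \<omega>) * indicator B (?k \<omega>) \<partial>P x)" by (rule M1) (use B in simp)
    also have "\<dots> = (\<integral>\<^sup>+\<omega>. indicator ?S \<omega> * F (?s \<omega>) \<partial>P x)"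
    proof (rule nn_integral_cong_AE, use ind in eventually_elim)
      case (elim \<omega>)
      then have eq: "?i \<omega> * indicator B (?k \<omega>) = (indicator ?S \<omega> :: ennreal)" by blast
      have "?i \<omega> * F (?s \<omega>) * indicator B (?k \<omega>) = (?i \<omega> * indicator B (?k \<omega>)) * F (?s \<omega>)"
        by (simp only: mult.assoc mult.commute[of "F (?s \<omega>)"])
      also have "\<dots> = indicator ?S \<omega> * F (?s \<omega>)" by (simp only: eq)
      finally show ?case .
    qed
    also have "\<dots> = (\<integral>\<^sup>+\<omega>. indicator ?S \<omega> * extend_zero (\<lambda>v. \<integral>\<^sup>+\<omega>'. F \<omega>' \<partial>P v) (\<omega> (enn2real (tau y l \<omega>))) \<partial>P x)"
      by (rule strong_markov_nn[OF tau_optional killing_at_tau_event[OF B] F])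
    also have "\<dots> = (\<integral>\<^sup>+\<omega>. ?c * (?i \<omega> * indicator B (?k \<omega>)) \<partial>P x)"
    proof (rule nn_integral_cong_AE, use ind in eventually_elim)
      case (elim \<omega>)
      then have eq: "?i \<omega> * indicator B (?k \<omega>) = (indicator ?S \<omega> :: ennreal)" by blast
      show ?case
      proof (cases "\<omega> \<in> ?S")
        case True
        then have "\<omega> (enn2real (tau y l \<omega>)) = Some y" using elim by blast
        then show ?thesis unfolding eq indicator_simps(1)[OF True] by simp
      next
        case False
        show ?thesis unfolding eq indicator_simps(2)[OF False] by simp
      qed
    qed
    also have "\<dots> = ?c * (\<integral>\<^sup>+\<omega>. ?i \<omega> * indicator B (?k \<omega>) \<partial>P x)"
      using B by (intro nn_integral_cmult) measurable
    also have "\<dots> = (\<integral>\<^sup>+\<omega>. indicator B \<omega> \<partial>M2)" by (rule M2[symmetric]) (use B in simp)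
    also have "\<dots> = emeasure M2 B" using B by (simp add: M2_def)
    finally show "emeasure M1 B = emeasure M2 B" .
  qed (simp add: M1_def M2_def)
  then have "(\<integral>\<^sup>+\<omega>. ?i \<omega> * F (?s \<omega>) * H (?k \<omega>) \<partial>P x) = ?c * (\<integral>\<^sup>+\<omega>. ?i \<omega> * H (?k \<omega>) \<partial>P x)"
    using M1[OF H] M2[OF H] by simp
  then show ?thesis by (simp add: mult_ac)
qed

end

lemma (in strong_markov_process) expected_total_occupation_alive:
  assumes "0 \<le> s" "A \<in> sets (path_filtration s)" "g \<in> borel_measurable borel"
  shows "(\<integral>\<^sup>+\<omega>. indicator A \<omega> * (indicator {\<omega>. ennreal s < lifetime \<omega>} \<omega> * total_occupation g (shift s \<omega>)) \<partial>P x) =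
    (\<integral>\<^sup>+\<omega>. indicator A \<omega> * extend_zero (\<lambda>v. \<integral>\<^sup>+y. u v y * g y \<partial>m) (\<omega> s) \<partial>P x)"
  using markov_nn[OF assms(1) borel_measurable_indicator[OF assms(2)] occupation_measurable(2)[OF assms(3)], of x]
  by (simp add: expected_total_occupation[OF assms(3)])

lemma occupation_after:
  fixes g :: "'a::metric_space \<Rightarrow> ennreal"
  assumes g: "g \<in> borel_measurable borel" and \<omega>: "\<omega> \<in> paths" and s: "0 \<le> s"
  shows "(\<integral>\<^sup>+t\<in>{s<..}. extend_zero g (\<omega> t) \<partial>lborel) = total_occupation g (shift s \<omega>)"
proof -
  have "(\<lambda>t. extend_zero g (\<omega> t) * indicator {s<..} t) \<in> borel_measurable lborel"
    by (rule path_section_measurable_indicator[OF g \<omega>]) (use s in auto)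
  then have "(\<integral>\<^sup>+t\<in>{s<..}. extend_zero g (\<omega> t) \<partial>lborel) =
      (\<integral>\<^sup>+t. extend_zero g (\<omega> (s + t)) * indicator {s<..} (s + t) \<partial>lborel)"
    using nn_integral_real_affine[of "\<lambda>t. extend_zero g (\<omega> t) * indicator {s<..} t" 1 s] by simp
  also have "\<dots> = total_occupation g (shift s \<omega>)" unfolding total_occupation_def
  proof (rule nn_integral_cong_AE)
    show "AE t in lborel. extend_zero g (\<omega> (s + t)) * indicator {s<..} (s + t) =
        extend_zero g (shift s \<omega> t) * indicator {0..} t"
      using AE_lborel_singleton[of 0] by eventually_elim (auto simp: indicator_def shift_def)
  qed
  finally show ?thesis .
qed

section \<open>Integration of Q over its end point\<close>

context loop_process
begin

lemma Q_section_measurable: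
  assumes "H \<in> borel_measurable path_algebra"
  shows "(\<lambda>y. \<integral>\<^sup>+\<omega>. H \<omega> \<partial>Q x y) \<in> borel_measurable borel"
    "(\<lambda>x. \<integral>\<^sup>+\<omega>. H \<omega> \<partial>Q x y) \<in> borel_measurable borel"
    "(\<lambda>x. \<integral>\<^sup>+\<omega>. H \<omega> \<partial>Q x x) \<in> borel_measurable borel"
proof -
  have 1: "Pair x \<in> borel \<rightarrow>\<^sub>M borel \<Otimes>\<^sub>M borel" "(\<lambda>x. (x, y)) \<in> borel \<rightarrow>\<^sub>M borel \<Otimes>\<^sub>M borel"
    "(\<lambda>x. (x, x)) \<in> borel \<rightarrow>\<^sub>M borel \<Otimes>\<^sub>M (borel :: 'a measure)" by measurable
  show "(\<lambda>y. \<integral>\<^sup>+\<omega>. H \<omega> \<partial>Q x y) \<in> borel_measurable borel"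
    "(\<lambda>x. \<integral>\<^sup>+\<omega>. H \<omega> \<partial>Q x y) \<in> borel_measurable borel"
    "(\<lambda>x. \<integral>\<^sup>+\<omega>. H \<omega> \<partial>Q x x) \<in> borel_measurable borel"
    using 1[THEN measurable_compose, OF Q_integral_measurable[OF assms]] by simp_all
qed

lemma Q_emeasure_section_measurable:
  assumes B: "B \<in> sets path_algebra"
  shows "(\<lambda>y. emeasure (Q x y) B) \<in> borel_measurable borel"
  using Q_section_measurable(1)[OF borel_measurable_indicator[OF B], of x] B by simp

text \<open>Killing at time \<open>t\<close> with weight \<open>g\<close> of the position,
  integrated over \<open>dt\<close>, mixes the laws \<open>Q x y\<close> with weight
  \<open>g\<close> over the end point: on the generator both sides are an expected occupation after
  \<open>s\<close>. The finiteness assumption is the one that \<open>path_measure_eqI\<close>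
  needs.\<close>

lemma Q_disintegration_finite:
  assumes g [measurable]: "g \<in> borel_measurable borel" and fin: "(\<integral>\<^sup>+y. u x y * g y \<partial>m) \<noteq> \<infinity>"
    and H: "H \<in> borel_measurable path_algebra"
  shows "(\<integral>\<^sup>+y. g y * (\<integral>\<^sup>+\<omega>. H \<omega> \<partial>Q x y) \<partial>m) =
    (\<integral>\<^sup>+\<omega>. (\<integral>\<^sup>+t\<in>{0..}. extend_zero g (\<omega> t) * H (killing t \<omega>) \<partial>lborel) \<partial>P x)"
proof -
  interpret PP: prob_space "P x" by (rule P_prob)
  let ?Z = "P x \<Otimes>\<^sub>M (lborel :: real measure)"
  let ?k = "\<lambda>z. killing (snd z) (fst z)"
  let ?d = "\<lambda>z. extend_zero g (fst z (max 0 (snd z))) * indicator {0..} (snd z)"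
  have fst_meas: "fst \<in> ?Z \<rightarrow>\<^sub>M path_algebra" by measurable
  have [measurable]: "(\<lambda>z. fst z (max 0 (snd z))) \<in> ?Z \<rightarrow>\<^sub>M cemetery_borel"
    by (rule coordinate_at_measurable[OF _ fst_meas]) auto
  have k [measurable]: "?k \<in> ?Z \<rightarrow>\<^sub>M path_algebra" by (rule killing_measurable[OF _ fst_meas]) measurable
  define N where "N = distr (density ?Z ?d) path_algebra ?k"
  have [measurable_cong, simp]: "sets N = sets path_algebra" by (simp add: N_def)
  have N_integral: "(\<integral>\<^sup>+\<omega>. H \<omega> \<partial>N) = (\<integral>\<^sup>+\<omega>. (\<integral>\<^sup>+t\<in>{0..}. extend_zero g (\<omega> t) * H (killing t \<omega>) \<partial>lborel) \<partial>P x)"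
    if [measurable]: "H \<in> borel_measurable path_algebra" for H
  proof -
    have "(\<integral>\<^sup>+\<omega>. H \<omega> \<partial>N) = (\<integral>\<^sup>+z. ?d z * H (?k z) \<partial>?Z)"
      unfolding N_def by (subst nn_integral_distr, measurable, subst nn_integral_density) measurable
    also have "\<dots> = (\<integral>\<^sup>+\<omega>. \<integral>\<^sup>+t. ?d (\<omega>, t) * H (?k (\<omega>, t)) \<partial>lborel \<partial>P x)"
      by (rule lborel.nn_integral_fst[symmetric]) measurable
    also have "\<dots> = (\<integral>\<^sup>+\<omega>. (\<integral>\<^sup>+t\<in>{0..}. extend_zero g (\<omega> t) * H (killing t \<omega>) \<partial>lborel) \<partial>P x)"
      by (intro nn_integral_cong) (auto simp: indicator_def)
    finally show ?thesis .
  qed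
  let ?M = "mixture (density m g) (Q x)"
  have meas: "(\<lambda>y. emeasure (Q x y) B) \<in> borel_measurable (density m g)" if "B \<in> sets path_algebra" for B
    using Q_emeasure_section_measurable[OF that] by (simp add: measurable_m)
  have M_integral: "(\<integral>\<^sup>+\<omega>. H \<omega> \<partial>?M) = (\<integral>\<^sup>+y. g y * (\<integral>\<^sup>+\<omega>. H \<omega> \<partial>Q x y) \<partial>m)"
    if "H \<in> borel_measurable path_algebra" for H
  proof -
    note [measurable] = Q_section_measurable(1)[OF that, of x]
    have "(\<integral>\<^sup>+\<omega>. H \<omega> \<partial>?M) = (\<integral>\<^sup>+y. (\<integral>\<^sup>+\<omega>. H \<omega> \<partial>Q x y) \<partial>density m g)"
      by (rule nn_integral_mixture[OF _ meas that]) simp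
    then show ?thesis by (subst (asm) nn_integral_density) measurable
  qed
  have "?M = N"
  proof (rule path_measure_eqI)
    show "AE \<omega> in ?M. 0 < lifetime \<omega>" by (rule AE_mixture_alive[OF _ meas]) (auto simp: AE_Q_alive)
    show "emeasure ?M paths \<noteq> \<infinity>"
    proof -
      have top: "paths \<in> sets path_algebra" using sets.top[of path_algebra] by simp
      have "emeasure ?M paths = (\<integral>\<^sup>+\<omega>. indicator paths \<omega> \<partial>?M)"
        using top by (intro nn_integral_indicator[symmetric]) simp
      also have "\<dots> = (\<integral>\<^sup>+y. g y * (\<integral>\<^sup>+\<omega>. indicator paths \<omega> \<partial>Q x y) \<partial>m)"
        by (rule M_integral[OF borel_measurable_indicator[OF top]])
      also have "\<dots> = (\<integral>\<^sup>+y. u x y * g y \<partial>m)"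
      proof (intro nn_integral_cong)
        fix y
        have "(\<integral>\<^sup>+\<omega>. indicator paths \<omega> \<partial>Q x y) = emeasure (Q x y) paths"
          using top by (intro nn_integral_indicator) simp
        then show "g y * (\<integral>\<^sup>+\<omega>. indicator paths \<omega> \<partial>Q x y) = u x y * g y"
          by (simp only: emeasure_Q_paths mult.commute)
      qed
      finally show ?thesis using fin by simp
    qed
    show "AE \<omega> in N. 0 < lifetime \<omega>"
    proof (rule AE_alive_from_integral)
      have S: "{\<omega> \<in> space path_algebra. lifetime \<omega> = 0} \<in> sets path_algebra" by measurable
      have "(\<integral>\<^sup>+\<omega>. indicator {\<omega> \<in> space path_algebra. lifetime \<omega> = 0} \<omega> \<partial>N) =
          (\<integral>\<^sup>+\<omega>. (\<integral>\<^sup>+t\<in>{0..}. extend_zero g (\<omega> t) * indicator {\<omega> \<in> space path_algebra. lifetime \<omega> = 0} (killing t \<omega>) \<partial>lborel) \<partial>P x)"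
        by (rule N_integral[OF borel_measurable_indicator[OF S]])
      also have "\<dots> = 0"
      proof (rule nn_integral_zero', use P_start[of x] AE_P_paths[of x] in eventually_elim)
        case (elim \<omega>)
        have alive: "0 < lifetime \<omega>" using lifetime_greater_iff[OF elim(2), of 0] elim(1) by simp
        show ?case
        proof (rule nn_integral_zero', use AE_lborel_singleton[of 0] in eventually_elim)
          case (elim t)
          show ?case
          proof (cases "0 < t")
            case True
            then have "0 < lifetime (killing t \<omega>)" using alive \<open>\<omega> \<in> paths\<close> by (simp add: lifetime_killing)
            then show ?thesis by (auto simp: indicator_def)
          qed (use elim in simp)
        qed
      qed
      finally show "(\<integral>\<^sup>+\<omega>. indicator {\<omega> \<in> space path_algebra. lifetime \<omega> = 0} \<omega> \<partial>N) = 0" .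
    qed simp
    fix s :: real and A :: "'a path set" assume s: "0 \<le> s" and A: "A \<in> sets (path_filtration s)"
    let ?B = "{\<omega> \<in> A. ennreal s < lifetime \<omega>}"
    have B: "?B \<in> sets path_algebra" using path_filtration_alive[OF s A] path_filtration_subset[OF s] by auto
    note [measurable] = coordinate_algebra[OF s]
    have [measurable]: "A \<in> sets path_algebra" using A path_filtration_subset[OF s] by auto
    have "emeasure N ?B = (\<integral>\<^sup>+\<omega>. indicator ?B \<omega> \<partial>N)" using B by simp
    also have "\<dots> = (\<integral>\<^sup>+\<omega>. (\<integral>\<^sup>+t\<in>{0..}. extend_zero g (\<omega> t) * indicator ?B (killing t \<omega>) \<partial>lborel) \<partial>P x)"
      by (rule N_integral[OF borel_measurable_indicator[OF B]])
    also have "\<dots> = (\<integral>\<^sup>+\<omega>. indicator A \<omega> * (indicator {\<omega>. ennreal s < lifetime \<omega>} \<omega> * total_occupation g (shift s \<omega>)) \<partial>P x)"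
    proof (intro nn_integral_cong)
      fix \<omega> assume "\<omega> \<in> space (P x)"
      then have \<omega>: "\<omega> \<in> paths" by simp
      have "extend_zero g (\<omega> t) * indicator ?B (killing t \<omega>) * indicator {0..} t =
          indicator ?B \<omega> * (extend_zero g (\<omega> t) * indicator {s<..} t)" for t
        using killing_in_alive_event[OF A \<omega> s, of t] s by (cases "0 \<le> t") (auto simp: indicator_def)
      then have "(\<integral>\<^sup>+t\<in>{0..}. extend_zero g (\<omega> t) * indicator ?B (killing t \<omega>) \<partial>lborel) =
          indicator ?B \<omega> * (\<integral>\<^sup>+t\<in>{s<..}. extend_zero g (\<omega> t) \<partial>lborel)"
      proof -
        assume eq: "\<And>t. extend_zero g (\<omega> t) * indicator ?B (killing t \<omega>) * indicator {0..} t =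
          indicator ?B \<omega> * (extend_zero g (\<omega> t) * indicator {s<..} t)"
        have "{s<..} \<subseteq> {0..}" using s by auto
        then show ?thesis unfolding eq
          using path_section_measurable_indicator[OF g \<omega>, of "{s<..}"] by (intro nn_integral_cmult) auto
      qed
      then show "(\<integral>\<^sup>+t\<in>{0..}. extend_zero g (\<omega> t) * indicator ?B (killing t \<omega>) \<partial>lborel) =
          indicator A \<omega> * (indicator {\<omega>. ennreal s < lifetime \<omega>} \<omega> * total_occupation g (shift s \<omega>))"
      proof -
        assume eq: "(\<integral>\<^sup>+t\<in>{0..}. extend_zero g (\<omega> t) * indicator ?B (killing t \<omega>) \<partial>lborel) =
          indicator ?B \<omega> * (\<integral>\<^sup>+t\<in>{s<..}. extend_zero g (\<omega> t) \<partial>lborel)"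
        have "indicator ?B \<omega> = indicator A \<omega> * (indicator {\<omega>. ennreal s < lifetime \<omega>} \<omega> :: ennreal)"
          by (auto simp: indicator_def)
        then show ?thesis unfolding eq occupation_after[OF g \<omega> s] by (simp only: mult.assoc)
      qed
    qed
    also have "\<dots> = (\<integral>\<^sup>+\<omega>. indicator A \<omega> * extend_zero (\<lambda>v. \<integral>\<^sup>+y. u v y * g y \<partial>m) (\<omega> s) \<partial>P x)"
      by (rule expected_total_occupation_alive[OF s A g])
    \<comment> \<open>The potential of \<open>g\<close> is opened into an integral over end points,
      which is then interchanged with \<open>P x\<close> to reach the formula for
      \<open>Q x y\<close>.\<close>
    also have "\<dots> = (\<integral>\<^sup>+\<omega>. \<integral>\<^sup>+y. indicator A \<omega> * (extend_zero (\<lambda>v. u v y) (\<omega> s) * g y) \<partial>m \<partial>P x)"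
    proof (intro nn_integral_cong)
      fix \<omega>
      show "indicator A \<omega> * extend_zero (\<lambda>v. \<integral>\<^sup>+y. u v y * g y \<partial>m) (\<omega> s) =
          (\<integral>\<^sup>+y. indicator A \<omega> * (extend_zero (\<lambda>v. u v y) (\<omega> s) * g y) \<partial>m)"
        by (cases "\<omega> s") (simp_all add: nn_integral_cmult)
    qed
    also have "\<dots> = (\<integral>\<^sup>+y. \<integral>\<^sup>+\<omega>. indicator A \<omega> * (extend_zero (\<lambda>v. u v y) (\<omega> s) * g y) \<partial>P x \<partial>m)"
    proof -
      interpret pp: pair_sigma_finite m "P x" by standard
      have [measurable]: "(\<lambda>z. extend_zero (\<lambda>v. u v (fst z)) (snd z s)) \<in> borel_measurable (m \<Otimes>\<^sub>M P x)"
      proof (rule extend_zero_parametric_measurable)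
        show "(\<lambda>z. snd z s) \<in> m \<Otimes>\<^sub>M P x \<rightarrow>\<^sub>M cemetery_borel" by measurable
        show "(\<lambda>z. u (snd z) (fst (fst z))) \<in> borel_measurable ((m \<Otimes>\<^sub>M P x) \<Otimes>\<^sub>M borel)"
        proof (rule u_measurable)
          show "snd \<in> borel_measurable ((m \<Otimes>\<^sub>M P x) \<Otimes>\<^sub>M borel)" by measurable
          have "fst \<in> m \<Otimes>\<^sub>M P x \<rightarrow>\<^sub>M borel" using measurable_fst[of m "P x"] by (simp only: measurable_m)
          then show "(\<lambda>z. fst (fst z)) \<in> borel_measurable ((m \<Otimes>\<^sub>M P x) \<Otimes>\<^sub>M borel)" by measurable
        qed
      qed
      show ?thesis by (rule pp.Fubini') (simp add: case_prod_beta')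
    qed
    also have "\<dots> = (\<integral>\<^sup>+y. g y * emeasure (Q x y) ?B \<partial>m)"
    proof (intro nn_integral_cong)
      fix y
      have "(\<integral>\<^sup>+\<omega>. indicator A \<omega> * (extend_zero (\<lambda>v. u v y) (\<omega> s) * g y) \<partial>P x) =
          (\<integral>\<^sup>+\<omega>. g y * (indicator A \<omega> * extend_zero (\<lambda>v. u v y) (\<omega> s)) \<partial>P x)"
        by (simp add: mult_ac)
      also have "\<dots> = g y * (\<integral>\<^sup>+\<omega>. indicator A \<omega> * extend_zero (\<lambda>v. u v y) (\<omega> s) \<partial>P x)"
        by (rule nn_integral_cmult) measurable
      finally show "(\<integral>\<^sup>+\<omega>. indicator A \<omega> * (extend_zero (\<lambda>v. u v y) (\<omega> s) * g y) \<partial>P x) = g y * emeasure (Q x y) ?B"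
        by (simp add: Q_alive_event[OF s A])
    qed
    also have "\<dots> = (\<integral>\<^sup>+y. g y * (\<integral>\<^sup>+\<omega>. indicator ?B \<omega> \<partial>Q x y) \<partial>m)" using B by simp
    also have "\<dots> = (\<integral>\<^sup>+\<omega>. indicator ?B \<omega> \<partial>?M)" by (rule M_integral[OF borel_measurable_indicator[OF B], symmetric])
    also have "\<dots> = emeasure ?M ?B" using B by simp
    finally show "emeasure ?M ?B = emeasure N ?B" by simp
  qed auto
  then show ?thesis using M_integral[OF H] N_integral[OF H] by simp
qed

text \<open>The integrable case and monotone convergence; finite values of \<open>g\<close> and of
  \<open>u\<close> allow an exhaustion by sets on which both are bounded.\<close>

theorem Q_disintegration:
  assumes g [measurable]: "g \<in> borel_measurable borel" and fin: "\<And>y. g y < top"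
    and H [measurable]: "H \<in> borel_measurable path_algebra"
  shows "(\<integral>\<^sup>+y. g y * (\<integral>\<^sup>+\<omega>. H \<omega> \<partial>Q x y) \<partial>m) =
    (\<integral>\<^sup>+\<omega>. (\<integral>\<^sup>+t\<in>{0..}. extend_zero g (\<omega> t) * H (killing t \<omega>) \<partial>lborel) \<partial>P x)"
proof -
  obtain D where D: "range D \<subseteq> sets m" "(\<Union>i. D i) = space m" "\<And>i. emeasure m (D i) \<noteq> \<infinity>" "incseq D"
    using sigma_finite_incseq by blast
  have [measurable]: "D n \<in> sets borel" for n using D(1) sets_m by auto
  \<comment> \<open>On \<open>C n\<close> the functions \<open>u x\<close> and \<open>g\<close> are
    at most \<open>n\<close> and the reference measure is finite, so the truncated integral is at
    most \<open>n * n\<close> times a finite mass.\<close>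
  define C where "C n = {y \<in> D n. u x y \<le> of_nat n \<and> g y \<le> of_nat n}" for n
  have [measurable]: "C n \<in> sets borel" for n
  proof -
    have "{y \<in> space borel. y \<in> D n \<and> u x y \<le> of_nat n \<and> g y \<le> of_nat n} \<in> sets borel" by measurable
    then show ?thesis by (simp add: C_def)
  qed
  have C_mono: "C n \<subseteq> C (Suc n)" for n
  proof -
    have "(of_nat n :: ennreal) \<le> of_nat (Suc n)" by simp
    then show ?thesis using incseq_SucD[OF D(4), of n] unfolding C_def by (auto intro: order_trans)
  qed
  have C_UN: "\<exists>n. y \<in> C n" for y
  proof -
    obtain n1 where n1: "y \<in> D n1" using D(2) by auto
    obtain n2 where n2: "u x y < of_nat n2" using ennreal_Ex_less_of_nat u_finite[of x y] by auto
    obtain n3 where n3: "g y < of_nat n3" using ennreal_Ex_less_of_nat fin[of y] by auto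
    let ?n = "max n1 (max n2 n3)"
    have "(of_nat n2 :: ennreal) \<le> of_nat ?n" "(of_nat n3 :: ennreal) \<le> of_nat ?n" by simp_all
    moreover have "y \<in> D ?n" using n1 incseqD[OF D(4), of n1 ?n] by auto
    ultimately have "y \<in> C ?n" unfolding C_def using n2 n3 by (auto intro: order_trans less_imp_le)
    then show ?thesis ..
  qed
  define G where "G n y = g y * indicator (C n) y" for n y
  have [measurable]: "G n \<in> borel_measurable borel" for n unfolding G_def by measurable
  have G_mono: "G n y \<le> G (Suc n) y" for n y using C_mono[of n] by (auto simp: G_def indicator_def)
  have G_SUP: "(SUP n. G n y) = g y" for y
  proof -
    obtain n where "y \<in> C n" using C_UN by blast
    then show ?thesis unfolding G_def
      by (intro antisym SUP_least SUP_upper2[of n]) (auto simp: indicator_def)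
  qed
  have G_fin: "(\<integral>\<^sup>+y. u x y * G n y \<partial>m) \<noteq> \<infinity>" for n
  proof -
    have "(\<integral>\<^sup>+y. u x y * G n y \<partial>m) \<le> (\<integral>\<^sup>+y. of_nat n * of_nat n * indicator (D n) y \<partial>m)"
      by (intro nn_integral_mono) (auto simp: G_def C_def indicator_def intro!: mult_mono)
    also have "\<dots> = of_nat n * of_nat n * emeasure m (D n)" using D(1) by (intro nn_integral_cmult_indicator) auto
    also have "\<dots> < \<infinity>" using D(3)[of n] by (simp add: less_top[symmetric] ennreal_mult_eq_top_iff)
    finally show ?thesis by simp
  qed
  have eq: "(\<integral>\<^sup>+y. G n y * (\<integral>\<^sup>+\<omega>. H \<omega> \<partial>Q x y) \<partial>m) =
    (\<integral>\<^sup>+\<omega>. (\<integral>\<^sup>+t\<in>{0..}. extend_zero (G n) (\<omega> t) * H (killing t \<omega>) \<partial>lborel) \<partial>P x)" for n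
    by (rule Q_disintegration_finite[OF _ G_fin H]) measurable
  note [measurable] = Q_section_measurable(1)[OF H, of x]
  have "(\<integral>\<^sup>+y. g y * (\<integral>\<^sup>+\<omega>. H \<omega> \<partial>Q x y) \<partial>m) = (\<integral>\<^sup>+y. (SUP n. G n y * (\<integral>\<^sup>+\<omega>. H \<omega> \<partial>Q x y)) \<partial>m)"
    by (simp add: SUP_mult_right_ennreal[symmetric] G_SUP)
  also have "\<dots> = (SUP n. \<integral>\<^sup>+y. G n y * (\<integral>\<^sup>+\<omega>. H \<omega> \<partial>Q x y) \<partial>m)"
    using G_mono by (intro nn_integral_monotone_convergence_SUP) (auto simp: incseq_Suc_iff le_fun_def intro!: mult_right_mono)
  also have "\<dots> = (SUP n. \<integral>\<^sup>+\<omega>. (\<integral>\<^sup>+t\<in>{0..}. extend_zero (G n) (\<omega> t) * H (killing t \<omega>) \<partial>lborel) \<partial>P x)"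
    by (simp add: eq)
  also have "\<dots> = (\<integral>\<^sup>+\<omega>. (\<integral>\<^sup>+t\<in>{0..}. extend_zero g (\<omega> t) * H (killing t \<omega>) \<partial>lborel) \<partial>P x)"
  proof -
    let ?I = "\<lambda>g \<omega> t. extend_zero g (\<omega> (max 0 t)) * H (killing t \<omega>) * indicator {0..} t"
    have conv: "(\<integral>\<^sup>+t\<in>{0..}. extend_zero g (\<omega> t) * H (killing t \<omega>) \<partial>lborel) = (\<integral>\<^sup>+t. ?I g \<omega> t \<partial>lborel)" for g \<omega>
      by (intro nn_integral_cong) (auto simp: indicator_def)
    have joint: "(\<lambda>z. ?I g (fst z) (snd z)) \<in> borel_measurable (P x \<Otimes>\<^sub>M lborel)"
      if [measurable]: "g \<in> borel_measurable borel" for g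
    proof -
      have fst_meas: "fst \<in> P x \<Otimes>\<^sub>M lborel \<rightarrow>\<^sub>M path_algebra" by measurable
      have [measurable]: "(\<lambda>z. fst z (max 0 (snd z))) \<in> P x \<Otimes>\<^sub>M lborel \<rightarrow>\<^sub>M cemetery_borel"
        by (rule coordinate_at_measurable[OF _ fst_meas]) auto
      have [measurable]: "(\<lambda>z. killing (snd z) (fst z)) \<in> P x \<Otimes>\<^sub>M lborel \<rightarrow>\<^sub>M path_algebra"
        by (rule killing_measurable[OF _ fst_meas]) measurable
      show ?thesis by measurable
    qed
    have ext_mono: "extend_zero (G n) z \<le> extend_zero (G (Suc n)) z" for n z using G_mono by (cases z) auto
    have ext_SUP: "extend_zero g z = (SUP n. extend_zero (G n) z)" for z using G_SUP by (cases z) auto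
    have sec: "?I (G n) \<omega> \<in> borel_measurable lborel" if "\<omega> \<in> space (P x)" for n \<omega>
      using measurable_compose[OF measurable_Pair1'[OF that] joint[of "G n"]] by simp
    have inner: "(\<integral>\<^sup>+t. ?I g \<omega> t \<partial>lborel) = (SUP n. \<integral>\<^sup>+t. ?I (G n) \<omega> t \<partial>lborel)" if "\<omega> \<in> space (P x)" for \<omega>
    proof -
      have "(\<integral>\<^sup>+t. ?I g \<omega> t \<partial>lborel) = (\<integral>\<^sup>+t. (SUP n. ?I (G n) \<omega> t) \<partial>lborel)"
        by (simp add: ext_SUP SUP_mult_right_ennreal)
      also have "\<dots> = (SUP n. \<integral>\<^sup>+t. ?I (G n) \<omega> t \<partial>lborel)"
        using ext_mono sec[OF that] by (intro nn_integral_monotone_convergence_SUP) (auto simp: incseq_Suc_iff le_fun_def intro!: mult_right_mono)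
      finally show ?thesis .
    qed
    have "(\<integral>\<^sup>+\<omega>. (\<integral>\<^sup>+t. ?I g \<omega> t \<partial>lborel) \<partial>P x) = (\<integral>\<^sup>+\<omega>. (SUP n. \<integral>\<^sup>+t. ?I (G n) \<omega> t \<partial>lborel) \<partial>P x)"
      by (intro nn_integral_cong inner)
    also have "\<dots> = (SUP n. \<integral>\<^sup>+\<omega>. (\<integral>\<^sup>+t. ?I (G n) \<omega> t \<partial>lborel) \<partial>P x)"
    proof (rule nn_integral_monotone_convergence_SUP)
      show "incseq (\<lambda>n \<omega>. \<integral>\<^sup>+t. ?I (G n) \<omega> t \<partial>lborel)"
        using ext_mono by (auto simp: incseq_Suc_iff le_fun_def intro!: nn_integral_mono mult_right_mono)
      show "(\<lambda>\<omega>. \<integral>\<^sup>+t. ?I (G n) \<omega> t \<partial>lborel) \<in> borel_measurable (P x)" for n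
        using lborel.borel_measurable_nn_integral_fst[OF joint[of "G n"]] by simp
    qed
    finally show ?thesis by (simp add: conv)
  qed
  finally show ?thesis .
qed

end

section \<open>Exponential functionals of the local times\<close>

text \<open>The function \<open>exp (- a)\<close> on extended nonnegative numbers, with limit value
  \<open>0\<close> at \<open>top\<close>. Products, limits and integrals then need no prior
  finiteness of local times.\<close>

definition nexp :: "ennreal \<Rightarrow> ennreal" where
  "nexp a = (if a = top then 0 else ennreal (exp (- enn2real a)))"

lemma nexp_ennreal: "0 \<le> r \<Longrightarrow> nexp (ennreal r) = ennreal (exp (- r))"
  by (simp add: nexp_def)

lemma nexp_top [simp]: "nexp top = 0" by (simp add: nexp_def)

lemma nexp_0 [simp]: "nexp 0 = 1" by (simp add: nexp_def)

lemma nexp_add: "nexp (a + b) = nexp a * nexp b"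
  by (cases a b rule: ennreal2_cases)
     (simp_all add: nexp_ennreal exp_diff exp_minus divide_inverse flip: ennreal_plus ennreal_mult)

lemma nexp_le_1: "nexp a \<le> 1"
  by (cases a rule: ennreal_cases) (auto simp: nexp_ennreal)

lemma nexp_measurable [measurable]: "nexp \<in> borel_measurable borel"
  unfolding nexp_def[abs_def] by measurable

context local_time_process
begin

text \<open>Finitely many coordinates suffice for laws of sequences. The rate \<open>q\<close> on
  the lifetime is auxiliary: integrated over \<open>q\<close>, it produces the factor
  \<open>1 / t\<close> of the loop measure.\<close>

definition weight :: "(nat \<Rightarrow> real) \<Rightarrow> (nat \<Rightarrow> 'a) \<Rightarrow> nat \<Rightarrow> real \<Rightarrow> 'a path \<Rightarrow> ennreal" where
  "weight lam xs n q \<omega> = nexp ((\<Sum>j<n. ennreal (lam j) * L_infinity (xs j) \<omega>) + ennreal q * lifetime \<omega>)"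

lemma weight_measurable [measurable]: "weight lam xs n q \<in> borel_measurable path_algebra"
  unfolding weight_def[abs_def] by measurable

lemma weight_le_1: "weight lam xs n q \<omega> \<le> 1"
  unfolding weight_def by (rule nexp_le_1)

text \<open>Local times and the lifetime are additive when a path is cut at \<open>\<sigma>\<close>,
  so the exponential of their combination is multiplicative.\<close>

lemma weight_killing_shift:
  assumes \<omega>: "\<omega> \<in> paths" "\<And>j. j < n \<Longrightarrow> \<omega> \<in> good (xs j)" and \<sigma>: "0 < \<sigma>" "ennreal \<sigma> < lifetime \<omega>"
    and shift: "\<And>j. j < n \<Longrightarrow> shift \<sigma> \<omega> \<in> good (xs j)" and t: "0 < t"
  shows "weight lam xs n q (killing (\<sigma> + t) \<omega>) = weight lam xs n q (killing \<sigma> \<omega>) * weight lam xs n q (killing t (shift \<sigma> \<omega>))"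
proof -
  note sh = shift_in_paths[OF \<omega>(1), of \<sigma>]
  have "L_infinity (xs j) (killing (\<sigma> + t) \<omega>) = L_infinity (xs j) (killing \<sigma> \<omega>) + L_infinity (xs j) (killing t (shift \<sigma> \<omega>))"
    if "j < n" for j
    using L_add[OF \<omega>(2)[OF that] _ shift[OF that], of t] \<sigma> t \<omega>(1) sh by (simp add: L_infinity_killing)
  moreover have "lifetime (killing (\<sigma> + t) \<omega>) = lifetime (killing \<sigma> \<omega>) + lifetime (killing t (shift \<sigma> \<omega>))"
  proof -
    have "min (ennreal \<sigma> + ennreal t) (ennreal \<sigma> + lifetime (shift \<sigma> \<omega>)) = ennreal \<sigma> + min (ennreal t) (lifetime (shift \<sigma> \<omega>))"
      by (cases "ennreal t \<le> lifetime (shift \<sigma> \<omega>)") (simp_all add: min_absorb1 min_absorb2 add_left_mono)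
    then show ?thesis
      using \<sigma> t \<omega>(1) sh lifetime_shift[OF \<omega>(1) _ \<sigma>(2)] by (simp add: lifetime_killing min_absorb1 less_imp_le)
  qed
  ultimately show ?thesis
    unfolding weight_def nexp_add[symmetric] by (simp add: distrib_left sum.distrib add_ac)
qed

text \<open>The integral of \<open>H\<close> of the killed path against the increase of the local
  time at \<open>y\<close>, written in the level variable; its expectation is an integral under
  \<open>Q\<close>.\<close>

definition kill_integral :: "'a \<Rightarrow> ('a path \<Rightarrow> ennreal) \<Rightarrow> 'a path \<Rightarrow> ennreal" where
  "kill_integral y H \<omega> = (\<integral>\<^sup>+l\<in>{0<..}. indicator {..<top} (tau y l \<omega>) * H (killing (enn2real (tau y l \<omega>)) \<omega>) \<partial>lborel)"

lemma killing_at_tau_measurable [measurable (raw)]: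
  assumes [measurable]: "X \<in> N \<rightarrow>\<^sub>M path_algebra" "l \<in> borel_measurable N"
  shows "(\<lambda>z. killing (enn2real (tau y (l z) (X z))) (X z)) \<in> N \<rightarrow>\<^sub>M path_algebra"
  by (rule killing_measurable) measurable

lemma kill_integral_measurable [measurable]:
  assumes [measurable]: "H \<in> borel_measurable path_algebra"
  shows "kill_integral y H \<in> borel_measurable path_algebra"
  unfolding kill_integral_def[abs_def] by measurable

text \<open>Only levels exceeded after \<open>\<sigma>\<close> contribute.
  \<open>tau_integral_shift\<close> moves them to the shifted path, and the weight factorises at
  \<open>\<sigma>\<close>.\<close>

lemma kill_integral_shift:
  assumes \<omega>: "\<omega> \<in> good y" "\<And>j. j < n \<Longrightarrow> \<omega> \<in> good (xs j)" and \<sigma>: "0 < \<sigma>" "ennreal \<sigma> < lifetime \<omega>"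
    and shift: "shift \<sigma> \<omega> \<in> good y" "\<And>j. j < n \<Longrightarrow> shift \<sigma> \<omega> \<in> good (xs j)"
  assumes W_def: "W = weight lam xs n q"
  shows "(\<integral>\<^sup>+l\<in>{0<..}. indicator {..<top} (tau y l \<omega>) * W (killing (enn2real (tau y l \<omega>)) \<omega>) *
      indicator {ennreal \<sigma><..} (tau y l \<omega>) \<partial>lborel) = W (killing \<sigma> \<omega>) * kill_integral y W (shift \<sigma> \<omega>)"
proof -
  have [measurable]: "W \<in> borel_measurable path_algebra" by (simp add: W_def)
  note paths = good_paths[OF \<omega>(1)] good_paths[OF shift(1)]
  have [measurable]: "(\<lambda>r. killing (enn2real r) \<omega>) \<in> borel \<rightarrow>\<^sub>M path_algebra"
    by (rule killing_measurable) (use paths in auto)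
  have const [measurable]: "(\<lambda>l. shift \<sigma> \<omega>) \<in> borel \<rightarrow>\<^sub>M path_algebra" using paths by (intro measurable_const) simp
  have "(\<integral>\<^sup>+l\<in>{0<..}. indicator {..<top} (tau y l \<omega>) * W (killing (enn2real (tau y l \<omega>)) \<omega>) *
      indicator {ennreal \<sigma><..} (tau y l \<omega>) \<partial>lborel) =
    (\<integral>\<^sup>+l\<in>{0<..}. indicator {..<top} (ennreal \<sigma> + tau y l (shift \<sigma> \<omega>)) *
      W (killing (enn2real (ennreal \<sigma> + tau y l (shift \<sigma> \<omega>))) \<omega>) \<partial>lborel)"
    by (rule tau_integral_shift[OF \<omega>(1) _ shift(1), where G="\<lambda>r. indicator {..<top} r * W (killing (enn2real r) \<omega>)"])
       (use \<sigma> in \<open>simp, measurable\<close>)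
  also have "\<dots> = (\<integral>\<^sup>+l. W (killing \<sigma> \<omega>) * (indicator {..<top} (tau y l (shift \<sigma> \<omega>)) *
      W (killing (enn2real (tau y l (shift \<sigma> \<omega>))) (shift \<sigma> \<omega>)) * indicator {0<..} l) \<partial>lborel)"
  proof (intro nn_integral_cong)
    fix l :: real
    show "indicator {..<top} (ennreal \<sigma> + tau y l (shift \<sigma> \<omega>)) *
        W (killing (enn2real (ennreal \<sigma> + tau y l (shift \<sigma> \<omega>))) \<omega>) * indicator {0<..} l =
      W (killing \<sigma> \<omega>) * (indicator {..<top} (tau y l (shift \<sigma> \<omega>)) *
        W (killing (enn2real (tau y l (shift \<sigma> \<omega>))) (shift \<sigma> \<omega>)) * indicator {0<..} l)"
    proof (cases "0 < l \<and> tau y l (shift \<sigma> \<omega>) < top")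
      case True
      then obtain t where t: "tau y l (shift \<sigma> \<omega>) = ennreal t" "0 \<le> t"
        by (cases "tau y l (shift \<sigma> \<omega>)" rule: ennreal_cases) auto
      then have "0 < t" using tau_positive[OF shift(1), of l] True by simp
      then have "W (killing (\<sigma> + t) \<omega>) = W (killing \<sigma> \<omega>) * W (killing t (shift \<sigma> \<omega>))"
        unfolding W_def by (intro weight_killing_shift paths \<omega> \<sigma> shift)
      then show ?thesis using True t \<sigma>(1) by (simp add: enn2real_plus)
    next
      case False
      then have "l \<le> 0 \<or> tau y l (shift \<sigma> \<omega>) = top" by (auto simp: less_top)
      then show ?thesis by (auto simp: indicator_def)
    qed
  qed
  also have "\<dots> = W (killing \<sigma> \<omega>) * kill_integral y W (shift \<sigma> \<omega>)"
    unfolding kill_integral_def by (rule nn_integral_cmult) measurable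
  finally show ?thesis .
qed

lemma AE_good_all:
  fixes n :: nat
  shows "AE \<omega> in P x. \<forall>j<n. \<omega> \<in> good (xs j)"
proof -
  have "AE \<omega> in P x. \<forall>j. \<omega> \<in> good (xs j)" by (subst AE_all_countable) (intro allI AE_good)
  then show ?thesis by eventually_elim blast
qed

lemma AE_shift_good_all:
  fixes n :: nat
  assumes "optional_time T"
  shows "AE \<omega> in P x. T \<omega> < lifetime \<omega> \<longrightarrow> (\<forall>j<n. shift (enn2real (T \<omega>)) \<omega> \<in> good (xs j))"
proof -
  have "AE \<omega> in P x. \<forall>j. T \<omega> < lifetime \<omega> \<longrightarrow> shift (enn2real (T \<omega>)) \<omega> \<in> good (xs j)"
    by (subst AE_all_countable) (intro allI AE_shift_good assms)
  then show ?thesis by eventually_elim blast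
qed

text \<open>The pathwise factorisation at \<open>\<sigma> = tau x0 l'\<close>, followed by
  \<open>strong_markov_at_tau\<close>. A positive level \<open>l'\<close> makes this time positive,
  as the cut requires.\<close>

lemma expected_kill_integral_after_tau:
  fixes x0 y x :: 'a and xs :: "nat \<Rightarrow> 'a"
  assumes l': "0 < l'"
  assumes W_def: "W = weight lam xs n q"
  shows "(\<integral>\<^sup>+\<omega>. (\<integral>\<^sup>+l\<in>{0<..}. indicator {..<top} (tau y l \<omega>) * W (killing (enn2real (tau y l \<omega>)) \<omega>) *
      indicator {tau x0 l' \<omega><..} (tau y l \<omega>) \<partial>lborel) \<partial>P x) =
    (\<integral>\<^sup>+\<omega>. indicator {..<top} (tau x0 l' \<omega>) * W (killing (enn2real (tau x0 l' \<omega>)) \<omega>) \<partial>P x) *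
    (\<integral>\<^sup>+\<omega>. kill_integral y W \<omega> \<partial>P x0)"
proof -
  have [measurable]: "W \<in> borel_measurable path_algebra" by (simp add: W_def)
  have "(\<integral>\<^sup>+\<omega>. (\<integral>\<^sup>+l\<in>{0<..}. indicator {..<top} (tau y l \<omega>) * W (killing (enn2real (tau y l \<omega>)) \<omega>) *
      indicator {tau x0 l' \<omega><..} (tau y l \<omega>) \<partial>lborel) \<partial>P x) =
    (\<integral>\<^sup>+\<omega>. indicator {..<top} (tau x0 l' \<omega>) * (W (killing (enn2real (tau x0 l' \<omega>)) \<omega>) *
      kill_integral y W (shift (enn2real (tau x0 l' \<omega>)) \<omega>)) \<partial>P x)"
  proof (rule nn_integral_cong_AE, use AE_good[of y x] AE_good[of x0 x] AE_good_all[where x=x and n=n and xs=xs]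
      AE_shift_good[OF tau_optional[of x0 l'], of y x] AE_shift_good_all[OF tau_optional[of x0 l'], where x=x and n=n and xs=xs] in eventually_elim)
    case (elim \<omega>)
    show ?case
    proof (cases "tau x0 l' \<omega> < top")
      case True
      define \<sigma> where "\<sigma> = enn2real (tau x0 l' \<omega>)"
      have \<sigma>: "tau x0 l' \<omega> = ennreal \<sigma>" using True by (simp add: \<sigma>_def ennreal_enn2real)
      have alive: "ennreal \<sigma> < lifetime \<omega>" using tau_alive[OF elim(2) True] \<sigma> by simp
      have "0 < \<sigma>" using tau_positive[OF elim(2) l'] \<sigma> by simp
      have "shift \<sigma> \<omega> \<in> good y" "\<forall>j<n. shift \<sigma> \<omega> \<in> good (xs j)"
        unfolding \<sigma>_def using elim(4,5) tau_alive[OF elim(2) True] by blast+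
      then have "(\<integral>\<^sup>+l\<in>{0<..}. indicator {..<top} (tau y l \<omega>) * W (killing (enn2real (tau y l \<omega>)) \<omega>) *
          indicator {ennreal \<sigma><..} (tau y l \<omega>) \<partial>lborel) = W (killing \<sigma> \<omega>) * kill_integral y W (shift \<sigma> \<omega>)"
        unfolding W_def using elim(3) by (intro kill_integral_shift elim(1) \<open>0 < \<sigma>\<close> alive) auto
      then show ?thesis using True \<sigma> \<open>0 < \<sigma>\<close> by simp
    next
      case False
      then have "tau x0 l' \<omega> = top" by (metis less_top)
      then show ?thesis by simp
    qed
  qed
  also have "\<dots> = (\<integral>\<^sup>+\<omega>. indicator {..<top} (tau x0 l' \<omega>) * W (killing (enn2real (tau x0 l' \<omega>)) \<omega>) \<partial>P x) *
    (\<integral>\<^sup>+\<omega>. kill_integral y W \<omega> \<partial>P x0)"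
    by (rule strong_markov_at_tau) measurable
  finally show ?thesis .
qed

end

context loop_process
begin

lemma Q_kill_integral: "H \<in> borel_measurable path_algebra \<Longrightarrow> (\<integral>\<^sup>+\<omega>. H \<omega> \<partial>Q x y) = (\<integral>\<^sup>+\<omega>. kill_integral y H \<omega> \<partial>P x)"
  unfolding kill_integral_def by (rule Q_representation)

text \<open>The local time at \<open>x0\<close> of a killed path is the length of the set of levels
  \<open>l'\<close> exceeded at \<open>x0\<close> before the killing. Exchanging the two level
  integrals makes \<open>tau x0 l'\<close> a cutting time, where the path factorises.\<close>

theorem Q_product_formula:
  fixes x0 x y :: 'a and xs :: "nat \<Rightarrow> 'a"
  assumes W_def: "W = weight lam xs n q"
  shows "(\<integral>\<^sup>+\<omega>. L_infinity x0 \<omega> * W \<omega> \<partial>Q x y) = (\<integral>\<^sup>+\<omega>. W \<omega> \<partial>Q x x0) * (\<integral>\<^sup>+\<omega>. W \<omega> \<partial>Q x0 y)"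
proof -
  have W [measurable]: "W \<in> borel_measurable path_algebra" by (simp add: W_def)
  interpret PP: prob_space "P x" by (rule P_prob)
  interpret pp: pair_sigma_finite "P x" "lborel :: real measure" by standard
  let ?F = "\<lambda>\<omega> l l'. indicator {..<top} (tau y l \<omega>) * W (killing (enn2real (tau y l \<omega>)) \<omega>) *
      indicator {tau x0 l' \<omega><..} (tau y l \<omega>) * indicator {0<..} l * indicator {0<..} l'"
  \<comment> \<open>An indicator whose set depends on the path is turned into a comparison, to which
    the measurability of \<open>tau\<close> applies.\<close>
  have ind: "indicator {tau x0 l' \<omega><..} (tau y l \<omega>) = (if tau x0 l' \<omega> < tau y l \<omega> then 1 else 0 :: ennreal)" for \<omega> l l'
    by (simp add: indicator_def)
  have "(\<integral>\<^sup>+\<omega>. L_infinity x0 \<omega> * W \<omega> \<partial>Q x y) = (\<integral>\<^sup>+\<omega>. kill_integral y (\<lambda>\<omega>. L_infinity x0 \<omega> * W \<omega>) \<omega> \<partial>P x)"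
    by (rule Q_kill_integral) measurable
  also have "\<dots> = (\<integral>\<^sup>+\<omega>. (\<integral>\<^sup>+l. \<integral>\<^sup>+l'. ?F \<omega> l l' \<partial>lborel \<partial>lborel) \<partial>P x)"
  proof (rule nn_integral_cong_AE, use AE_good[of y x] AE_good[of x0 x] in eventually_elim)
    case (elim \<omega>)
    note [measurable] = tau_section_measurable[OF good_paths[OF elim(1)]]
    show ?case unfolding kill_integral_def
    proof (intro nn_integral_cong)
      fix l :: real
      show "indicator {..<top} (tau y l \<omega>) * (L_infinity x0 (killing (enn2real (tau y l \<omega>)) \<omega>) *
          W (killing (enn2real (tau y l \<omega>)) \<omega>)) * indicator {0<..} l = (\<integral>\<^sup>+l'. ?F \<omega> l l' \<partial>lborel)"
      proof (cases "0 < l \<and> tau y l \<omega> < top")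
        case True
        then obtain t where t: "tau y l \<omega> = ennreal t" "0 \<le> t" by (cases "tau y l \<omega>" rule: ennreal_cases) auto
        then have "0 < t" using tau_positive[OF elim(1), of l] True by simp
        have "(\<integral>\<^sup>+l'. ?F \<omega> l l' \<partial>lborel) = (\<integral>\<^sup>+l'. W (killing t \<omega>) * (indicator {..<ennreal t} (tau x0 l' \<omega>) * indicator {0<..} l') \<partial>lborel)"
          using True t by (intro nn_integral_cong) (auto simp: indicator_def)
        also have "\<dots> = W (killing t \<omega>) * (\<integral>\<^sup>+l'\<in>{0<..}. indicator {..<ennreal t} (tau x0 l' \<omega>) \<partial>lborel)"
          by (rule nn_integral_cmult) measurable
        also have "\<dots> = W (killing t \<omega>) * L x0 t \<omega>" by (simp only: tau_integral_L[OF elim(2) t(2)])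
        finally show ?thesis
          using True t L_infinity_killing[OF good_paths[OF elim(1)] \<open>0 < t\<close>] by (simp add: mult.commute)
      next
        case False
        then have "l \<le> 0 \<or> tau y l \<omega> = top" by (auto simp: less_top)
        then have "?F \<omega> l l' = 0" for l' by (auto simp: indicator_def)
        then show ?thesis using False by (auto simp: indicator_def)
      qed
    qed
  qed
  also have "\<dots> = (\<integral>\<^sup>+\<omega>. (\<integral>\<^sup>+l'. \<integral>\<^sup>+l. ?F \<omega> l l' \<partial>lborel \<partial>lborel) \<partial>P x)"
  proof (rule nn_integral_cong)
    fix \<omega> assume "\<omega> \<in> space (P x)"
    then have \<omega>: "\<omega> \<in> paths" by simp
    have [measurable]: "(\<lambda>z. \<omega>) \<in> lborel \<Otimes>\<^sub>M (lborel :: real measure) \<rightarrow>\<^sub>M path_algebra" using \<omega> by (intro measurable_const) simp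
    show "(\<integral>\<^sup>+l. \<integral>\<^sup>+l'. ?F \<omega> l l' \<partial>lborel \<partial>lborel) = (\<integral>\<^sup>+l'. \<integral>\<^sup>+l. ?F \<omega> l l' \<partial>lborel \<partial>lborel)"
      unfolding ind by (rule lborel_pair.Fubini') (simp add: case_prod_beta')
  qed
  also have "\<dots> = (\<integral>\<^sup>+l'. \<integral>\<^sup>+\<omega>. (\<integral>\<^sup>+l. ?F \<omega> l l' \<partial>lborel) \<partial>P x \<partial>lborel)"
    unfolding ind by (rule pp.Fubini'[symmetric]) (simp add: case_prod_beta')
  also have "\<dots> = (\<integral>\<^sup>+l'. (\<integral>\<^sup>+\<omega>. kill_integral y W \<omega> \<partial>P x0) *
     (\<integral>\<^sup>+\<omega>. indicator {..<top} (tau x0 l' \<omega>) * W (killing (enn2real (tau x0 l' \<omega>)) \<omega>) * indicator {0<..} l' \<partial>P x) \<partial>lborel)"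
  proof (intro nn_integral_cong)
    fix l' :: real
    show "(\<integral>\<^sup>+\<omega>. (\<integral>\<^sup>+l. ?F \<omega> l l' \<partial>lborel) \<partial>P x) = (\<integral>\<^sup>+\<omega>. kill_integral y W \<omega> \<partial>P x0) *
     (\<integral>\<^sup>+\<omega>. indicator {..<top} (tau x0 l' \<omega>) * W (killing (enn2real (tau x0 l' \<omega>)) \<omega>) * indicator {0<..} l' \<partial>P x)"
      using expected_kill_integral_after_tau[OF _ W_def, of l' x y x0]
      by (cases "0 < l'") (simp_all add: mult.commute)
  qed
  also have "\<dots> = (\<integral>\<^sup>+\<omega>. kill_integral y W \<omega> \<partial>P x0) *
     (\<integral>\<^sup>+l'. \<integral>\<^sup>+\<omega>. indicator {..<top} (tau x0 l' \<omega>) * W (killing (enn2real (tau x0 l' \<omega>)) \<omega>) * indicator {0<..} l' \<partial>P x \<partial>lborel)"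
    by (rule nn_integral_cmult) measurable
  also have "(\<integral>\<^sup>+l'. \<integral>\<^sup>+\<omega>. indicator {..<top} (tau x0 l' \<omega>) * W (killing (enn2real (tau x0 l' \<omega>)) \<omega>) * indicator {0<..} l' \<partial>P x \<partial>lborel) =
     (\<integral>\<^sup>+\<omega>. kill_integral x0 W \<omega> \<partial>P x)"
    unfolding kill_integral_def by (rule pp.Fubini') (simp add: case_prod_beta')
  finally show ?thesis by (simp add: Q_kill_integral mult.commute)
qed

text \<open>The first factor becomes a function of the end point of the second path. Disintegration
  kills the path from \<open>x0\<close> at a time \<open>t\<close> integrated over
  \<open>dt\<close>, and the Markov property continues it from there back to \<open>x0\<close>. A
  given loop arises once for each cutting time, which makes the factor
  \<open>lifetime\<close>.\<close>

theorem Q_diagonal_formula: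
  fixes x0 :: 'a and xs :: "nat \<Rightarrow> 'a"
  assumes W_def: "W = weight lam xs n q"
  shows "(\<integral>\<^sup>+x. (\<integral>\<^sup>+\<omega>. W \<omega> \<partial>Q x x0) * (\<integral>\<^sup>+\<omega>. W \<omega> \<partial>Q x0 x) \<partial>m) = (\<integral>\<^sup>+\<omega>. lifetime \<omega> * W \<omega> \<partial>Q x0 x0)"
proof -
  have W [measurable]: "W \<in> borel_measurable path_algebra" by (simp add: W_def)
  interpret PP: prob_space "P x0" by (rule P_prob)
  interpret pp: pair_sigma_finite "P x0" "lborel :: real measure" by standard
  define g where "g v = (\<integral>\<^sup>+\<omega>. kill_integral x0 W \<omega> \<partial>P v)" for v
  have g_Q: "g v = (\<integral>\<^sup>+\<omega>. W \<omega> \<partial>Q v x0)" for v by (simp add: g_def Q_kill_integral)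
  have [measurable]: "g \<in> borel_measurable borel" unfolding g_def by (rule P_integral_measurable) measurable
  have g_fin: "g v < top" for v
  proof -
    have "g v \<le> (\<integral>\<^sup>+\<omega>. 1 \<partial>Q v x0)" unfolding g_Q W_def by (intro nn_integral_mono weight_le_1)
    also have "\<dots> = u v x0" using emeasure_Q_paths[of v x0] by simp
    finally show ?thesis using u_finite[of v x0] by (simp add: le_less_trans)
  qed
  let ?T = "\<lambda>\<omega> t l. indicator {..<top} (tau x0 l \<omega>) * W (killing (enn2real (tau x0 l \<omega>)) \<omega>) *
      indicator {ennreal t<..} (tau x0 l \<omega>) * indicator {0<..} l"
  have ind: "indicator {ennreal t<..} (tau x0 l \<omega>) = (if ennreal t < tau x0 l \<omega> then 1 else 0 :: ennreal)" for \<omega> l t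
    by (simp add: indicator_def)
  have fst_meas: "fst \<in> P x0 \<Otimes>\<^sub>M lborel \<rightarrow>\<^sub>M path_algebra" by measurable
  have [measurable]: "(\<lambda>z. fst z (max 0 (snd z))) \<in> P x0 \<Otimes>\<^sub>M lborel \<rightarrow>\<^sub>M cemetery_borel"
    by (rule coordinate_at_measurable[OF _ fst_meas]) auto
  have [measurable]: "(\<lambda>z. killing (snd z) (fst z)) \<in> P x0 \<Otimes>\<^sub>M lborel \<rightarrow>\<^sub>M path_algebra"
    by (rule killing_measurable[OF _ fst_meas]) measurable
  \<comment> \<open>Gluing at a fixed time: the two weights combine into the weight of one path,
    killed at a level at \<open>x0\<close> that is exceeded after \<open>t\<close>.\<close>
  have at_t: "(\<integral>\<^sup>+\<omega>. extend_zero g (\<omega> t) * W (killing t \<omega>) \<partial>P x0) = (\<integral>\<^sup>+\<omega>. (\<integral>\<^sup>+l. ?T \<omega> t l \<partial>lborel) \<partial>P x0)" if t: "0 < t" for t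
  proof -
    have "(\<integral>\<^sup>+\<omega>. extend_zero g (\<omega> t) * W (killing t \<omega>) \<partial>P x0) =
        (\<integral>\<^sup>+\<omega>. W (killing t \<omega>) * extend_zero (\<lambda>v. \<integral>\<^sup>+\<omega>. kill_integral x0 W \<omega> \<partial>P v) (\<omega> t) \<partial>P x0)"
      by (simp add: g_def[abs_def] mult.commute)
    also have "\<dots> = (\<integral>\<^sup>+\<omega>. W (killing t \<omega>) * (indicator {\<omega>. ennreal t < lifetime \<omega>} \<omega> * kill_integral x0 W (shift t \<omega>)) \<partial>P x0)"
    proof (rule markov_nn[symmetric])
      show "(\<lambda>\<omega>. W (killing t \<omega>)) \<in> borel_measurable (path_filtration t)"
        using measurable_compose[OF killing_adapted W, of t] t by simp
    qed (use t in \<open>simp, measurable\<close>)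
    also have "\<dots> = (\<integral>\<^sup>+\<omega>. (\<integral>\<^sup>+l. ?T \<omega> t l \<partial>lborel) \<partial>P x0)"
    proof (rule nn_integral_cong_AE, use AE_good[of x0 x0] AE_good_all[where x=x0 and n=n and xs=xs]
        AE_shift_good_const[OF less_imp_le[OF t], of x0 x0]
        AE_shift_good_all[OF optional_time_const[OF less_imp_le[OF t]], where x=x0 and n=n and xs=xs] in eventually_elim)
      case (elim \<omega>)
      show ?case
      proof (cases "ennreal t < lifetime \<omega>")
        case True
        have "(\<integral>\<^sup>+l. ?T \<omega> t l \<partial>lborel) = W (killing t \<omega>) * kill_integral x0 W (shift t \<omega>)"
          unfolding W_def using elim t True by (intro kill_integral_shift) auto
        then show ?thesis using True by simp
      next
        case False
        have "?T \<omega> t l = 0" for l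
        proof (cases "tau x0 l \<omega> < top")
          case True
          then have "\<not> ennreal t < tau x0 l \<omega>" using tau_alive[OF elim(1) True] False by (auto dest: less_trans)
          then show ?thesis by simp
        qed simp
        then have "(\<integral>\<^sup>+l. ?T \<omega> t l \<partial>lborel) = 0" by (intro nn_integral_zero' AE_I2)
        then show ?thesis using False by simp
      qed
    qed
    finally show ?thesis .
  qed
  have "(\<integral>\<^sup>+x. (\<integral>\<^sup>+\<omega>. W \<omega> \<partial>Q x x0) * (\<integral>\<^sup>+\<omega>. W \<omega> \<partial>Q x0 x) \<partial>m) = (\<integral>\<^sup>+x. g x * (\<integral>\<^sup>+\<omega>. W \<omega> \<partial>Q x0 x) \<partial>m)"
    by (simp add: g_Q)
  also have "\<dots> = (\<integral>\<^sup>+\<omega>. (\<integral>\<^sup>+t\<in>{0..}. extend_zero g (\<omega> t) * W (killing t \<omega>) \<partial>lborel) \<partial>P x0)"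
    by (rule Q_disintegration) (auto simp: g_fin)
  also have "\<dots> = (\<integral>\<^sup>+\<omega>. (\<integral>\<^sup>+t. extend_zero g (\<omega> (max 0 t)) * W (killing t \<omega>) * indicator {0..} t \<partial>lborel) \<partial>P x0)"
    by (intro nn_integral_cong) (auto simp: indicator_def)
  also have "\<dots> = (\<integral>\<^sup>+t. \<integral>\<^sup>+\<omega>. extend_zero g (\<omega> (max 0 t)) * W (killing t \<omega>) * indicator {0..} t \<partial>P x0 \<partial>lborel)"
    by (rule pp.Fubini'[symmetric]) (simp add: case_prod_beta')
  also have "\<dots> = (\<integral>\<^sup>+t. \<integral>\<^sup>+\<omega>. (\<integral>\<^sup>+l. ?T \<omega> t l * indicator {0<..} t \<partial>lborel) \<partial>P x0 \<partial>lborel)"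
  proof (rule nn_integral_cong_AE, use AE_lborel_singleton[of 0] in eventually_elim)
    case (elim t)
    show ?case
    proof (cases "0 < t")
      case True
      then show ?thesis using at_t[OF True] by simp
    next
      case False
      then show ?thesis using elim by simp
    qed
  qed
  also have "\<dots> = (\<integral>\<^sup>+\<omega>. (\<integral>\<^sup>+t. \<integral>\<^sup>+l. ?T \<omega> t l * indicator {0<..} t \<partial>lborel \<partial>lborel) \<partial>P x0)"
    unfolding ind by (rule pp.Fubini') (simp add: case_prod_beta')
  also have "\<dots> = (\<integral>\<^sup>+\<omega>. (\<integral>\<^sup>+l. \<integral>\<^sup>+t. ?T \<omega> t l * indicator {0<..} t \<partial>lborel \<partial>lborel) \<partial>P x0)"
  proof (rule nn_integral_cong)
    fix \<omega> assume "\<omega> \<in> space (P x0)"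
    then have \<omega>: "\<omega> \<in> paths" by simp
    have [measurable]: "(\<lambda>z. \<omega>) \<in> lborel \<Otimes>\<^sub>M (lborel :: real measure) \<rightarrow>\<^sub>M path_algebra" using \<omega> by (intro measurable_const) simp
    show "(\<integral>\<^sup>+t. \<integral>\<^sup>+l. ?T \<omega> t l * indicator {0<..} t \<partial>lborel \<partial>lborel) = (\<integral>\<^sup>+l. \<integral>\<^sup>+t. ?T \<omega> t l * indicator {0<..} t \<partial>lborel \<partial>lborel)"
      unfolding ind by (rule lborel_pair.Fubini') (simp add: case_prod_beta')
  qed
  \<comment> \<open>For a path killed at time \<open>s\<close> the admissible cutting times fill the
    open interval from \<open>0\<close> to \<open>s\<close>, whose length is the lifetime of the
    killed path.\<close>
  also have "\<dots> = (\<integral>\<^sup>+\<omega>. kill_integral x0 (\<lambda>\<omega>. lifetime \<omega> * W \<omega>) \<omega> \<partial>P x0)"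
  proof (rule nn_integral_cong_AE, use AE_good[of x0 x0] in eventually_elim)
    case (elim \<omega>)
    show ?case unfolding kill_integral_def
    proof (intro nn_integral_cong)
      fix l :: real
      show "(\<integral>\<^sup>+t. ?T \<omega> t l * indicator {0<..} t \<partial>lborel) = indicator {..<top} (tau x0 l \<omega>) *
          (lifetime (killing (enn2real (tau x0 l \<omega>)) \<omega>) * W (killing (enn2real (tau x0 l \<omega>)) \<omega>)) * indicator {0<..} l"
      proof (cases "0 < l \<and> tau x0 l \<omega> < top")
        case True
        then obtain s where s: "tau x0 l \<omega> = ennreal s" "0 \<le> s" by (cases "tau x0 l \<omega>" rule: ennreal_cases) auto
        have "lifetime (killing s \<omega>) = ennreal s"
          using tau_alive[OF elim, of l] s True good_paths[OF elim] by (simp add: lifetime_killing min_absorb1 less_imp_le)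
        moreover have "(\<integral>\<^sup>+t. ?T \<omega> t l * indicator {0<..} t \<partial>lborel) = (\<integral>\<^sup>+t. W (killing s \<omega>) * indicator {0<..<s} t \<partial>lborel)"
          using True s by (intro nn_integral_cong) (auto simp: indicator_def ennreal_less_iff)
        moreover have "\<dots> = W (killing s \<omega>) * ennreal s" using s by (simp add: nn_integral_cmult_indicator)
        ultimately show ?thesis using True s by (simp add: mult.commute)
      next
        case False
        then have "l \<le> 0 \<or> tau x0 l \<omega> = top" by (auto simp: less_top)
        then show ?thesis by (auto simp: indicator_def)
      qed
    qed
  qed
  also have "\<dots> = (\<integral>\<^sup>+\<omega>. lifetime \<omega> * W \<omega> \<partial>Q x0 x0)" by (rule Q_kill_integral[symmetric]) measurable
  finally show ?thesis .
qed

end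

section \<open>The loop measure\<close>

text \<open>The exponential density with rate \<open>t\<close>, in the variable \<open>q\<close>,
  has total mass one.\<close>

lemma nn_integral_exp_times:
  assumes "0 < t" shows "(\<integral>\<^sup>+q\<in>{0<..}. ennreal t * ennreal (exp (- (q * t))) \<partial>lborel) = 1"
proof -
  interpret E: prob_space "density lborel (exponential_density t)"
    by (rule prob_space_exponential_density[OF assms])
  have "1 = (\<integral>\<^sup>+q. ennreal (exponential_density t q) \<partial>lborel)"
    using E.emeasure_space_1 by (subst (asm) emeasure_density) auto
  also have "\<dots> = (\<integral>\<^sup>+q\<in>{0<..}. ennreal t * ennreal (exp (- (q * t))) \<partial>lborel)"
  proof (rule nn_integral_cong_AE)
    show "AE q in lborel. ennreal (exponential_density t q) = ennreal t * ennreal (exp (- (q * t))) * indicator {0<..} q"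
      using AE_lborel_singleton[of 0]
    proof eventually_elim
      fix q :: real assume "q \<noteq> 0"
      then show "ennreal (exponential_density t q) = ennreal t * ennreal (exp (- (q * t))) * indicator {0<..} q"
        using assms by (auto simp: exponential_density_def indicator_def ennreal_mult')
    qed
  qed
  finally show ?thesis by simp
qed

lemma nn_integral_exp:
  assumes "0 < t" shows "(\<integral>\<^sup>+q\<in>{0<..}. ennreal (exp (- (q * t))) \<partial>lborel) = ennreal (1 / t)"
proof -
  have "ennreal t * (\<integral>\<^sup>+q\<in>{0<..}. ennreal (exp (- (q * t))) \<partial>lborel) = 1"
    using nn_integral_exp_times[OF assms] by (simp add: mult.assoc nn_integral_cmult)
  then have "ennreal (1 / t) * (ennreal t * (\<integral>\<^sup>+q\<in>{0<..}. ennreal (exp (- (q * t))) \<partial>lborel)) = ennreal (1 / t)" by simp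
  moreover have "ennreal (1 / t) * ennreal t = 1" using assms by (simp flip: ennreal_mult)
  ultimately show ?thesis by (simp add: mult.assoc[symmetric])
qed

section \<open>The loop measure as a mixture of killed bridges\<close>

context loop_process
begin

lemma weight_split: "weight lam xs n q \<omega> = weight lam xs n 0 \<omega> * nexp (ennreal q * lifetime \<omega>)"
  by (simp add: weight_def nexp_add)

text \<open>\<open>Q\<close> is a mixture of bridges, and a bridge of length \<open>t\<close> lives
  exactly for time \<open>t\<close>.\<close>

lemma AE_Q_lifetime_finite: "AE \<omega> in Q x y. lifetime \<omega> < top"
proof -
  have S: "{\<omega> \<in> space path_algebra. lifetime \<omega> = top} \<in> sets path_algebra" by measurable
  have "(\<integral>\<^sup>+\<omega>. indicator {\<omega> \<in> space path_algebra. lifetime \<omega> = top} \<omega> \<partial>Q x y) =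
      (\<integral>\<^sup>+t. \<integral>\<^sup>+\<omega>. indicator {\<omega> \<in> space path_algebra. lifetime \<omega> = top} \<omega> \<partial>bridge_kill t x y \<partial>lborel)"
    by (rule Q_integral_bridge[OF borel_measurable_indicator[OF S]])
  also have "\<dots> = (\<integral>\<^sup>+(t::real). 0 \<partial>lborel)"
  proof (intro nn_integral_cong nn_integral_zero')
    show "AE \<omega> in bridge_kill t x y. indicator {\<omega> \<in> space path_algebra. lifetime \<omega> = top} \<omega> = (0::ennreal)" for t
      using AE_bridge_kill_lifetime[of t x y] by eventually_elim (simp add: indicator_def)
  qed
  finally have zero: "(\<integral>\<^sup>+\<omega>. indicator {\<omega> \<in> space path_algebra. lifetime \<omega> = top} \<omega> \<partial>Q x y) = 0" by simp
  have "AE \<omega> in Q x y. indicator {\<omega> \<in> space path_algebra. lifetime \<omega> = top} \<omega> = (0 :: ennreal)"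
    by (rule nn_integral_0_iff_AE[THEN iffD1, OF _ zero]) (use S in measurable)
  then show ?thesis using AE_space[of "Q x y"]
    by eventually_elim (auto simp: indicator_def less_top split: if_splits)
qed

definition loop_intensity :: "(real \<times> 'a) measure" where
  "loop_intensity = density (lborel \<Otimes>\<^sub>M m) (\<lambda>z. ennreal (1 / fst z) * indicator {0<..} (fst z))"

lemma bridge_kill_diagonal_measurable:
  assumes H: "H \<in> borel_measurable path_algebra"
  shows "(\<lambda>z. \<integral>\<^sup>+\<omega>. H \<omega> \<partial>bridge_kill (fst z) (snd z) (snd z)) \<in> borel_measurable (lborel \<Otimes>\<^sub>M m)"
proof (rule bridge_kill_integral_measurable[OF H])
  show "snd \<in> borel_measurable ((lborel :: real measure) \<Otimes>\<^sub>M m)"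
    using measurable_snd[of "lborel :: real measure" m] by (simp only: measurable_m)
  then show "snd \<in> borel_measurable ((lborel :: real measure) \<Otimes>\<^sub>M m)" .
qed measurable

lemma loop_intensity_kernel_measurable:
  assumes B: "B \<in> sets path_algebra"
  shows "(\<lambda>z. emeasure (bridge_kill (fst z) (snd z) (snd z)) B) \<in> borel_measurable loop_intensity"
  using bridge_kill_diagonal_measurable[OF borel_measurable_indicator[OF B]] B
  by (simp add: loop_intensity_def)

text \<open>In this form the loop measure inherits countable additivity and its integration formula
  from the jointly measurable kernel \<open>bridge_kill\<close>.\<close>

theorem loop_measure_eq: "loop_measure m Qb = mixture loop_intensity (\<lambda>z. bridge_kill (fst z) (snd z) (snd z))"
  unfolding loop_measure_def mixture_def
proof (rule measure_of_eq)
  show "sets path_algebra \<subseteq> Pow paths" using sets.space_closed[of path_algebra] by simp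
  fix B :: "'a path set" assume "B \<in> sigma_sets paths (sets path_algebra)"
  then have B: "B \<in> sets path_algebra" using sets.sigma_sets_eq[of "path_algebra :: 'a path measure"] by simp
  note meas = bridge_kill_diagonal_measurable[OF borel_measurable_indicator[OF B]]
  have meas' [measurable]: "(\<lambda>z. emeasure (bridge_kill (fst z) (snd z) (snd z)) B) \<in> borel_measurable (lborel \<Otimes>\<^sub>M m)"
    using meas B by simp
  have "(\<integral>\<^sup>+z. emeasure (bridge_kill (fst z) (snd z) (snd z)) B \<partial>loop_intensity) =
      (\<integral>\<^sup>+z. ennreal (1 / fst z) * indicator {0<..} (fst z) * emeasure (bridge_kill (fst z) (snd z) (snd z)) B \<partial>(lborel \<Otimes>\<^sub>M m))"
    unfolding loop_intensity_def by (rule nn_integral_density) measurable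
  also have "\<dots> = (\<integral>\<^sup>+t. \<integral>\<^sup>+x. ennreal (1 / t) * indicator {0<..} t * emeasure (bridge_kill t x x) B \<partial>m \<partial>lborel)"
    by (subst nn_integral_fst[symmetric]) simp_all
  also have "\<dots> = (\<integral>\<^sup>+t\<in>{0<..}. ennreal (1 / t) * (\<integral>\<^sup>+x. emeasure (Qb t x x) (killing t -` B \<inter> paths) \<partial>m) \<partial>lborel)"
  proof (intro nn_integral_cong)
    fix t :: real
    have sec: "(\<lambda>x. emeasure (bridge_kill t x x) B) \<in> borel_measurable m"
      using measurable_compose[OF measurable_Pair1' meas', of t] by simp
    show "(\<integral>\<^sup>+x. ennreal (1 / t) * indicator {0<..} t * emeasure (bridge_kill t x x) B \<partial>m) =
        ennreal (1 / t) * (\<integral>\<^sup>+x. emeasure (Qb t x x) (killing t -` B \<inter> paths) \<partial>m) * indicator {0<..} t"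
    proof (cases "0 < t")
      case True
      have "emeasure (bridge_kill t x x) B = emeasure (Qb t x x) (killing t -` B \<inter> paths)" for x
        using True emeasure_distr[OF killing_measurable_Qb[OF True] B, of x x] by (simp add: bridge_kill_def space_Qb)
      then show ?thesis using True sec by (simp add: nn_integral_cmult)
    qed simp
  qed
  finally show "(\<integral>\<^sup>+t\<in>{0<..}. ennreal (1 / t) * (\<integral>\<^sup>+x. emeasure (Qb t x x) (killing t -` B \<inter> paths) \<partial>m) \<partial>lborel) =
      (\<integral>\<^sup>+z. emeasure (bridge_kill (fst z) (snd z) (snd z)) B \<partial>loop_intensity)" by simp
qed

lemma sets_loop_measure [measurable_cong, simp]: "sets (loop_measure m Qb) = sets path_algebra"
  unfolding loop_measure_eq by simp

lemma loop_measure_integral: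
  assumes H: "H \<in> borel_measurable path_algebra"
  shows "(\<integral>\<^sup>+\<omega>. H \<omega> \<partial>loop_measure m Qb) = (\<integral>\<^sup>+z. ennreal (1 / fst z) * indicator {0<..} (fst z) *
    (\<integral>\<^sup>+\<omega>. H \<omega> \<partial>bridge_kill (fst z) (snd z) (snd z)) \<partial>(lborel \<Otimes>\<^sub>M m))"
proof -
  note [measurable] = bridge_kill_diagonal_measurable[OF H]
  have "(\<integral>\<^sup>+\<omega>. H \<omega> \<partial>loop_measure m Qb) = (\<integral>\<^sup>+z. (\<integral>\<^sup>+\<omega>. H \<omega> \<partial>bridge_kill (fst z) (snd z) (snd z)) \<partial>loop_intensity)"
    unfolding loop_measure_eq by (rule nn_integral_mixture[OF _ loop_intensity_kernel_measurable H]) simp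
  also have "\<dots> = (\<integral>\<^sup>+z. ennreal (1 / fst z) * indicator {0<..} (fst z) *
    (\<integral>\<^sup>+\<omega>. H \<omega> \<partial>bridge_kill (fst z) (snd z) (snd z)) \<partial>(lborel \<Otimes>\<^sub>M m))"
    unfolding loop_intensity_def by (rule nn_integral_density) measurable
  finally show ?thesis .
qed

text \<open>
  The factor \<open>1 / t\<close> is written as \<open>\<integral>\<^sub>0\<^sup>\<infinity> exp (- q t) dq\<close>; for fixed \<open>q\<close> the product formula and the
  semigroup property turn the integral over all base points into one loop rooted at \<open>x0\<close>, weighted by
  its length.
\<close>

theorem loop_measure_local_time:
  "(\<integral>\<^sup>+\<omega>. L_infinity x0 \<omega> * weight lam xs n 0 \<omega> \<partial>loop_measure m Qb) = (\<integral>\<^sup>+\<omega>. weight lam xs n 0 \<omega> \<partial>Q x0 x0)"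
proof -
  let ?H = "\<lambda>q \<omega>. L_infinity x0 \<omega> * weight lam xs n q \<omega>"
  have H [measurable]: "?H q \<in> borel_measurable path_algebra" for q by measurable
  define h where "h z = (\<integral>\<^sup>+\<omega>. ?H 0 \<omega> \<partial>bridge_kill (fst z) (snd z) (snd z))" for z
  have h [measurable]: "h \<in> borel_measurable (lborel \<Otimes>\<^sub>M m)"
    unfolding h_def by (rule bridge_kill_diagonal_measurable[OF H])
  interpret lm: pair_sigma_finite lborel m by standard
  interpret lml: pair_sigma_finite "lborel \<Otimes>\<^sub>M m" "lborel :: real measure"
    by (intro pair_sigma_finite.intro lm.sigma_finite_measure_axioms lborel.sigma_finite_measure_axioms)
  interpret FQ: finite_measure "Q x0 x0" by (rule finite_measure_Q)
  interpret lQ: pair_sigma_finite "lborel :: real measure" "Q x0 x0" by standard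
  let ?e = "\<lambda>t q. ennreal (exp (- (q * t))) * indicator {0<..} q * indicator {0<..} t"
  have fixed_q: "(\<integral>\<^sup>+z. ?e (fst z) q * h z \<partial>(lborel \<Otimes>\<^sub>M m)) =
      indicator {0<..} q * (\<integral>\<^sup>+\<omega>. lifetime \<omega> * weight lam xs n q \<omega> \<partial>Q x0 x0)" for q
  proof (cases "0 < q")
    case True
    have "(\<integral>\<^sup>+z. ?e (fst z) q * h z \<partial>(lborel \<Otimes>\<^sub>M m)) = (\<integral>\<^sup>+x. \<integral>\<^sup>+t. ?e t q * h (t, x) \<partial>lborel \<partial>m)"
      by (subst lm.nn_integral_snd[symmetric]) simp_all
    also have "\<dots> = (\<integral>\<^sup>+x. (\<integral>\<^sup>+\<omega>. weight lam xs n q \<omega> \<partial>Q x x0) * (\<integral>\<^sup>+\<omega>. weight lam xs n q \<omega> \<partial>Q x0 x) \<partial>m)"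
    proof (rule nn_integral_cong)
      fix x
      \<comment> \<open>The bridge has lifetime exactly \<open>t\<close>, so the discount
        \<open>exp (- (q * t))\<close> is absorbed into the weight with rate
        \<open>q\<close>.\<close>
      have "?e t q * h (t, x) = (\<integral>\<^sup>+\<omega>. ?H q \<omega> \<partial>bridge_kill t x x)" for t
      proof (cases "0 < t")
        case t: True
        have "(\<integral>\<^sup>+\<omega>. ?H q \<omega> \<partial>bridge_kill t x x) = (\<integral>\<^sup>+\<omega>. ennreal (exp (- (q * t))) * ?H 0 \<omega> \<partial>bridge_kill t x x)"
        proof (rule nn_integral_cong_AE, use AE_bridge_kill_lifetime[of t x x] in eventually_elim)
          case (elim \<omega>)
          have "nexp (ennreal q * ennreal t) = ennreal (exp (- (q * t)))"
            using True t by (simp add: nexp_ennreal flip: ennreal_mult)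
          then show ?case unfolding weight_split[of lam xs n q] elim by (simp add: mult_ac)
        qed
        also have "\<dots> = ennreal (exp (- (q * t))) * h (t, x)" unfolding h_def fst_conv snd_conv
          by (rule nn_integral_cmult) measurable
        finally show ?thesis using True t by simp
      next
        case False
        then show ?thesis by (simp add: bridge_kill_def nn_integral_null_measure)
      qed
      then have "(\<integral>\<^sup>+t. ?e t q * h (t, x) \<partial>lborel) = (\<integral>\<^sup>+\<omega>. ?H q \<omega> \<partial>Q x x)"
        by (simp add: Q_integral_bridge[OF H])
      then show "(\<integral>\<^sup>+t. ?e t q * h (t, x) \<partial>lborel) =
          (\<integral>\<^sup>+\<omega>. weight lam xs n q \<omega> \<partial>Q x x0) * (\<integral>\<^sup>+\<omega>. weight lam xs n q \<omega> \<partial>Q x0 x)"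
        by (simp add: Q_product_formula[OF refl])
    qed
    also have "\<dots> = (\<integral>\<^sup>+\<omega>. lifetime \<omega> * weight lam xs n q \<omega> \<partial>Q x0 x0)" by (rule Q_diagonal_formula[OF refl])
    finally show ?thesis using True by simp
  qed simp
  have "(\<integral>\<^sup>+\<omega>. ?H 0 \<omega> \<partial>loop_measure m Qb) = (\<integral>\<^sup>+z. ennreal (1 / fst z) * indicator {0<..} (fst z) * h z \<partial>(lborel \<Otimes>\<^sub>M m))"
    unfolding h_def by (rule loop_measure_integral[OF H])
  also have "\<dots> = (\<integral>\<^sup>+z. (\<integral>\<^sup>+q. ?e (fst z) q * h z \<partial>lborel) \<partial>(lborel \<Otimes>\<^sub>M m))"
  proof (rule nn_integral_cong)
    fix z :: "real \<times> 'a"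
    have "(\<integral>\<^sup>+q. ?e (fst z) q * h z \<partial>lborel) = (\<integral>\<^sup>+q\<in>{0<..}. ennreal (exp (- (q * fst z))) \<partial>lborel) * (indicator {0<..} (fst z) * h z)"
      unfolding mult.assoc[of _ _ "h z"] mult.assoc[of _ "indicator {0<..} (fst z)"] by (rule nn_integral_multc) measurable
    then show "ennreal (1 / fst z) * indicator {0<..} (fst z) * h z = (\<integral>\<^sup>+q. ?e (fst z) q * h z \<partial>lborel)"
      using nn_integral_exp[of "fst z"] by (cases "0 < fst z") (simp_all add: mult.assoc)
  qed
  also have "\<dots> = (\<integral>\<^sup>+q. \<integral>\<^sup>+z. ?e (fst z) q * h z \<partial>(lborel \<Otimes>\<^sub>M m) \<partial>lborel)"
    by (rule lml.Fubini'[symmetric]) (simp add: case_prod_beta')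
  also have "\<dots> = (\<integral>\<^sup>+q. \<integral>\<^sup>+\<omega>. indicator {0<..} q * (lifetime \<omega> * weight lam xs n q \<omega>) \<partial>Q x0 x0 \<partial>lborel)"
    by (intro nn_integral_cong) (simp add: fixed_q nn_integral_cmult)
  also have "\<dots> = (\<integral>\<^sup>+q. \<integral>\<^sup>+\<omega>. indicator {0<..} q * (lifetime \<omega> * (weight lam xs n 0 \<omega> * nexp (ennreal q * lifetime \<omega>))) \<partial>Q x0 x0 \<partial>lborel)"
    by (subst weight_split) simp
  also have "\<dots> = (\<integral>\<^sup>+\<omega>. \<integral>\<^sup>+q. indicator {0<..} q * (lifetime \<omega> * (weight lam xs n 0 \<omega> * nexp (ennreal q * lifetime \<omega>))) \<partial>lborel \<partial>Q x0 x0)"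
    by (rule lQ.Fubini'[symmetric]) (simp add: case_prod_beta')
  \<comment> \<open>Almost every path has a positive and finite lifetime \<open>t\<close>, and the
    exponential density with rate \<open>t\<close> integrates to one over \<open>q\<close>. Here the
    factor \<open>lifetime\<close> is cancelled.\<close>
  also have "\<dots> = (\<integral>\<^sup>+\<omega>. weight lam xs n 0 \<omega> \<partial>Q x0 x0)"
  proof (rule nn_integral_cong_AE, use AE_Q_lifetime_finite[of x0 x0] AE_Q_alive[of x0 x0] in eventually_elim)
    case (elim \<omega>)
    then obtain t where t: "lifetime \<omega> = ennreal t" "0 < t" by (cases "lifetime \<omega>" rule: ennreal_cases) auto
    have "(\<integral>\<^sup>+q. indicator {0<..} q * (lifetime \<omega> * (weight lam xs n 0 \<omega> * nexp (ennreal q * lifetime \<omega>))) \<partial>lborel) =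
        (\<integral>\<^sup>+q. weight lam xs n 0 \<omega> * (ennreal t * ennreal (exp (- (q * t))) * indicator {0<..} q) \<partial>lborel)"
    proof (rule nn_integral_cong)
      fix q :: real
      have "0 < q \<Longrightarrow> nexp (ennreal q * ennreal t) = ennreal (exp (- (q * t)))"
        using t by (simp add: nexp_ennreal flip: ennreal_mult)
      then show "indicator {0<..} q * (lifetime \<omega> * (weight lam xs n 0 \<omega> * nexp (ennreal q * lifetime \<omega>))) =
          weight lam xs n 0 \<omega> * (ennreal t * ennreal (exp (- (q * t))) * indicator {0<..} q)"
        by (cases "0 < q") (simp_all add: t mult_ac)
    qed
    also have "\<dots> = weight lam xs n 0 \<omega> * (\<integral>\<^sup>+q\<in>{0<..}. ennreal t * ennreal (exp (- (q * t))) \<partial>lborel)"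
      by (rule nn_integral_cmult) measurable
    finally show ?case using nn_integral_exp_times[OF t(2)] by simp
  qed
  finally show ?thesis .
qed

end

section \<open>Laplace functional and Palm formula of a Poisson process\<close>

lemma nexp_antimono: "a \<le> b \<Longrightarrow> nexp b \<le> nexp a"
  by (cases a b rule: ennreal2_cases) (auto simp: nexp_ennreal top_unique intro!: ennreal_leI)

lemma nexp_finite [simp]: "nexp a \<noteq> top"
  using nexp_le_1[of a] by (auto simp: top_unique)

text \<open>Beyond continuity of the real exponential, the content is continuity at
  \<open>top\<close>.\<close>

lemma nexp_tendsto:
  assumes "(f \<longlongrightarrow> a) F" shows "((\<lambda>x. nexp (f x)) \<longlongrightarrow> nexp a) F"
proof (cases a rule: ennreal_cases)
  case (real r)
  have lim: "((\<lambda>x. ennreal (exp (- enn2real (f x)))) \<longlongrightarrow> ennreal (exp (- r))) F"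
    using assms real by (intro tendsto_intros tendsto_ennrealI) auto
  have "\<forall>\<^sub>F x in F. f x < top" using order_tendstoD(2)[OF assms, of top] real by simp
  then have "\<forall>\<^sub>F x in F. ennreal (exp (- enn2real (f x))) = nexp (f x)"
    by eventually_elim (simp add: nexp_def)
  from Lim_transform_eventually[OF lim this] show ?thesis using real by (simp add: nexp_ennreal)
next
  case top
  have "((\<lambda>x. nexp (f x)) \<longlongrightarrow> 0) F"
  proof (rule order_tendstoI)
    fix e :: ennreal assume "0 < e"
    then obtain r where r: "0 < ennreal r" "ennreal r < e" using dense[of 0 e] by (metis ennreal_cases not_less_iff_gr_or_eq order.strict_trans1 top_greatest)
    \<comment> \<open>Any level with \<open>exp (- K) \<le> r\<close> would do; the maximum keeps it
      nonnegative, as \<open>nexp_ennreal\<close> requires.\<close>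
    define K where "K = max 0 (- ln r)"
    have "ennreal (exp (- K)) \<le> ennreal r"
    proof (rule ennreal_leI)
      have "exp (- K) \<le> exp (ln r)" by (simp add: K_def)
      also have "exp (ln r) = r" using r by simp
      finally show "exp (- K) \<le> r" .
    qed
    note K = this
    have "\<forall>\<^sub>F x in F. ennreal K < f x" using order_tendstoD(1)[OF assms, of "ennreal K"] top by simp
    then show "\<forall>\<^sub>F x in F. nexp (f x) < e"
    proof eventually_elim
      case (elim x)
      have "nexp (f x) \<le> nexp (ennreal K)" using elim by (intro nexp_antimono less_imp_le)
      also have "\<dots> = ennreal (exp (- K))" by (rule nexp_ennreal) (simp add: K_def)
      also have "\<dots> < e" using K r(2) by (rule le_less_trans)
      finally show ?case .
    qed
  qed simp
  then show ?thesis using top by simp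
qed

lemma nexp_sum: "finite I \<Longrightarrow> nexp (\<Sum>i\<in>I. h i) = (\<Prod>i\<in>I. nexp (h i))"
  by (induction I rule: finite_induct) (simp_all add: nexp_add)

text \<open>Adding \<open>nexp (a + b)\<close> to either side gives \<open>1\<close>, and this
  finite term can be cancelled.\<close>

lemma diff_diff_nexp: "1 - nexp (a + b) = (1 - nexp a) + nexp a * (1 - nexp b)"
proof -
  have "1 - nexp (a + b) + nexp (a + b) = 1"
    by (rule diff_add_cancel_ennreal[OF nexp_le_1])
  moreover have "(1 - nexp a) + nexp a * (1 - nexp b) + nexp (a + b) = 1"
  proof -
    have "nexp a * (1 - nexp b) + nexp (a + b) = nexp a * (1 - nexp b + nexp b)"
      by (simp add: nexp_add distrib_left)
    also have "\<dots> = nexp a" by (simp add: diff_add_cancel_ennreal[OF nexp_le_1])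
    finally show ?thesis by (simp add: add.assoc diff_add_cancel_ennreal[OF nexp_le_1])
  qed
  ultimately show ?thesis by (metis ennreal_add_diff_cancel_right nexp_finite)
qed

text \<open>The difference quotient of \<open>1 - exp (- s a)\<close> in \<open>s\<close> at step
  \<open>1 / 2 ^ k\<close>. Since it increases to \<open>a\<close>, monotone convergence can replace
  differentiation under the integral.\<close>

definition rho :: "nat \<Rightarrow> ennreal \<Rightarrow> ennreal" where
  "rho k a = ennreal (2 ^ k) * (1 - nexp (a / ennreal (2 ^ k)))"

lemma rho_measurable [measurable]: "rho k \<in> borel_measurable borel"
  unfolding rho_def[abs_def] by measurable

lemma rho_real: "0 \<le> r \<Longrightarrow> rho k (ennreal r) = ennreal (2 ^ k * (1 - exp (- (r / 2 ^ k))))"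
proof -
  assume r: "0 \<le> r"
  have "rho k (ennreal r) = ennreal (2 ^ k) * (1 - ennreal (exp (- (r / 2 ^ k))))"
    using r by (simp add: rho_def divide_ennreal nexp_ennreal)
  also have "1 - ennreal (exp (- (r / 2 ^ k))) = ennreal (1 - exp (- (r / 2 ^ k)))"
    by (simp flip: ennreal_1 add: ennreal_minus)
  also have "ennreal (2 ^ k) * \<dots> = ennreal (2 ^ k * (1 - exp (- (r / 2 ^ k))))"
    by (rule ennreal_mult[symmetric]) (use r in simp_all)
  finally show ?thesis .
qed

lemma rho_top: "rho k top = ennreal (2 ^ k)"
  by (simp add: rho_def ennreal_top_divide)

lemma rho_mono: "a \<le> b \<Longrightarrow> rho k a \<le> rho k b"
  unfolding rho_def by (intro mult_left_mono ennreal_mono_minus nexp_antimono divide_right_mono_ennreal) auto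

text \<open>Up to the factor \<open>2 ^ k\<close> this is
  \<open>1 - s * s \<le> 2 * (1 - s)\<close>, where \<open>s\<close> is the exponential at the
  halved step.\<close>

lemma rho_incseq: "rho k a \<le> rho (Suc k) a"
proof (cases a rule: ennreal_cases)
  case (real r)
  define s where "s = exp (- (r / 2 ^ Suc k))"
  have s: "0 \<le> s" "s \<le> 1" using real by (simp_all add: s_def)
  have "exp (- (r / 2 ^ k)) = s * s"
    unfolding s_def exp_add[symmetric] by (simp add: field_simps)
  then have "2 ^ k * (1 - exp (- (r / 2 ^ k))) = 2 ^ k * ((1 - s) * (1 + s))" by (simp add: algebra_simps)
  also have "\<dots> \<le> 2 ^ k * ((1 - s) * 2)" using s by (intro mult_left_mono) auto
  finally have "2 ^ k * (1 - exp (- (r / 2 ^ k))) \<le> 2 ^ Suc k * (1 - s)" by simp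
  then show ?thesis using real by (simp only: rho_real s_def ennreal_leI)
next
  case top
  then show ?thesis by (simp add: rho_top ennreal_leI)
qed

lemma rho_le: "rho k a \<le> a"
proof (cases a rule: ennreal_cases)
  case (real r)
  have "1 - exp (- (r / 2 ^ k)) \<le> r / 2 ^ k" using exp_ge_add_one_self[of "- (r / 2 ^ k)"] by linarith
  then have "2 ^ k * (1 - exp (- (r / 2 ^ k))) \<le> 2 ^ k * (r / 2 ^ k)" by (intro mult_left_mono) auto
  then show ?thesis using real by (simp add: rho_real ennreal_leI)
qed simp

text \<open>The lower bound uses \<open>1 - exp (- x) \<ge> x / (1 + x)\<close> at
  \<open>x = r / 2 ^ k\<close>. Testing with finite \<open>r \<le> a\<close> includes the case
  \<open>a = top\<close>.\<close>

lemma rho_SUP: "(SUP k. rho k a) = a"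
proof (rule antisym)
  show "(SUP k. rho k a) \<le> a" by (intro SUP_least rho_le)
  have lower: "ennreal r \<le> (SUP k. rho k a)" if r: "0 \<le> r" "ennreal r \<le> a" for r
  proof -
    have "(\<lambda>k. r / (1 + r * (1 / 2) ^ k)) \<longlonglongrightarrow> r / (1 + r * 0)"
      by (intro tendsto_intros LIMSEQ_power_zero) auto
    then have lim: "(\<lambda>k. ennreal (r / (1 + r * (1 / 2) ^ k))) \<longlonglongrightarrow> ennreal r" by (intro tendsto_ennrealI) simp
    have le: "ennreal (r / (1 + r * (1 / 2) ^ k)) \<le> (SUP k. rho k a)" for k
    proof -
      define x where "x = r / 2 ^ k"
      have x: "0 \<le> x" using r by (simp add: x_def)
      have "exp (- x) \<le> 1 / (1 + x)"
        using exp_ge_add_one_self[of x] x by (simp add: exp_minus inverse_eq_divide frac_le)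
      then have "x / (1 + x) \<le> 1 - exp (- x)" using x by (simp add: field_simps)
      then have "2 ^ k * (x / (1 + x)) \<le> 2 ^ k * (1 - exp (- x))" by (intro mult_left_mono) auto
      then have "r / (1 + r * (1 / 2) ^ k) \<le> 2 ^ k * (1 - exp (- (r / 2 ^ k)))"
        by (simp add: x_def power_one_over)
      then have "ennreal (r / (1 + r * (1 / 2) ^ k)) \<le> rho k (ennreal r)"
        unfolding rho_real[OF r(1)] by (rule ennreal_leI)
      also have "\<dots> \<le> rho k a" by (rule rho_mono[OF r(2)])
      also have "\<dots> \<le> (SUP k. rho k a)" by (intro SUP_upper) simp
      finally show ?thesis .
    qed
    show ?thesis by (rule LIMSEQ_le_const2[OF lim]) (use le in auto)
  qed
  show "a \<le> (SUP k. rho k a)"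
  proof (rule dense_le)
    fix c assume "c < a"
    then show "c \<le> (SUP k. rho k a)" using lower[of "enn2real c"] by (cases c rule: ennreal_cases) auto
  qed
qed

section \<open>Sums over the points of a Poisson process\<close>

definition point_sum :: "('w \<Rightarrow> 'b set) \<Rightarrow> ('b \<Rightarrow> ennreal) \<Rightarrow> 'w \<Rightarrow> ennreal" where
  "point_sum \<L> g w = (\<integral>\<^sup>+\<omega>. g \<omega> \<partial>count_space (\<L> w))"

lemma point_sum_cmult: "point_sum \<L> (\<lambda>x. c * g x) w = c * point_sum \<L> g w"
  unfolding point_sum_def by (rule nn_integral_cmult) simp

lemma point_sum_add: "point_sum \<L> (\<lambda>x. g x + h x) w = point_sum \<L> g w + point_sum \<L> h w"
  unfolding point_sum_def by (rule nn_integral_add) simp_all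

lemma point_sum_sum: "finite I \<Longrightarrow> point_sum \<L> (\<lambda>x. \<Sum>i\<in>I. g i x) w = (\<Sum>i\<in>I. point_sum \<L> (g i) w)"
  unfolding point_sum_def by (rule nn_integral_sum) simp_all

lemma point_sum_cong: "(\<And>x. x \<in> \<L> w \<Longrightarrow> g x = h x) \<Longrightarrow> point_sum \<L> g w = point_sum \<L> h w"
  unfolding point_sum_def by (intro nn_integral_cong) simp

lemma point_sum_SUP:
  assumes "incseq U" shows "point_sum \<L> (\<lambda>x. SUP i. U i x) w = (SUP i. point_sum \<L> (U i) w)"
  unfolding point_sum_def using assms by (intro nn_integral_monotone_convergence_SUP) simp_all

lemma point_sum_indicator: "point_sum \<L> (indicator A) w = point_count \<L> A w"
proof -
  have "point_sum \<L> (indicator A) w = emeasure (count_space (\<L> w)) (\<L> w \<inter> A)"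
    unfolding point_sum_def by (subst nn_integral_indicator') (auto simp: Int_commute)
  then show ?thesis by (simp add: point_count_def emeasure_count_space)
qed

locale poisson =
  fixes M :: "'w measure" and \<nu> :: "'b measure" and \<L> :: "'w \<Rightarrow> 'b set"
  assumes poisson: "poisson_process M \<nu> \<L>"
begin

sublocale prob_space M
  using poisson by (simp add: poisson_process_def)

lemma points_in_space: "w \<in> space M \<Longrightarrow> \<L> w \<subseteq> space \<nu>"
  using poisson by (simp add: poisson_process_def)

lemma point_count_measurable [measurable]: "A \<in> sets \<nu> \<Longrightarrow> point_count \<L> A \<in> borel_measurable M"
  using poisson by (simp add: poisson_process_def)

lemma point_count_law:
  assumes "A \<in> sets \<nu>"
  shows "if emeasure \<nu> A = \<infinity> then AE w in M. point_count \<L> A w = \<infinity>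
    else \<forall>k. measure M {w \<in> space M. point_count \<L> A w = of_nat k} =
      measure \<nu> A ^ k / fact k * exp (- measure \<nu> A)"
  using poisson assms unfolding poisson_process_def by blast

lemma point_count_infinite: "A \<in> sets \<nu> \<Longrightarrow> emeasure \<nu> A = \<infinity> \<Longrightarrow> AE w in M. point_count \<L> A w = \<infinity>"
  using point_count_law[of A] by simp

lemma point_count_distribution:
  "A \<in> sets \<nu> \<Longrightarrow> emeasure \<nu> A \<noteq> \<infinity> \<Longrightarrow> measure M {w \<in> space M. point_count \<L> A w = of_nat k} =
    measure \<nu> A ^ k / fact k * exp (- measure \<nu> A)"
  using point_count_law[of A] by simp

lemma point_count_indep:
  "(\<And>i. i < k \<Longrightarrow> A i \<in> sets \<nu>) \<Longrightarrow> disjoint_family_on A {..<k::nat} \<Longrightarrow>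
    indep_vars (\<lambda>_. borel) (\<lambda>i. point_count \<L> (A i)) {..<k}"
  using poisson unfolding poisson_process_def by blast

lemma point_sum_measurable [measurable]:
  assumes "g \<in> borel_measurable \<nu>" shows "point_sum \<L> g \<in> borel_measurable M"
  using assms
proof (induction rule: borel_measurable_induct)
  case (cong f g)
  have "point_sum \<L> f w = point_sum \<L> g w" if "w \<in> space M" for w
    using points_in_space[OF that] cong.hyps(3) by (intro point_sum_cong) auto
  then show ?case using cong.IH by (subst measurable_cong[where g="point_sum \<L> g"]) auto
next
  case (set A)
  then show ?case using point_count_measurable[OF set] by (simp add: point_sum_indicator cong: measurable_cong)
next
  case (mult f c)
  then show ?case by (simp add: point_sum_cmult cong: measurable_cong)
next
  case (add f g)
  then show ?case by (simp add: point_sum_add cong: measurable_cong)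
next
  case (seq U)
  have "point_sum \<L> (SUP i. U i) = (\<lambda>w. SUP i. point_sum \<L> (U i) w)"
  proof
    fix w
    have "point_sum \<L> (SUP i. U i) w = point_sum \<L> (\<lambda>x. SUP i. U i x) w"
      by (intro point_sum_cong) (simp add: image_comp)
    then show "point_sum \<L> (SUP i. U i) w = (SUP i. point_sum \<L> (U i) w)"
      by (simp only: point_sum_SUP[OF seq.hyps(3)])
  qed
  then show ?case using seq.IH by (simp only:) measurable
qed

text \<open>The Poisson generating function at \<open>exp (- c)\<close>. On a set of infinite
  intensity the count is infinite and both sides vanish for positive \<open>c\<close>, while for
  \<open>c = 0\<close> both are one; hence the first case distinction.\<close>

lemma point_count_laplace:
  assumes A: "A \<in> sets \<nu>" and c: "c < top"
  shows "(\<integral>\<^sup>+w. nexp (c * point_count \<L> A w) \<partial>M) = nexp ((1 - nexp c) * emeasure \<nu> A)"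
proof (cases "c = 0")
  case True then show ?thesis by (simp add: emeasure_space_1)
next
  case False
  then obtain r where r: "c = ennreal r" "0 < r" using c by (cases c rule: ennreal_cases) auto
  have one: "1 - nexp c = ennreal (1 - exp (- r))"
    using r by (simp add: nexp_ennreal flip: ennreal_1 add: ennreal_minus)
  note [measurable] = point_count_measurable[OF A]
  show ?thesis
  proof (cases "emeasure \<nu> A = \<infinity>")
    case True
    have "(\<integral>\<^sup>+w. nexp (c * point_count \<L> A w) \<partial>M) = 0"
    proof (rule nn_integral_zero', use point_count_infinite[OF A True] in eventually_elim)
      case (elim w)
      then show ?case using \<open>c \<noteq> 0\<close> by (simp add: ennreal_mult_top)
    qed
    moreover have "(1 - nexp c) * emeasure \<nu> A = top"
    proof -
      have "ennreal (1 - exp (- r)) \<noteq> 0" using r by simp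
      then show ?thesis unfolding one True by (simp add: ennreal_mult_top)
    qed
    ultimately show ?thesis by simp
  next
    case False
    define b where "b = measure \<nu> A"
    have b: "emeasure \<nu> A = ennreal b" "0 \<le> b"
      using False by (simp_all add: b_def emeasure_eq_ennreal_measure)
    define p where "p k = b ^ k / fact k * exp (- b)" for k
    define E where "E k = {w \<in> space M. point_count \<L> A w = of_nat k}" for k :: nat
    have E [measurable]: "E k \<in> events" for k unfolding E_def by measurable
    have p: "emeasure M (E k) = ennreal (p k)" "0 \<le> p k" for k
      using point_count_distribution[OF A False, of k] b(2) by (simp_all add: E_def p_def b_def emeasure_eq_measure)
    have exp_sums: "(\<lambda>k. x ^ k / fact k * exp (- b)) sums (exp x * exp (- b))" for x
      using sums_mult2[OF exp_converges[of x], of "exp (- b)"] by (simp add: divide_inverse mult_ac)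
    have disj: "disjoint_family E" by (auto simp: disjoint_family_on_def E_def)
    have "emeasure M (\<Union>k. E k) = (\<Sum>k. emeasure M (E k))"
      using E disj by (intro suminf_emeasure[symmetric]) auto
    also have "\<dots> = ennreal (\<Sum>k. p k)"
      unfolding p(1) using exp_sums[of b] p(2) by (intro suminf_ennreal2) (auto simp: p_def sums_iff)
    also have "(\<Sum>k. p k) = 1" using exp_sums[of b] by (simp add: p_def sums_iff exp_minus)
    \<comment> \<open>The Poisson weights already add up to one, so the count is almost surely
      finite.\<close>
    finally have "prob (\<Union>k. E k) = 1" by (simp add: measure_def)
    then have "AE w in M. w \<in> (\<Union>k. E k)" using E by (subst AE_in_set_eq_1) auto
    then have "(\<integral>\<^sup>+w. nexp (c * point_count \<L> A w) \<partial>M) = (\<integral>\<^sup>+w. (\<Sum>k. nexp (c * of_nat k) * indicator (E k) w) \<partial>M)"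
    proof (intro nn_integral_cong_AE, eventually_elim)
      case (elim w)
      then obtain j where j: "w \<in> E j" by blast
      have eq: "(\<Sum>k. nexp (c * of_nat k) * indicator (E k) w) = (\<Sum>k\<in>{j}. nexp (c * of_nat k) * indicator (E k) w)"
        using j by (intro suminf_finite) (auto simp: E_def indicator_def)
      have "point_count \<L> A w = of_nat j" using j by (simp add: E_def)
      then show ?case unfolding eq using j by simp
    qed
    also have "\<dots> = (\<Sum>k. \<integral>\<^sup>+w. nexp (c * of_nat k) * indicator (E k) w \<partial>M)"
      by (rule nn_integral_suminf) measurable
    also have "\<dots> = (\<Sum>k. nexp (c * of_nat k) * ennreal (p k))"
      by (simp add: nn_integral_cmult_indicator p(1))
    also have "\<dots> = (\<Sum>k. ennreal ((b * exp (- r)) ^ k / fact k * exp (- b)))"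
    proof (intro suminf_cong)
      fix k
      have "c * of_nat k = ennreal (r * real k)" using r by (simp add: ennreal_of_nat_eq_real_of_nat ennreal_mult)
      then have "nexp (c * of_nat k) = ennreal (exp (- r) ^ k)"
        using r by (simp add: nexp_ennreal exp_of_nat_mult[symmetric] mult.commute)
      then show "nexp (c * of_nat k) * ennreal (p k) = ennreal ((b * exp (- r)) ^ k / fact k * exp (- b))"
        using p(2)[of k] by (simp add: p_def power_mult_distrib mult_ac flip: ennreal_mult)
    qed
    also have "\<dots> = ennreal (exp (b * exp (- r)) * exp (- b))"
      using exp_sums[of "b * exp (- r)"] b(2) by (subst suminf_ennreal2) (auto simp: sums_iff)
    also have "\<dots> = nexp ((1 - nexp c) * emeasure \<nu> A)"
    proof -
      have "(1 - nexp c) * emeasure \<nu> A = ennreal ((1 - exp (- r)) * b)"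
        unfolding one b(1) using r b(2) by (intro ennreal_mult[symmetric]) auto
      moreover have "0 \<le> (1 - exp (- r)) * b" using r b(2) by simp
      ultimately have "nexp ((1 - nexp c) * emeasure \<nu> A) = ennreal (exp (- ((1 - exp (- r)) * b)))"
        by (simp only: nexp_ennreal)
      also have "exp (- ((1 - exp (- r)) * b)) = exp (b * exp (- r)) * exp (- b)"
        unfolding exp_add[symmetric] by (simp add: algebra_simps)
      finally show ?thesis by simp
    qed
    finally show ?thesis .
  qed
qed

text \<open>The level sets of \<open>g\<close> are disjoint, so their counts are independent and the
  expectation factorises over the values of \<open>g\<close>.\<close>

lemma laplace_simple:
  assumes g: "simple_function \<nu> g" and fin: "\<And>x. g x < top"
  shows "(\<integral>\<^sup>+w. nexp (point_sum \<L> g w) \<partial>M) = nexp (\<integral>\<^sup>+x. 1 - nexp (g x) \<partial>\<nu>)"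
proof -
  have "finite (g ` space \<nu>)" using g by (rule simple_functionD)
  then obtain e where e: "bij_betw e {0..<card (g ` space \<nu>)} (g ` space \<nu>)" using ex_bij_betw_nat_finite by blast
  define k where "k = card (g ` space \<nu>)"
  have e: "bij_betw e {..<k} (g ` space \<nu>)" using e by (simp add: k_def lessThan_atLeast0)
  define A where "A i = g -` {e i} \<inter> space \<nu>" for i
  have A: "A i \<in> sets \<nu>" for i unfolding A_def by (rule simple_functionD(2)[OF g])
  have disj: "disjoint_family_on A {..<k}"
    using bij_betw_imp_inj_on[OF e] by (auto simp: disjoint_family_on_def A_def inj_on_def)
  \<comment> \<open>The level sets partition the whole space, so an arbitrary \<open>h\<close> can
    be expanded; it is applied to the identity and to \<open>1 - nexp\<close>.\<close>
  have decomp: "h (g x) = (\<Sum>i<k. h (e i) * indicator (A i) x)" if x: "x \<in> space \<nu>" for x and h :: "ennreal \<Rightarrow> ennreal"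
  proof -
    obtain j where j: "j < k" "e j = g x" using e x unfolding bij_betw_def by (metis imageE imageI lessThan_iff)
    have "(\<Sum>i<k. h (e i) * indicator (A i) x) = (\<Sum>i\<in>{j}. h (e i) * indicator (A i) x)"
    proof (rule sum.mono_neutral_right)
      show "\<forall>i\<in>{..<k} - {j}. h (e i) * indicator (A i) x = 0"
        using bij_betw_imp_inj_on[OF e] j by (auto simp: A_def inj_on_def indicator_def)
    qed (use j in auto)
    then show ?thesis using j x by (simp add: A_def)
  qed
  have efin: "e i < top" if "i < k" for i
  proof -
    have "e i \<in> g ` space \<nu>" using e that unfolding bij_betw_def by auto
    then show ?thesis using fin by auto
  qed
  have "(\<integral>\<^sup>+w. nexp (point_sum \<L> g w) \<partial>M) = (\<integral>\<^sup>+w. (\<Prod>i<k. nexp (e i * point_count \<L> (A i) w)) \<partial>M)"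
  proof (rule nn_integral_cong)
    fix w assume w: "w \<in> space M"
    have "point_sum \<L> g w = point_sum \<L> (\<lambda>x. \<Sum>i<k. e i * indicator (A i) x) w"
      using decomp[of _ "\<lambda>c. c"] points_in_space[OF w] by (intro point_sum_cong) auto
    also have "\<dots> = (\<Sum>i<k. e i * point_count \<L> (A i) w)"
      by (subst point_sum_sum) (simp_all add: point_sum_cmult point_sum_indicator)
    finally show "nexp (point_sum \<L> g w) = (\<Prod>i<k. nexp (e i * point_count \<L> (A i) w))"
      by (simp add: nexp_sum)
  qed
  also have "\<dots> = (\<Prod>i<k. \<integral>\<^sup>+w. nexp (e i * point_count \<L> (A i) w) \<partial>M)"
  proof (rule indep_vars_nn_integral)
    show "indep_vars (\<lambda>_. borel) (\<lambda>i w. nexp (e i * point_count \<L> (A i) w)) {..<k}"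
      by (rule indep_vars_compose2[where Y="\<lambda>i n. nexp (e i * n)", OF point_count_indep[OF A disj]]) measurable
  qed auto
  also have "\<dots> = (\<Prod>i<k. nexp ((1 - nexp (e i)) * emeasure \<nu> (A i)))"
    using efin by (intro prod.cong point_count_laplace A) auto
  also have "\<dots> = nexp (\<Sum>i<k. (1 - nexp (e i)) * emeasure \<nu> (A i))" by (simp add: nexp_sum)
  also have "(\<Sum>i<k. (1 - nexp (e i)) * emeasure \<nu> (A i)) = (\<integral>\<^sup>+x. (\<Sum>i<k. (1 - nexp (e i)) * indicator (A i) x) \<partial>\<nu>)"
    using A by (subst nn_integral_sum) (auto simp: nn_integral_cmult_indicator)
  also have "\<dots> = (\<integral>\<^sup>+x. 1 - nexp (g x) \<partial>\<nu>)"
    using decomp[of _ "\<lambda>c. 1 - nexp c"] by (intro nn_integral_cong) auto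
  finally show ?thesis .
qed

text \<open>Simple functions increasing to \<open>g\<close>: the left side converges by domination,
  because \<open>nexp\<close> is at most one, and the integrals on the right increase.\<close>

theorem laplace:
  assumes g: "g \<in> borel_measurable \<nu>"
  shows "(\<integral>\<^sup>+w. nexp (point_sum \<L> g w) \<partial>M) = nexp (\<integral>\<^sup>+x. 1 - nexp (g x) \<partial>\<nu>)"
proof -
  from borel_measurable_implies_simple_function_sequence'[OF g]
  obtain U where U: "\<And>i. simple_function \<nu> (U i)" "incseq U" "\<And>i x. U i x < top" "\<And>x. (SUP i. U i x) = g x"
    by blast
  note [measurable] = borel_measurable_simple_function[OF U(1)] g
  have inc: "incseq (\<lambda>i. U i x)" for x using U(2) by (auto simp: incseq_def le_fun_def)
  have U_lim: "(\<lambda>i. U i x) \<longlonglongrightarrow> g x" for x using LIMSEQ_SUP[OF inc, of x] U(4) by simp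
  have "incseq (\<lambda>i. point_sum \<L> (U i) w)" for w
    unfolding point_sum_def using U(2) by (auto simp: incseq_def le_fun_def intro!: nn_integral_mono)
  from LIMSEQ_SUP[OF this] have S_lim: "(\<lambda>i. point_sum \<L> (U i) w) \<longlonglongrightarrow> point_sum \<L> g w" for w
    using point_sum_SUP[OF U(2), of \<L> w] U(4) by simp
  have "(\<lambda>i. \<integral>\<^sup>+w. nexp (point_sum \<L> (U i) w) \<partial>M) \<longlonglongrightarrow> (\<integral>\<^sup>+w. nexp (point_sum \<L> g w) \<partial>M)"
  proof (rule nn_integral_dominated_convergence[where w="\<lambda>_. 1"])
    show "AE w in M. (\<lambda>i. nexp (point_sum \<L> (U i) w)) \<longlonglongrightarrow> nexp (point_sum \<L> g w)"
      by (intro AE_I2 nexp_tendsto S_lim)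
  qed (auto simp: nexp_le_1 emeasure_space_1)
  moreover have "(\<lambda>i. \<integral>\<^sup>+x. 1 - nexp (U i x) \<partial>\<nu>) \<longlonglongrightarrow> (\<integral>\<^sup>+x. 1 - nexp (g x) \<partial>\<nu>)"
  proof -
    have inc': "incseq (\<lambda>i x. 1 - nexp (U i x))"
      using U(2) by (auto simp: incseq_def le_fun_def intro!: ennreal_mono_minus nexp_antimono)
    have "(\<lambda>i. 1 - nexp (U i x)) \<longlonglongrightarrow> 1 - nexp (g x)" for x
      by (intro tendsto_diff_ennreal tendsto_const nexp_tendsto U_lim) auto
    moreover have "(\<lambda>i. 1 - nexp (U i x)) \<longlonglongrightarrow> (SUP i. 1 - nexp (U i x))" for x
      using inc' by (intro LIMSEQ_SUP) (auto simp: incseq_def le_fun_def)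
    ultimately have SUP: "(SUP i. 1 - nexp (U i x)) = 1 - nexp (g x)" for x using LIMSEQ_unique by blast
    have "(\<integral>\<^sup>+x. 1 - nexp (g x) \<partial>\<nu>) = (SUP i. \<integral>\<^sup>+x. 1 - nexp (U i x) \<partial>\<nu>)"
      unfolding SUP[symmetric] using inc' by (intro nn_integral_monotone_convergence_SUP) auto
    moreover have "incseq (\<lambda>i. \<integral>\<^sup>+x. 1 - nexp (U i x) \<partial>\<nu>)"
      using inc' by (auto simp: incseq_def le_fun_def intro!: nn_integral_mono)
    ultimately show ?thesis using LIMSEQ_SUP by metis
  qed
  then have "(\<lambda>i. nexp (\<integral>\<^sup>+x. 1 - nexp (U i x) \<partial>\<nu>)) \<longlonglongrightarrow> nexp (\<integral>\<^sup>+x. 1 - nexp (g x) \<partial>\<nu>)" by (rule nexp_tendsto)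
  ultimately show ?thesis unfolding laplace_simple[OF U(1,3)] by (rule LIMSEQ_unique)
qed

text \<open>
  Palm's formula for exponential functionals: the derivative at \<open>0\<close> of the Laplace functional at
  \<open>g + s g0\<close>.  Along \<open>s = 1 / 2 ^ k\<close> the difference quotients increase.
\<close>

theorem palm:
  assumes g [measurable]: "g \<in> borel_measurable \<nu>" and g0 [measurable]: "g0 \<in> borel_measurable \<nu>"
  shows "(\<integral>\<^sup>+w. point_sum \<L> g0 w * nexp (point_sum \<L> g w) \<partial>M) =
    (\<integral>\<^sup>+x. g0 x * nexp (g x) \<partial>\<nu>) * (\<integral>\<^sup>+w. nexp (point_sum \<L> g w) \<partial>M)"
proof -
  define \<kappa> where "\<kappa> k = (\<integral>\<^sup>+x. nexp (g x) * rho k (g0 x) \<partial>\<nu>)" for k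
  \<comment> \<open>An exact identity before the limit: the Laplace functional at
    \<open>g + g0 / 2 ^ k\<close> splits by \<open>diff_diff_nexp\<close>, and both difference
    quotients take the form \<open>rho k\<close>.\<close>
  have step: "(\<integral>\<^sup>+w. nexp (point_sum \<L> g w) * rho k (point_sum \<L> g0 w) \<partial>M) =
      (\<integral>\<^sup>+w. nexp (point_sum \<L> g w) \<partial>M) * rho k (\<kappa> k)" for k
  proof -
    let ?c = "ennreal (2 ^ k)"
    have c: "?c \<noteq> 0" "?c \<noteq> top" by simp_all
    define h where "h x = g0 x / ?c" for x
    have h [measurable]: "h \<in> borel_measurable \<nu>" unfolding h_def by measurable
    have S: "point_sum \<L> h w = point_sum \<L> g0 w / ?c" for w
      unfolding h_def divide_ennreal_def point_sum_cmult[symmetric] using point_sum_cmult[of \<L> "inverse ?c" g0 w] by (simp add: mult.commute)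
    define \<delta> where "\<delta> = (\<integral>\<^sup>+x. nexp (g x) * (1 - nexp (h x)) \<partial>\<nu>)"
    have "\<kappa> k = (\<integral>\<^sup>+x. ?c * (nexp (g x) * (1 - nexp (h x))) \<partial>\<nu>)"
      unfolding \<kappa>_def rho_def h_def by (simp add: mult.left_commute)
    also have "\<dots> = ?c * \<delta>" unfolding \<delta>_def by (rule nn_integral_cmult) measurable
    finally have \<delta>: "\<kappa> k / ?c = \<delta>" using c by (simp add: mult.commute[of ?c] mult_divide_eq_ennreal)
    have "(\<integral>\<^sup>+x. 1 - nexp (g x + h x) \<partial>\<nu>) = (\<integral>\<^sup>+x. 1 - nexp (g x) \<partial>\<nu>) + \<delta>"
      unfolding diff_diff_nexp \<delta>_def by (rule nn_integral_add) measurable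
    then have both: "(\<integral>\<^sup>+w. nexp (point_sum \<L> (\<lambda>x. g x + h x) w) \<partial>M) = (\<integral>\<^sup>+w. nexp (point_sum \<L> g w) \<partial>M) * nexp \<delta>"
      by (simp add: laplace nexp_add)
    have le1: "(\<integral>\<^sup>+w. nexp (point_sum \<L> g w) \<partial>M) \<noteq> top"
      unfolding laplace[OF g] by simp
    have "(\<integral>\<^sup>+w. nexp (point_sum \<L> g w) * rho k (point_sum \<L> g0 w) \<partial>M) =
        (\<integral>\<^sup>+w. ?c * (nexp (point_sum \<L> g w) - nexp (point_sum \<L> (\<lambda>x. g x + h x) w)) \<partial>M)"
    proof (rule nn_integral_cong)
      fix w
      show "nexp (point_sum \<L> g w) * rho k (point_sum \<L> g0 w) =
          ?c * (nexp (point_sum \<L> g w) - nexp (point_sum \<L> (\<lambda>x. g x + h x) w))"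
        unfolding rho_def S[symmetric] point_sum_add nexp_add
        by (subst mult.left_commute) (simp add: ennreal_right_diff_distrib)
    qed
    also have "\<dots> = ?c * (\<integral>\<^sup>+w. nexp (point_sum \<L> g w) - nexp (point_sum \<L> (\<lambda>x. g x + h x) w) \<partial>M)"
      by (rule nn_integral_cmult) measurable
    also have "(\<integral>\<^sup>+w. nexp (point_sum \<L> g w) - nexp (point_sum \<L> (\<lambda>x. g x + h x) w) \<partial>M) =
        (\<integral>\<^sup>+w. nexp (point_sum \<L> g w) \<partial>M) - (\<integral>\<^sup>+w. nexp (point_sum \<L> (\<lambda>x. g x + h x) w) \<partial>M)"
    proof (rule nn_integral_diff)
      show "(\<integral>\<^sup>+w. nexp (point_sum \<L> (\<lambda>x. g x + h x) w) \<partial>M) \<noteq> \<infinity>" by (simp add: laplace)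
      show "AE w in M. nexp (point_sum \<L> (\<lambda>x. g x + h x) w) \<le> nexp (point_sum \<L> g w)"
        by (intro AE_I2 nexp_antimono) (simp add: point_sum_add)
    qed measurable
    also have "?c * \<dots> = (\<integral>\<^sup>+w. nexp (point_sum \<L> g w) \<partial>M) * (?c * (1 - nexp \<delta>))"
    proof -
      have "(\<integral>\<^sup>+w. nexp (point_sum \<L> g w) \<partial>M) - (\<integral>\<^sup>+w. nexp (point_sum \<L> g w) \<partial>M) * nexp \<delta> =
          (\<integral>\<^sup>+w. nexp (point_sum \<L> g w) \<partial>M) * (1 - nexp \<delta>)"
        using ennreal_right_diff_distrib[OF le1, of 1 "nexp \<delta>"] by simp
      then show ?thesis unfolding both by (simp only: mult.left_commute)
    qed
    finally show ?thesis unfolding rho_def \<delta> .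
  qed
  have S_SUP: "(SUP k. nexp (point_sum \<L> g w) * rho k (point_sum \<L> g0 w)) = point_sum \<L> g0 w * nexp (point_sum \<L> g w)" for w
    by (simp add: SUP_mult_left_ennreal[symmetric] rho_SUP mult.commute)
  have "(\<integral>\<^sup>+w. point_sum \<L> g0 w * nexp (point_sum \<L> g w) \<partial>M) =
      (SUP k. \<integral>\<^sup>+w. nexp (point_sum \<L> g w) * rho k (point_sum \<L> g0 w) \<partial>M)"
    unfolding S_SUP[symmetric]
    by (intro nn_integral_monotone_convergence_SUP) (auto simp: incseq_Suc_iff le_fun_def intro!: mult_left_mono rho_incseq)
  also have "\<dots> = (\<integral>\<^sup>+w. nexp (point_sum \<L> g w) \<partial>M) * (SUP k. rho k (\<kappa> k))"
    unfolding step by (simp add: SUP_mult_left_ennreal)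
  \<comment> \<open>A diagonal supremum: \<open>rho\<close> increases both in its index and in its
    argument, so the two indices can be separated and \<open>rho_SUP\<close> applied.\<close>
  also have "(SUP k. rho k (\<kappa> k)) = (SUP k. \<kappa> k)"
  proof (rule antisym)
    show "(SUP k. rho k (\<kappa> k)) \<le> (SUP k. \<kappa> k)" by (intro SUP_mono) (auto intro: rho_le)
    have \<kappa>_mono: "incseq \<kappa>"
      unfolding \<kappa>_def by (auto simp: incseq_Suc_iff intro!: nn_integral_mono mult_left_mono rho_incseq)
    have rho_mono': "incseq (\<lambda>k. rho k a)" for a by (auto simp: incseq_Suc_iff rho_incseq)
    show "(SUP k. \<kappa> k) \<le> (SUP k. rho k (\<kappa> k))"
    proof (rule SUP_least)
      fix j
      have "rho k (\<kappa> j) \<le> (SUP k. rho k (\<kappa> k))" for k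
      proof -
        have "rho k (\<kappa> j) \<le> rho (max k j) (\<kappa> j)" by (rule incseqD[OF rho_mono']) simp
        also have "\<dots> \<le> rho (max k j) (\<kappa> (max k j))" by (intro rho_mono incseqD[OF \<kappa>_mono]) simp
        also have "\<dots> \<le> (SUP k. rho k (\<kappa> k))" by (intro SUP_upper) simp
        finally show ?thesis .
      qed
      then have "(SUP k. rho k (\<kappa> j)) \<le> (SUP k. rho k (\<kappa> k))" by (intro SUP_least)
      then show "\<kappa> j \<le> (SUP k. rho k (\<kappa> k))" by (simp add: rho_SUP)
    qed
  qed
  also have "(SUP k. \<kappa> k) = (\<integral>\<^sup>+x. g0 x * nexp (g x) \<partial>\<nu>)"
  proof -
    have "(SUP k. nexp (g x) * rho k (g0 x)) = g0 x * nexp (g x)" for x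
      by (simp add: SUP_mult_left_ennreal[symmetric] rho_SUP mult.commute)
    moreover have "(SUP k. \<kappa> k) = (\<integral>\<^sup>+x. (SUP k. nexp (g x) * rho k (g0 x)) \<partial>\<nu>)"
      unfolding \<kappa>_def
      by (intro nn_integral_monotone_convergence_SUP[symmetric]) (auto simp: incseq_Suc_iff le_fun_def intro!: mult_left_mono rho_incseq)
    ultimately show ?thesis by simp
  qed
  finally show ?thesis by (simp add: mult.commute)
qed

end

section \<open>Uniqueness of Laplace transforms\<close>

text \<open>At integers the Laplace transforms are moments of \<open>exp (- x)\<close>, which ranges
  in \<open>[0, 1]\<close>, and Weierstrass approximation passes from polynomials to continuous
  functions. The \<open>max 0\<close> keeps the variable in this interval even on the null set of
  negative points.\<close>

lemma integral_exp_max_eq: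
  fixes h :: "real \<Rightarrow> real"
  assumes fin: "finite_measure R1" "finite_measure R2" and sets: "sets R1 = sets borel" "sets R2 = sets borel"
    and nonneg: "AE x in R1. 0 \<le> x" "AE x in R2. 0 \<le> (x::real)"
    and eq: "\<And>k::nat. (\<integral>\<^sup>+x. ennreal (exp (- (real k * x))) \<partial>R1) = (\<integral>\<^sup>+x. ennreal (exp (- (real k * x))) \<partial>R2)"
    and h: "continuous_on {0..1} h" "h \<in> borel_measurable borel"
  shows "(\<integral>x. h (exp (- max 0 x)) \<partial>R1) = (\<integral>x. h (exp (- max 0 x)) \<partial>R2)"
proof -
  let ?y = "\<lambda>x::real. exp (- max 0 x)"
  have y: "?y x \<in> {0..1}" for x by simp
  have power: "(\<integral>x. ?y x ^ k \<partial>R) = enn2real (\<integral>\<^sup>+x. ennreal (exp (- (real k * x))) \<partial>R)"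
    if "AE x in R. 0 \<le> x" "sets R = sets borel" for R :: "real measure" and k
  proof -
    have "(\<integral>x. ?y x ^ k \<partial>R) = enn2real (\<integral>\<^sup>+x. ennreal (?y x ^ k) \<partial>R)"
    proof (rule integral_eq_nn_integral)
      show "(\<lambda>x. ?y x ^ k) \<in> borel_measurable R"
        unfolding measurable_cong_sets[OF that(2) refl] by measurable
    qed simp
    also have "(\<integral>\<^sup>+x. ennreal (?y x ^ k) \<partial>R) = (\<integral>\<^sup>+x. ennreal (exp (- (real k * x))) \<partial>R)"
      by (rule nn_integral_cong_AE, use that(1) in eventually_elim) (simp add: exp_of_nat_mult[symmetric])
    finally show ?thesis .
  qed
  have int: "integrable R (\<lambda>x. g (?y x))" if "finite_measure R" "sets R = sets borel" "g \<in> borel_measurable borel" "\<And>t. t \<in> {0..1} \<Longrightarrow> \<bar>g t\<bar> \<le> B" for R :: "real measure" and g and B :: real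
  proof -
    interpret finite_measure R by fact
    have "(\<lambda>x. g (?y x)) \<in> borel_measurable borel" using that(3) by measurable
    then have "(\<lambda>x. g (?y x)) \<in> borel_measurable R" by (simp add: measurable_cong_sets[OF that(2) refl])
    then show ?thesis by (rule integrable_const_bound[where B=B, rotated]) (use that(4) y in auto)
  qed
  obtain B where B: "\<And>t. t \<in> {0..1} \<Longrightarrow> \<bar>h t\<bar> \<le> B"
    using compact_imp_bounded[OF compact_continuous_image[OF h(1)]] unfolding bounded_iff real_norm_def by (metis compact_Icc imageI)
  note h_int = int[OF fin(1) sets(1) h(2) B] int[OF fin(2) sets(2) h(2) B]
  have close: "\<bar>(\<integral>x. h (?y x) \<partial>R1) - (\<integral>x. h (?y x) \<partial>R2)\<bar> \<le> e * (measure R1 (space R1) + measure R2 (space R2))"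
    if e: "0 < e" for e
  proof -
    obtain g where g: "real_polynomial_function g" "\<And>t. t \<in> {0..1} \<Longrightarrow> \<bar>h t - g t\<bar> < e"
      using Stone_Weierstrass_real_polynomial_function[OF compact_Icc h(1) e] by blast
    obtain a n where a: "g = (\<lambda>t. \<Sum>i\<le>n. a i * t ^ i)" using g(1) real_polynomial_function_iff_sum by auto
    have g_meas: "g \<in> borel_measurable borel" unfolding a by measurable
    have g_bound: "\<bar>g t\<bar> \<le> B + e" if "t \<in> {0..1}" for t using g(2)[OF that] B[OF that] by linarith
    note g_int = int[OF fin(1) sets(1) g_meas g_bound] int[OF fin(2) sets(2) g_meas g_bound]
    have g_eq: "(\<integral>x. g (?y x) \<partial>R) = (\<Sum>i\<le>n. a i * (\<integral>x. ?y x ^ i \<partial>R))" if "finite_measure R" "sets R = sets borel" for R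
    proof -
      have "integrable R (\<lambda>x. ?y x ^ i)" for i
        by (rule int[OF that, where g="\<lambda>t. t ^ i" and B=1]) (auto simp: power_le_one)
      then show ?thesis unfolding a by (subst Bochner_Integration.integral_sum) auto
    qed
    have same: "(\<integral>x. g (?y x) \<partial>R1) = (\<integral>x. g (?y x) \<partial>R2)"
      by (simp add: g_eq[OF fin(1) sets(1)] g_eq[OF fin(2) sets(2)] power[OF nonneg(1) sets(1)] power[OF nonneg(2) sets(2)] eq)
    have diff: "\<bar>(\<integral>x. h (?y x) \<partial>R) - (\<integral>x. g (?y x) \<partial>R)\<bar> \<le> e * measure R (space R)"
      if "finite_measure R" "integrable R (\<lambda>x. h (?y x))" "integrable R (\<lambda>x. g (?y x))" for R
    proof -
      interpret finite_measure R by fact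
      have "\<bar>(\<integral>x. h (?y x) \<partial>R) - (\<integral>x. g (?y x) \<partial>R)\<bar> = \<bar>\<integral>x. h (?y x) - g (?y x) \<partial>R\<bar>"
        using that by simp
      also have "\<dots> \<le> (\<integral>x. \<bar>h (?y x) - g (?y x)\<bar> \<partial>R)" by (rule integral_abs_bound)
      also have "\<dots> \<le> (\<integral>x. e \<partial>R)"
        using g(2)[OF y] that by (intro integral_mono) (auto intro: less_imp_le)
      finally show ?thesis by (simp add: mult.commute)
    qed
    show ?thesis
      using diff[OF fin(1) h_int(1) g_int(1)] diff[OF fin(2) h_int(2) g_int(2)] same
      by (simp add: distrib_left)
  qed
  have "\<bar>(\<integral>x. h (?y x) \<partial>R1) - (\<integral>x. h (?y x) \<partial>R2)\<bar> \<le> 0"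
  proof (rule field_le_epsilon)
    fix e :: real assume e: "0 < e"
    \<comment> \<open>The estimate \<open>close\<close> is used with \<open>e / (1 + c)\<close>; the
      added one avoids division by zero.\<close>
    define c where "c = measure R1 (space R1) + measure R2 (space R2)"
    have c: "0 \<le> c" by (simp add: c_def)
    have "\<bar>(\<integral>x. h (?y x) \<partial>R1) - (\<integral>x. h (?y x) \<partial>R2)\<bar> \<le> e / (1 + c) * c"
      unfolding c_def by (rule close) (use e c in \<open>simp add: c_def add_pos_nonneg\<close>)
    also have "\<dots> \<le> 0 + e" using e c by (simp add: field_simps)
    finally show "\<bar>(\<integral>x. h (?y x) \<partial>R1) - (\<integral>x. h (?y x) \<partial>R2)\<bar> \<le> 0 + e" .
  qed
  then show ?thesis by simp
qed

text \<open>Distribution functions are recovered as limits of integrals of continuous ramps in the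
  variable \<open>exp (- x)\<close>, to which \<open>integral_exp_max_eq\<close> applies.\<close>

lemma laplace_unique:
  assumes fin: "finite_measure R1" "finite_measure R2" and sets: "sets R1 = sets borel" "sets R2 = sets borel"
    and nonneg: "AE x in R1. 0 \<le> x" "AE x in R2. 0 \<le> (x::real)"
    and eq: "\<And>k::nat. (\<integral>\<^sup>+x. ennreal (exp (- (real k * x))) \<partial>R1) = (\<integral>\<^sup>+x. ennreal (exp (- (real k * x))) \<partial>R2)"
  shows "R1 = R2"
proof (rule cdf_unique')
  show "finite_borel_measure R1" "finite_borel_measure R2"
    using fin sets by (auto simp: finite_borel_measure_def finite_borel_measure_axioms_def)
  show "cdf R1 = cdf R2"
  proof
    fix a :: real
    show "cdf R1 a = cdf R2 a"
    proof (cases "0 \<le> a")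
      case False
      have "measure R {..a} = 0" if "AE x in R. 0 \<le> x" "sets R = sets borel" for R :: "real measure"
      proof -
        have "{..a} \<in> null_sets R"
          using that False by (subst AE_iff_null_sets) (auto elim!: eventually_mono)
        then show ?thesis by (simp add: measure_eq_0_null_sets)
      qed
      then show ?thesis using nonneg sets by (simp add: cdf_def)
    next
      case True
      \<comment> \<open>A ramp equal to one from \<open>exp (- a)\<close> on, which for positive
        \<open>n\<close> vanishes up to \<open>exp (- a) - 1 / n\<close>. As
        \<open>exp (- x)\<close> decreases in \<open>x\<close>, the limit is the indicator of
        \<open>x \<le> a\<close>.\<close>
      define h where "h n t = min 1 (max 0 (1 + real n * (t - exp (- a))))" for n :: nat and t :: real
      have h_cont: "continuous_on S (h n)" for S n unfolding h_def by (intro continuous_intros)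
      have h_meas: "h n \<in> borel_measurable borel" for n by (rule borel_measurable_continuous_onI[OF h_cont])
      have lim: "(\<lambda>n. \<integral>x. h n (exp (- max 0 x)) \<partial>R) \<longlonglongrightarrow> measure R {..a}"
        if R: "finite_measure R" "sets R = sets borel" for R :: "real measure"
      proof -
        interpret finite_measure R by fact
        have meas_R: "measurable R borel = borel_measurable borel" by (rule measurable_cong_sets[OF R(2) refl])
        have "(\<lambda>n. \<integral>x. h n (exp (- max 0 x)) \<partial>R) \<longlonglongrightarrow> (\<integral>x. indicator {..a} x \<partial>R)"
        proof (rule integral_dominated_convergence[where w="\<lambda>_. 1"])
          show "(\<lambda>x. h n (exp (- max 0 x))) \<in> borel_measurable R" for n
            unfolding meas_R using h_meas[of n] by measurable
          show "indicator {..a} \<in> borel_measurable R" unfolding meas_R by measurable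
          show "AE x in R. norm (h n (exp (- max 0 x))) \<le> 1" for n by (intro AE_I2) (auto simp: h_def)
          show "AE x in R. (\<lambda>n. h n (exp (- max 0 x))) \<longlonglongrightarrow> indicator {..a} x"
          proof (intro AE_I2)
            fix x :: real
            show "(\<lambda>n. h n (exp (- max 0 x))) \<longlonglongrightarrow> indicator {..a} x"
            proof (cases "x \<le> a")
              case le: True
              then have "exp (- a) \<le> exp (- max 0 x)" using True by simp
              then have "h n (exp (- max 0 x)) = 1" for n
                unfolding h_def by (simp add: min_absorb1 max_absorb2 mult_nonneg_nonneg)
              then show ?thesis using le by simp
            next
              case False
              then have d: "exp (- max 0 x) - exp (- a) < 0" using True by simp
              obtain N :: nat where N: "1 / (exp (- a) - exp (- max 0 x)) < real N" using reals_Archimedean2 by blast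
              have "h n (exp (- max 0 x)) = 0" if "N \<le> n" for n
              proof -
                have "1 / (exp (- a) - exp (- max 0 x)) < real n" using N that by simp
                then have "1 < real n * (exp (- a) - exp (- max 0 x))" using d by (simp add: pos_divide_less_eq)
                then have "1 + real n * (exp (- max 0 x) - exp (- a)) \<le> 0" by (simp add: algebra_simps)
                then show ?thesis by (simp add: h_def)
              qed
              then have "\<forall>\<^sub>F n in sequentially. h n (exp (- max 0 x)) = indicator {..a} x"
                using False by (auto simp: eventually_sequentially)
              then show ?thesis by (rule tendsto_eventually)
            qed
          qed
        qed simp
        moreover have "{..a} \<inter> space R = {..a}" using sets_eq_imp_space_eq[OF R(2)] by simp
        ultimately show ?thesis by simp
      qed
      have "(\<integral>x. h n (exp (- max 0 x)) \<partial>R1) = (\<integral>x. h n (exp (- max 0 x)) \<partial>R2)" for n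
        by (rule integral_exp_max_eq[OF fin sets nonneg eq h_cont h_meas])
      then have "measure R1 {..a} = measure R2 {..a}"
        using lim[OF fin(1) sets(1)] lim[OF fin(2) sets(2)] by (auto intro: LIMSEQ_unique)
      then show ?thesis by (simp add: cdf_def)
    qed
  qed
qed

text \<open>The exponentials are replaced by indicators one coordinate at a time.\<close>

lemma laplace_unique_PiM:
  fixes N1 N2 :: "(nat \<Rightarrow> real) measure"
  assumes fin: "finite_measure N1" "finite_measure N2"
    and sets: "sets N1 = sets (PiM UNIV (\<lambda>_. borel))" "sets N2 = sets (PiM UNIV (\<lambda>_. borel))"
    and nonneg: "AE y in N1. \<forall>j. 0 \<le> y j" "AE y in N2. \<forall>j. 0 \<le> y j"
    and eq: "\<And>n lam. (\<And>j. 0 \<le> lam j) \<Longrightarrow>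
      (\<integral>\<^sup>+y. (\<Prod>j<n. ennreal (exp (- (lam j * y j)))) \<partial>N1) = (\<integral>\<^sup>+y. (\<Prod>j<n. ennreal (exp (- (lam j * y j)))) \<partial>N2)"
  shows "N1 = N2"
proof -
  have meas_N: "measurable N1 K = measurable (PiM UNIV (\<lambda>_. borel)) K" "measurable N2 K = measurable (PiM UNIV (\<lambda>_. borel)) K" for K :: "'c measure"
    by (rule measurable_cong_sets[OF sets(1) refl], rule measurable_cong_sets[OF sets(2) refl])
  have space_N: "space N1 = UNIV" "space N2 = UNIV"
    using sets_eq_imp_space_eq[OF sets(1)] sets_eq_imp_space_eq[OF sets(2)] by (simp_all add: space_PiM)
  have comp [measurable]: "(\<lambda>y. y j) \<in> borel_measurable (PiM UNIV (\<lambda>_. borel :: real measure))" for j :: nat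
    by (rule measurable_component_singleton) simp
  \<comment> \<open>Mixed products, with indicators in the first \<open>k\<close> coordinates and
    exponentials in the others: \<open>k = 0\<close> is the hypothesis, and \<open>k = n\<close>
    gives the finite-dimensional events.\<close>
  have step: "(\<integral>\<^sup>+y. (\<Prod>j<n. \<phi> j (y j)) \<partial>N1) = (\<integral>\<^sup>+y. (\<Prod>j<n. \<phi> j (y j)) \<partial>N2)"
    if "k \<le> n" "\<And>j. j < k \<Longrightarrow> \<exists>B\<in>sets borel. \<phi> j = indicator B"
      "\<And>j. k \<le> j \<Longrightarrow> \<exists>l\<ge>0. \<phi> j = (\<lambda>x. ennreal (exp (- (l * x))))" for k n and \<phi> :: "nat \<Rightarrow> real \<Rightarrow> ennreal"
    using that
  proof (induction k arbitrary: \<phi>)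
    case 0
    then have "\<forall>j. \<exists>l\<ge>0. \<phi> j = (\<lambda>x. ennreal (exp (- (l * x))))" by blast
    then obtain lam where lam: "\<And>j. 0 \<le> lam j" "\<And>j. \<phi> j = (\<lambda>x. ennreal (exp (- (lam j * x))))" by metis
    show ?case unfolding lam(2) by (rule eq[OF lam(1)])
  next
    case (Suc k)
    obtain B where B: "B \<in> sets borel" "\<phi> k = indicator B" using Suc.prems(2)[of k] by blast
    have \<phi>_prop: "\<phi> j \<in> borel_measurable borel \<and> (\<forall>x\<ge>0. \<phi> j x \<le> 1)" for j
    proof (cases "j < Suc k")
      case True
      then show ?thesis using Suc.prems(2)[of j] by (auto simp: indicator_def)
    next
      case False
      then obtain l where "0 \<le> l" "\<phi> j = (\<lambda>x. ennreal (exp (- (l * x))))" using Suc.prems(3)[of j] by auto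
      then show ?thesis by auto
    qed
    then have [measurable]: "\<phi> j \<in> borel_measurable borel" for j by blast
    \<comment> \<open>The factors of the other coordinates act as a density, at most one on
      nonnegative sequences. The weighted law of coordinate \<open>k\<close> is then finite, and
      \<open>laplace_unique\<close> applies to it.\<close>
    define \<psi> where "\<psi> y = (\<Prod>j\<in>{..<n} - {k}. \<phi> j (y j))" for y :: "nat \<Rightarrow> real"
    have \<psi> [measurable]: "\<psi> \<in> borel_measurable (PiM UNIV (\<lambda>_. borel))" unfolding \<psi>_def by measurable
    have split: "(\<Prod>j<n. (\<phi>(k := \<xi>)) j (y j)) = \<psi> y * \<xi> (y k)" for \<xi> y
    proof -
      have "(\<Prod>j<n. (\<phi>(k := \<xi>)) j (y j)) = (\<phi>(k := \<xi>)) k (y k) * (\<Prod>j\<in>{..<n} - {k}. (\<phi>(k := \<xi>)) j (y j))"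
        using Suc.prems(1) by (intro prod.remove) auto
      also have "(\<Prod>j\<in>{..<n} - {k}. (\<phi>(k := \<xi>)) j (y j)) = \<psi> y" unfolding \<psi>_def by (intro prod.cong) auto
      finally show ?thesis by (simp add: mult.commute)
    qed
    define R where "R N = distr (density N \<psi>) borel (\<lambda>y. y k)" for N
    have sets_R: "sets (R N) = sets borel" for N by (simp add: R_def)
    have R_integral: "(\<integral>\<^sup>+x. \<xi> x \<partial>R N) = (\<integral>\<^sup>+y. \<psi> y * \<xi> (y k) \<partial>N)"
      if N: "sets N = sets (PiM UNIV (\<lambda>_. borel))" and [measurable]: "\<xi> \<in> borel_measurable borel" for N \<xi>
    proof -
      have m: "measurable N K = measurable (PiM UNIV (\<lambda>_. borel)) K" for K :: "'d measure"
        by (rule measurable_cong_sets[OF N refl])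
      have 1: "\<psi> \<in> borel_measurable N" "(\<lambda>y. y k) \<in> borel_measurable N" "(\<lambda>y. \<xi> (y k)) \<in> borel_measurable N"
        unfolding measurable_cong_sets[OF N refl] by measurable
      have "(\<integral>\<^sup>+x. \<xi> x \<partial>R N) = (\<integral>\<^sup>+y. \<xi> (y k) \<partial>density N \<psi>)"
        unfolding R_def using 1 by (intro nn_integral_distr) auto
      also have "\<dots> = (\<integral>\<^sup>+y. \<psi> y * \<xi> (y k) \<partial>N)" using 1 by (intro nn_integral_density)
      finally show ?thesis .
    qed
    have fin_R: "finite_measure (R N)" if N: "sets N = sets (PiM UNIV (\<lambda>_. borel))" "finite_measure N" "AE y in N. \<forall>j. 0 \<le> y j" for N
    proof
      interpret finite_measure N by fact
      have "emeasure (R N) (space (R N)) = (\<integral>\<^sup>+x. 1 \<partial>R N)" by simp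
      also have "\<dots> = (\<integral>\<^sup>+y. \<psi> y * 1 \<partial>N)" by (rule R_integral[OF N(1)]) simp
      also have "\<dots> \<le> (\<integral>\<^sup>+y. 1 \<partial>N)"
      proof (rule nn_integral_mono_AE, use N(3) in eventually_elim)
        case (elim y)
        then show ?case unfolding \<psi>_def using \<phi>_prop by (simp, intro prod_le_1) auto
      qed
      also have "\<dots> < \<infinity>" by (simp add: less_top[symmetric])
      finally show "emeasure (R N) (space (R N)) \<noteq> \<infinity>" by simp
    qed
    have nonneg_R: "AE x in R N. 0 \<le> x" if N: "sets N = sets (PiM UNIV (\<lambda>_. borel))" "AE y in N. \<forall>j. 0 \<le> y j" for N
    proof -
      have 1: "\<psi> \<in> borel_measurable N" "(\<lambda>y. y k) \<in> borel_measurable N"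
        unfolding measurable_cong_sets[OF N(1) refl] by measurable
      have "AE y in density N \<psi>. 0 \<le> y k"
        unfolding AE_density[OF 1(1)] using N(2) by eventually_elim auto
      then show ?thesis unfolding R_def using 1 by (subst AE_distr_iff) auto
    qed
    have "R N1 = R N2"
    proof (rule laplace_unique[OF fin_R fin_R sets_R sets_R nonneg_R nonneg_R])
      fix q :: nat
      let ?\<xi> = "\<lambda>x. ennreal (exp (- (real q * x)))"
      have "(\<integral>\<^sup>+y. (\<Prod>j<n. (\<phi>(k := ?\<xi>)) j (y j)) \<partial>N1) = (\<integral>\<^sup>+y. (\<Prod>j<n. (\<phi>(k := ?\<xi>)) j (y j)) \<partial>N2)"
      proof (rule Suc.IH)
        show "k \<le> n" using Suc.prems(1) by simp
        show "\<exists>B\<in>sets borel. (\<phi>(k := ?\<xi>)) j = indicator B" if "j < k" for j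
          using Suc.prems(2)[of j] that by simp
        show "\<exists>l\<ge>0. (\<phi>(k := ?\<xi>)) j = (\<lambda>x. ennreal (exp (- (l * x))))" if "k \<le> j" for j
          using Suc.prems(3)[of j] that by (cases "j = k") (auto intro!: exI[of _ "real q"])
      qed
      then show "(\<integral>\<^sup>+x. ?\<xi> x \<partial>R N1) = (\<integral>\<^sup>+x. ?\<xi> x \<partial>R N2)"
        unfolding split by (simp add: R_integral sets)
    qed (use sets fin nonneg in auto)
    then have "(\<integral>\<^sup>+x. indicator B x \<partial>R N1) = (\<integral>\<^sup>+x. indicator B x \<partial>R N2)" by simp
    then have "(\<integral>\<^sup>+y. \<psi> y * indicator B (y k) \<partial>N1) = (\<integral>\<^sup>+y. \<psi> y * indicator B (y k) \<partial>N2)"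
      using B(1) by (simp add: R_integral sets)
    moreover have "(\<Prod>j<n. \<phi> j (y j)) = \<psi> y * indicator B (y k)" for y
      using split[of "\<phi> k" y] B(2) by (metis fun_upd_triv)
    ultimately show ?case by simp
  qed
  show ?thesis
  proof (rule measure_eqI_PiM_infinite[OF sets _ fin(1)])
    fix A :: "nat \<Rightarrow> real set" and J assume J: "finite J" "J \<subseteq> UNIV" and A: "\<And>i. i \<in> J \<Longrightarrow> A i \<in> sets borel"
    obtain n where n: "J \<subseteq> {..<n}" using J(1) finite_nat_iff_bounded by auto
    define B where "B j = (if j \<in> J then A j else UNIV)" for j
    have B: "B j \<in> sets borel" for j using A by (simp add: B_def)
    have emb: "prod_emb UNIV (\<lambda>_. borel) J (Pi\<^sub>E J A) = {y. \<forall>j\<in>J. y j \<in> A j}"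
      by (auto simp: prod_emb_def space_PiM PiE_def Pi_def)
    have ind: "indicator {y. \<forall>j\<in>J. y j \<in> A j} y = (\<Prod>j<n. indicator (B j) (y j) :: ennreal)" for y
    proof (cases "\<forall>j\<in>J. y j \<in> A j")
      case True
      then have "y j \<in> B j" for j by (simp add: B_def)
      then show ?thesis using True by simp
    next
      case False
      then obtain j where j: "j \<in> J" "y j \<notin> A j" by blast
      then have "(\<Prod>j<n. indicator (B j) (y j) :: ennreal) = 0"
        using n by (intro prod_zero) (auto simp: B_def intro!: bexI[of _ j])
      then show ?thesis using False by simp
    qed
    have set: "prod_emb UNIV (\<lambda>_. borel) J (Pi\<^sub>E J A) \<in> sets (PiM UNIV (\<lambda>_. borel))"
      using J A by (intro sets_PiM_I) auto
    have "(\<integral>\<^sup>+y. (\<Prod>j<n. (if j < n then indicator (B j) else (\<lambda>x. ennreal (exp (- (0 * x))))) (y j)) \<partial>N1) =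
        (\<integral>\<^sup>+y. (\<Prod>j<n. (if j < n then indicator (B j) else (\<lambda>x. ennreal (exp (- (0 * x))))) (y j)) \<partial>N2)"
      by (rule step[of n n]) (use B in auto)
    then have "(\<integral>\<^sup>+y. (\<Prod>j<n. indicator (B j) (y j)) \<partial>N1) = (\<integral>\<^sup>+y. (\<Prod>j<n. indicator (B j) (y j)) \<partial>N2)" by simp
    then show "emeasure N1 (prod_emb UNIV (\<lambda>_. borel) J (Pi\<^sub>E J A)) = emeasure N2 (prod_emb UNIV (\<lambda>_. borel) J (Pi\<^sub>E J A))"
      using set unfolding emb ind[symmetric] by (simp add: sets)
  qed
qed

section \<open>The isomorphism theorem\<close>

lemma prod_exp_eq_nexp:
  fixes n :: nat
  assumes "\<And>j. j < n \<Longrightarrow> a j < top" "\<And>j. 0 \<le> lam j"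
  shows "(\<Prod>j<n. ennreal (exp (- (lam j * enn2real (a j))))) = nexp (\<Sum>j<n. ennreal (lam j) * a j)"
proof -
  have "ennreal (exp (- (lam j * enn2real (a j)))) = nexp (ennreal (lam j) * a j)" if "j < n" for j
    using assms(1)[OF that] assms(2)[of j]
    by (cases "a j" rule: ennreal_cases) (simp_all add: nexp_ennreal flip: ennreal_mult)
  then show ?thesis by (simp add: nexp_sum)
qed

lemma AE_finite_of_nn_integral:
  assumes "g \<in> borel_measurable K" "(\<integral>\<^sup>+x. g x \<partial>K) < \<infinity>"
  shows "AE x in K. g x < top"
  using nn_integral_PInf_AE[OF assms(1)] assms(2) by (auto simp: less_top)

section \<open>Local times of the loop soup\<close>

locale loop_soup = loop_process m p P f L Q Qb
  for m :: "'a::{metric_space, second_countable_topology} measure" and p P f L Q Qb +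
  fixes \<alpha> :: real and M :: "'w measure" and \<L> :: "'w \<Rightarrow> 'a path set"
  assumes alpha: "0 < \<alpha>"
    and soup: "poisson_process M (scale_measure (ennreal \<alpha>) (loop_measure m Qb)) \<L>"
begin

sublocale poisson M "scale_measure (ennreal \<alpha>) (loop_measure m Qb)" \<L>
  by standard (rule soup)

abbreviation S :: "'a \<Rightarrow> 'w \<Rightarrow> ennreal" where
  "S y w \<equiv> soup_local_time L (\<L> w) y"

lemma S_eq_point_sum: "S y w = point_sum \<L> (L_infinity y) w"
  by (simp add: soup_local_time_def point_sum_def)

lemma path_algebra_measurable_intensity:
  fixes g :: "'a path \<Rightarrow> ennreal"
  assumes "g \<in> borel_measurable path_algebra"
  shows "g \<in> borel_measurable (scale_measure (ennreal \<alpha>) (loop_measure m Qb))"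
    and "g \<in> borel_measurable (loop_measure m Qb)"
proof -
  have sets: "sets (scale_measure (ennreal \<alpha>) (loop_measure m Qb)) = sets path_algebra"
    "sets (loop_measure m Qb) = sets path_algebra" by (simp_all add: sets_loop_measure)
  show "g \<in> borel_measurable (scale_measure (ennreal \<alpha>) (loop_measure m Qb))"
    unfolding measurable_cong_sets[OF sets(1) refl] by fact
  show "g \<in> borel_measurable (loop_measure m Qb)"
    unfolding measurable_cong_sets[OF sets(2) refl] by fact
qed

lemma S_measurable [measurable]: "S y \<in> borel_measurable M"
  unfolding S_eq_point_sum by (intro point_sum_measurable path_algebra_measurable_intensity(1) L_infinity_measurable)

text \<open>Palm's formula with \<open>g0\<close> the local time at \<open>x0\<close>. The integral
  over a single loop is evaluated by \<open>loop_measure_local_time\<close>, and scaling the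
  intensity contributes \<open>\<alpha>\<close>.\<close>

lemma soup_palm:
  "(\<integral>\<^sup>+w. S x0 w * nexp (\<Sum>j<n. ennreal (lam j) * S (xs j) w) \<partial>M) =
     ennreal \<alpha> * (\<integral>\<^sup>+\<omega>. weight lam xs n 0 \<omega> \<partial>Q x0 x0) *
     (\<integral>\<^sup>+w. nexp (\<Sum>j<n. ennreal (lam j) * S (xs j) w) \<partial>M)"
proof -
  define g where "g \<omega> = (\<Sum>j<n. ennreal (lam j) * L_infinity (xs j) \<omega>)" for \<omega>
  have g [measurable]: "g \<in> borel_measurable path_algebra" unfolding g_def[abs_def] by measurable
  have sum: "point_sum \<L> g w = (\<Sum>j<n. ennreal (lam j) * S (xs j) w)" for w
    unfolding g_def[abs_def] by (simp add: point_sum_sum point_sum_cmult S_eq_point_sum)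
  have w: "weight lam xs n 0 \<omega> = nexp (g \<omega>)" for \<omega> by (simp add: weight_def g_def)
  have "(\<lambda>\<omega>. L_infinity x0 \<omega> * nexp (g \<omega>)) \<in> borel_measurable path_algebra" by measurable
  note meas = path_algebra_measurable_intensity(2)[OF this]
  show ?thesis
    using palm[OF path_algebra_measurable_intensity(1)[OF g] path_algebra_measurable_intensity(1)[OF L_infinity_measurable[of x0]]]
      loop_measure_local_time[of x0 lam xs n]
    by (simp add: sum nn_integral_scale_measure[OF meas] w S_eq_point_sum[where y=x0, symmetric])
qed

text \<open>The empty family \<open>n = 0\<close> in \<open>soup_palm\<close>, whose weight is one.
  As \<open>u\<close> is finite, the soup local times are almost surely finite.\<close>

lemma expected_S: "(\<integral>\<^sup>+w. S y w \<partial>M) = ennreal \<alpha> * u y y"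
  using soup_palm[where ?x0.0=y and n=0] emeasure_Q_paths[of y y] by (simp add: weight_def emeasure_space_1)

lemma AE_S_finite: "AE w in M. S y w < top"
  using AE_finite_of_nn_integral[OF S_measurable] expected_S[of y] u_finite[of y y]
  by (simp add: ennreal_mult_less_top)

text \<open>The product formula with the trivial weight, that is with \<open>n = 0\<close> and
  \<open>q = 0\<close>.\<close>

lemma expected_L_infinity_Q: "(\<integral>\<^sup>+\<omega>. L_infinity y \<omega> \<partial>Q x z) = u x y * u y z"
  using Q_product_formula[OF refl, where n=0 and q=0 and ?x0.0=y and x=x and y=z] by (simp add: weight_def emeasure_Q_paths)

lemma AE_Q_L_infinity_finite: "AE \<omega> in Q x z. L_infinity y \<omega> < top"
  using expected_L_infinity_Q[where x=x and y=y and z=z] u_finite[of x y] u_finite[of y z]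
  by (intro AE_finite_of_nn_integral) (auto simp: ennreal_mult_less_top)

text \<open>The left side of the theorem as a measure on sequences: the law of the soup local times
  biased by the one at \<open>x0\<close>. \<open>enn2real\<close> sends infinite values to zero,
  which by \<open>AE_S_finite\<close> affects only a null set.\<close>

definition tilted_law :: "'a \<Rightarrow> (nat \<Rightarrow> 'a) \<Rightarrow> (nat \<Rightarrow> real) measure" where
  "tilted_law x0 xs = distr (density M (\<lambda>w. ennreal (enn2real (S x0 w)))) (PiM UNIV (\<lambda>_. borel))
     (\<lambda>w j. enn2real (S (xs j) w))"

text \<open>The right side of the theorem as a measure on sequences; the product measure expresses
  independence of the soup and the extra path.\<close>

definition shifted_law :: "'a \<Rightarrow> (nat \<Rightarrow> 'a) \<Rightarrow> (nat \<Rightarrow> real) measure" where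
  "shifted_law x0 xs = distr (density (M \<Otimes>\<^sub>M Q x0 x0) (\<lambda>_. ennreal \<alpha>)) (PiM UNIV (\<lambda>_. borel))
     (\<lambda>(w, \<omega>) j. enn2real (S (xs j) w + L_infinity (xs j) \<omega>))"

lemma soup_vector_measurable [measurable]:
  "(\<lambda>w j. enn2real (S (xs j) w)) \<in> measurable M (PiM UNIV (\<lambda>_::nat. borel))"
  by (rule measurable_PiM_single') (auto simp: PiE_def)

lemma sum_vector_measurable [measurable]:
  "(\<lambda>(w, \<omega>) j. enn2real (S (xs j) w + L_infinity (xs j) \<omega>)) \<in> measurable (M \<Otimes>\<^sub>M Q x0 x0) (PiM UNIV (\<lambda>_::nat. borel))"
proof -
  have "(\<lambda>z j. enn2real (S (xs j) (fst z) + L_infinity (xs j) (snd z))) \<in> measurable (M \<Otimes>\<^sub>M Q x0 x0) (PiM UNIV (\<lambda>_::nat. borel))"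
    by (rule measurable_PiM_single') (auto simp: PiE_def)
  then show ?thesis by (simp add: case_prod_beta')
qed

lemma exp_prod_measurable:
  "(\<lambda>y. \<Prod>j<n. ennreal (exp (- (lam j * y j)))) \<in> borel_measurable (PiM UNIV (\<lambda>_::nat. borel))"
proof -
  have [measurable]: "(\<lambda>y. y j) \<in> borel_measurable (PiM UNIV (\<lambda>_. borel :: real measure))" for j :: nat
    by (rule measurable_component_singleton) simp
  show ?thesis by measurable
qed

lemma tilted_law_laplace:
  assumes lam: "\<And>j. 0 \<le> lam j"
  shows "(\<integral>\<^sup>+y. (\<Prod>j<n. ennreal (exp (- (lam j * y j)))) \<partial>tilted_law x0 xs) =
    (\<integral>\<^sup>+w. S x0 w * nexp (\<Sum>j<n. ennreal (lam j) * S (xs j) w) \<partial>M)"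
proof -
  have fin: "AE w in M. \<forall>y\<in>insert x0 (range xs). S y w < top"
    using AE_S_finite by (subst AE_ball_countable) auto
  have "(\<integral>\<^sup>+y. (\<Prod>j<n. ennreal (exp (- (lam j * y j)))) \<partial>tilted_law x0 xs) =
      (\<integral>\<^sup>+w. (\<Prod>j<n. ennreal (exp (- (lam j * enn2real (S (xs j) w))))) \<partial>density M (\<lambda>w. ennreal (enn2real (S x0 w))))"
    unfolding tilted_law_def by (rule nn_integral_distr) (use exp_prod_measurable in auto)
  also have "\<dots> = (\<integral>\<^sup>+w. ennreal (enn2real (S x0 w)) * (\<Prod>j<n. ennreal (exp (- (lam j * enn2real (S (xs j) w))))) \<partial>M)"
    by (rule nn_integral_density) measurable
  also have "\<dots> = (\<integral>\<^sup>+w. S x0 w * nexp (\<Sum>j<n. ennreal (lam j) * S (xs j) w) \<partial>M)"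
    by (rule nn_integral_cong_AE, use fin in eventually_elim) (simp add: prod_exp_eq_nexp lam)
  finally show ?thesis .
qed

text \<open>Under the product measure the exponential of a sum of local times splits into a soup
  factor and a path factor. Almost everywhere finiteness on both sides lets \<open>nexp\<close>
  replace the real exponential.\<close>

lemma shifted_law_laplace:
  assumes lam: "\<And>j. 0 \<le> lam j"
  shows "(\<integral>\<^sup>+y. (\<Prod>j<n. ennreal (exp (- (lam j * y j)))) \<partial>shifted_law x0 xs) =
    ennreal \<alpha> * (\<integral>\<^sup>+\<omega>. weight lam xs n 0 \<omega> \<partial>Q x0 x0) *
     (\<integral>\<^sup>+w. nexp (\<Sum>j<n. ennreal (lam j) * S (xs j) w) \<partial>M)"
proof -
  interpret QQ: finite_measure "Q x0 x0" by (rule finite_measure_Q)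
  interpret pair_sigma_finite M "Q x0 x0" by standard
  have finS: "AE w in M. \<forall>j. S (xs j) w < top" using AE_S_finite by (subst AE_all_countable) auto
  have finL: "AE \<omega> in Q x0 x0. \<forall>j. L_infinity (xs j) \<omega> < top"
    using AE_Q_L_infinity_finite by (subst AE_all_countable) auto
  let ?a = "\<lambda>w \<omega> j. S (xs j) w + L_infinity (xs j) \<omega>"
  have "(\<integral>\<^sup>+y. (\<Prod>j<n. ennreal (exp (- (lam j * y j)))) \<partial>shifted_law x0 xs) =
      (\<integral>\<^sup>+z. (\<Prod>j<n. ennreal (exp (- (lam j * (case z of (w, \<omega>) \<Rightarrow> \<lambda>j. enn2real (?a w \<omega> j)) j))))
        \<partial>density (M \<Otimes>\<^sub>M Q x0 x0) (\<lambda>_. ennreal \<alpha>))"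
    unfolding shifted_law_def by (rule nn_integral_distr) (use exp_prod_measurable in auto)
  also have "\<dots> = (\<integral>\<^sup>+z. (\<Prod>j<n. ennreal (exp (- (lam j * enn2real (?a (fst z) (snd z) j)))))
        \<partial>density (M \<Otimes>\<^sub>M Q x0 x0) (\<lambda>_. ennreal \<alpha>))" by (simp add: case_prod_beta')
  also have "\<dots> = (\<integral>\<^sup>+z. ennreal \<alpha> * (\<Prod>j<n. ennreal (exp (- (lam j * enn2real (?a (fst z) (snd z) j))))) \<partial>(M \<Otimes>\<^sub>M Q x0 x0))"
    by (rule nn_integral_density) measurable
  also have "\<dots> = ennreal \<alpha> * (\<integral>\<^sup>+z. (\<Prod>j<n. ennreal (exp (- (lam j * enn2real (?a (fst z) (snd z) j))))) \<partial>(M \<Otimes>\<^sub>M Q x0 x0))"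
    by (rule nn_integral_cmult) measurable
  also have "(\<integral>\<^sup>+z. (\<Prod>j<n. ennreal (exp (- (lam j * enn2real (?a (fst z) (snd z) j))))) \<partial>(M \<Otimes>\<^sub>M Q x0 x0)) =
      (\<integral>\<^sup>+w. \<integral>\<^sup>+\<omega>. (\<Prod>j<n. ennreal (exp (- (lam j * enn2real (?a w \<omega> j))))) \<partial>Q x0 x0 \<partial>M)"
    by (subst QQ.nn_integral_fst[symmetric]) simp_all
  also have "\<dots> = (\<integral>\<^sup>+w. nexp (\<Sum>j<n. ennreal (lam j) * S (xs j) w) * (\<integral>\<^sup>+\<omega>. weight lam xs n 0 \<omega> \<partial>Q x0 x0) \<partial>M)"
  proof (rule nn_integral_cong_AE, use finS in eventually_elim)
    case (elim w)
    have "(\<integral>\<^sup>+\<omega>. (\<Prod>j<n. ennreal (exp (- (lam j * enn2real (?a w \<omega> j))))) \<partial>Q x0 x0) =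
        (\<integral>\<^sup>+\<omega>. nexp (\<Sum>j<n. ennreal (lam j) * S (xs j) w) * weight lam xs n 0 \<omega> \<partial>Q x0 x0)"
    proof (rule nn_integral_cong_AE, use finL in eventually_elim)
      case (elim \<omega>)
      then show ?case using \<open>\<forall>j. S (xs j) w < top\<close>
        by (simp add: prod_exp_eq_nexp lam weight_def distrib_left sum.distrib nexp_add)
    qed
    also have "\<dots> = nexp (\<Sum>j<n. ennreal (lam j) * S (xs j) w) * (\<integral>\<^sup>+\<omega>. weight lam xs n 0 \<omega> \<partial>Q x0 x0)"
      by (rule nn_integral_cmult) measurable
    finally show ?case .
  qed
  also have "\<dots> = (\<integral>\<^sup>+w. nexp (\<Sum>j<n. ennreal (lam j) * S (xs j) w) \<partial>M) * (\<integral>\<^sup>+\<omega>. weight lam xs n 0 \<omega> \<partial>Q x0 x0)"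
    by (rule nn_integral_multc) measurable
  finally show ?thesis by (simp add: ac_simps)
qed

text \<open>\<open>soup_palm\<close> states that the two Laplace transforms coincide, and finiteness
  of \<open>u x0 x0\<close> makes both total masses finite.\<close>

lemma tilted_law_eq_shifted_law: "tilted_law x0 xs = shifted_law x0 xs"
proof (rule laplace_unique_PiM)
  have one: "(\<integral>\<^sup>+y. 1 \<partial>tilted_law x0 xs) = (\<integral>\<^sup>+w. S x0 w \<partial>M)"
    using tilted_law_laplace[of "\<lambda>_. 0" x0 xs 0] by simp
  show "finite_measure (tilted_law x0 xs)"
    by standard (use one expected_S[of x0] u_finite[of x0 x0] in \<open>auto simp: ennreal_mult_eq_top_iff\<close>)
  have two: "(\<integral>\<^sup>+y. 1 \<partial>shifted_law x0 xs) = (\<integral>\<^sup>+w. S x0 w \<partial>M)"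
    using shifted_law_laplace[of "\<lambda>_. 0" x0 xs 0] soup_palm[of x0 "\<lambda>_. 0" xs 0] by simp
  show "finite_measure (shifted_law x0 xs)"
    by standard (use two expected_S[of x0] u_finite[of x0 x0] in \<open>auto simp: ennreal_mult_eq_top_iff\<close>)
  have nonneg_set: "{y. \<forall>j. 0 \<le> y j} \<in> sets (PiM UNIV (\<lambda>_::nat. borel :: real measure))"
  proof -
    have [measurable]: "(\<lambda>y. y j) \<in> borel_measurable (PiM UNIV (\<lambda>_. borel :: real measure))" for j :: nat
      by (rule measurable_component_singleton) simp
    have "{y \<in> space (PiM UNIV (\<lambda>_::nat. borel :: real measure)). \<forall>j. 0 \<le> y j} \<in> sets (PiM UNIV (\<lambda>_::nat. borel :: real measure))"
      by measurable
    then show ?thesis by (simp add: space_PiM)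
  qed
  show "AE y in tilted_law x0 xs. \<forall>j. 0 \<le> y j"
    unfolding tilted_law_def by (subst AE_distr_iff) (use nonneg_set in \<open>auto simp: space_PiM\<close>)
  show "AE y in shifted_law x0 xs. \<forall>j. 0 \<le> y j"
    unfolding shifted_law_def by (subst AE_distr_iff) (use nonneg_set in \<open>auto simp: space_PiM split_beta\<close>)
qed (simp_all add: tilted_law_laplace shifted_law_laplace soup_palm, simp_all add: tilted_law_def shifted_law_def)

text \<open>Each side is an integral of \<open>F\<close> against one of two laws now known to be
  equal. A bounded \<open>F\<close> is integrable because the biasing local time has finite
  expectation and \<open>Q x0 x0\<close> has finite mass.\<close>

theorem isomorphism:
  fixes F :: "(nat \<Rightarrow> real) \<Rightarrow> real"
  assumes F [measurable]: "F \<in> borel_measurable (PiM UNIV (\<lambda>_. borel))" and "bounded (range F)"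
  shows "integrable M (\<lambda>w. enn2real (S x0 w) * F (\<lambda>j. enn2real (S (xs j) w)))"
    and "integrable (M \<Otimes>\<^sub>M Q x0 x0) (\<lambda>(w, \<omega>). F (\<lambda>j. enn2real (S (xs j) w + L_infinity (xs j) \<omega>)))"
    and "(\<integral>w. enn2real (S x0 w) * F (\<lambda>j. enn2real (S (xs j) w)) \<partial>M) =
      \<alpha> * (\<integral>(w, \<omega>). F (\<lambda>j. enn2real (S (xs j) w + L_infinity (xs j) \<omega>)) \<partial>(M \<Otimes>\<^sub>M Q x0 x0))"
proof -
  obtain B where B: "\<And>y. \<bar>F y\<bar> \<le> B" using assms(2) by (auto simp: bounded_iff)
  let ?V = "\<lambda>w j. enn2real (S (xs j) w)"
  let ?W = "\<lambda>(w, \<omega>) j. enn2real (S (xs j) w + L_infinity (xs j) \<omega>)"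
  have V [measurable]: "(\<lambda>w. F (?V w)) \<in> borel_measurable M"
    using measurable_compose[OF soup_vector_measurable F] .
  have W [measurable]: "(\<lambda>z. F (?W z)) \<in> borel_measurable (M \<Otimes>\<^sub>M Q x0 x0)"
    using measurable_compose[OF sum_vector_measurable F] .
  have W_eq: "(\<lambda>(w, \<omega>). F (\<lambda>j. enn2real (S (xs j) w + L_infinity (xs j) \<omega>))) = (\<lambda>z. F (?W z))"
    by (simp add: case_prod_beta')
  interpret QQ: finite_measure "Q x0 x0" by (rule finite_measure_Q)
  have fin: "finite_measure (M \<Otimes>\<^sub>M Q x0 x0)" by (rule finite_measure_pair_measure; unfold_locales)
  then show "integrable (M \<Otimes>\<^sub>M Q x0 x0) (\<lambda>(w, \<omega>). F (\<lambda>j. enn2real (S (xs j) w + L_infinity (xs j) \<omega>)))"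
    unfolding W_eq by (intro finite_measure.integrable_const_bound[where B=B] W) (use B in auto)
  have S_int: "integrable M (\<lambda>w. enn2real (S x0 w))"
  proof (rule integrableI_nonneg)
    have "(\<integral>\<^sup>+w. ennreal (enn2real (S x0 w)) \<partial>M) = (\<integral>\<^sup>+w. S x0 w \<partial>M)"
      by (rule nn_integral_cong_AE, use AE_S_finite[of x0] in eventually_elim) simp
    then show "(\<integral>\<^sup>+w. ennreal (enn2real (S x0 w)) \<partial>M) < \<infinity>"
      using u_finite[of x0 x0] by (simp add: expected_S ennreal_mult_less_top)
  qed auto
  show "integrable M (\<lambda>w. enn2real (S x0 w) * F (?V w))"
  proof (rule Bochner_Integration.integrable_bound)
    show "integrable M (\<lambda>w. B * enn2real (S x0 w))" using S_int by simp
    have "\<bar>enn2real (S x0 w) * F (?V w)\<bar> \<le> \<bar>B * enn2real (S x0 w)\<bar>" for w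
      using mult_left_mono[OF order_trans[OF B abs_ge_self], of "enn2real (S x0 w)" "?V w"]
      by (simp add: abs_mult mult.commute)
    then show "AE w in M. norm (enn2real (S x0 w) * F (?V w)) \<le> norm (B * enn2real (S x0 w))" by simp
  qed measurable
  have "(\<integral>w. enn2real (S x0 w) * F (?V w) \<partial>M) = (\<integral>w. F (?V w) \<partial>density M (\<lambda>w. ennreal (enn2real (S x0 w))))"
    by (subst integral_density) auto
  also have "\<dots> = (\<integral>y. F y \<partial>tilted_law x0 xs)"
    unfolding tilted_law_def by (rule integral_distr[symmetric]) auto
  also have "\<dots> = (\<integral>z. F (?W z) \<partial>density (M \<Otimes>\<^sub>M Q x0 x0) (\<lambda>_. ennreal \<alpha>))"
    unfolding tilted_law_eq_shifted_law unfolding shifted_law_def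
    by (rule integral_distr) (auto simp: sum_vector_measurable)
  also have "\<dots> = (\<integral>z. \<alpha> * F (?W z) \<partial>(M \<Otimes>\<^sub>M Q x0 x0))"
    using alpha W by (subst integral_density) auto
  finally show "(\<integral>w. enn2real (S x0 w) * F (?V w) \<partial>M) =
      \<alpha> * (\<integral>(w, \<omega>). F (\<lambda>j. enn2real (S (xs j) w + L_infinity (xs j) \<omega>)) \<partial>(M \<Otimes>\<^sub>M Q x0 x0))"
    unfolding W_eq by simp
qed

end

theorem mainTheorem2:
  fixes m :: "'a::{metric_space, second_countable_topology} measure"
    and p :: "real \<Rightarrow> 'a \<Rightarrow> 'a \<Rightarrow> real"
    and P :: "'a \<Rightarrow> 'a path measure"
    and f :: "real \<Rightarrow> 'a \<Rightarrow> 'a \<Rightarrow> real"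
    and L :: "'a \<Rightarrow> real \<Rightarrow> 'a path \<Rightarrow> ennreal"
    and Q :: "'a \<Rightarrow> 'a \<Rightarrow> 'a path measure"
    and Qb :: "real \<Rightarrow> 'a \<Rightarrow> 'a \<Rightarrow> 'a path measure"
    and \<alpha> :: real
    and M :: "'w measure"
    and \<L> :: "'w \<Rightarrow> 'a path set"
    and F :: "(nat \<Rightarrow> real) \<Rightarrow> real"
    and x0 :: 'a and xs :: "nat \<Rightarrow> 'a"
  assumes process: "strong_markov_process m p P"
    and u_finite: "\<And>x y. potential_density p x y < \<infinity>"
    and u_continuous: "continuous_on UNIV (\<lambda>(x, y). potential_density p x y)"
    and delta: "approximate_delta m f"
    and local_time: "is_local_time P f L"
    and Q: "\<And>x y. is_Q_measure P p x y (Q x y)"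
    and bridge: "\<And>t x y. 0 < t \<Longrightarrow> is_bridge_measure P p t x y (Qb t x y)"
    and alpha: "0 < \<alpha>"
    and soup: "poisson_process M (scale_measure (ennreal \<alpha>) (loop_measure m Qb)) \<L>"
    and F_measurable: "F \<in> borel_measurable (PiM UNIV (\<lambda>_. borel))"
    and F_bounded: "bounded (range F)"
  shows "integrable M (\<lambda>w. enn2real (soup_local_time L (\<L> w) x0) *
             F (\<lambda>j. enn2real (soup_local_time L (\<L> w) (xs j)))) \<and>
         integrable (M \<Otimes>\<^sub>M Q x0 x0) (\<lambda>(w, \<omega>).
             F (\<lambda>j. enn2real (soup_local_time L (\<L> w) (xs j) + total_local_time L (xs j) \<omega>))) \<and>
         (\<integral>w. enn2real (soup_local_time L (\<L> w) x0) *
             F (\<lambda>j. enn2real (soup_local_time L (\<L> w) (xs j))) \<partial>M) =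
         \<alpha> * (\<integral>(w, \<omega>).
             F (\<lambda>j. enn2real (soup_local_time L (\<L> w) (xs j) + total_local_time L (xs j) \<omega>))
             \<partial>(M \<Otimes>\<^sub>M Q x0 x0))"
proof -
  interpret strong_markov_process m p P by (rule process)
  interpret loop_soup m p P f L Q Qb \<alpha> M \<L>
    by standard (fact u_finite u_continuous delta local_time Q bridge alpha soup)+
  show ?thesis using isomorphism[OF F_measurable F_bounded] by blast
qed

end
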